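(* Let $X,Z,\Theta,W,f,h,\boldsymbol G,\pi$ be as in the context, satisfying assumptions (A1)–(A7), and let $Y$ be a measurement with observed value $y\in\mathcal Y$ and conditional density $\psi$ satisfying assumptions (B1)–(B4). For $w\in\mathcal C(\mathcal T,\mathbb R^n)$, $x_0\in\mathbb R^n$, $z_0\in\mathbb R^q$, $\theta\in\mathbb R^m$ and $\epsilon>0$ let $$\mathbb B^{\mathrm n}_\epsilon:=\Big\{\omega\in\Omega : \sup_{t\in\mathcal T}|w(t)-W_t(\omega)|<\epsilon,\ |X_0(\omega)-x_0|<\epsilon,\ |Z_0(\omega)-z_0|<\epsilon,\ |\Theta(\omega)-\theta|<\epsilon\Big\}.$$ Then there exist $a_{11},a_{12}\in\mathbb R_{>0}$ such that, for all $w\in\mathcal W_n^2$ with $w(0)=0$, $x_0\in\mathbb R^n$, $z_0\in\mathbb R^q$ and $\theta\in\mathbb R^m$, $$\lim_{\epsilon\downarrow0}\frac{P(\mathbb B^{\mathrm n}_\epsilon\mid Y=y)}{a_{11}\exp\left(-\frac{a_{12}}{\epsilon^2}\right)\epsilon^{m+n+q}}=\psi(y\mid x,z,\theta)\,\pi(x_0,z_0,\theta)\exp\Big(-\tfrac12\int_{\mathcal T}|\dot w(t)|^2dt\Big),$$ where $x\in\mathcal W_n^2$ and $z\in\mathcal W_q^2$ are the solutions to the integral equations, for all $t\in\mathcal T$, $$x(t)=x_0+\int_0^tf(\tau,x(\tau),z(\tau),\theta)\,d\tau+\boldsymbol Gw(t),\qquad z(t)=z_0+\int_0^th(\tau,x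(\tau),z(\tau),\theta)\,d\tau.$$
   Context: Fix $t_{\mathrm f}>0$, $\mathcal T:=[0,t_{\mathrm f}]$, a probability space $(\Omega,\mathcal E,P)$ with a filtration $\{\mathcal E_t\}_{t\ge0}$, and an $n$-dimensional Wiener process $W$ with respect to this filtration. $|\cdot|$ is the Euclidean norm and $\operatorname{supp}(P_\Theta)$ is the topological support of the law of $\Theta$. The $\mathbb R^n$- and $\mathbb R^q$-valued processes $X,Z$ over $\mathcal T$ and the $\mathbb R^m$-valued random variable $\Theta$ satisfy $$dX_t=f(t,X_t,Z_t,\Theta)\,dt+\boldsymbol G\,dW_t,\qquad dZ_t=h(t,X_t,Z_t,\Theta)\,dt,$$ with $f:\mathcal T\times\mathbb R^n\times\mathbb R^q\times\mathbb R^m\to\mathbb R^n$, $h:\mathcal T\times\mathbb R^n\times\mathbb R^q\times\mathbb R^m\to\mathbb R^q$, $\boldsymbol G\in\mathbb R^{n\times n}$. Assumptions on the system: (A1) $X_0,Z_0,\Theta$ are $\mathcal E_0$-measurable. (A2) $X_0,Z_0,\Theta$ admit a continuous joint density $\pi:\mathbb R^n\times\mathbb R^q\times\mathbb R^m\to\mathbb R_{\ge0}$. (A3) $f$ and $h$ are uniformly continuous in all arguments on $\mathcal T\times\mathbb R^n\times\mathbb R^q\times\operatorname{supp}(P_\Theta)$. (A4) For each $\theta\in\operatorname{supp}(P_\Theta)$ there are $L_{\mathrm f}^\theta,L_{\mathrm h}^\theta>0$ such that for all $t\in\mathcal T$, $x,x'\in\mathbb R^n$, $z,z'\in\mathbb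 R^q$: $|f(t,x,z,\theta)-f(t,x',z',\theta)|\le L_{\mathrm f}^\theta(|x-x'|+|z-z'|)$ and $|h(t,x,z,\theta)-h(t,x',z',\theta)|\le L_{\mathrm h}^\theta(|x-x'|+|z-z'|)$. (A5) For all $t\in\mathcal T$ and $\theta\in\operatorname{supp}(P_\Theta)$, $f$ is twice differentiable with respect to $x$ and differentiable with respect to $t$ and $z$, and these first and second derivatives are continuous with respect to all arguments. (A6) $\boldsymbol G$ has full rank. (A7) $\mathrm E\big[\exp\big(\int_0^{t_{\mathrm f}}|\boldsymbol G^{-1}f(t,X_t,Z_t,\Theta)|^2dt\big)\big]<\infty$. Assumptions on the measurement: (B1) The random variable $Y$ takes values in a metric space $\mathcal Y$ and is observed; $y\in\mathcal Y$ is the observed value. (B2) There are a measure $\nu$ on the Borel sets $\mathcal B_{\mathcal Y}$ and a conditional density $\psi\ge0$ such that for all $x\in\mathcal C(\mathcal T,\mathbb R^n)$, $z\in\mathcal C(\mathcal T,\mathbb R^q)$, $\theta\in\mathbb R^m$, $\mathbb B\in\mathcal B_{\mathcal Y}$: $P(Y\in\mathbb B\mid X=x,Z=z,\Theta=\theta)=\int_{\mathbb B}\psi(y'\mid x,z,\theta)\,d\nu(y')$. (B3) For the observed $y$, $(x,z,\theta)\mapsto\psi(y\mid x,z,\theta)$ is continuous (supremum norm on the path arguments). (B4) $0<\mathrm E[\psi(y\mid X,Z,\Theta)]<\infty$. The posterior $P(\cdot\mid Y=y)$ is the version given by Bayes' theorem, $P(\mathbb A\mid Y=y)=\int_{\mathbb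 A}\psi(y\mid X,Z,\Theta)\,dP/\mathrm E[\psi(y\mid X,Z,\Theta)]$ (the noise path $W$ on $\mathcal T$ being determined by $X,Z,\Theta$ since $\boldsymbol G$ is invertible). $\mathcal W_n^2$ is the space of absolutely continuous functions $\mathcal T\to\mathbb R^n$ with square-integrable weak derivative. When $\theta\notin\operatorname{supp}(P_\Theta)$ one has $\pi(x_0,z_0,\theta)=0$ and the right-hand side of the limit is read as $0$. *)

theory Defs
  imports "HOL-Probability.Probability"
begin

section \<open>Path space\<close>

text \<open>\<open>C([0,tf], E)\<close> with the supremum metric. As always for \<^const>\<open>cfunspace\<close>, its points are
  extensional functions: they take the value \<^const>\<open>undefined\<close> outside \<open>[0,tf]\<close>, so a function on
  this space depends only on the values of a path on \<open>[0,tf]\<close>.\<close>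

definition path_metric :: "real \<Rightarrow> (real \<Rightarrow> 'e::euclidean_space) metric" where
  "path_metric tf = cfunspace (top_of_set {0..tf}) euclidean_metric"

lemma mspace_path_metric:
  "mspace (path_metric tf :: (real \<Rightarrow> 'e::euclidean_space) metric) =
     {w \<in> extensional {0..tf}. continuous_on {0..tf} w}"
proof -
  have "bounded (w ` {0..tf})" if "continuous_on {0..tf} w" for w :: "real \<Rightarrow> 'e"
    using that by (intro compact_imp_bounded compact_continuous_image) auto
  then have "Metric_space.mbounded UNIV dist (w ` {0..tf})"
    if "continuous_on {0..tf} w" for w :: "real \<Rightarrow> 'e"
    using that by (simp add: mbounded_iff_bounded)
  then show ?thesis
    by (auto simp: path_metric_def)
qed

definition path_of :: "real \<Rightarrow> (real \<Rightarrow> 'a \<Rightarrow> 'e) \<Rightarrow> 'a \<Rightarrow> (real \<Rightarrow> 'e)" where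
  "path_of tf X \<omega> = (\<lambda>t\<in>{0..tf}. X t \<omega>)"

definition borel_algebra_of :: "'a topology \<Rightarrow> 'a measure" where
  "borel_algebra_of T = sigma (topspace T) {U. openin T U}"

text \<open>The product of the path spaces of \<open>X\<close> and \<open>Z\<close> and of the space of parameters.\<close>

definition state_topology ::
  "real \<Rightarrow> ((real \<Rightarrow> 'e::euclidean_space) \<times> (real \<Rightarrow> 'f::euclidean_space) \<times> 'g::euclidean_space) topology"
where
  "state_topology tf = prod_topology (mtopology_of (path_metric tf))
     (prod_topology (mtopology_of (path_metric tf)) euclidean)"

section \<open>Absolutely continuous paths with square-integrable weak derivative\<close>

definition absolutely_continuous_on_Icc :: "real \<Rightarrow> (real \<Rightarrow> 'e::euclidean_space) \<Rightarrow> bool" where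
  "absolutely_continuous_on_Icc tf w \<longleftrightarrow>
     (\<forall>e>0. \<exists>d>0. \<forall>(N::nat) (a::nat \<Rightarrow> real) (b::nat \<Rightarrow> real).
        (\<forall>i<N. 0 \<le> a i \<and> a i \<le> b i \<and> b i \<le> tf) \<longrightarrow>
        disjoint_family_on (\<lambda>i. {a i<..<b i}) {..<N} \<longrightarrow>
        (\<Sum>i<N. b i - a i) < d \<longrightarrow>
        (\<Sum>i<N. norm (w (b i) - w (a i))) < e)"

definition test_functions :: "real \<Rightarrow> (real \<Rightarrow> real) set" where
  "test_functions tf = {\<phi>. (\<forall>k. (deriv ^^ k) \<phi> differentiable_on UNIV) \<and>
     (\<exists>K. compact K \<and> K \<subseteq> {0<..<tf} \<and> (\<forall>t. t \<notin> K \<longrightarrow> \<phi> t = 0))}"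

definition has_weak_derivative ::
  "real \<Rightarrow> (real \<Rightarrow> 'e::euclidean_space) \<Rightarrow> (real \<Rightarrow> 'e) \<Rightarrow> bool" where
  "has_weak_derivative tf w v \<longleftrightarrow> v absolutely_integrable_on {0..tf} \<and>
     (\<forall>\<phi>\<in>test_functions tf.
        integral {0..tf} (\<lambda>t. deriv \<phi> t *\<^sub>R w t) = - integral {0..tf} (\<lambda>t. \<phi> t *\<^sub>R v t))"

text \<open>A weak derivative is unique up to a null set, so the choice does not affect integrals.\<close>

definition weak_deriv :: "real \<Rightarrow> (real \<Rightarrow> 'e::euclidean_space) \<Rightarrow> (real \<Rightarrow> 'e)" where
  "weak_deriv tf w = (SOME v. has_weak_derivative tf w v)"

definition W2_paths :: "real \<Rightarrow> (real \<Rightarrow> 'e::euclidean_space) set" where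
  "W2_paths tf = {w \<in> mspace (path_metric tf). absolutely_continuous_on_Icc tf w \<and>
     (\<exists>v. has_weak_derivative tf w v \<and> (\<lambda>t. (norm (v t))\<^sup>2) integrable_on {0..tf})}"

section \<open>Wiener process and stochastic differential equation\<close>

text \<open>Only nonnegative times matter. Since the index type of \<^locale>\<open>filtration\<close> is all of \<open>real\<close>,
  the family is frozen at negative times, which makes the condition there trivial.\<close>

definition filtration_of :: "'a measure \<Rightarrow> (real \<Rightarrow> 'a measure) \<Rightarrow> bool" where
  "filtration_of M F \<longleftrightarrow>
     filtration (space M) (\<lambda>t. F (max 0 t)) \<and> (\<forall>t\<ge>0. subalgebra M (F t))"

definition wiener_process ::
  "'a measure \<Rightarrow> (real \<Rightarrow> 'a measure) \<Rightarrow> (real \<Rightarrow> 'a \<Rightarrow> real^'n) \<Rightarrow> bool" where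
  "wiener_process M F W \<longleftrightarrow>
     (\<forall>t\<ge>0. W t \<in> borel_measurable (F t)) \<and>
     (\<forall>\<omega>\<in>space M. continuous_on {0..} (\<lambda>t. W t \<omega>)) \<and>
     (AE \<omega> in M. W 0 \<omega> = 0) \<and>
     (\<forall>s t. 0 \<le> s \<longrightarrow> s < t \<longrightarrow>
        distributed M lborel (\<lambda>\<omega>. W t \<omega> - W s \<omega>)
          (\<lambda>x. ennreal (\<Prod>i\<in>UNIV. normal_density 0 (sqrt (t - s)) (x $ i))) \<and>
        prob_space.indep_set M (sets (F s))
          (sets (vimage_algebra (space M) (\<lambda>\<omega>. W t \<omega> - W s \<omega>) borel)))"

text \<open>The diffusion matrix is constant, so the stochastic integral of \<open>G\<close> over \<open>[0,t]\<close> is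
  \<open>G (W t - W 0)\<close>, where \<open>W 0 = 0\<close> almost surely.\<close>

definition sde_solution ::
  "'a measure \<Rightarrow> (real \<Rightarrow> 'a measure) \<Rightarrow> real
   \<Rightarrow> (real \<Rightarrow> real^'n \<Rightarrow> real^'q \<Rightarrow> real^'m \<Rightarrow> real^'n)
   \<Rightarrow> (real \<Rightarrow> real^'n \<Rightarrow> real^'q \<Rightarrow> real^'m \<Rightarrow> real^'q)
   \<Rightarrow> real^'n^'n \<Rightarrow> (real \<Rightarrow> 'a \<Rightarrow> real^'n) \<Rightarrow> (real \<Rightarrow> 'a \<Rightarrow> real^'n) \<Rightarrow> (real \<Rightarrow> 'a \<Rightarrow> real^'q)
   \<Rightarrow> ('a \<Rightarrow> real^'m) \<Rightarrow> bool" where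
  "sde_solution M F tf f h G W X Z \<Theta> \<longleftrightarrow>
     (\<forall>t\<in>{0..tf}. X t \<in> borel_measurable (F t) \<and> Z t \<in> borel_measurable (F t)) \<and>
     (\<forall>\<omega>\<in>space M. continuous_on {0..tf} (\<lambda>t. X t \<omega>) \<and> continuous_on {0..tf} (\<lambda>t. Z t \<omega>)) \<and>
     (AE \<omega> in M. \<forall>t\<in>{0..tf}.
        X t \<omega> = X 0 \<omega> + integral {0..t} (\<lambda>\<tau>. f \<tau> (X \<tau> \<omega>) (Z \<tau> \<omega>) (\<Theta> \<omega>)) + G *v (W t \<omega> - W 0 \<omega>) \<and>
        Z t \<omega> = Z 0 \<omega> + integral {0..t} (\<lambda>\<tau>. h \<tau> (X \<tau> \<omega>) (Z \<tau> \<omega>) (\<Theta> \<omega>)))"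

definition topological_support :: "'b::topological_space measure \<Rightarrow> 'b set" where
  "topological_support \<mu> = {x. \<forall>U. open U \<longrightarrow> x \<in> U \<longrightarrow> emeasure \<mu> U > 0}"

text \<open>Derivatives of \<open>f\<close> in \<open>t\<close>, \<open>z\<close> and \<open>x\<close> and the second derivative in \<open>x\<close>, all jointly
  continuous on \<open>[0,tf] \<times> UNIV \<times> UNIV \<times> S\<close>; at the end points of \<open>[0,tf]\<close> the derivative in \<open>t\<close> is
  one-sided.\<close>

definition drift_differentiable ::
  "real \<Rightarrow> (real^'m) set \<Rightarrow> (real \<Rightarrow> real^'n \<Rightarrow> real^'q \<Rightarrow> real^'m \<Rightarrow> real^'n) \<Rightarrow> bool" where
  "drift_differentiable tf S f \<longleftrightarrow>
     (\<exists>(ft :: real \<Rightarrow> real^'n \<Rightarrow> real^'q \<Rightarrow> real^'m \<Rightarrow> real^'n)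
       (fz :: real \<Rightarrow> real^'n \<Rightarrow> real^'q \<Rightarrow> real^'m \<Rightarrow> ((real^'q) \<Rightarrow>\<^sub>L (real^'n)))
       (fx :: real \<Rightarrow> real^'n \<Rightarrow> real^'q \<Rightarrow> real^'m \<Rightarrow> ((real^'n) \<Rightarrow>\<^sub>L (real^'n)))
       (fxx :: real \<Rightarrow> real^'n \<Rightarrow> real^'q \<Rightarrow> real^'m \<Rightarrow> ((real^'n) \<Rightarrow>\<^sub>L ((real^'n) \<Rightarrow>\<^sub>L (real^'n)))).
       (\<forall>t\<in>{0..tf}. \<forall>x z. \<forall>\<theta>\<in>S.
          ((\<lambda>s. f s x z \<theta>) has_vector_derivative ft t x z \<theta>) (at t within {0..tf}) \<and>
          ((\<lambda>z'. f t x z' \<theta>) has_derivative blinfun_apply (fz t x z \<theta>)) (at z) \<and>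
          ((\<lambda>x'. f t x' z \<theta>) has_derivative blinfun_apply (fx t x z \<theta>)) (at x) \<and>
          ((\<lambda>x'. fx t x' z \<theta>) has_derivative blinfun_apply (fxx t x z \<theta>)) (at x)) \<and>
       continuous_on ({0..tf} \<times> UNIV \<times> UNIV \<times> S) (\<lambda>(t, x, z, \<theta>). ft t x z \<theta>) \<and>
       continuous_on ({0..tf} \<times> UNIV \<times> UNIV \<times> S) (\<lambda>(t, x, z, \<theta>). fz t x z \<theta>) \<and>
       continuous_on ({0..tf} \<times> UNIV \<times> UNIV \<times> S) (\<lambda>(t, x, z, \<theta>). fx t x z \<theta>) \<and>
       continuous_on ({0..tf} \<times> UNIV \<times> UNIV \<times> S) (\<lambda>(t, x, z, \<theta>). fxx t x z \<theta>))"

section \<open>Measurement and posterior\<close>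

text \<open>\<open>u \<mapsto> (B \<mapsto> \<integral>\<^sub>B p y u d\<nu>(y))\<close> is a probability kernel and a version of the conditional
  distribution of \<open>Y\<close> given \<open>U\<close>, where \<open>U\<close> takes values in \<open>N\<close>.\<close>

definition conditional_density ::
  "'a measure \<Rightarrow> 'u measure \<Rightarrow> ('a \<Rightarrow> 'u) \<Rightarrow> ('a \<Rightarrow> 'y::metric_space) \<Rightarrow> 'y measure
   \<Rightarrow> ('y \<Rightarrow> 'u \<Rightarrow> real) \<Rightarrow> bool" where
  "conditional_density M N U Y \<nu> p \<longleftrightarrow>
     (\<forall>u\<in>space N. (\<lambda>y. p y u) \<in> borel_measurable \<nu> \<and> (\<forall>y. 0 \<le> p y u)) \<and>
     (\<lambda>u. density \<nu> (\<lambda>y. ennreal (p y u))) \<in> N \<rightarrow>\<^sub>M prob_algebra borel \<and>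
     (\<forall>B\<in>sets borel. AE \<omega> in M.
        real_cond_exp M (vimage_algebra (space M) U N) (indicator (Y -` B \<inter> space M)) \<omega>
        = (LINT y:B|\<nu>. p y (U \<omega>)))"

definition posterior_prob :: "'a measure \<Rightarrow> ('a \<Rightarrow> real) \<Rightarrow> 'a set \<Rightarrow> real" where
  "posterior_prob M L A = (LINT \<omega>:A|M. L \<omega>) / (LINT \<omega>|M. L \<omega>)"

definition noise_ball ::
  "'a measure \<Rightarrow> real \<Rightarrow> (real \<Rightarrow> 'a \<Rightarrow> real^'n) \<Rightarrow> (real \<Rightarrow> 'a \<Rightarrow> real^'n) \<Rightarrow> (real \<Rightarrow> 'a \<Rightarrow> real^'q)
   \<Rightarrow> ('a \<Rightarrow> real^'m) \<Rightarrow> (real \<Rightarrow> real^'n) \<Rightarrow> real^'n \<Rightarrow> real^'q \<Rightarrow> real^'m \<Rightarrow> real \<Rightarrow> 'a set" where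
  "noise_ball M tf W X Z \<Theta> w x0 z0 \<theta> \<epsilon> = {\<omega> \<in> space M.
     (SUP t\<in>{0..tf}. norm (w t - W t \<omega>)) < \<epsilon> \<and>
     norm (X 0 \<omega> - x0) < \<epsilon> \<and> norm (Z 0 \<omega> - z0) < \<epsilon> \<and> norm (\<Theta> \<omega> - \<theta>) < \<epsilon>}"

definition path_solution ::
  "real \<Rightarrow> (real \<Rightarrow> real^'n \<Rightarrow> real^'q \<Rightarrow> real^'m \<Rightarrow> real^'n)
   \<Rightarrow> (real \<Rightarrow> real^'n \<Rightarrow> real^'q \<Rightarrow> real^'m \<Rightarrow> real^'q)
   \<Rightarrow> real^'n^'n \<Rightarrow> (real \<Rightarrow> real^'n) \<Rightarrow> real^'n \<Rightarrow> real^'q \<Rightarrow> real^'m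
   \<Rightarrow> (real \<Rightarrow> real^'n) \<Rightarrow> (real \<Rightarrow> real^'q) \<Rightarrow> bool" where
  "path_solution tf f h G w x0 z0 \<theta> x z \<longleftrightarrow>
     x \<in> W2_paths tf \<and> z \<in> W2_paths tf \<and>
     (\<forall>t\<in>{0..tf}.
        x t = x0 + integral {0..t} (\<lambda>\<tau>. f \<tau> (x \<tau>) (z \<tau>) \<theta>) + G *v w t \<and>
        z t = z0 + integral {0..t} (\<lambda>\<tau>. h \<tau> (x \<tau>) (z \<tau>) \<theta>))"

end

theory Submission
  imports Defs "HOL-Real_Asymp.Real_Asymp" "HOL-Computational_Algebra.Polynomial"
begin

text \<open>
  The noise enters additively, so on the noise ball the whole state \<open>(X, Z, \<Theta>)\<close> is pinned down
  pathwise: by a Gronwall estimate it lies uniformly close to the solution \<open>(x, z, \<theta>)\<close> of the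
  integral equations driven by \<open>w\<close> (\<open>path_solution_stable\<close>), and since the likelihood is continuous,
  it is close to \<open>\<psi>(y | x, z, \<theta>)\<close> there. The numerator of the posterior probability of the ball
  \<open>B\<close> is therefore \<open>\<psi>(y | x, z, \<theta>) P(B)\<close> up to a vanishing multiple of \<open>P(B)\<close>.

  It remains to find \<open>P(B)\<close>. The initial values and \<open>\<Theta>\<close> are known at time \<open>0\<close> and hence independent
  of the Wiener path, so that \<open>P(B)\<close> is the product of the probability that \<open>(X\<^sub>0, Z\<^sub>0, \<Theta>)\<close> lies in a
  product of three small balls, which is asymptotically \<open>\<pi>(x\<^sub>0, z\<^sub>0, \<theta>)\<close> times a volume
  (\<open>small_ball_probability\<close>), and the probability that \<open>W\<close> stays in the tube of radius \<open>r\<close>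
  around \<open>w\<close>. The heart of the matter is the asymptotics of the latter (\<open>open_tube_asymptotics\<close>),
    \<open>P(sup |w - W| < r) \<sim> a exp(- \<kappa> / r\<^sup>2) exp(- Q / 2)\<close> with \<open>Q\<close> the integral of \<open>|w'|\<^sup>2\<close>.

  The factor \<open>exp(- Q / 2)\<close> compares the tube around \<open>w\<close> with the tube around \<open>0\<close>. The comparison is made
  at the times of a dyadic partition, where the probability of staying in the tube is an iterated
  Gaussian integral (\<open>chain\<close>), and then passed to the limit. Shifting every step by the increments of
  \<open>w\<close> costs at most \<open>exp(- Q / 2)\<close>, by the Cauchy-Schwarz inequality applied to the two shifts by \<open>w\<close>
  and by \<open>- w\<close>, which have equal probability (\<open>chain_shift_lower_bound\<close>). For the opposite bound, \<open>w\<close>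
  is split into a polygon and a remainder. The polygon is removed by an exponential tilt, which
  produces the factor \<open>exp(- Q\<^sub>J / 2)\<close> for the energy \<open>Q\<^sub>J\<close> of the polygon up to a boundary term that
  vanishes with \<open>r\<close>; the remainder is removed by Anderson's inequality, that a centred
  tube is the most probable one (\<open>chain_anderson\<close>), a consequence of the inequality of Prekopa
  and Leindler. Refining the polygon gives the claim.

  The factor \<open>a exp(- \<kappa> / r\<^sup>2)\<close> belongs to the tube around \<open>0\<close>. By Brownian scaling, the probability
  of this tube is the one that \<open>W\<close> stays in the unit ball up to the time \<open>T / r\<^sup>2\<close>. With \<open>v\<^sub>t(x)\<close> the
  probability to survive up to \<open>t\<close> when started at \<open>x\<close> and \<open>G(t)\<close> its integral over the ball, symmetry
  of the killed semigroup says that the integral of \<open>v\<^sub>s v\<^sub>t\<close> is \<open>G(s + t)\<close>. Hence \<open>G\<close> is log-convex; it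
  also tends to zero and is submultiplicative up to a constant, which together force
  \<open>G(t) \<sim> b exp(- \<kappa> t)\<close> (\<open>exponential_asymptotics\<close>). The same identity turns
  this into convergence of \<open>exp(\<kappa> t) v\<^sub>t\<close> in the space \<open>L\<^sup>2\<close> of the ball, and one further unit of time
  smooths it to convergence at the centre (\<open>survival_asymptotics\<close>).

  For a parameter \<open>\<theta>\<close> outside of the support of the law of \<open>\<Theta>\<close>, small noise balls are null sets.
\<close>

section \<open>The inequality of Prekopa and Leindler\<close>

lemma half_double_ennreal: "2 * x / 2 = (x::ennreal)"
  by (subst mult.commute) (simp add: ennreal_mult_divide_eq)

lemma emeasure_half_shift:
  fixes A :: "real set" and c :: real
  assumes [measurable]: "A \<in> sets borel"
  shows "emeasure lborel {x. 2 * x - c \<in> A} = emeasure lborel A / 2"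
proof -
  have "emeasure lborel A = (\<integral>\<^sup>+x. indicator A x \<partial>lborel)" by simp
  also have "\<dots> = 2 * (\<integral>\<^sup>+x. indicator A (-c + 2 * x) \<partial>lborel)"
    by (subst nn_integral_real_affine[where c=2 and t="-c"]) auto
  also have "(\<integral>\<^sup>+x. indicator A (-c + 2 * x) \<partial>lborel) = (\<integral>\<^sup>+x. indicator {x. 2 * x - c \<in> A} x \<partial>lborel)"
    by (intro nn_integral_cong) (auto simp: indicator_def)
  also have "\<dots> = emeasure lborel {x. 2 * x - c \<in> A}"
    by (intro nn_integral_indicator) measurable
  finally show ?thesis
    by (simp add: half_double_ennreal)
qed

text \<open>
  Cut \<open>A\<close> at a point \<open>a\<close> near its supremum and \<open>B\<close> at a point \<open>b\<close> near its infimum. The midpoints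
  of \<open>b\<close> with the remaining part of \<open>A\<close> lie to the left of \<open>(a + b) / 2\<close> and those of \<open>a\<close> with the
  remaining part of \<open>B\<close> to the right of it, so these two half-size copies in \<open>C\<close> are disjoint.
\<close>

lemma brunn_minkowski_real:
  fixes A B C :: "real set"
  assumes [measurable]: "A \<in> sets borel" "B \<in> sets borel" "C \<in> sets borel"
    and ne: "A \<noteq> {}" "B \<noteq> {}" and bdd: "bdd_above A" "bdd_below B"
    and mid: "\<And>x y. x \<in> A \<Longrightarrow> y \<in> B \<Longrightarrow> (x + y) / 2 \<in> C"
  shows "emeasure lborel A + emeasure lborel B \<le> 2 * emeasure lborel C"
proof (rule ennreal_le_epsilon)
  fix e :: real assume "e > 0"
  obtain a where a: "a \<in> A" "Sup A - e/2 < a"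
    using less_cSup_iff[OF ne(1) bdd(1), of "Sup A - e/2"] \<open>e > 0\<close> by auto
  obtain b where b: "b \<in> B" "b < Inf B + e/2"
    using cInf_less_iff[OF ne(2) bdd(2), of "Inf B + e/2"] \<open>e > 0\<close> by auto
  let ?A = "A \<inter> {..a}" and ?B = "B \<inter> {b<..}"
  let ?A' = "{x. 2 * x - b \<in> ?A}" and ?B' = "{x. 2 * x - a \<in> ?B}"
  have m [measurable]: "?A' \<in> sets borel" "?B' \<in> sets borel" by measurable
  have "A \<subseteq> ?A \<union> {a..Sup A}"
    using cSup_upper[OF _ bdd(1)] by auto
  then have "emeasure lborel A \<le> emeasure lborel (?A \<union> {a..Sup A})"
    by (intro emeasure_mono) auto
  also have "\<dots> \<le> emeasure lborel ?A + emeasure lborel {a..Sup A}"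
    by (intro emeasure_subadditive) auto
  also have "emeasure lborel {a..Sup A} \<le> ennreal (e/2)"
    using a by (simp add: emeasure_lborel_Icc_eq cSup_upper[OF a(1) bdd(1)] ennreal_leI)
  finally have 1: "emeasure lborel A \<le> emeasure lborel ?A + ennreal (e/2)"
    by (simp add: add_left_mono)
  have "B \<subseteq> ?B \<union> {Inf B..b}"
    using cInf_lower[OF _ bdd(2)] by auto
  then have "emeasure lborel B \<le> emeasure lborel (?B \<union> {Inf B..b})"
    by (intro emeasure_mono) auto
  also have "\<dots> \<le> emeasure lborel ?B + emeasure lborel {Inf B..b}"
    by (intro emeasure_subadditive) auto
  also have "emeasure lborel {Inf B..b} \<le> ennreal (e/2)"
    using b by (simp add: emeasure_lborel_Icc_eq cInf_lower[OF b(1) bdd(2)] ennreal_leI)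
  finally have 2: "emeasure lborel B \<le> emeasure lborel ?B + ennreal (e/2)"
    by (simp add: add_left_mono)
  have "emeasure lborel ?A' + emeasure lborel ?B' = emeasure lborel (?A' \<union> ?B')"
    by (rule plus_emeasure) auto
  also have "\<dots> \<le> emeasure lborel C"
  proof (intro emeasure_mono)
    show "?A' \<union> ?B' \<subseteq> C"
      using mid[OF _ b(1)] mid[OF a(1)] by fastforce
  qed simp
  finally have "emeasure lborel ?A / 2 + emeasure lborel ?B / 2 \<le> emeasure lborel C"
    by (subst (asm) (1 2) emeasure_half_shift) auto
  then have "2 * (emeasure lborel ?A / 2 + emeasure lborel ?B / 2) \<le> 2 * emeasure lborel C"
    by (intro mult_left_mono) auto
  then have 3: "emeasure lborel ?A + emeasure lborel ?B \<le> 2 * emeasure lborel C"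
    by (simp add: distrib_left ennreal_times_divide half_double_ennreal)
  have "emeasure lborel A + emeasure lborel B
     \<le> (emeasure lborel ?A + ennreal (e/2)) + (emeasure lborel ?B + ennreal (e/2))"
    by (intro add_mono 1 2)
  also have "\<dots> = (emeasure lborel ?A + emeasure lborel ?B) + (ennreal (e/2) + ennreal (e/2))"
    by (simp add: ac_simps)
  also have "ennreal (e/2) + ennreal (e/2) = ennreal e"
    using \<open>e > 0\<close> by (simp flip: ennreal_plus)
  finally show "emeasure lborel A + emeasure lborel B \<le> 2 * emeasure lborel C + ennreal e"
    using 3 by (meson add_right_mono order_trans)
qed

text \<open>
  The levels are cut off at \<open>1\<close> for the sake of functions \<open>h\<close> that are compared with functions of
  supremum \<open>1\<close> and may exceed it themselves.
\<close>

lemma layer_cake_below_one: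
  fixes h :: "'a \<Rightarrow> ennreal"
  assumes [measurable]: "h \<in> borel_measurable M" and "sigma_finite_measure M"
  shows "(\<integral>\<^sup>+t\<in>{0<..<1}. emeasure M {x \<in> space M. ennreal t < h x} \<partial>lborel) = (\<integral>\<^sup>+x. min 1 (h x) \<partial>M)"
proof -
  interpret sigma_finite_measure M by fact
  interpret pair_sigma_finite M "lborel :: real measure" ..
  have "(\<integral>\<^sup>+t\<in>{0<..<1}. emeasure M {x \<in> space M. ennreal t < h x} \<partial>lborel)
      = (\<integral>\<^sup>+t. (\<integral>\<^sup>+x. indicator {0<..<1} t * indicator {y. ennreal t < y} (h x) \<partial>M) \<partial>lborel)"
  proof (intro nn_integral_cong)
    fix t :: real
    have "emeasure M {x \<in> space M. ennreal t < h x} = (\<integral>\<^sup>+x. indicator {x \<in> space M. ennreal t < h x} x \<partial>M)"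
      by simp
    also have "\<dots> = (\<integral>\<^sup>+x. indicator {y. ennreal t < y} (h x) \<partial>M)"
      by (intro nn_integral_cong) (auto simp: indicator_def)
    finally show "emeasure M {x \<in> space M. ennreal t < h x} * indicator {0<..<1} t = 
       (\<integral>\<^sup>+x. indicator {0<..<1} t * indicator {y. ennreal t < y} (h x) \<partial>M)"
      by (subst nn_integral_cmult) (auto simp: mult.commute)
  qed
  also have "\<dots> = (\<integral>\<^sup>+x. (\<integral>\<^sup>+t. indicator {0<..<1} t * indicator {y. ennreal t < y} (h x) \<partial>lborel) \<partial>M)"
  proof (rule Fubini')
    have "(\<lambda>(x, t). indicator {0<..<1} t * (if ennreal t < h x then 1 else 0::ennreal)) \<in> borel_measurable (M \<Otimes>\<^sub>M lborel)"
      by measurable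
    then show "(\<lambda>(x, t). indicator {0<..<1} t * indicator {y. ennreal t < y} (h x)) \<in> borel_measurable (M \<Otimes>\<^sub>M lborel)"
      by (simp add: indicator_def case_prod_beta')
  qed
  also have "\<dots> = (\<integral>\<^sup>+x. min 1 (h x) \<partial>M)"
  proof (intro nn_integral_cong)
    fix x
    have "(\<integral>\<^sup>+t. indicator {0<..<1} t * indicator {y. ennreal t < y} (h x) \<partial>lborel)
       = (\<integral>\<^sup>+t. indicator {0<..<(if h x \<ge> 1 then 1 else enn2real (h x))} t \<partial>lborel)"
    proof (intro nn_integral_cong)
      fix t :: real
      show "indicator {0<..<1} t * indicator {y. ennreal t < y} (h x) = (indicator {0<..<(if h x \<ge> 1 then 1 else enn2real (h x))} t :: ennreal)"
        by (cases "h x") (auto simp: indicator_def ennreal_less_iff not_le  split: if_splits)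
    qed
    also have "\<dots> = min 1 (h x)"
      by (cases "h x") (auto simp: min_def)
    finally show "(\<integral>\<^sup>+t. indicator {0<..<1} t * indicator {y. ennreal t < y} (h x) \<partial>lborel) = min 1 (h x)" .
  qed
  finally show ?thesis .
qed

text \<open>
  Inequality of the arithmetic and geometric means.
\<close>

lemma ennreal_mult_le_square_of_add_le:
  fixes a b c :: ennreal
  assumes "a + b \<le> 2 * c"
  shows "a * b \<le> c\<^sup>2"
proof (cases "c = \<top>")
  case False
  then obtain r where r: "c = ennreal r" "r \<ge> 0" by (cases c) auto
  then have ab: "a + b \<le> ennreal (2 * r)" using assms by (simp add: ennreal_mult)
  moreover have "a \<le> a + b" "b \<le> a + b" by auto
  ultimately have "a < \<top>" "b < \<top>"
    by (meson ennreal_less_top order_trans le_less_trans)+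
  then obtain p q where pq: "a = ennreal p" "p \<ge> 0" "b = ennreal q" "q \<ge> 0"
    by (cases a; cases b) auto
  then have "p + q \<le> 2 * r" using ab r by (simp flip: ennreal_plus)
  then have "(p + q)\<^sup>2 \<le> (2 * r)\<^sup>2" using pq by (intro power_mono) auto
  then have "p * q \<le> r\<^sup>2" using sum_squares_bound[of p q] by (simp add: power2_eq_square algebra_simps)
  then show ?thesis using pq r by (simp add: ennreal_power flip: ennreal_mult)
qed (auto simp: power2_eq_square ennreal_mult_eq_top_iff)

text \<open>
  If \<open>f x > t\<close> and \<open>g y > t\<close> then \<open>h ((x + y) / 2) > t\<close>, so that the superlevel sets of \<open>f\<close>, \<open>g\<close>
  and \<open>h\<close> satisfy the Brunn-Minkowski inequality at each level. For levels below the common supremum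
  \<open>1\<close> those of \<open>f\<close> and \<open>g\<close> are not empty; integrate over these levels.
\<close>

lemma prekopa_leindler_sup_one:
  fixes f g h :: "real \<Rightarrow> ennreal"
  assumes [measurable]: "f \<in> borel_measurable borel" "g \<in> borel_measurable borel" "h \<in> borel_measurable borel"
    and mid: "\<And>x y. f x * g y \<le> (h ((x + y) / 2))\<^sup>2"
    and sup: "(SUP x. f x) = 1" "(SUP x. g x) = 1"
    and supp: "\<And>x. \<bar>x\<bar> > R \<Longrightarrow> f x = 0" "\<And>x. \<bar>x\<bar> > R \<Longrightarrow> g x = 0"
  shows "integral\<^sup>N lborel f + integral\<^sup>N lborel g \<le> 2 * integral\<^sup>N lborel h"
proof -
  let ?L = "\<lambda>f t. emeasure lborel {x::real. ennreal t < (f x :: ennreal)}"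
  have le1: "f x \<le> 1" "g x \<le> 1" for x
    using sup by (metis SUP_upper UNIV_I)+
  have cake: "(\<integral>\<^sup>+t\<in>{0<..<1}. ?L F t \<partial>lborel) = (\<integral>\<^sup>+x. min 1 (F x) \<partial>lborel)"
    if "F \<in> borel_measurable borel" for F
    using layer_cake_below_one[of F lborel] that by (simp add: sigma_finite_lborel)
  have L: "(\<lambda>t. ?L F t) \<in> borel_measurable borel" if [measurable]: "F \<in> borel_measurable borel" for F
  proof -
    have "(\<lambda>t. emeasure lborel {x\<in>space lborel. ennreal t < F x}) \<in> borel_measurable borel"
      by measurable
    then show ?thesis by simp
  qed
  have pt: "?L f t + ?L g t \<le> 2 * ?L h t" if t: "0 < t" "t < 1" for t
  proof (rule brunn_minkowski_real)
    have "ennreal t < 1" using t by (simp add: ennreal_less_one_iff)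
    then show "{x. ennreal t < f x} \<noteq> {}" "{x. ennreal t < g x} \<noteq> {}"
      using sup less_SUP_iff[of "ennreal t" f UNIV] less_SUP_iff[of "ennreal t" g UNIV] by auto
    show "bdd_above {x. ennreal t < f x}"
      using supp(1) by (intro bdd_aboveI[of _ R]) (metis abs_ge_self le_less_trans linorder_not_le mem_Collect_eq not_less_zero)
    show "bdd_below {x. ennreal t < g x}"
      using supp(2) by (intro bdd_belowI[of _ "-R"]) (smt (verit) mem_Collect_eq not_less_zero)
    fix x y assume "x \<in> {x. ennreal t < f x}" "y \<in> {x. ennreal t < g x}"
    then have "ennreal t < f x" "ennreal t < g y" by auto
    then have "(ennreal t)\<^sup>2 < f x * g y"
      unfolding power2_eq_square using t by (cases "f x"; cases "g y") (auto simp: ennreal_less_iff ennreal_top_mult ennreal_mult_top simp flip: ennreal_mult intro!: mult_strict_mono)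
    also have "\<dots> \<le> (h ((x + y) / 2))\<^sup>2" by (rule mid)
    finally have "\<not> h ((x + y) / 2) \<le> ennreal t"
      by (metis leD power_mono zero_le)
    then show "(x + y) / 2 \<in> {x. ennreal t < h x}" by auto
  qed (measurable)
  have "integral\<^sup>N lborel f + integral\<^sup>N lborel g
     = (\<integral>\<^sup>+t\<in>{0<..<1}. ?L f t \<partial>lborel) + (\<integral>\<^sup>+t\<in>{0<..<1}. ?L g t \<partial>lborel)"
    using le1 by (subst (1 2) cake) (auto simp: min_absorb2)
  also have "\<dots> = (\<integral>\<^sup>+t\<in>{0<..<1}. (?L f t + ?L g t) \<partial>lborel)"
    using L[of f] L[of g] by (subst nn_integral_add[symmetric]) (auto simp: distrib_right)
  also have "\<dots> \<le> (\<integral>\<^sup>+t\<in>{0<..<1}. (2 * ?L h t) \<partial>lborel)"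
    using pt by (intro nn_integral_mono) (auto simp: indicator_def)
  also have "\<dots> = 2 * (\<integral>\<^sup>+t\<in>{0<..<1}. ?L h t \<partial>lborel)"
    using L[of h] by (subst nn_integral_cmult[symmetric]) (auto simp: mult.assoc)
  also have "\<dots> \<le> 2 * integral\<^sup>N lborel h"
    by (subst cake) (auto intro!: mult_left_mono nn_integral_mono)
  finally show ?thesis .
qed

text \<open>
  Normalize both functions to supremum \<open>1\<close>; the additive inequality then gives the
  multiplicative one, which is invariant under scaling.
\<close>

lemma prekopa_leindler_bounded:
  fixes f g h :: "real \<Rightarrow> ennreal"
  assumes [measurable]: "f \<in> borel_measurable borel" "g \<in> borel_measurable borel" "h \<in> borel_measurable borel"
    and mid: "\<And>x y. f x * g y \<le> (h ((x + y) / 2))\<^sup>2"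
    and bdd: "\<And>x. f x \<le> ennreal R" "\<And>x. g x \<le> ennreal R"
    and supp: "\<And>x. \<bar>x\<bar> > R \<Longrightarrow> f x = 0" "\<And>x. \<bar>x\<bar> > R \<Longrightarrow> g x = 0"
  shows "integral\<^sup>N lborel f * integral\<^sup>N lborel g \<le> (integral\<^sup>N lborel h)\<^sup>2"
proof (cases "(SUP x. f x) = 0 \<or> (SUP x. g x) = 0")
  case True
  then have "(\<forall>x. f x = 0) \<or> (\<forall>x. g x = 0)"
    by (metis SUP_upper UNIV_I le_zero_eq)
  then have "f = (\<lambda>_. 0) \<or> g = (\<lambda>_. 0)"
    by auto
  then show ?thesis by auto
next
  case False
  have "(SUP x. f x) \<le> ennreal R" "(SUP x. g x) \<le> ennreal R" by (auto intro: SUP_least bdd)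
  then obtain p q where p: "(SUP x. f x) = ennreal p" "p > 0" and q: "(SUP x. g x) = ennreal q" "q > 0"
    using False
    by (cases "SUP x. f x"; cases "SUP x. g x") (auto simp: top_unique less_le)
  define s where "s = sqrt (p * q)"
  have s: "s > 0" "s * s = p * q" using p q by (auto simp: s_def)
  let ?f = "\<lambda>x. ennreal (1/p) * f x" and ?g = "\<lambda>x. ennreal (1/q) * g x" and ?h = "\<lambda>x. ennreal (1/s) * h x"
  have "integral\<^sup>N lborel ?f + integral\<^sup>N lborel ?g \<le> 2 * integral\<^sup>N lborel ?h"
  proof (rule prekopa_leindler_sup_one)
    show "(SUP x. ?f x) = 1" "(SUP x. ?g x) = 1"
      using p q by (simp_all add: SUP_mult_left_ennreal flip: SUP_mult_left_ennreal ennreal_mult)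
    fix x y
    have "?f x * ?g y = ennreal (1/p * (1/q)) * (f x * g y)"
      using p q by (subst ennreal_mult) (auto simp: ac_simps)
    also have "1/p * (1/q) = (1/s) * (1/s)" using s by (simp add: field_simps)
    also have "ennreal ((1/s) * (1/s)) * (f x * g y) \<le> ennreal ((1/s) * (1/s)) * (h ((x + y) / 2))\<^sup>2"
      by (intro mult_left_mono mid) auto
    also have "\<dots> = (?h ((x + y) / 2))\<^sup>2"
      using s by (subst ennreal_mult) (auto simp: power2_eq_square ac_simps)
    finally show "?f x * ?g y \<le> (?h ((x + y) / 2))\<^sup>2" .
  qed (use supp in auto)
  then have "integral\<^sup>N lborel ?f * integral\<^sup>N lborel ?g \<le> (integral\<^sup>N lborel ?h)\<^sup>2"
    by (rule ennreal_mult_le_square_of_add_le)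
  then have "(ennreal (1/p) * integral\<^sup>N lborel f) * (ennreal (1/q) * integral\<^sup>N lborel g)
      \<le> (ennreal (1/s) * integral\<^sup>N lborel h)\<^sup>2"
    by (simp add: nn_integral_cmult)
  then have "ennreal (s * s) * ((ennreal (1/p) * integral\<^sup>N lborel f) * (ennreal (1/q) * integral\<^sup>N lborel g))
      \<le> ennreal (s * s) * (ennreal (1/s) * integral\<^sup>N lborel h)\<^sup>2"
    by (intro mult_left_mono) auto
  moreover have "ennreal (s * s) * ((ennreal (1/p) * integral\<^sup>N lborel f) * (ennreal (1/q) * integral\<^sup>N lborel g))
     = ennreal (p * q * (1/p) * (1/q)) * (integral\<^sup>N lborel f * integral\<^sup>N lborel g)"
    using p q unfolding s(2) by (simp only: ennreal_mult less_imp_le divide_nonneg_nonneg mult_nonneg_nonneg zero_le_one ac_simps)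
  moreover have "ennreal (s * s) * (ennreal (1/s) * integral\<^sup>N lborel h)\<^sup>2
     = ennreal (s * s * (1/s) * (1/s)) * (integral\<^sup>N lborel h)\<^sup>2"
    using s(1) by (simp only: power2_eq_square ennreal_mult less_imp_le divide_nonneg_nonneg mult_nonneg_nonneg zero_le_one ac_simps)
  moreover have "p * q * (1/p) * (1/q) = 1" "s * s * (1/s) * (1/s) = 1" using p q s by auto
  ultimately show ?thesis by simp
qed

text \<open>
  Truncate both functions in height and in support, and use monotone convergence.
\<close>

lemma prekopa_leindler_real:
  fixes f g h :: "real \<Rightarrow> ennreal"
  assumes [measurable]: "f \<in> borel_measurable borel" "g \<in> borel_measurable borel" "h \<in> borel_measurable borel"
    and mid: "\<And>x y. f x * g y \<le> (h ((x + y) / 2))\<^sup>2"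
  shows "integral\<^sup>N lborel f * integral\<^sup>N lborel g \<le> (integral\<^sup>N lborel h)\<^sup>2"
proof -
  let ?T = "\<lambda>F n x. min (F x) (of_nat n) * indicator {-real n..real n} x :: ennreal"
  have mono: "incseq (\<lambda>n. ?T F n)" for F :: "real \<Rightarrow> ennreal"
  proof (intro incseq_SucI le_funI mult_mono min.mono)
    show "of_nat n \<le> (of_nat (Suc n) :: ennreal)" for n by (rule of_nat_mono) simp
  qed (auto simp: indicator_def)
  have lim: "(SUP n. ?T F n x) = F x" for F :: "real \<Rightarrow> ennreal" and x
  proof (rule antisym)
    show "(SUP n. ?T F n x) \<le> F x" by (intro SUP_least) (auto simp: indicator_def)
    obtain N where N: "\<bar>x\<bar> \<le> real N" using real_arch_simple by blast
    show "F x \<le> (SUP n. ?T F n x)"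
    proof (rule le_SUP_iff[THEN iffD2], intro allI impI)
      fix c assume c: "c < F x"
      then obtain r where r: "c = ennreal r" "r \<ge> 0" by (cases c) auto
      obtain m where m: "r < real m" using reals_Archimedean2 by blast
      have "c < of_nat (max N m)"
        using m r by (simp add: ennreal_less_iff flip: ennreal_of_nat_eq_real_of_nat)
          (metis ennreal_less_iff ennreal_of_nat_eq_real_of_nat less_max_iff_disj of_nat_max)
      then have "c < ?T F (max N m) x" using c N by (auto simp: indicator_def)
      then show "\<exists>i\<in>UNIV. c < ?T F i x" by blast
    qed
  qed
  have int: "integral\<^sup>N lborel F = (SUP n. integral\<^sup>N lborel (?T F n))" if [measurable]: "F \<in> borel_measurable borel" for F
    using nn_integral_monotone_convergence_SUP[OF mono[of F], of lborel] by (simp add: lim image_image)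
  have fg: "integral\<^sup>N lborel (?T f n) * integral\<^sup>N lborel (?T g n) \<le> (integral\<^sup>N lborel h)\<^sup>2" for n
  proof (rule prekopa_leindler_bounded[where R="real n"])
    show "?T f n x * ?T g n y \<le> (h ((x + y) / 2))\<^sup>2" for x y
      by (rule order_trans[OF mult_mono mid]) (auto simp: indicator_def)
  qed (auto simp: indicator_def ennreal_of_nat_eq_real_of_nat)
  have I_mono: "integral\<^sup>N lborel (?T F m) \<le> integral\<^sup>N lborel (?T F n)" if "m \<le> n" for F m n
    using incseqD[OF mono[of F] that] by (intro nn_integral_mono) (auto simp: le_fun_def)
  have "integral\<^sup>N lborel f * integral\<^sup>N lborel g
     = (SUP m. SUP n. integral\<^sup>N lborel (?T f m) * integral\<^sup>N lborel (?T g n))"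
    unfolding int[OF assms(1)] int[OF assms(2)]
    by (simp add: SUP_mult_left_ennreal SUP_mult_right_ennreal) (rule SUP_commute)
  also have "\<dots> \<le> (integral\<^sup>N lborel h)\<^sup>2"
  proof (intro SUP_least)
    fix m n
    have "integral\<^sup>N lborel (?T f m) * integral\<^sup>N lborel (?T g n)
        \<le> integral\<^sup>N lborel (?T f (max m n)) * integral\<^sup>N lborel (?T g (max m n))"
      by (intro mult_mono I_mono) auto
    also have "\<dots> \<le> (integral\<^sup>N lborel h)\<^sup>2" by (rule fg)
    finally show "integral\<^sup>N lborel (?T f m) * integral\<^sup>N lborel (?T g n) \<le> (integral\<^sup>N lborel h)\<^sup>2" .
  qed
  finally show ?thesis .
qed

text \<open>
  Integrating out one coordinate preserves the hypothesis, by the induction hypothesis applied to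
  the sections; the one-dimensional case then handles the last coordinate.
\<close>

lemma prekopa_leindler_PiM:
  fixes f g h :: "('i \<Rightarrow> real) \<Rightarrow> ennreal"
  assumes "finite I"
    and "f \<in> borel_measurable (PiM I (\<lambda>_. lborel))" "g \<in> borel_measurable (PiM I (\<lambda>_. lborel))"
      "h \<in> borel_measurable (PiM I (\<lambda>_. lborel))"
    and "\<And>x y. x \<in> extensional I \<Longrightarrow> y \<in> extensional I \<Longrightarrow> f x * g y \<le> (h (\<lambda>i\<in>I. (x i + y i) / 2))\<^sup>2"
  shows "integral\<^sup>N (PiM I (\<lambda>_. lborel)) f * integral\<^sup>N (PiM I (\<lambda>_. lborel)) g
     \<le> (integral\<^sup>N (PiM I (\<lambda>_. lborel)) h)\<^sup>2"
  using assms
proof (induction I arbitrary: f g h rule: finite_induct)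
  case empty
  interpret product_sigma_finite "\<lambda>_::'i. lborel :: real measure" ..
  have "f (\<lambda>k. undefined) * g (\<lambda>k. undefined) \<le> (h (\<lambda>k. undefined))\<^sup>2"
    using empty(4)[of "\<lambda>k. undefined" "\<lambda>k. undefined"] by (simp add: restrict_def)
  then show ?case by (simp add: PiM_empty nn_integral_count_space_finite)
next
  case (insert i I)
  interpret product_sigma_finite "\<lambda>_::'i. lborel :: real measure" ..
  note meas = insert.prems(1-3)
  let ?P = "PiM I (\<lambda>_. lborel :: real measure)"
  have upd: "(\<lambda>x. F (x(i := u))) \<in> borel_measurable ?P"
    if "F \<in> borel_measurable (PiM (insert i I) (\<lambda>_. lborel))" for F :: "('i \<Rightarrow> real) \<Rightarrow> ennreal" and u
    using that by (rule measurable_compose[rotated]) (intro measurable_fun_upd[where J=I], auto)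
  have upd2: "(\<lambda>u. \<integral>\<^sup>+x. F (x(i := u)) \<partial>?P) \<in> borel_measurable borel"
    if [measurable]: "F \<in> borel_measurable (PiM (insert i I) (\<lambda>_. lborel))" for F :: "('i \<Rightarrow> real) \<Rightarrow> ennreal"
  proof -
    interpret finite_product_sigma_finite "\<lambda>_::'i. lborel :: real measure" I
      using insert.hyps(1) by unfold_locales
    have "(\<lambda>(u, x). x(i := u)) \<in> lborel \<Otimes>\<^sub>M ?P \<rightarrow>\<^sub>M PiM (insert i I) (\<lambda>_. lborel :: real measure)"
      unfolding case_prod_beta by (intro measurable_fun_upd[where J=I]) auto
    then have "(\<lambda>(u, x). F (x(i := u))) \<in> borel_measurable (lborel \<Otimes>\<^sub>M ?P)"
      using measurable_compose[OF _ that] by (simp add: case_prod_beta')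
    then have "(\<lambda>u. \<integral>\<^sup>+x. F (x(i := u)) \<partial>?P) \<in> borel_measurable lborel"
      by measurable
    then show ?thesis by simp
  qed
  have "integral\<^sup>N lborel (\<lambda>u. \<integral>\<^sup>+x. f (x(i := u)) \<partial>?P) * integral\<^sup>N lborel (\<lambda>u. \<integral>\<^sup>+x. g (x(i := u)) \<partial>?P)
      \<le> (integral\<^sup>N lborel (\<lambda>u. \<integral>\<^sup>+x. h (x(i := u)) \<partial>?P))\<^sup>2"
  proof (rule prekopa_leindler_real)
    fix u v :: real
    show "(\<integral>\<^sup>+x. f (x(i := u)) \<partial>?P) * (\<integral>\<^sup>+x. g (x(i := v)) \<partial>?P)
        \<le> (\<integral>\<^sup>+x. h (x(i := (u + v) / 2)) \<partial>?P)\<^sup>2"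
    proof (rule insert.IH)
      fix x y :: "'i \<Rightarrow> real" assume xy: "x \<in> extensional I" "y \<in> extensional I"
      then have "f (x(i := u)) * g (y(i := v))
          \<le> (h (\<lambda>j\<in>insert i I. ((x(i := u)) j + (y(i := v)) j) / 2))\<^sup>2"
        by (intro insert.prems(4)) (auto simp: extensional_def)
      also have "(\<lambda>j\<in>insert i I. ((x(i := u)) j + (y(i := v)) j) / 2) = (\<lambda>j\<in>I. (x j + y j) / 2)(i := (u + v) / 2)"
        using insert.hyps(2) by (auto simp: fun_eq_iff)
      finally show "f (x(i := u)) * g (y(i := v)) \<le> (h ((\<lambda>j\<in>I. (x j + y j) / 2)(i := (u + v) / 2)))\<^sup>2" .
    qed (intro upd meas)+
  qed (intro upd2 meas)+
  then show ?case
    using insert.hyps meas by (simp add: product_nn_integral_insert_rev)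
qed

theorem prekopa_leindler:
  fixes f g h :: "'a::euclidean_space \<Rightarrow> ennreal"
  assumes [measurable]: "f \<in> borel_measurable borel" "g \<in> borel_measurable borel" "h \<in> borel_measurable borel"
    and mid: "\<And>x y. f x * g y \<le> (h ((1/2) *\<^sub>R (x + y)))\<^sup>2"
  shows "integral\<^sup>N lborel f * integral\<^sup>N lborel g \<le> (integral\<^sup>N lborel h)\<^sup>2"
proof -
  let ?P = "PiM Basis (\<lambda>_. lborel :: real measure)"
  let ?s = "\<lambda>x. \<Sum>b\<in>Basis. x b *\<^sub>R b :: 'a"
  have int: "integral\<^sup>N lborel F = (\<integral>\<^sup>+x. F (?s x) \<partial>?P)" if "F \<in> borel_measurable borel" for F
    using that by (subst lborel_eq) (intro nn_integral_distr, auto)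
  have "(\<integral>\<^sup>+x. f (?s x) \<partial>?P) * (\<integral>\<^sup>+x. g (?s x) \<partial>?P) \<le> (\<integral>\<^sup>+x. h (?s x) \<partial>?P)\<^sup>2"
  proof (rule prekopa_leindler_PiM)
    fix x y :: "'a \<Rightarrow> real"
    have "f (?s x) * g (?s y) \<le> (h ((1/2) *\<^sub>R (?s x + ?s y)))\<^sup>2" by (rule mid)
    also have "(1/2) *\<^sub>R (?s x + ?s y) = ?s (\<lambda>i\<in>Basis. (x i + y i) / 2)"
      by (auto simp: scaleR_right_distrib scaleR_sum_right scaleR_left_distrib add_divide_distrib
          simp flip: sum.distrib intro!: sum.cong)
    finally show "f (?s x) * g (?s y) \<le> (h (?s (\<lambda>i\<in>Basis. (x i + y i) / 2)))\<^sup>2" .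
  qed auto
  then show ?thesis by (simp only: int assms)
qed

section \<open>Gaussian walks confined to a ball\<close>

text \<open>
  The density of the centred normal distribution with covariance matrix \<open>\<delta>\<close> times the identity.
\<close>

definition gauss :: "real \<Rightarrow> 'a::euclidean_space \<Rightarrow> real" where
  "gauss \<delta> x = exp (- (norm x)\<^sup>2 / (2 * \<delta>)) / sqrt (2 * pi * \<delta>) ^ DIM('a)"

lemma gauss_measurable [measurable]: "gauss \<delta> \<in> borel_measurable borel"
  unfolding gauss_def by measurable

lemma gauss_nonneg [simp]: "\<delta> > 0 \<Longrightarrow> 0 \<le> gauss \<delta> x"
  by (simp add: gauss_def)

lemma gauss_minus [simp]: "gauss \<delta> (- x) = gauss \<delta> x"
  by (simp add: gauss_def)

lemma gauss_le: "\<delta> > 0 \<Longrightarrow> gauss \<delta> (x::'a::euclidean_space) \<le> 1 / sqrt (2 * pi * \<delta>) ^ DIM('a)"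
  unfolding gauss_def by (intro divide_right_mono) auto

lemma gauss_eq_prod:
  fixes x :: "real^'n"
  assumes "\<delta> > 0"
  shows "(\<Prod>i\<in>UNIV. normal_density 0 (sqrt \<delta>) (x $ i)) = gauss \<delta> x"
proof -
  have "(\<Prod>i\<in>UNIV. normal_density 0 (sqrt \<delta>) (x $ i))
      = (\<Prod>i\<in>(UNIV::'n set). exp (- (x $ i)\<^sup>2 / (2 * \<delta>)) / sqrt (2 * pi * \<delta>))"
    using assms by (simp add: normal_density_def)
  also have "\<dots> = exp (\<Sum>i\<in>UNIV. - (x $ i)\<^sup>2 / (2 * \<delta>)) / sqrt (2 * pi * \<delta>) ^ CARD('n)"
    by (simp add: prod_dividef exp_sum)
  also have "(\<Sum>i\<in>UNIV. - (x $ i)\<^sup>2 / (2 * \<delta>)) = - (norm x)\<^sup>2 / (2 * \<delta>)"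
    by (simp add: norm_vec_def L2_set_def sum_nonneg sum_negf flip: sum_divide_distrib)
  finally show ?thesis by (simp add: gauss_def)
qed

text \<open>
  Log-concavity, that is, the parallelogram law for the exponents.
\<close>

lemma gauss_mult_midpoint:
  assumes "\<delta> > 0"
  shows "gauss \<delta> a * gauss \<delta> b \<le> (gauss \<delta> ((1/2) *\<^sub>R (a + b)))\<^sup>2"
proof -
  have "(norm (a + b))\<^sup>2 \<le> 2 * (norm a)\<^sup>2 + 2 * (norm b)\<^sup>2"
  proof -
    have "(norm (a + b))\<^sup>2 \<le> (norm a + norm b)\<^sup>2" by (intro power_mono norm_triangle_ineq) auto
    then show ?thesis using sum_squares_bound[of "norm a" "norm b"] by (simp add: power2_sum)
  qed
  then have *: "- (norm a)\<^sup>2 / (2 * \<delta>) + - (norm b)\<^sup>2 / (2 * \<delta>)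
      \<le> 2 * (- (norm ((1/2) *\<^sub>R (a + b)))\<^sup>2 / (2 * \<delta>))"
    using assms by (simp add: divide_simps power_mult_distrib del: scaleR_right_distrib)
  let ?c = "sqrt (2 * pi * \<delta>) ^ DIM('a)"
  have "gauss \<delta> a * gauss \<delta> b = exp (- (norm a)\<^sup>2 / (2 * \<delta>) + - (norm b)\<^sup>2 / (2 * \<delta>)) / (?c * ?c)"
    by (simp add: gauss_def exp_add[symmetric])
  also have "\<dots> \<le> exp (2 * (- (norm ((1/2) *\<^sub>R (a + b)))\<^sup>2 / (2 * \<delta>))) / (?c * ?c)"
    using * by (intro divide_right_mono) (auto simp: zero_le_mult_iff)
  also have "\<dots> = (gauss \<delta> ((1/2) *\<^sub>R (a + b)))\<^sup>2"
    unfolding exp_double gauss_def by (simp add: power_divide power2_eq_square)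
  finally show ?thesis .
qed

lemma gauss_tilt:
  assumes "\<delta> > 0"
  shows "gauss \<delta> (z + \<delta> *\<^sub>R a) = exp (- (a \<bullet> z) - \<delta> * (norm a)\<^sup>2 / 2) * gauss \<delta> z"
proof -
  have "(norm (z + \<delta> *\<^sub>R a))\<^sup>2 = (norm z)\<^sup>2 + 2 * \<delta> * (a \<bullet> z) + \<delta>\<^sup>2 * (norm a)\<^sup>2"
    unfolding power2_norm_eq_inner by (simp add: inner_add_left inner_add_right inner_commute power2_eq_square algebra_simps del: power2_norm_eq_inner)
  then have *: "- (norm (z + \<delta> *\<^sub>R a))\<^sup>2 / (2 * \<delta>) = (- (a \<bullet> z) - \<delta> * (norm a)\<^sup>2 / 2) + - (norm z)\<^sup>2 / (2 * \<delta>)"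
    using assms by (simp add: divide_simps) (simp add: algebra_simps power2_eq_square)
  show ?thesis unfolding gauss_def * exp_add by simp
qed

lemma gauss_mult_opposite:
  assumes "\<delta> > 0"
  shows "gauss \<delta> (z + d) * gauss \<delta> (z - d) = exp (- (norm d)\<^sup>2 / \<delta>) * (gauss \<delta> z)\<^sup>2"
proof -
  have 1: "gauss \<delta> (z + d) = exp (- ((d /\<^sub>R \<delta>) \<bullet> z) - \<delta> * (norm (d /\<^sub>R \<delta>))\<^sup>2 / 2) * gauss \<delta> z"
    using gauss_tilt[OF assms, of z "d /\<^sub>R \<delta>"] assms by simp
  have 2: "gauss \<delta> (z - d) = exp (- ((- d /\<^sub>R \<delta>) \<bullet> z) - \<delta> * (norm (- d /\<^sub>R \<delta>))\<^sup>2 / 2) * gauss \<delta> z"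
    using gauss_tilt[OF assms, of z "- d /\<^sub>R \<delta>"] assms by simp
  have "exp (- ((d /\<^sub>R \<delta>) \<bullet> z) - \<delta> * (norm (d /\<^sub>R \<delta>))\<^sup>2 / 2) * exp (- ((- d /\<^sub>R \<delta>) \<bullet> z) - \<delta> * (norm (- d /\<^sub>R \<delta>))\<^sup>2 / 2)
     = exp (- (norm d)\<^sup>2 / \<delta>)"
    using assms by (simp add: exp_add[symmetric] power_divide field_simps power2_eq_square)
  then show ?thesis unfolding 1 2 by (simp add: power2_eq_square ac_simps)
qed

lemma gauss_scale:
  assumes "c > 0" "\<delta> > 0"
  shows "c ^ DIM('a) * gauss (c\<^sup>2 * \<delta>) (c *\<^sub>R x) = gauss \<delta> (x::'a::euclidean_space)"
proof -
  have "sqrt (2 * pi * (c\<^sup>2 * \<delta>)) = c * sqrt (2 * pi * \<delta>)"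
    using assms by (simp add: real_sqrt_mult)
  then show ?thesis
    using assms by (simp add: gauss_def power_mult_distrib)
qed

text \<open>
  The pairs \<open>(\<delta>, d)\<close> describe the steps of a random walk started at \<open>x\<close>: each adds a centred Gaussian
  of variance \<open>\<delta>\<close> and subtracts \<open>d\<close>. The number is the expectation of \<open>u\<close> at the end of the walk,
  restricted to the event that the walk has stayed in the ball of radius \<open>\<epsilon>\<close> after each step. With \<open>d\<close>
  the increments of a path \<open>w\<close>, the walk is \<open>W - w\<close> at the times of a partition.
\<close>

fun chain :: "real \<Rightarrow> (real \<times> 'a::euclidean_space) list \<Rightarrow> ('a \<Rightarrow> ennreal) \<Rightarrow> 'a \<Rightarrow> ennreal" where
  "chain \<epsilon> [] u x = u x"
| "chain \<epsilon> (p # ps) u x =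
     (\<integral>\<^sup>+y. ennreal (gauss (fst p) (y - x + snd p)) * (indicator (cball 0 \<epsilon>) y * chain \<epsilon> ps u y) \<partial>lborel)"

declare borel_closed[OF closed_cball, measurable]

lemma chain_borel:
  assumes "u \<in> borel_measurable borel"
  shows "chain \<epsilon> ps u \<in> borel_measurable borel"
proof (induction ps)
  case (Cons p ps)
  note [measurable] = Cons measurable_compose[OF _ Cons, measurable (raw)]
  show ?case unfolding chain.simps by measurable
qed (use assms in simp)

lemma chain_measurable [measurable (raw)]:
  assumes "u \<in> borel_measurable borel" "f \<in> borel_measurable M"
  shows "(\<lambda>x. chain \<epsilon> ps u (f x)) \<in> borel_measurable M"
  using measurable_compose[OF assms(2) chain_borel[OF assms(1)]] .

lemma chain_append: "chain \<epsilon> (ps @ qs) u = chain \<epsilon> ps (chain \<epsilon> qs u)"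
proof (induction ps)
  case (Cons p ps)
  show ?case by (rule ext) (simp add: Cons)
qed auto

lemma chain_mono:
  assumes "\<And>y. y \<in> cball 0 \<epsilon> \<Longrightarrow> u y \<le> v y" "x \<in> cball 0 \<epsilon>"
  shows "chain \<epsilon> ps u x \<le> chain \<epsilon> ps v x"
  using assms(2)
proof (induction ps arbitrary: x)
  case (Cons p ps)
  show ?case unfolding chain.simps
    by (rule nn_integral_mono, rule mult_left_mono) (auto simp: indicator_def Cons.IH)
qed (use assms in auto)

lemma chain_cmult:
  assumes [measurable]: "u \<in> borel_measurable borel"
  shows "chain \<epsilon> ps (\<lambda>y. c * u y) x = c * chain \<epsilon> ps u x"
proof (induction ps arbitrary: x)
  case (Cons p ps)
  have "chain \<epsilon> (p # ps) (\<lambda>y. c * u y) x = (\<integral>\<^sup>+y. c * (ennreal (gauss (fst p) (y - x + snd p)) * (indicator (cball 0 \<epsilon>) y * chain \<epsilon> ps u y)) \<partial>lborel)"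
    by (simp add: Cons ac_simps)
  also have "\<dots> = c * chain \<epsilon> (p # ps) u x"
    by (subst nn_integral_cmult) auto
  finally show ?case .
qed simp

lemma chain_add:
  assumes [measurable]: "u \<in> borel_measurable borel" "v \<in> borel_measurable borel"
  shows "chain \<epsilon> ps (\<lambda>y. u y + v y) x = chain \<epsilon> ps u x + chain \<epsilon> ps v x"
proof (induction ps arbitrary: x)
  case (Cons p ps)
  show ?case unfolding chain.simps Cons
    by (subst nn_integral_add[symmetric]) (auto simp: distrib_left)
qed simp

definition flip_steps :: "(real \<times> 'a::euclidean_space) list \<Rightarrow> (real \<times> 'a) list" where
  "flip_steps = map (\<lambda>(\<delta>, d). (\<delta>, - d))"

definition unshifted_steps :: "(real \<times> 'a::euclidean_space) list \<Rightarrow> (real \<times> 'a) list" where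
  "unshifted_steps = map (\<lambda>(\<delta>, d). (\<delta>, 0))"

lemma nn_integral_lborel_uminus:
  fixes f :: "'a::euclidean_space \<Rightarrow> ennreal"
  assumes [measurable]: "f \<in> borel_measurable borel"
  shows "(\<integral>\<^sup>+x. f (- x) \<partial>lborel) = (\<integral>\<^sup>+x. f x \<partial>lborel)"
proof -
  have "(\<integral>\<^sup>+x. f x \<partial>lborel) = (\<integral>\<^sup>+x. f x \<partial>density (distr lborel borel (\<lambda>x. 0 + (-1) *\<^sub>R x)) (\<lambda>_. ennreal (\<bar>-1\<bar>^DIM('a))))"
    using lborel_affine[of "-1" "0::'a"] by simp
  also have "\<dots> = (\<integral>\<^sup>+x. f (- x) \<partial>lborel)"
    by (simp add: nn_integral_density nn_integral_distr)
  finally show ?thesis by simp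
qed

lemma nn_integral_lborel_scale:
  fixes f :: "'a::euclidean_space \<Rightarrow> ennreal"
  assumes [measurable]: "f \<in> borel_measurable borel" and "c > 0"
  shows "(\<integral>\<^sup>+x. f x \<partial>lborel) = (\<integral>\<^sup>+x. ennreal (c ^ DIM('a)) * f (c *\<^sub>R x) \<partial>lborel)"
proof -
  have "(\<integral>\<^sup>+x. f x \<partial>lborel) = (\<integral>\<^sup>+x. f x \<partial>density (distr lborel borel (\<lambda>x. 0 + c *\<^sub>R x)) (\<lambda>_. \<bar>c\<bar>^DIM('a)))"
    using assms by (subst lborel_affine[of c 0, symmetric]) auto
  also have "\<dots> = (\<integral>\<^sup>+x. ennreal (c ^ DIM('a)) * f (c *\<^sub>R x) \<partial>lborel)"
    using assms(2) by (simp add: nn_integral_density nn_integral_distr)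
  finally show ?thesis .
qed

text \<open>
  The reflected walk has the reflected shifts.
\<close>

lemma chain_flip:
  assumes [measurable]: "u \<in> borel_measurable borel" and "\<And>x. u (- x) = u x"
  shows "chain \<epsilon> (flip_steps ps) u x = chain \<epsilon> ps u (- x)"
proof (induction ps arbitrary: x)
  case (Cons p ps)
  have "chain \<epsilon> (flip_steps (p # ps)) u x
     = (\<integral>\<^sup>+y. ennreal (gauss (fst p) (y - x - snd p)) * (indicator (cball 0 \<epsilon>) y * chain \<epsilon> ps u (- y)) \<partial>lborel)"
    using Cons by (simp add: flip_steps_def case_prod_beta)
  also have "\<dots> = (\<integral>\<^sup>+y. ennreal (gauss (fst p) ((- y) - x - snd p)) * (indicator (cball 0 \<epsilon>) (- y) * chain \<epsilon> ps u (- (- y))) \<partial>lborel)"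
    by (subst nn_integral_lborel_uminus[symmetric]) auto
  also have "\<dots> = chain \<epsilon> (p # ps) u (- x)"
  proof -
    have "gauss (fst p) ((- y) - x - snd p) = gauss (fst p) (y - (- x) + snd p)" for y
    proof -
      have "(- y) - x - snd p = - (y - (- x) + snd p)" by simp
      then show ?thesis by (simp only: gauss_minus)
    qed
    then show ?thesis by (simp add: indicator_def)
  qed
  finally show ?case .
qed (use assms in \<open>simp add: flip_steps_def\<close>)

text \<open>
  The integrands are products of log-concave kernels and of the indicator of a convex set, so the
  inequality of Prekopa and Leindler propagates the midpoint condition through each integration.
\<close>

lemma chain_midpoint:
  fixes u u' u'' :: "'a::euclidean_space \<Rightarrow> ennreal"
  assumes [measurable]: "u \<in> borel_measurable borel" "u' \<in> borel_measurable borel" "u'' \<in> borel_measurable borel"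
    and u: "\<And>x x'. u x * u' x' \<le> (u'' ((1/2) *\<^sub>R (x + x')))\<^sup>2"
    and pos: "\<And>\<delta> d. (\<delta>, d) \<in> set ps \<Longrightarrow> \<delta> > 0"
  shows "chain \<epsilon> ps u x * chain \<epsilon> (flip_steps ps) u' x' \<le> (chain \<epsilon> (unshifted_steps ps) u'' ((1/2) *\<^sub>R (x + x')))\<^sup>2"
  using pos
proof (induction ps arbitrary: x x')
  case (Cons p ps)
  obtain \<delta> d where p: "p = (\<delta>, d)" by fastforce
  have \<delta>: "\<delta> > 0" using Cons.prems p by auto
  have IH: "chain \<epsilon> ps u y * chain \<epsilon> (flip_steps ps) u' y' \<le> (chain \<epsilon> (unshifted_steps ps) u'' ((1/2) *\<^sub>R (y + y')))\<^sup>2" for y y'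
    using Cons by auto
  have "(\<integral>\<^sup>+y. ennreal (gauss \<delta> (y - x + d)) * (indicator (cball 0 \<epsilon>) y * chain \<epsilon> ps u y) \<partial>lborel)
      * (\<integral>\<^sup>+y. ennreal (gauss \<delta> (y - x' + - d)) * (indicator (cball 0 \<epsilon>) y * chain \<epsilon> (flip_steps ps) u' y) \<partial>lborel)
     \<le> (\<integral>\<^sup>+y. ennreal (gauss \<delta> (y - (1/2) *\<^sub>R (x + x') + 0)) * (indicator (cball 0 \<epsilon>) y * chain \<epsilon> (unshifted_steps ps) u'' y) \<partial>lborel)\<^sup>2"
  proof (rule prekopa_leindler)
    fix y y' :: 'a
    let ?m = "(1/2) *\<^sub>R (y + y')"
    have 1: "ennreal (gauss \<delta> (y - x + d)) * ennreal (gauss \<delta> (y' - x' + - d)) \<le> (ennreal (gauss \<delta> (?m - (1/2) *\<^sub>R (x + x') + 0)))\<^sup>2"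
    proof -
      have "?m - (1/2) *\<^sub>R (x + x') + 0 = (1/2) *\<^sub>R ((y - x + d) + (y' - x' + - d))"
        by (simp add: algebra_simps)
      then show ?thesis
        using gauss_mult_midpoint[OF \<delta>, of "y - x + d" "y' - x' + - d"] \<delta>
        by (auto simp: ennreal_power simp flip: ennreal_mult intro!: ennreal_leI)
    qed
    have 2: "indicator (cball 0 \<epsilon>) y * indicator (cball 0 \<epsilon>) y' \<le> (indicator (cball 0 \<epsilon>) ?m :: ennreal)\<^sup>2"
    proof -
      have "?m \<in> cball 0 \<epsilon>" if "y \<in> cball 0 \<epsilon>" "y' \<in> cball 0 \<epsilon>"
        using convexD[OF convex_cball that, of "1/2" "1/2"] by (simp add: scaleR_add_right)
      then show ?thesis by (auto simp: indicator_def)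
    qed
    have "(ennreal (gauss \<delta> (y - x + d)) * (indicator (cball 0 \<epsilon>) y * chain \<epsilon> ps u y))
      * (ennreal (gauss \<delta> (y' - x' + - d)) * (indicator (cball 0 \<epsilon>) y' * chain \<epsilon> (flip_steps ps) u' y'))
      = (ennreal (gauss \<delta> (y - x + d)) * ennreal (gauss \<delta> (y' - x' + - d)))
        * ((indicator (cball 0 \<epsilon>) y * indicator (cball 0 \<epsilon>) y') * (chain \<epsilon> ps u y * chain \<epsilon> (flip_steps ps) u' y'))"
      by (simp add: ac_simps)
    also have "\<dots> \<le> (ennreal (gauss \<delta> (?m - (1/2) *\<^sub>R (x + x') + 0)))\<^sup>2
       * ((indicator (cball 0 \<epsilon>) ?m)\<^sup>2 * (chain \<epsilon> (unshifted_steps ps) u'' ?m)\<^sup>2)"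
      by (intro mult_mono 1 2 IH) auto
    also have "\<dots> = (ennreal (gauss \<delta> (?m - (1/2) *\<^sub>R (x + x') + 0)) * (indicator (cball 0 \<epsilon>) ?m * chain \<epsilon> (unshifted_steps ps) u'' ?m))\<^sup>2"
      by (simp add: power_mult_distrib)
    finally show "(ennreal (gauss \<delta> (y - x + d)) * (indicator (cball 0 \<epsilon>) y * chain \<epsilon> ps u y))
      * (ennreal (gauss \<delta> (y' - x' + - d)) * (indicator (cball 0 \<epsilon>) y' * chain \<epsilon> (flip_steps ps) u' y')) \<le> \<dots>" .
  qed measurable
  then show ?case by (simp add: p flip_steps_def unshifted_steps_def)
qed (use u in \<open>simp add: flip_steps_def unshifted_steps_def\<close>)

lemma ennreal_square_le_imp_le:
  fixes a b :: ennreal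
  assumes "a\<^sup>2 \<le> b\<^sup>2"
  shows "a \<le> b"
proof (cases "b = \<top>")
  case False
  then have "b\<^sup>2 \<noteq> \<top>" by (simp add: power2_eq_square ennreal_mult_eq_top_iff)
  then have "a\<^sup>2 \<noteq> \<top>" using assms top.extremum_unique by fastforce
  then have "a \<noteq> \<top>" by (auto simp: power2_eq_square)
  with False assms show ?thesis
    by (cases a; cases b) (auto simp: ennreal_power dest: power2_le_imp_le)
qed auto

text \<open>
  Anderson's inequality: the chain with shifts \<open>d\<close> from \<open>x\<close> equals the one with shifts \<open>- d\<close>
  from \<open>- x\<close>, and the walk halfway between the two is centred and starts at \<open>0\<close>.
\<close>

theorem chain_anderson:
  assumes pos: "\<And>\<delta> d. (\<delta>, d) \<in> set ps \<Longrightarrow> \<delta> > 0"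
  shows "chain \<epsilon> ps (\<lambda>_. 1) x \<le> chain \<epsilon> (unshifted_steps ps) (\<lambda>_. 1) 0"
proof (rule ennreal_square_le_imp_le)
  have "(chain \<epsilon> ps (\<lambda>_. 1) x)\<^sup>2 = chain \<epsilon> ps (\<lambda>_. 1) x * chain \<epsilon> (flip_steps ps) (\<lambda>_. 1) (- x)"
    by (subst chain_flip) (auto simp: power2_eq_square)
  also have "\<dots> \<le> (chain \<epsilon> (unshifted_steps ps) (\<lambda>_. 1) ((1/2) *\<^sub>R (x + - x)))\<^sup>2"
    by (rule chain_midpoint) (use pos in auto)
  finally show "(chain \<epsilon> ps (\<lambda>_. 1) x)\<^sup>2 \<le> (chain \<epsilon> (unshifted_steps ps) (\<lambda>_. 1) 0)\<^sup>2" by simp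
qed

text \<open>
  For the increments of a path along a partition this is the integral of the squared speed of the
  interpolating polygon.
\<close>

definition action :: "(real \<times> 'a::euclidean_space) list \<Rightarrow> real" where
  "action ps = (\<Sum>(\<delta>, d)\<leftarrow>ps. (norm d)\<^sup>2 / \<delta>)"

lemma nn_integral_sqrt_cauchy_schwarz:
  assumes [measurable]: "f \<in> borel_measurable M" "g \<in> borel_measurable M" "k \<in> borel_measurable M"
    and k: "\<And>x. x \<in> space M \<Longrightarrow> (k x)\<^sup>2 \<le> f x * g x"
  shows "(\<integral>\<^sup>+x. k x \<partial>M)\<^sup>2 \<le> (\<integral>\<^sup>+x. f x \<partial>M) * (\<integral>\<^sup>+x. g x \<partial>M)"
proof -
  define sq :: "ennreal \<Rightarrow> ennreal" where "sq a = (if a = \<top> then \<top> else ennreal (sqrt (enn2real a)))" for a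
  have [measurable]: "sq \<in> borel_measurable borel" unfolding sq_def by measurable
  have sq: "(sq a)\<^sup>2 = a" for a
    by (cases a) (auto simp: sq_def power2_eq_square simp flip: ennreal_mult)
  have "k x \<le> sq (f x) * sq (g x)" if "x \<in> space M" for x
    by (rule ennreal_square_le_imp_le) (use k[OF that] in \<open>simp add: power_mult_distrib sq\<close>)
  then have "(\<integral>\<^sup>+x. k x \<partial>M)\<^sup>2 \<le> (\<integral>\<^sup>+x. sq (f x) * sq (g x) \<partial>M)\<^sup>2"
    by (intro power_mono nn_integral_mono) auto
  also have "\<dots> \<le> (\<integral>\<^sup>+x. (sq (f x))\<^sup>2 \<partial>M) * (\<integral>\<^sup>+x. (sq (g x))\<^sup>2 \<partial>M)"
    by (rule Cauchy_Schwarz_nn_integral) measurable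
  finally show ?thesis by (simp add: sq)
qed

text \<open>
  Since \<open>gauss \<delta> (z + d) * gauss \<delta> (z - d)\<close> is \<open>(gauss \<delta> z)\<^sup>2\<close> up to the factor
  \<open>exp (- |d|\<^sup>2 / \<delta>)\<close>, the geometric mean of the two shifted integrands is the centred one up to the
  square root of this factor; apply the Cauchy-Schwarz inequality in each step.
\<close>

lemma chain_opposite_shifts:
  assumes pos: "\<And>\<delta> d. (\<delta>, d) \<in> set ps \<Longrightarrow> \<delta> > 0"
  shows "ennreal (exp (- action ps)) * (chain \<epsilon> (unshifted_steps ps) (\<lambda>_. 1) x)\<^sup>2
     \<le> chain \<epsilon> ps (\<lambda>_. 1) x * chain \<epsilon> (flip_steps ps) (\<lambda>_. 1) x"
  using pos
proof (induction ps arbitrary: x)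
  case (Cons p ps)
  obtain \<delta> d where p: "p = (\<delta>, d)" by fastforce
  have \<delta>: "\<delta> > 0" using Cons.prems p by auto
  have IH: "ennreal (exp (- action ps)) * (chain \<epsilon> (unshifted_steps ps) (\<lambda>_. 1) y)\<^sup>2
     \<le> chain \<epsilon> ps (\<lambda>_. 1) y * chain \<epsilon> (flip_steps ps) (\<lambda>_. 1) y" for y
    using Cons by auto
  define e where "e = exp (- action (p # ps) / 2)"
  have e: "e \<ge> 0" "e * e = exp (- (norm d)\<^sup>2 / \<delta>) * exp (- action ps)"
    by (auto simp: e_def action_def p exp_add[symmetric])
  have ee: "e * e = exp (- action (p # ps))"
    by (auto simp: e_def exp_add[symmetric])
  have "(\<integral>\<^sup>+y. ennreal e * (ennreal (gauss \<delta> (y - x + 0)) * (indicator (cball 0 \<epsilon>) y * chain \<epsilon> (unshifted_steps ps) (\<lambda>_. 1) y)) \<partial>lborel)\<^sup>2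
    \<le> (\<integral>\<^sup>+y. ennreal (gauss \<delta> (y - x + d)) * (indicator (cball 0 \<epsilon>) y * chain \<epsilon> ps (\<lambda>_. 1) y) \<partial>lborel)
      * (\<integral>\<^sup>+y. ennreal (gauss \<delta> (y - x + - d)) * (indicator (cball 0 \<epsilon>) y * chain \<epsilon> (flip_steps ps) (\<lambda>_. 1) y) \<partial>lborel)"
  proof (rule nn_integral_sqrt_cauchy_schwarz)
    fix y
    have "(ennreal e * (ennreal (gauss \<delta> (y - x + 0)) * (indicator (cball 0 \<epsilon>) y * chain \<epsilon> (unshifted_steps ps) (\<lambda>_. 1) y)))\<^sup>2
      = ennreal (e * e) * (ennreal ((gauss \<delta> (y - x))\<^sup>2) * ((indicator (cball 0 \<epsilon>) y)\<^sup>2 * (chain \<epsilon> (unshifted_steps ps) (\<lambda>_. 1) y)\<^sup>2))"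
      using e(1) \<delta> by (simp add: power2_eq_square ennreal_mult ac_simps)
    also have "\<dots> = ennreal (exp (- (norm d)\<^sup>2 / \<delta>) * (gauss \<delta> (y - x))\<^sup>2) * ((indicator (cball 0 \<epsilon>) y)\<^sup>2 *
        (ennreal (exp (- action ps)) * (chain \<epsilon> (unshifted_steps ps) (\<lambda>_. 1) y)\<^sup>2))"
      unfolding e(2) by (simp add: ennreal_mult ac_simps)
    also have "\<dots> \<le> ennreal (exp (- (norm d)\<^sup>2 / \<delta>) * (gauss \<delta> (y - x))\<^sup>2) * ((indicator (cball 0 \<epsilon>) y)\<^sup>2 *
        (chain \<epsilon> ps (\<lambda>_. 1) y * chain \<epsilon> (flip_steps ps) (\<lambda>_. 1) y))"
      by (intro mult_left_mono IH) auto
    also have "exp (- (norm d)\<^sup>2 / \<delta>) * (gauss \<delta> (y - x))\<^sup>2 = gauss \<delta> (y - x + d) * gauss \<delta> (y - x + - d)"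
      using gauss_mult_opposite[OF \<delta>, of "y - x" d] by simp
    finally show "(ennreal e * (ennreal (gauss \<delta> (y - x + 0)) * (indicator (cball 0 \<epsilon>) y * chain \<epsilon> (unshifted_steps ps) (\<lambda>_. 1) y)))\<^sup>2
      \<le> ennreal (gauss \<delta> (y - x + d)) * (indicator (cball 0 \<epsilon>) y * chain \<epsilon> ps (\<lambda>_. 1) y)
       * (ennreal (gauss \<delta> (y - x + - d)) * (indicator (cball 0 \<epsilon>) y * chain \<epsilon> (flip_steps ps) (\<lambda>_. 1) y))"
      using \<delta> by (simp add: ennreal_mult power2_eq_square ac_simps)
  qed measurable
  also have "(\<integral>\<^sup>+y. ennreal e * (ennreal (gauss \<delta> (y - x + 0)) * (indicator (cball 0 \<epsilon>) y * chain \<epsilon> (unshifted_steps ps) (\<lambda>_. 1) y)) \<partial>lborel)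
     = ennreal e * (\<integral>\<^sup>+y. ennreal (gauss \<delta> (y - x + 0)) * (indicator (cball 0 \<epsilon>) y * chain \<epsilon> (unshifted_steps ps) (\<lambda>_. 1) y) \<partial>lborel)"
    by (rule nn_integral_cmult) measurable
  finally show ?case
    unfolding power_mult_distrib ennreal_power[OF e(1)] power2_eq_square[of e] ee
    by (simp add: p flip_steps_def unshifted_steps_def)
qed (simp add: action_def flip_steps_def unshifted_steps_def)

text \<open>
  By symmetry both shifted chains agree when the walk starts at \<open>0\<close>.
\<close>

theorem chain_shift_lower_bound:
  assumes pos: "\<And>\<delta> d. (\<delta>, d) \<in> set ps \<Longrightarrow> \<delta> > 0"
  shows "ennreal (exp (- action ps / 2)) * chain \<epsilon> (unshifted_steps ps) (\<lambda>_. 1) 0 \<le> chain \<epsilon> ps (\<lambda>_. 1) 0"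
proof (rule ennreal_square_le_imp_le)
  have "(ennreal (exp (- action ps / 2)) * chain \<epsilon> (unshifted_steps ps) (\<lambda>_. 1) 0)\<^sup>2
     = ennreal (exp (- action ps)) * (chain \<epsilon> (unshifted_steps ps) (\<lambda>_. 1) 0)\<^sup>2"
    by (simp add: power_mult_distrib ennreal_power exp_double[symmetric])
  also have "\<dots> \<le> chain \<epsilon> ps (\<lambda>_. 1) 0 * chain \<epsilon> (flip_steps ps) (\<lambda>_. 1) 0"
    by (rule chain_opposite_shifts) (rule pos)
  also have "\<dots> = (chain \<epsilon> ps (\<lambda>_. 1) 0)\<^sup>2"
    by (subst chain_flip) (auto simp: power2_eq_square)
  finally show "(ennreal (exp (- action ps / 2)) * chain \<epsilon> (unshifted_steps ps) (\<lambda>_. 1) 0)\<^sup>2 \<le> (chain \<epsilon> ps (\<lambda>_. 1) 0)\<^sup>2" .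
qed

lemma ennreal_regroup: "a * c = e * f \<Longrightarrow> a * (b * (c * d)) = e * (f * (b * (d::ennreal)))"
  by (metis (no_types, opaque_lifting) mult.assoc mult.commute)

definition tilt_steps :: "'a \<Rightarrow> (real \<times> 'a::euclidean_space) list \<Rightarrow> (real \<times> 'a) list" where
  "tilt_steps a = map (\<lambda>(\<delta>, d). (\<delta>, d + \<delta> *\<^sub>R a))"

text \<open>
  A discrete Cameron-Martin formula. In the exponent the terms \<open>a \<bullet> (y - x + d)\<close> of the single steps
  telescope, so that only the two end points of the walk and the sum of the shifts survive.
\<close>

lemma chain_tilt:
  assumes [measurable]: "u \<in> borel_measurable borel"
    and pos: "\<And>\<delta> d. (\<delta>, d) \<in> set ps \<Longrightarrow> \<delta> > 0"
  shows "chain \<epsilon> (tilt_steps a ps) u x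
     = ennreal (exp (a \<bullet> x - a \<bullet> sum_list (map snd ps) - sum_list (map fst ps) * (norm a)\<^sup>2 / 2))
       * chain \<epsilon> ps (\<lambda>y. ennreal (exp (- (a \<bullet> y))) * u y) x"
  using pos
proof (induction ps arbitrary: x)
  case Nil
  then show ?case
    by (simp add: tilt_steps_def flip: ennreal_mult exp_add mult.assoc)
next
  case (Cons p ps)
  obtain \<delta> d where p: "p = (\<delta>, d)" by fastforce
  have \<delta>: "\<delta> > 0" using Cons.prems p by auto
  let ?u = "\<lambda>y. ennreal (exp (- (a \<bullet> y))) * u y"
  let ?c = "\<lambda>ps x. a \<bullet> x - a \<bullet> sum_list (map snd ps) - sum_list (map fst ps) * (norm a)\<^sup>2 / 2"
  have IH: "chain \<epsilon> (tilt_steps a ps) u y = ennreal (exp (?c ps y)) * chain \<epsilon> ps ?u y" for y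
    using Cons by auto
  have "chain \<epsilon> (tilt_steps a (p # ps)) u x
     = (\<integral>\<^sup>+y. ennreal (gauss \<delta> (y - x + (d + \<delta> *\<^sub>R a))) * (indicator (cball 0 \<epsilon>) y * (ennreal (exp (?c ps y)) * chain \<epsilon> ps ?u y)) \<partial>lborel)"
    by (simp add: tilt_steps_def p IH[unfolded tilt_steps_def])
  also have "\<dots> = (\<integral>\<^sup>+y. ennreal (exp (?c (p # ps) x)) * (ennreal (gauss \<delta> (y - x + d)) * (indicator (cball 0 \<epsilon>) y * chain \<epsilon> ps ?u y)) \<partial>lborel)"
  proof (intro nn_integral_cong)
    fix y
    have "gauss \<delta> (y - x + (d + \<delta> *\<^sub>R a)) = exp (- (a \<bullet> (y - x + d)) - \<delta> * (norm a)\<^sup>2 / 2) * gauss \<delta> (y - x + d)"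
      using gauss_tilt[OF \<delta>, of "y - x + d" a] by (simp add: add.assoc)
    then have "gauss \<delta> (y - x + (d + \<delta> *\<^sub>R a)) * exp (?c ps y)
       = exp (- (a \<bullet> (y - x + d)) - \<delta> * (norm a)\<^sup>2 / 2) * exp (?c ps y) * gauss \<delta> (y - x + d)"
      by simp
    also have "exp (- (a \<bullet> (y - x + d)) - \<delta> * (norm a)\<^sup>2 / 2) * exp (?c ps y) = exp (?c (p # ps) x)"
      unfolding exp_add[symmetric] by (simp add: p inner_simps algebra_simps add_divide_distrib)
    finally have "ennreal (gauss \<delta> (y - x + (d + \<delta> *\<^sub>R a))) * ennreal (exp (?c ps y))
      = ennreal (exp (?c (p # ps) x)) * ennreal (gauss \<delta> (y - x + d))"
      using \<delta> by (simp flip: ennreal_mult)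
    then show "ennreal (gauss \<delta> (y - x + (d + \<delta> *\<^sub>R a))) * (indicator (cball 0 \<epsilon>) y * (ennreal (exp (?c ps y)) * chain \<epsilon> ps ?u y))
      = ennreal (exp (?c (p # ps) x)) * (ennreal (gauss \<delta> (y - x + d)) * (indicator (cball 0 \<epsilon>) y * chain \<epsilon> ps ?u y))"
      by (rule ennreal_regroup)
  qed
  also have "\<dots> = ennreal (exp (?c (p # ps) x)) * chain \<epsilon> (p # ps) ?u x"
    by (subst nn_integral_cmult) (auto simp: p)
  finally show ?case .
qed

text \<open>
  If the shifts sum to zero, the tilt only sees the two end points of the walk. These lie in the
  ball, which costs at most \<open>\<epsilon> |a|\<close> each.
\<close>

lemma chain_tilt_bridge_le:
  assumes [measurable]: "u \<in> borel_measurable borel"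
    and pos: "\<And>\<delta> d. (\<delta>, d) \<in> set ps \<Longrightarrow> \<delta> > 0"
    and bridge: "sum_list (map snd ps) = 0" and x: "x \<in> cball 0 \<epsilon>"
  shows "chain \<epsilon> (tilt_steps a ps) u x
     \<le> ennreal (exp (2 * \<epsilon> * norm a - sum_list (map fst ps) * (norm a)\<^sup>2 / 2)) * chain \<epsilon> ps u x"
proof -
  have inner: "\<bar>a \<bullet> y\<bar> \<le> \<epsilon> * norm a" if "y \<in> cball 0 \<epsilon>" for y
  proof -
    have "\<bar>a \<bullet> y\<bar> \<le> norm a * norm y" by (rule Cauchy_Schwarz_ineq2)
    also have "\<dots> \<le> norm a * \<epsilon>" using that by (intro mult_left_mono) auto
    finally show ?thesis by (simp add: mult.commute)
  qed
  let ?s = "sum_list (map fst ps) * (norm a)\<^sup>2 / 2"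
  have "chain \<epsilon> (tilt_steps a ps) u x
     = ennreal (exp (a \<bullet> x - ?s)) * chain \<epsilon> ps (\<lambda>y. ennreal (exp (- (a \<bullet> y))) * u y) x"
    using chain_tilt[OF assms(1) pos] bridge by simp
  also have "\<dots> \<le> ennreal (exp (\<epsilon> * norm a - ?s)) * chain \<epsilon> ps (\<lambda>y. ennreal (exp (\<epsilon> * norm a)) * u y) x"
    using inner[OF x] inner
    by (intro mult_mono chain_mono x mult_right_mono ennreal_leI) (auto simp: abs_le_iff minus_le_iff)
  also have "\<dots> = ennreal (exp (\<epsilon> * norm a - ?s)) * ennreal (exp (\<epsilon> * norm a)) * chain \<epsilon> ps u x"
    by (simp add: chain_cmult mult.assoc)
  also have "ennreal (exp (\<epsilon> * norm a - ?s)) * ennreal (exp (\<epsilon> * norm a)) = ennreal (exp (2 * \<epsilon> * norm a - ?s))"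
    by (simp flip: ennreal_mult exp_add)
  finally show ?thesis .
qed

text \<open>
  Several successive blocks, each with its own slope \<open>a\<close>, as they arise from a polygon.
\<close>

lemma chain_tilt_blocks_le:
  assumes pos: "\<And>a ps \<delta> d. (a, ps) \<in> set bs \<Longrightarrow> (\<delta>, d) \<in> set ps \<Longrightarrow> \<delta> > 0"
    and bridge: "\<And>a ps. (a, ps) \<in> set bs \<Longrightarrow> sum_list (map snd ps) = 0" and x: "x \<in> cball 0 \<epsilon>"
  shows "chain \<epsilon> (concat (map (\<lambda>(a, ps). tilt_steps a ps) bs)) (\<lambda>_. 1) x
     \<le> ennreal (exp (\<Sum>(a, ps)\<leftarrow>bs. 2 * \<epsilon> * norm a - sum_list (map fst ps) * (norm a)\<^sup>2 / 2))
       * chain \<epsilon> (concat (map snd bs)) (\<lambda>_. 1) x"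
  using pos bridge x
proof (induction bs arbitrary: x)
  case (Cons b bs)
  obtain a ps where b: "b = (a, ps)" by fastforce
  let ?e = "\<lambda>(a, ps). 2 * \<epsilon> * norm a - sum_list (map fst ps) * (norm a)\<^sup>2 / 2"
  let ?E = "\<Sum>b\<leftarrow>bs. ?e b"
  have IH: "chain \<epsilon> (concat (map (\<lambda>(a, ps). tilt_steps a ps) bs)) (\<lambda>_. 1) y
     \<le> ennreal (exp ?E) * chain \<epsilon> (concat (map snd bs)) (\<lambda>_. 1) y" if "y \<in> cball 0 \<epsilon>" for y
  proof (rule Cons.IH)
    show "\<delta> > 0" if "(a, ps) \<in> set bs" "(\<delta>, d) \<in> set ps" for a ps \<delta> d
      using Cons.prems(1) that by (meson list.set_intros(2))
    show "sum_list (map snd ps) = 0" if "(a, ps) \<in> set bs" for a ps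
      using Cons.prems(2) that by (meson list.set_intros(2))
  qed (use that in auto)
  have "chain \<epsilon> (concat (map (\<lambda>(a, ps). tilt_steps a ps) (b # bs))) (\<lambda>_. 1) x
     = chain \<epsilon> (tilt_steps a ps) (chain \<epsilon> (concat (map (\<lambda>(a, ps). tilt_steps a ps) bs)) (\<lambda>_. 1)) x"
    by (simp add: b chain_append)
  also have "\<dots> \<le> chain \<epsilon> (tilt_steps a ps) (\<lambda>y. ennreal (exp ?E) * chain \<epsilon> (concat (map snd bs)) (\<lambda>_. 1) y) x"
    by (intro chain_mono IH Cons.prems)
  also have "\<dots> = ennreal (exp ?E) * chain \<epsilon> (tilt_steps a ps) (chain \<epsilon> (concat (map snd bs)) (\<lambda>_. 1)) x"
    by (rule chain_cmult) measurable
  also have "\<dots> \<le> ennreal (exp ?E) * (ennreal (exp (?e b)) * chain \<epsilon> ps (chain \<epsilon> (concat (map snd bs)) (\<lambda>_. 1)) x)"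
    unfolding b prod.case
  proof (intro mult_left_mono chain_tilt_bridge_le)
    show "\<delta> > 0" if "(\<delta>, d) \<in> set ps" for \<delta> d
      using Cons.prems(1)[of a ps] that b by simp
    show "sum_list (map snd ps) = 0"
      using Cons.prems(2)[of a ps] b by simp
  qed (use Cons.prems in auto)
  also have "\<dots> = ennreal (exp ?E) * ennreal (exp (?e b)) * chain \<epsilon> (concat (map snd (b # bs))) (\<lambda>_. 1) x"
    by (simp add: b chain_append mult.assoc)
  also have "ennreal (exp ?E) * ennreal (exp (?e b)) = ennreal (exp (\<Sum>b\<leftarrow>b # bs. ?e b))"
    by (simp add: add.commute flip: ennreal_mult exp_add)
  finally show ?case .
qed simp

lemma chain_scale:
  assumes [measurable]: "u \<in> borel_measurable borel" and c: "c > 0"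
    and pos: "\<And>\<delta> d. (\<delta>, d) \<in> set ps \<Longrightarrow> \<delta> > 0"
  shows "chain (c * \<epsilon>) (map (\<lambda>(\<delta>, d). (c\<^sup>2 * \<delta>, c *\<^sub>R d)) ps) u (c *\<^sub>R x) = chain \<epsilon> ps (\<lambda>y. u (c *\<^sub>R y)) x"
  using pos
proof (induction ps arbitrary: x)
  case (Cons p ps)
  obtain \<delta> d where p: "p = (\<delta>, d)" by fastforce
  have \<delta>: "\<delta> > 0" using Cons.prems p by auto
  let ?ps = "map (\<lambda>(\<delta>, d). (c\<^sup>2 * \<delta>, c *\<^sub>R d)) ps"
  have IH: "chain (c * \<epsilon>) ?ps u (c *\<^sub>R y) = chain \<epsilon> ps (\<lambda>y. u (c *\<^sub>R y)) y" for y
    using Cons by auto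
  have "chain (c * \<epsilon>) (map (\<lambda>(\<delta>, d). (c\<^sup>2 * \<delta>, c *\<^sub>R d)) (p # ps)) u (c *\<^sub>R x)
    = (\<integral>\<^sup>+y. ennreal (gauss (c\<^sup>2 * \<delta>) (y - c *\<^sub>R x + c *\<^sub>R d)) * (indicator (cball 0 (c * \<epsilon>)) y * chain (c * \<epsilon>) ?ps u y) \<partial>lborel)"
    by (simp add: p)
  also have "\<dots> = (\<integral>\<^sup>+y. ennreal (c ^ DIM('a)) * (ennreal (gauss (c\<^sup>2 * \<delta>) (c *\<^sub>R y - c *\<^sub>R x + c *\<^sub>R d)) *
      (indicator (cball 0 (c * \<epsilon>)) (c *\<^sub>R y) * chain (c * \<epsilon>) ?ps u (c *\<^sub>R y))) \<partial>lborel)"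
    by (rule nn_integral_lborel_scale) (use c in auto)
  also have "\<dots> = (\<integral>\<^sup>+y. ennreal (gauss \<delta> (y - x + d)) * (indicator (cball 0 \<epsilon>) y * chain \<epsilon> ps (\<lambda>y. u (c *\<^sub>R y)) y) \<partial>lborel)"
  proof (intro nn_integral_cong)
    fix y
    have "c *\<^sub>R y - c *\<^sub>R x + c *\<^sub>R d = c *\<^sub>R (y - x + d)" by (simp add: algebra_simps)
    then have eq1: "ennreal (c ^ DIM('a)) * ennreal (gauss (c\<^sup>2 * \<delta>) (c *\<^sub>R y - c *\<^sub>R x + c *\<^sub>R d)) = ennreal (gauss \<delta> (y - x + d))"
      using gauss_scale[OF c \<delta>, of "y - x + d"] c \<delta> by (simp flip: ennreal_mult)
    have eq2: "indicator (cball 0 (c * \<epsilon>)) (c *\<^sub>R y) = (indicator (cball 0 \<epsilon>) y :: ennreal)"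
      using c by (auto simp: indicator_def)
    show "ennreal (c ^ DIM('a)) * (ennreal (gauss (c\<^sup>2 * \<delta>) (c *\<^sub>R y - c *\<^sub>R x + c *\<^sub>R d)) *
      (indicator (cball 0 (c * \<epsilon>)) (c *\<^sub>R y) * chain (c * \<epsilon>) ?ps u (c *\<^sub>R y)))
      = ennreal (gauss \<delta> (y - x + d)) * (indicator (cball 0 \<epsilon>) y * chain \<epsilon> ps (\<lambda>y. u (c *\<^sub>R y)) y)"
      by (simp only: IH mult.assoc[symmetric] eq1 eq2)
  qed
  also have "\<dots> = chain \<epsilon> (p # ps) (\<lambda>y. u (c *\<^sub>R y)) x" by (simp add: p)
  finally show ?case .
qed simp

text \<open>
  The kernel of a centred step is symmetric, so the operator with the steps in reverse order is the
  adjoint in the space \<open>L\<^sup>2\<close> of the ball.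
\<close>

lemma chain_adjoint:
  fixes f g :: "'a::euclidean_space \<Rightarrow> ennreal"
  assumes [measurable]: "f \<in> borel_measurable borel" "g \<in> borel_measurable borel"
    and centred: "\<And>\<delta> d. (\<delta>, d) \<in> set ps \<Longrightarrow> d = 0"
  shows "(\<integral>\<^sup>+x\<in>cball 0 \<epsilon>. (f x * chain \<epsilon> ps g x) \<partial>lborel) = (\<integral>\<^sup>+x\<in>cball 0 \<epsilon>. (chain \<epsilon> (rev ps) f x * g x) \<partial>lborel)"
  using assms
proof (induction ps arbitrary: f)
  case (Cons p ps)
  obtain \<delta> where p: "p = (\<delta>, 0)" using Cons.prems(3)[of "fst p" "snd p"] by (cases p) auto
  note [measurable] = Cons.prems(1,2)
  let ?B = "cball 0 \<epsilon> :: 'a set"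
  have "(\<integral>\<^sup>+x\<in>?B. (f x * chain \<epsilon> (p # ps) g x) \<partial>lborel)
     = (\<integral>\<^sup>+x. (\<integral>\<^sup>+y. (f x * indicator ?B x) * (ennreal (gauss \<delta> (y - x)) * (indicator ?B y * chain \<epsilon> ps g y)) \<partial>lborel) \<partial>lborel)"
    by (subst nn_integral_cmult) (auto simp: p ac_simps)
  also have "\<dots> = (\<integral>\<^sup>+y. (\<integral>\<^sup>+x. (f x * indicator ?B x) * (ennreal (gauss \<delta> (y - x)) * (indicator ?B y * chain \<epsilon> ps g y)) \<partial>lborel) \<partial>lborel)"
    by (rule lborel_pair.Fubini'[symmetric]) measurable
  also have "\<dots> = (\<integral>\<^sup>+y\<in>?B. (chain \<epsilon> [p] f y * chain \<epsilon> ps g y) \<partial>lborel)"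
  proof (intro nn_integral_cong)
    fix y
    have "(\<integral>\<^sup>+x. (f x * indicator ?B x) * (ennreal (gauss \<delta> (y - x)) * (indicator ?B y * chain \<epsilon> ps g y)) \<partial>lborel)
      = (\<integral>\<^sup>+x. (ennreal (gauss \<delta> (x - y)) * (indicator ?B x * f x)) * (indicator ?B y * chain \<epsilon> ps g y) \<partial>lborel)"
    proof (intro nn_integral_cong)
      fix x
      have "gauss \<delta> (y - x) = gauss \<delta> (x - y)" using gauss_minus[of \<delta> "x - y"] by simp
      then show "(f x * indicator ?B x) * (ennreal (gauss \<delta> (y - x)) * (indicator ?B y * chain \<epsilon> ps g y))
        = (ennreal (gauss \<delta> (x - y)) * (indicator ?B x * f x)) * (indicator ?B y * chain \<epsilon> ps g y)"
        by (simp only: ac_simps)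
    qed
    also have "\<dots> = chain \<epsilon> [p] f y * (indicator ?B y * chain \<epsilon> ps g y)"
      by (subst nn_integral_multc) (auto simp: p)
    finally show "(\<integral>\<^sup>+x. (f x * indicator ?B x) * (ennreal (gauss \<delta> (y - x)) * (indicator ?B y * chain \<epsilon> ps g y)) \<partial>lborel)
       = chain \<epsilon> [p] f y * chain \<epsilon> ps g y * indicator ?B y" by (simp add: ac_simps)
  qed
  also have "\<dots> = (\<integral>\<^sup>+y\<in>?B. (chain \<epsilon> (rev ps) (chain \<epsilon> [p] f) y * g y) \<partial>lborel)"
    by (rule Cons.IH) (use Cons.prems in \<open>auto intro: chain_measurable\<close>)
  also have "chain \<epsilon> (rev ps) (chain \<epsilon> [p] f) = chain \<epsilon> (rev (p # ps)) f"
    by (simp add: chain_append)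
  finally show ?case .
qed simp

text \<open>
  One step smooths, since its density is bounded.
\<close>

lemma chain_Cons_le:
  fixes x :: "'a::euclidean_space"
  assumes [measurable]: "u \<in> borel_measurable borel" and "\<delta> > 0"
  shows "chain \<epsilon> ((\<delta>, d) # ps) u x
     \<le> ennreal (1 / sqrt (2 * pi * \<delta>) ^ DIM('a)) * (\<integral>\<^sup>+y\<in>cball 0 \<epsilon>. chain \<epsilon> ps u y \<partial>lborel)"
proof -
  have "chain \<epsilon> ((\<delta>, d) # ps) u x
    \<le> (\<integral>\<^sup>+y. ennreal (1 / sqrt (2 * pi * \<delta>) ^ DIM('a)) * (chain \<epsilon> ps u y * indicator (cball 0 \<epsilon>) y) \<partial>lborel)"
    using gauss_le[OF assms(2)] unfolding chain.simps fst_conv snd_conv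
    by (intro nn_integral_mono) (auto simp: indicator_def intro!: mult_right_mono ennreal_leI)
  also have "\<dots> = ennreal (1 / sqrt (2 * pi * \<delta>) ^ DIM('a)) * (\<integral>\<^sup>+y\<in>cball 0 \<epsilon>. chain \<epsilon> ps u y \<partial>lborel)"
    by (rule nn_integral_cmult) measurable
  finally show ?thesis .
qed

section \<open>Wiener processes and tubes\<close>

locale wiener =
  fixes M :: "'a measure" and F :: "real \<Rightarrow> 'a measure" and W :: "real \<Rightarrow> 'a \<Rightarrow> real^'n"
  assumes prob: "prob_space M" and filt: "filtration_of M F" and wien: "wiener_process M F W"
begin

sublocale prob_space M by (rule prob)

lemma space_F: "t \<ge> 0 \<Longrightarrow> space (F t) = space M"
  and sets_F_le: "t \<ge> 0 \<Longrightarrow> sets (F t) \<subseteq> sets M"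
  using filt unfolding filtration_of_def subalgebra_def by auto

lemma sets_F_mono: "0 \<le> s \<Longrightarrow> s \<le> t \<Longrightarrow> sets (F s) \<subseteq> sets (F t)"
proof -
  assume "0 \<le> s" "s \<le> t"
  moreover have "filtration (space M) (\<lambda>t. F (max 0 t))" using filt by (simp add: filtration_of_def)
  ultimately show ?thesis using filtration.sets_F_mono[of "space M" "\<lambda>t. F (max 0 t)" s t] by simp
qed

lemma F_measurable_M: "t \<ge> 0 \<Longrightarrow> f \<in> F t \<rightarrow>\<^sub>M N \<Longrightarrow> f \<in> M \<rightarrow>\<^sub>M N"
  using space_F[of t] sets_F_le[of t] by (auto simp: measurable_def)

lemma F_measurable_mono: "0 \<le> s \<Longrightarrow> s \<le> t \<Longrightarrow> f \<in> F s \<rightarrow>\<^sub>M N \<Longrightarrow> f \<in> F t \<rightarrow>\<^sub>M N"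
  using space_F[of s] space_F[of t] sets_F_mono[of s t] by (auto simp: measurable_def)

lemma W_measurable_F: "t \<ge> 0 \<Longrightarrow> W t \<in> borel_measurable (F t)"
  using wien by (simp add: wiener_process_def)

lemma W_measurable: "t \<ge> 0 \<Longrightarrow> W t \<in> borel_measurable M"
  using F_measurable_M W_measurable_F by blast

lemma W_continuous: "\<omega> \<in> space M \<Longrightarrow> continuous_on {0..} (\<lambda>t. W t \<omega>)"
  using wien by (simp add: wiener_process_def)

lemma W_0: "AE \<omega> in M. W 0 \<omega> = 0"
  using wien by (simp add: wiener_process_def)

lemma increment_distr:
  assumes "0 \<le> s" "s < t"
  shows "distr M borel (\<lambda>\<omega>. W t \<omega> - W s \<omega>) = density lborel (\<lambda>x. ennreal (gauss (t - s) x))"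
proof -
  have "distributed M lborel (\<lambda>\<omega>. W t \<omega> - W s \<omega>)
          (\<lambda>x. ennreal (\<Prod>i\<in>UNIV. normal_density 0 (sqrt (t - s)) (x $ i)))"
    using wien assms by (simp add: wiener_process_def)
  moreover have "(\<Prod>i\<in>UNIV. normal_density 0 (sqrt (t - s)) (x $ i)) = gauss (t - s) x" for x :: "real^'n"
    using assms by (intro gauss_eq_prod) auto
  ultimately have "distr M lborel (\<lambda>\<omega>. W t \<omega> - W s \<omega>) = density lborel (\<lambda>x. ennreal (gauss (t - s) x))"
    by (simp add: distributed_def)
  moreover have "distr M borel (\<lambda>\<omega>. W t \<omega> - W s \<omega>) = distr M lborel (\<lambda>\<omega>. W t \<omega> - W s \<omega>)"
    by (intro distr_cong) auto
  ultimately show ?thesis by simp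
qed

text \<open>
  Independence of the increment from the past, as an identity between joint laws.
\<close>

lemma increment_joint_distr:
  assumes "0 \<le> s" "s < t" and U: "U \<in> F s \<rightarrow>\<^sub>M N"
  shows "distr M N U \<Otimes>\<^sub>M distr M borel (\<lambda>\<omega>. W t \<omega> - W s \<omega>)
    = distr M (N \<Otimes>\<^sub>M borel) (\<lambda>\<omega>. (U \<omega>, W t \<omega> - W s \<omega>))"
proof (rule pair_measure_eqI)
  let ?I = "\<lambda>\<omega>. W t \<omega> - W s \<omega>"
  have UM [measurable]: "U \<in> M \<rightarrow>\<^sub>M N" using F_measurable_M U assms by auto
  have I [measurable]: "?I \<in> borel_measurable M" using W_measurable[of t] W_measurable[of s] assms by auto
  show "sigma_finite_measure (distr M N U)" "sigma_finite_measure (distr M borel ?I)"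
    by (intro prob_space_imp_sigma_finite prob_space_distr; simp)+
  have ind: "indep_set (sets (F s)) (sets (vimage_algebra (space M) ?I borel))"
    using wien assms by (simp add: wiener_process_def)
  fix A B assume "A \<in> sets (distr M N U)" "B \<in> sets (distr M borel ?I)"
  then have A [measurable]: "A \<in> sets N" and B [measurable]: "B \<in> sets borel" by auto
  have a: "U -` A \<inter> space M \<in> sets (F s)"
    using measurable_sets[OF U A] space_F[of s] assms by simp
  have b: "?I -` B \<inter> space M \<in> sets (vimage_algebra (space M) ?I borel)"
    using B by (intro in_vimage_algebra)
  have "emeasure (distr M (N \<Otimes>\<^sub>M borel) (\<lambda>\<omega>. (U \<omega>, ?I \<omega>))) (A \<times> B)
     = emeasure M ((U -` A \<inter> space M) \<inter> (?I -` B \<inter> space M))"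
    by (subst emeasure_distr) (auto intro!: arg_cong[where f="emeasure M"])
  also have "\<dots> = emeasure M (U -` A \<inter> space M) * emeasure M (?I -` B \<inter> space M)"
    using indep_setD[OF ind a b] by (simp add: emeasure_eq_measure ennreal_mult)
  finally show "emeasure (distr M N U) A * emeasure (distr M borel ?I) B
    = emeasure (distr M (N \<Otimes>\<^sub>M borel) (\<lambda>\<omega>. (U \<omega>, ?I \<omega>))) (A \<times> B)"
    by (simp add: emeasure_distr)
qed (simp cong: sets_pair_measure_cong)

lemma increment_expectation:
  assumes st: "0 \<le> s" "s < t" and U: "U \<in> F s \<rightarrow>\<^sub>M N"
    and g [measurable]: "g \<in> borel_measurable (N \<Otimes>\<^sub>M borel)"
  shows "(\<integral>\<^sup>+\<omega>. g (U \<omega>, W t \<omega> - W s \<omega>) \<partial>M)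
    = (\<integral>\<^sup>+\<omega>. (\<integral>\<^sup>+z. ennreal (gauss (t - s) z) * g (U \<omega>, z) \<partial>lborel) \<partial>M)"
proof -
  let ?I = "\<lambda>\<omega>. W t \<omega> - W s \<omega>"
  have [measurable]: "U \<in> M \<rightarrow>\<^sub>M N" "?I \<in> borel_measurable M"
    using F_measurable_M U W_measurable[of t] W_measurable[of s] assms by auto
  have ind: "distr M N U \<Otimes>\<^sub>M distr M borel ?I = distr M (N \<Otimes>\<^sub>M borel) (\<lambda>\<omega>. (U \<omega>, ?I \<omega>))"
    by (rule increment_joint_distr[OF st U])
  interpret I: prob_space "distr M borel ?I" by (rule prob_space_distr) simp
  have "(\<integral>\<^sup>+\<omega>. g (U \<omega>, ?I \<omega>) \<partial>M) = (\<integral>\<^sup>+p. g p \<partial>distr M (N \<Otimes>\<^sub>M borel) (\<lambda>\<omega>. (U \<omega>, ?I \<omega>)))"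
    by (subst nn_integral_distr) auto
  also have "\<dots> = (\<integral>\<^sup>+u. (\<integral>\<^sup>+z. g (u, z) \<partial>distr M borel ?I) \<partial>distr M N U)"
    unfolding ind[symmetric] by (rule I.nn_integral_fst[symmetric]) simp
  also have "\<dots> = (\<integral>\<^sup>+u. (\<integral>\<^sup>+z. ennreal (gauss (t - s) z) * g (u, z) \<partial>lborel) \<partial>distr M N U)"
  proof (rule nn_integral_cong)
    fix u assume "u \<in> space (distr M N U)"
    then have [measurable]: "(\<lambda>z. g (u, z)) \<in> borel_measurable borel" by auto
    show "(\<integral>\<^sup>+z. g (u, z) \<partial>distr M borel ?I) = (\<integral>\<^sup>+z. ennreal (gauss (t - s) z) * g (u, z) \<partial>lborel)"
      unfolding increment_distr[OF st] by (subst nn_integral_density) auto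
  qed
  also have "\<dots> = (\<integral>\<^sup>+\<omega>. (\<integral>\<^sup>+z. ennreal (gauss (t - s) z) * g (U \<omega>, z) \<partial>lborel) \<partial>M)"
    by (subst nn_integral_distr) auto
  finally show ?thesis .
qed

end

text \<open>
  The path \<open>w\<close>, observed from time \<open>s\<close> on after each of the time steps, stays within \<open>\<epsilon>\<close> of the points
  that start at \<open>c\<close> and move by the given increments.
\<close>

fun confined :: "real \<Rightarrow> (real \<Rightarrow> 'e::euclidean_space) \<Rightarrow> real \<Rightarrow> 'e \<Rightarrow> (real \<times> 'e) list \<Rightarrow> bool" where
  "confined \<epsilon> w s c [] \<longleftrightarrow> True"
| "confined \<epsilon> w s c (p # ps) \<longleftrightarrow>
     w (s + fst p) - (c + snd p) \<in> cball 0 \<epsilon> \<and> confined \<epsilon> w (s + fst p) (c + snd p) ps"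

lemma confined_endpoint:
  assumes "ps \<noteq> []" "confined \<epsilon> w s c ps"
  shows "w (s + sum_list (map fst ps)) - (c + sum_list (map snd ps)) \<in> cball 0 \<epsilon>"
  using assms
proof (induction ps arbitrary: s c)
  case (Cons p ps)
  then show ?case using Cons.IH[of "s + fst p" "c + snd p"] by (cases "ps = []") (auto simp: add.assoc)
qed simp

lemma nn_integral_lborel_shift:
  fixes f :: "'a::euclidean_space \<Rightarrow> ennreal"
  assumes [measurable]: "f \<in> borel_measurable borel"
  shows "(\<integral>\<^sup>+x. f (a + x) \<partial>lborel) = (\<integral>\<^sup>+x. f x \<partial>lborel)"
proof -
  have "(\<integral>\<^sup>+x. f x \<partial>lborel) = (\<integral>\<^sup>+x. f x \<partial>distr lborel borel ((+) a))"
    by (simp add: lborel_distr_plus)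
  also have "\<dots> = (\<integral>\<^sup>+x. f (a + x) \<partial>lborel)"
    by (subst nn_integral_distr) auto
  finally show ?thesis by simp
qed

context wiener begin

text \<open>
  The Markov property. The factor \<open>\<Phi>\<close>, known at the initial time, carries the induction: in each
  step the indicator of the next position is absorbed into it. It also yields the independence of the
  tube from the initial sigma-algebra.
\<close>

theorem confined_expectation:
  assumes "0 \<le> s" and "\<Phi> \<in> borel_measurable (F s)"
    and pos: "\<And>\<delta> d. (\<delta>, d) \<in> set ps \<Longrightarrow> \<delta> > 0"
    and u: "u \<in> borel_measurable borel"
  shows "(\<integral>\<^sup>+\<omega>. \<Phi> \<omega> * (indicator {\<omega>. confined \<epsilon> (\<lambda>t. W t \<omega>) s c ps} \<omega>
            * u (W (s + sum_list (map fst ps)) \<omega> - (c + sum_list (map snd ps)))) \<partial>M)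
     = (\<integral>\<^sup>+\<omega>. \<Phi> \<omega> * chain \<epsilon> ps u (W s \<omega> - c) \<partial>M)"
  using assms(1-3)
proof (induction ps arbitrary: s c \<Phi>)
  case (Cons p ps)
  obtain \<delta> d where p: "p = (\<delta>, d)" by fastforce
  have \<delta>: "\<delta> > 0" using Cons.prems p by auto
  note [measurable] = u
  let ?s = "s + \<delta>" and ?c = "c + d"
  let ?V = "\<lambda>\<omega>. W ?s \<omega> - ?c"
  let ?\<Phi> = "\<lambda>\<omega>. \<Phi> \<omega> * indicator (cball 0 \<epsilon>) (?V \<omega>)"
  have [measurable]: "\<Phi> \<in> borel_measurable (F ?s)" "W ?s \<in> borel_measurable (F ?s)"
    using F_measurable_mono[OF _ _ Cons.prems(2), of ?s] Cons.prems(1) \<delta> W_measurable_F[of ?s] by auto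
  have "(\<integral>\<^sup>+\<omega>. \<Phi> \<omega> * (indicator {\<omega>. confined \<epsilon> (\<lambda>t. W t \<omega>) s c (p # ps)} \<omega>
            * u (W (s + sum_list (map fst (p # ps))) \<omega> - (c + sum_list (map snd (p # ps))))) \<partial>M)
     = (\<integral>\<^sup>+\<omega>. ?\<Phi> \<omega> * (indicator {\<omega>. confined \<epsilon> (\<lambda>t. W t \<omega>) ?s ?c ps} \<omega>
            * u (W (?s + sum_list (map fst ps)) \<omega> - (?c + sum_list (map snd ps)))) \<partial>M)"
    by (intro nn_integral_cong) (auto simp: p indicator_def add.assoc)
  also have "\<dots> = (\<integral>\<^sup>+\<omega>. ?\<Phi> \<omega> * chain \<epsilon> ps u (?V \<omega>) \<partial>M)"
    by (rule Cons.IH) (use Cons.prems \<delta> in auto)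
  also have "\<dots> = (\<integral>\<^sup>+\<omega>. (\<lambda>((\<phi>, v), z). \<phi> * (indicator (cball 0 \<epsilon>) (v - c + (z - d)) * chain \<epsilon> ps u (v - c + (z - d))))
        ((\<Phi> \<omega>, W s \<omega>), W ?s \<omega> - W s \<omega>) \<partial>M)"
    by (simp add: algebra_simps)
  also have "\<dots> = (\<integral>\<^sup>+\<omega>. (\<integral>\<^sup>+z. ennreal (gauss (?s - s) z) * (\<lambda>((\<phi>, v), z). \<phi> * (indicator (cball 0 \<epsilon>) (v - c + (z - d)) * chain \<epsilon> ps u (v - c + (z - d))))
        ((\<Phi> \<omega>, W s \<omega>), z) \<partial>lborel) \<partial>M)"
  proof (rule increment_expectation)
    show "(\<lambda>\<omega>. (\<Phi> \<omega>, W s \<omega>)) \<in> F s \<rightarrow>\<^sub>M borel \<Otimes>\<^sub>M borel"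
      using Cons.prems W_measurable_F[of s] by measurable
    show "(\<lambda>((\<phi>, v), z). \<phi> * (indicator (cball 0 \<epsilon>) (v - c + (z - d)) * chain \<epsilon> ps u (v - c + (z - d)))) \<in> borel_measurable ((borel \<Otimes>\<^sub>M borel) \<Otimes>\<^sub>M borel)"
      by (simp add: case_prod_beta')
  qed (use Cons.prems \<delta> in auto)
  also have "\<dots> = (\<integral>\<^sup>+\<omega>. \<Phi> \<omega> * chain \<epsilon> (p # ps) u (W s \<omega> - c) \<partial>M)"
  proof (intro nn_integral_cong)
    fix \<omega>
    let ?x = "W s \<omega> - c"
    have "(\<integral>\<^sup>+z. ennreal (gauss (?s - s) z) * (\<lambda>((\<phi>, v), z). \<phi> * (indicator (cball 0 \<epsilon>) (v - c + (z - d)) * chain \<epsilon> ps u (v - c + (z - d))))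
        ((\<Phi> \<omega>, W s \<omega>), z) \<partial>lborel)
      = (\<integral>\<^sup>+z. \<Phi> \<omega> * (ennreal (gauss \<delta> z) * (indicator (cball 0 \<epsilon>) (?x + (z - d)) * chain \<epsilon> ps u (?x + (z - d)))) \<partial>lborel)"
      by (simp add: ac_simps)
    also have "\<dots> = (\<integral>\<^sup>+y. \<Phi> \<omega> * (ennreal (gauss \<delta> (d - ?x + y)) * (indicator (cball 0 \<epsilon>) (?x + ((d - ?x + y) - d)) * chain \<epsilon> ps u (?x + ((d - ?x + y) - d)))) \<partial>lborel)"
      by (rule nn_integral_lborel_shift[symmetric]) measurable
    also have "\<dots> = (\<integral>\<^sup>+y. \<Phi> \<omega> * (ennreal (gauss \<delta> (y - ?x + d)) * (indicator (cball 0 \<epsilon>) y * chain \<epsilon> ps u y)) \<partial>lborel)"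
      by (simp add: algebra_simps)
    also have "\<dots> = \<Phi> \<omega> * chain \<epsilon> (p # ps) u ?x"
      by (subst nn_integral_cmult) (auto simp: p)
    finally show "(\<integral>\<^sup>+z. ennreal (gauss (?s - s) z) * (\<lambda>((\<phi>, v), z). \<phi> * (indicator (cball 0 \<epsilon>) (v - c + (z - d)) * chain \<epsilon> ps u (v - c + (z - d))))
        ((\<Phi> \<omega>, W s \<omega>), z) \<partial>lborel) = \<Phi> \<omega> * chain \<epsilon> (p # ps) u (W s \<omega> - c)" .
  qed
  finally show ?case .
qed simp

lemma chain_eq_expectation:
  assumes "\<And>\<delta> d. (\<delta>, d) \<in> set ps \<Longrightarrow> \<delta> > 0" and "u \<in> borel_measurable borel"
  shows "chain \<epsilon> ps u x = (\<integral>\<^sup>+\<omega>. indicator {\<omega>. confined \<epsilon> (\<lambda>t. W t \<omega>) 0 (- x) ps} \<omega>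
            * u (W (sum_list (map fst ps)) \<omega> + x - sum_list (map snd ps)) \<partial>M)"
proof -
  have "(\<integral>\<^sup>+\<omega>. 1 * chain \<epsilon> ps u (W 0 \<omega> - (- x)) \<partial>M) = (\<integral>\<^sup>+\<omega>. chain \<epsilon> ps u x \<partial>M)"
    using W_0 by (intro nn_integral_cong_AE) auto
  then show ?thesis
    using confined_expectation[OF _ _ assms, where s=0 and \<Phi>="\<lambda>_. 1" and \<epsilon>=\<epsilon> and c="- x"]
    by (simp add: emeasure_space_1 algebra_simps)
qed

text \<open>
  Forget the confinement at all times but the last.
\<close>

lemma chain_le_free:
  fixes ps :: "(real \<times> (real^'n)) list"
  assumes pos: "\<And>\<delta> d. (\<delta>, d) \<in> set ps \<Longrightarrow> \<delta> > 0" and [measurable]: "u \<in> borel_measurable borel" and ne: "ps \<noteq> []"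
  shows "chain \<epsilon> ps u x \<le> chain \<epsilon> [(sum_list (map fst ps), sum_list (map snd ps))] u x"
proof -
  have "sum_list (map fst ps) > 0"
  proof -
    obtain p qs where q: "ps = p # qs" using ne by (cases ps) auto
    have "fst p > 0" using pos[of "fst p" "snd p"] q by auto
    moreover have "sum_list (map fst qs) \<ge> 0"
      by (intro sum_list_nonneg) (use pos q in fastforce)
    ultimately show ?thesis using q by simp
  qed
  then have pos': "(\<delta>, d) \<in> set [(sum_list (map fst ps), sum_list (map snd ps))] \<Longrightarrow> \<delta> > 0" for \<delta> d by auto
  have "chain \<epsilon> ps u x = (\<integral>\<^sup>+\<omega>. indicator {\<omega>. confined \<epsilon> (\<lambda>t. W t \<omega>) 0 (- x) ps} \<omega>
            * u (W (sum_list (map fst ps)) \<omega> + x - sum_list (map snd ps)) \<partial>M)"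
    by (rule chain_eq_expectation) (use pos in auto)
  also have "\<dots> \<le> (\<integral>\<^sup>+\<omega>. indicator {\<omega>. confined \<epsilon> (\<lambda>t. W t \<omega>) 0 (- x) [(sum_list (map fst ps), sum_list (map snd ps))]} \<omega>
            * u (W (sum_list (map fst [(sum_list (map fst ps), sum_list (map snd ps))])) \<omega> + x
                - sum_list (map snd [(sum_list (map fst ps), sum_list (map snd ps))])) \<partial>M)"
    using confined_endpoint[OF ne, where \<epsilon>=\<epsilon> and s=0 and c="- x"]
    by (intro nn_integral_mono) (auto simp: indicator_def)
  also have "\<dots> = chain \<epsilon> [(sum_list (map fst ps), sum_list (map snd ps))] u x"
    by (rule chain_eq_expectation[symmetric]) (use pos' in auto)
  finally show ?thesis .
qed

end

fun increments :: "(real \<Rightarrow> 'e::euclidean_space) \<Rightarrow> real \<Rightarrow> real list \<Rightarrow> (real \<times> 'e) list" where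
  "increments w s [] = []"
| "increments w s (\<delta> # ds) = (\<delta>, w (s + \<delta>) - w s) # increments w (s + \<delta>) ds"

fun partition_points :: "real \<Rightarrow> real list \<Rightarrow> real set" where
  "partition_points s [] = {}"
| "partition_points s (\<delta> # ds) = insert (s + \<delta>) (partition_points (s + \<delta>) ds)"

lemma fst_increments [simp]: "map fst (increments w s ds) = ds"
  by (induction ds arbitrary: s) auto

lemma sum_snd_increments: "sum_list (map snd (increments w s ds)) = w (s + sum_list ds) - w s"
  by (induction ds arbitrary: s) (auto simp: add.assoc)

lemma increments_pos: "(\<And>\<delta>. \<delta> \<in> set ds \<Longrightarrow> \<delta> > 0) \<Longrightarrow> (\<delta>, d) \<in> set (increments w s ds) \<Longrightarrow> \<delta> > 0"
  by (induction ds arbitrary: s) auto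

lemma increments_append: "increments w s (xs @ ys) = increments w s xs @ increments w (s + sum_list xs) ys"
  by (induction xs arbitrary: s) (auto simp: add.assoc)

lemma unshifted_increments: "unshifted_steps (increments w s ds) = map (\<lambda>\<delta>. (\<delta>, 0)) ds"
  by (induction ds arbitrary: s) (auto simp: unshifted_steps_def)

lemma increments_const: "increments (\<lambda>_. c) s ds = map (\<lambda>\<delta>. (\<delta>, 0)) ds"
  by (induction ds arbitrary: s) auto

lemma partition_points_append:
  "partition_points s (xs @ ys) = partition_points s xs \<union> partition_points (s + sum_list xs) ys"
  by (induction xs arbitrary: s) (auto simp: add.assoc)

lemma finite_partition_points [simp]: "finite (partition_points s ds)"
  by (induction ds arbitrary: s) auto

lemma partition_points_replicate: "partition_points s (replicate n \<delta>) = {s + real k * \<delta> |k. 1 \<le> k \<and> k \<le> n}"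
proof (induction n arbitrary: s)
  case (Suc n)
  have "{s + real k * \<delta> |k. 1 \<le> k \<and> k \<le> Suc n} = insert (s + \<delta>) {s + \<delta> + real k * \<delta> |k. 1 \<le> k \<and> k \<le> n}" (is "?L = ?R")
  proof (intro set_eqI iffI)
    fix x assume "x \<in> ?L"
    then obtain k where k: "x = s + real k * \<delta>" "1 \<le> k" "k \<le> Suc n" by auto
    show "x \<in> ?R"
    proof (cases "k = 1")
      case False
      then have "x = s + \<delta> + real (k - 1) * \<delta>" "1 \<le> k - 1" "k - 1 \<le> n"
        using k by (auto simp: of_nat_diff algebra_simps)
      then show ?thesis by blast
    qed (use k in auto)
  next
    fix x assume "x \<in> ?R"
    then consider "x = s + \<delta>" | k where "x = s + \<delta> + real k * \<delta>" "1 \<le> k" "k \<le> n" by auto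
    then show "x \<in> ?L"
    proof cases
      case 1
      then show ?thesis by (intro CollectI exI[of _ 1]) simp
    next
      case 2
      then show ?thesis by (intro CollectI exI[of _ "Suc k"]) (simp add: algebra_simps)
    qed
  qed
  then show ?case using Suc by simp
qed auto

lemma confined_increments:
  "confined \<epsilon> v s (w s) (increments w s ds) \<longleftrightarrow> (\<forall>t\<in>partition_points s ds. norm (v t - w t) \<le> \<epsilon>)"
  by (induction ds arbitrary: s) auto

definition dyadic_steps :: "real \<Rightarrow> nat \<Rightarrow> real list" where
  "dyadic_steps T N = replicate (2 ^ N) (T / 2 ^ N)"

lemma sum_dyadic_steps [simp]: "sum_list (dyadic_steps T N) = T"
  by (simp add: dyadic_steps_def sum_list_replicate)

lemma dyadic_steps_pos: "T > 0 \<Longrightarrow> \<delta> \<in> set (dyadic_steps T N) \<Longrightarrow> \<delta> > 0"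
  by (simp add: dyadic_steps_def)

lemma partition_points_dyadic:
  "partition_points s (dyadic_steps T N) = {s + real k * (T / 2 ^ N) |k. 1 \<le> k \<and> k \<le> 2 ^ N}"
  by (simp add: dyadic_steps_def partition_points_replicate)

lemma incseq_dyadic_points: "incseq (\<lambda>N. partition_points s (dyadic_steps T N))"
proof (rule incseq_SucI)
  fix N
  show "partition_points s (dyadic_steps T N) \<subseteq> partition_points s (dyadic_steps T (Suc N))"
    unfolding partition_points_dyadic
  proof safe
    fix k :: nat assume "1 \<le> k" "k \<le> 2 ^ N"
    then show "\<exists>ka. s + real k * (T / 2 ^ N) = s + real ka * (T / 2 ^ Suc N) \<and> 1 \<le> ka \<and> ka \<le> 2 ^ Suc N"
      by (intro exI[of _ "2 * k"]) auto
  qed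
qed

lemma dyadic_points_subset: "T \<ge> 0 \<Longrightarrow> partition_points s (dyadic_steps T N) \<subseteq> {s..s+T}"
proof -
  assume "T \<ge> 0"
  moreover have "real k * (T / 2 ^ N) \<le> T" if "k \<le> 2 ^ N" for k
  proof -
    have "real k \<le> 2 ^ N" using that by (metis of_nat_le_iff of_nat_numeral of_nat_power)
    then show ?thesis using \<open>T \<ge> 0\<close> by (simp add: divide_simps mult.commute mult_left_mono)
  qed
  ultimately show ?thesis unfolding partition_points_dyadic by auto
qed

lemma dyadic_points_dense:
  assumes "T > 0"
  shows "{s..s+T} \<subseteq> closure (\<Union>N. partition_points s (dyadic_steps T N))"
proof
  fix t assume t: "t \<in> {s..s+T}"
  show "t \<in> closure (\<Union>N. partition_points s (dyadic_steps T N))"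
    unfolding closure_approachable
  proof (intro allI impI)
    fix e :: real assume "e > 0"
    obtain N where "T / e < 2 ^ N"
      using real_arch_pow[of 2 "T / e"] by auto
    then have N: "T / 2 ^ N < e" using \<open>e > 0\<close> by (simp add: field_simps)
    define x where "x = (t - s) * 2 ^ N / T"
    have x: "0 \<le> x" "x \<le> 2 ^ N" using t assms
      by (auto simp: x_def divide_simps distrib_right[symmetric] mult.commute[of T] intro!: mult_right_mono)
    define k where "k = max 1 (nat \<lceil>x\<rceil>)"
    have k: "1 \<le> k" "k \<le> 2 ^ N"
    proof -
      have "\<lceil>x\<rceil> \<le> 2 ^ N" using x by (simp add: ceiling_le_iff)
      then show "k \<le> 2 ^ N" by (auto simp: k_def nat_le_iff)
    qed (auto simp: k_def)
    have "\<bar>real k - x\<bar> \<le> 1"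
      using x by (auto simp: k_def max_def; linarith)
    then have "\<bar>(real k - x) * (T / 2 ^ N)\<bar> \<le> T / 2 ^ N"
      using assms mult_right_mono[of "\<bar>real k - x\<bar>" 1 "T / 2 ^ N"] by (simp add: abs_mult)
    moreover have "s + real k * (T / 2 ^ N) - t = (real k - x) * (T / 2 ^ N)"
      using assms by (simp add: x_def field_simps)
    ultimately have "dist (s + real k * (T / 2 ^ N)) t < e"
      using N by (simp add: dist_real_def)
    then show "\<exists>y\<in>\<Union>N. partition_points s (dyadic_steps T N). dist y t < e"
      unfolding partition_points_dyadic using k by blast
  qed
qed


context wiener begin

definition tube :: "real \<Rightarrow> real \<Rightarrow> (real \<Rightarrow> real^'n) \<Rightarrow> 'a set" where
  "tube T r w = {\<omega> \<in> space M. \<forall>t\<in>{0..T}. norm (W t \<omega> - w t) \<le> r}"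

definition tube_prob :: "real \<Rightarrow> real \<Rightarrow> (real \<Rightarrow> real^'n) \<Rightarrow> ennreal" where
  "tube_prob T r w = emeasure M (tube T r w)"

text \<open>
  By continuity, staying in a closed tube at a dense set of times is enough. This is why closed tubes
  are used up to the final step.
\<close>

lemma tube_eq_dense:
  assumes w: "continuous_on {0..T} w" and P: "P \<subseteq> {0..T}" "{0..T} \<subseteq> closure P"
  shows "tube T r w = {\<omega> \<in> space M. \<forall>t\<in>P. norm (W t \<omega> - w t) \<le> r}"
proof -
  have "norm (W t \<omega> - w t) \<le> r" if \<omega>: "\<omega> \<in> space M" and p: "\<forall>t\<in>P. norm (W t \<omega> - w t) \<le> r" and t: "t \<in> {0..T}" for \<omega> t
  proof -
    have c: "continuous_on {0..T} (\<lambda>t. norm (W t \<omega> - w t))"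
      by (intro continuous_intros w continuous_on_subset[OF W_continuous[OF \<omega>]]) auto
    obtain x where x: "\<And>n. x n \<in> P" "x \<longlonglongrightarrow> t"
      using P t closure_sequential by blast
    have "(\<lambda>n. norm (W (x n) \<omega> - w (x n))) \<longlonglongrightarrow> norm (W t \<omega> - w t)"
      
      by (rule continuous_on_tendsto_compose[OF c x(2) t]) (use x(1) P(1) in \<open>auto intro!: always_eventually simp del: atLeastAtMost_iff\<close>)
    then show ?thesis
      by (rule LIMSEQ_le_const2) (use p x(1) in auto)
  qed
  then show ?thesis using P by (auto simp: tube_def)
qed

text \<open>
  The walk is \<open>W - w\<close> at the times of the partition, started at \<open>- w 0\<close>.
\<close>

lemma partition_tube_prob:
  assumes D: "D \<in> sets (F 0)" and ds: "\<And>\<delta>. \<delta> \<in> set ds \<Longrightarrow> \<delta> > 0"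
  shows "{\<omega> \<in> D. \<forall>t\<in>partition_points 0 ds. norm (W t \<omega> - w t) \<le> r} \<in> sets M"
    and "emeasure M {\<omega> \<in> D. \<forall>t\<in>partition_points 0 ds. norm (W t \<omega> - w t) \<le> r}
      = emeasure M D * chain r (increments w 0 ds) (\<lambda>_. 1) (- w 0)"
proof -
  have DM [measurable]: "D \<in> sets M" and Dsp: "D \<subseteq> space M"
    using D sets_F_le[of 0] sets.sets_into_space[of D M] by auto
  have pp: "t \<ge> 0" if "t \<in> partition_points 0 ds" for t
  proof -
    have "partition_points s ds \<subseteq> {s..}" if "\<And>\<delta>. \<delta> \<in> set ds \<Longrightarrow> \<delta> > 0" for s ds
      using that by (induction ds arbitrary: s) (auto, force+)
    then show ?thesis using ds that by fastforce
  qed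
  have "{\<omega> \<in> D. \<forall>t\<in>partition_points 0 ds. norm (W t \<omega> - w t) \<le> r}
     = D \<inter> {\<omega> \<in> space M. \<forall>t\<in>partition_points 0 ds. norm (W t \<omega> - w t) \<le> r}"
    using Dsp by auto
  also have "\<dots> \<in> sets M"
  proof (intro sets.Int DM sets.sets_Collect_finite_All)
    fix t assume "t \<in> partition_points 0 ds"
    then have [measurable]: "W t \<in> borel_measurable M" by (intro W_measurable pp)
    show "{\<omega> \<in> space M. norm (W t \<omega> - w t) \<le> r} \<in> sets M" by measurable
  qed simp
  finally show m: "{\<omega> \<in> D. \<forall>t\<in>partition_points 0 ds. norm (W t \<omega> - w t) \<le> r} \<in> sets M" .
  let ?ps = "increments w 0 ds"
  have "emeasure M {\<omega> \<in> D. \<forall>t\<in>partition_points 0 ds. norm (W t \<omega> - w t) \<le> r}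
     = (\<integral>\<^sup>+\<omega>. indicator {\<omega> \<in> D. \<forall>t\<in>partition_points 0 ds. norm (W t \<omega> - w t) \<le> r} \<omega> \<partial>M)"
    using m by simp
  also have "\<dots> = (\<integral>\<^sup>+\<omega>. indicator D \<omega> * (indicator {\<omega>. confined r (\<lambda>t. W t \<omega>) 0 (w 0) ?ps} \<omega>
            * (\<lambda>_. 1) (W (0 + sum_list (map fst ?ps)) \<omega> - (w 0 + sum_list (map snd ?ps)))) \<partial>M)"
    by (intro nn_integral_cong) (auto simp: indicator_def confined_increments)
  also have "\<dots> = (\<integral>\<^sup>+\<omega>. indicator D \<omega> * chain r ?ps (\<lambda>_. 1) (W 0 \<omega> - w 0) \<partial>M)"
  proof (rule confined_expectation)
    show "indicator D \<in> borel_measurable (F 0)" using D by simp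
    show "\<And>\<delta> d. (\<delta>, d) \<in> set ?ps \<Longrightarrow> 0 < \<delta>" using increments_pos[of ds] ds by blast
  qed auto
  also have "\<dots> = (\<integral>\<^sup>+\<omega>. chain r ?ps (\<lambda>_. 1) (- w 0) * indicator D \<omega> \<partial>M)"
    using W_0 by (intro nn_integral_cong_AE) (auto simp: mult.commute)
  also have "\<dots> = emeasure M D * chain r ?ps (\<lambda>_. 1) (- w 0)"
    by (subst nn_integral_cmult_indicator) (auto simp: mult.commute)
  finally show "emeasure M {\<omega> \<in> D. \<forall>t\<in>partition_points 0 ds. norm (W t \<omega> - w t) \<le> r}
      = emeasure M D * chain r ?ps (\<lambda>_. 1) (- w 0)" .
qed

text \<open>
  The events along refining partitions decrease to the tube.
\<close>

lemma chain_tendsto_tube_general: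
  assumes w: "continuous_on {0..T} w" and D: "D \<in> sets (F 0)"
    and ds: "\<And>N \<delta>. \<delta> \<in> set (ds N) \<Longrightarrow> \<delta> > 0"
    and inc: "incseq (\<lambda>N. partition_points 0 (ds N))"
    and sub: "\<And>N. partition_points 0 (ds N) \<subseteq> {0..T}"
    and dense: "{0..T} \<subseteq> closure (\<Union>N. partition_points 0 (ds N))"
  shows "tube T r w \<in> sets M"
    and "(\<lambda>N. emeasure M D * chain r (increments w 0 (ds N)) (\<lambda>_. 1) (- w 0)) \<longlonglongrightarrow> emeasure M (D \<inter> tube T r w)"
proof -
  let ?P = "\<Union>N. partition_points 0 (ds N)"
  let ?E = "\<lambda>D N. {\<omega> \<in> D. \<forall>t\<in>partition_points 0 (ds N). norm (W t \<omega> - w t) \<le> r}"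
  have tube: "tube T r w = {\<omega> \<in> space M. \<forall>t\<in>?P. norm (W t \<omega> - w t) \<le> r}"
    by (rule tube_eq_dense[OF w]) (use sub dense in auto)
  have Dsp: "D \<subseteq> space M"
    using D sets_F_le[of 0] sets.sets_into_space[of D M] by auto
  have eq: "D' \<inter> tube T r w = (\<Inter>N. ?E D' N)" if "D' \<subseteq> space M" for D'
    using that unfolding tube by auto
  have "space M \<in> sets (F 0)" using space_F[of 0] sets.top[of "F 0"] by simp
  then have "(\<Inter>N. ?E (space M) N) \<in> sets M"
    using partition_tube_prob(1)[OF _ ds] by (intro sets.countable_INT) auto
  then show tm: "tube T r w \<in> sets M" using eq[of "space M"] by (simp add: tube_def Int_absorb1)
  have E: "emeasure M (?E D N) = emeasure M D * chain r (increments w 0 (ds N)) (\<lambda>_. 1) (- w 0)" for N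
    by (rule partition_tube_prob(2)[OF D ds])
  have "(\<lambda>N. emeasure M (?E D N)) \<longlonglongrightarrow> emeasure M (\<Inter>N. ?E D N)"
  proof (rule Lim_emeasure_decseq)
    show "range (?E D) \<subseteq> sets M" using partition_tube_prob(1)[OF D ds] by auto
    show "decseq (?E D)" using inc by (intro decseq_SucI) (auto simp: incseq_Suc_iff)
  qed simp
  then show "(\<lambda>N. emeasure M D * chain r (increments w 0 (ds N)) (\<lambda>_. 1) (- w 0)) \<longlonglongrightarrow> emeasure M (D \<inter> tube T r w)"
    by (simp only: eq[OF Dsp] E)
qed

lemma space_in_F0: "space M \<in> sets (F 0)"
  using space_F[of 0] sets.top[of "F 0"] by simp

lemma dyadic_conditions:
  assumes "T > 0"
  shows "incseq (\<lambda>N. partition_points 0 (dyadic_steps T N))"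
    "partition_points 0 (dyadic_steps T N) \<subseteq> {0..T}"
    "{0..T} \<subseteq> closure (\<Union>N. partition_points 0 (dyadic_steps T N))"
  using incseq_dyadic_points[of 0 T] dyadic_points_subset[of T 0 N] dyadic_points_dense[of T 0] assms by auto

lemma tube_measurable: "T > 0 \<Longrightarrow> continuous_on {0..T} w \<Longrightarrow> tube T r w \<in> sets M"
  by (rule chain_tendsto_tube_general(1)[where ds="dyadic_steps T" and D="space M"])
     (use dyadic_steps_pos dyadic_conditions space_in_F0 in auto)

lemma chain_tendsto_tube:
  assumes "T > 0" "continuous_on {0..T} w"
  shows "(\<lambda>N. chain r (increments w 0 (dyadic_steps T N)) (\<lambda>_. 1) (- w 0)) \<longlonglongrightarrow> tube_prob T r w"
proof -
  have "(\<lambda>N. emeasure M (space M) * chain r (increments w 0 (dyadic_steps T N)) (\<lambda>_. 1) (- w 0)) \<longlonglongrightarrow> emeasure M (space M \<inter> tube T r w)"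
    by (rule chain_tendsto_tube_general(2)[OF assms(2) space_in_F0])
       (use assms(1) dyadic_steps_pos dyadic_conditions in auto)
  then show ?thesis
    by (simp add: emeasure_space_1 tube_prob_def tube_def Int_absorb1)
qed

lemma tube_indep_initial:
  assumes "T > 0" "continuous_on {0..T} w" and D: "D \<in> sets (F 0)"
  shows "emeasure M (D \<inter> tube T r w) = emeasure M D * tube_prob T r w"
proof (rule LIMSEQ_unique)
  show "(\<lambda>N. emeasure M D * chain r (increments w 0 (dyadic_steps T N)) (\<lambda>_. 1) (- w 0)) \<longlonglongrightarrow> emeasure M (D \<inter> tube T r w)"
    by (rule chain_tendsto_tube_general(2)[OF assms(2) D])
       (use assms(1) dyadic_steps_pos dyadic_conditions in auto)
  show "(\<lambda>N. emeasure M D * chain r (increments w 0 (dyadic_steps T N)) (\<lambda>_. 1) (- w 0)) \<longlonglongrightarrow> emeasure M D * tube_prob T r w"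
    using chain_tendsto_tube[OF assms(1,2)] emeasure_finite
    by (intro tendsto_mult_ennreal) (auto simp: tube_prob_def)
qed

text \<open>
  The intervals \<open>[0, s]\<close> and \<open>[s, s + t]\<close> are partitioned separately, so that the chain is the
  composition of the two operators.
\<close>

lemma chain_tendsto_two_dyadic:
  assumes "s > 0" "t > 0"
  shows "(\<lambda>N. chain r (map (\<lambda>\<delta>. (\<delta>, 0)) (dyadic_steps s N @ dyadic_steps t N)) (\<lambda>_. 1) x)
     \<longlonglongrightarrow> tube_prob (s + t) r (\<lambda>_. - x)"
proof -
  let ?ds = "\<lambda>N. dyadic_steps s N @ dyadic_steps t N"
  have pp: "partition_points 0 (?ds N) = partition_points 0 (dyadic_steps s N) \<union> partition_points s (dyadic_steps t N)" for N
    by (simp add: partition_points_append)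
  have "(\<lambda>N. emeasure M (space M) * chain r (increments (\<lambda>_. - x) 0 (?ds N)) (\<lambda>_. 1) (- (- x))) \<longlonglongrightarrow> emeasure M (space M \<inter> tube (s + t) r (\<lambda>_. - x))"
  proof (rule chain_tendsto_tube_general(2)[OF _ space_in_F0])
    show "incseq (\<lambda>N. partition_points 0 (?ds N))"
      using incseq_dyadic_points[of 0 s] incseq_dyadic_points[of s t] unfolding pp
      by (auto simp: incseq_def; blast)
    show "partition_points 0 (?ds N) \<subseteq> {0..s + t}" for N
      unfolding pp using dyadic_points_subset[of s 0 N] dyadic_points_subset[of t s N] assms by fastforce
    have "{0..s + t} = {0..0+s} \<union> {s..s + t}" using assms by auto
    also have "\<dots> \<subseteq> closure (\<Union>N. partition_points 0 (dyadic_steps s N)) \<union> closure (\<Union>N. partition_points s (dyadic_steps t N))"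
      using dyadic_points_dense[of s 0] dyadic_points_dense[of t s] assms by (intro Un_mono) auto
    also have "\<dots> \<subseteq> closure (\<Union>N. partition_points 0 (?ds N))"
      unfolding pp by (intro Un_least closure_mono) auto
    finally show "{0..s + t} \<subseteq> closure (\<Union>N. partition_points 0 (?ds N))" .
  qed (use assms dyadic_steps_pos in auto)
  then show ?thesis
    by (simp only: increments_const minus_minus) (simp add: emeasure_space_1 tube_prob_def tube_def Int_absorb1)
qed

end

section \<open>Exponential asymptotics of log-convex functions\<close>

text \<open>
  Log-convexity says that the ratios of successive terms increase.
\<close>

lemma log_convex_ratio:
  fixes g :: "nat \<Rightarrow> real"
  assumes pos: "\<And>k. g k > 0" and dec: "\<And>k. g (Suc k) \<le> g k"
    and conv: "\<And>k. (g (Suc k))\<^sup>2 \<le> g k * g (Suc (Suc k))"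
  obtains \<rho> where "\<rho> > 0" "\<rho> \<le> 1" "(\<lambda>k. g (Suc k) / g k) \<longlonglongrightarrow> \<rho>" "\<And>k. g (Suc k) \<le> \<rho> * g k"
proof -
  let ?r = "\<lambda>k. g (Suc k) / g k"
  have inc: "incseq ?r"
  proof (rule incseq_SucI)
    fix k show "?r k \<le> ?r (Suc k)"
      using pos[of k] pos[of "Suc k"] conv[of k] by (simp add: divide_simps power2_eq_square mult.commute)
  qed
  have le1: "?r k \<le> 1" for k using pos[of k] dec[of k] by simp
  obtain \<rho> where \<rho>: "?r \<longlonglongrightarrow> \<rho>" "\<And>k. ?r k \<le> \<rho>"
    using incseq_convergent[OF inc, of 1] le1 by auto
  show thesis
  proof (rule that[OF _ _ \<rho>(1)])
    show "\<rho> > 0" using \<rho>(2)[of 0] pos[of 0] pos[of 1] by (smt (verit) One_nat_def divide_pos_pos)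
    show "\<rho> \<le> 1" using \<rho>(1) le1 by (intro LIMSEQ_le_const2) auto
    show "g (Suc k) \<le> \<rho> * g k" for k using \<rho>(2)[of k] pos[of k] by (simp add: divide_simps)
  qed
qed

text \<open>
  Along each lattice of mesh \<open>1 / m\<close> the ratios increase to a limit, and this limit is the \<open>m\<close>-th root
  of the one for \<open>m = 1\<close>, because the ratios of mesh \<open>1\<close> are products of \<open>m\<close> ratios of mesh \<open>1 / m\<close>.
  Hence \<open>exp (\<kappa> * t) * G t\<close> decreases along the rationals, and by monotonicity of \<open>G\<close> everywhere.
\<close>

lemma rate_of_log_convex:
  fixes G :: "real \<Rightarrow> real"
  assumes pos: "\<And>t. t > 0 \<Longrightarrow> G t > 0" and anti: "\<And>s t. 0 < s \<Longrightarrow> s \<le> t \<Longrightarrow> G t \<le> G s"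
    and conv: "\<And>s t. 0 < s \<Longrightarrow> 0 < t \<Longrightarrow> (G (s + t))\<^sup>2 \<le> G (2 * s) * G (2 * t)"
  obtains \<kappa> where "\<kappa> \<ge> 0" "(\<lambda>k. G (real (Suc (Suc k))) / G (real (Suc k))) \<longlonglongrightarrow> exp (- \<kappa>)"
    "\<And>s t. 0 < s \<Longrightarrow> s \<le> t \<Longrightarrow> exp (\<kappa> * t) * G t \<le> exp (\<kappa> * s) * G s"
proof -
  have lattice: "\<exists>\<rho>>0. \<rho> \<le> 1 \<and> (\<lambda>k. G (real (Suc (Suc k)) / real m) / G (real (Suc k) / real m)) \<longlonglongrightarrow> \<rho>
      \<and> (\<forall>k. G (real (Suc (Suc k)) / real m) \<le> \<rho> * G (real (Suc k) / real m))" if m: "m > 0" for m :: nat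
  proof -
    let ?g = "\<lambda>k. G (real (Suc k) / real m)"
    have "?g k > 0" for k using m by (intro pos) auto
    moreover have "?g (Suc k) \<le> ?g k" for k using m by (intro anti) (auto simp: divide_right_mono)
    moreover have "(?g (Suc k))\<^sup>2 \<le> ?g k * ?g (Suc (Suc k))" for k
    proof -
      have conv': "(G ((a + b) / 2))\<^sup>2 \<le> G a * G b" if "a > 0" "b > 0" for a b
        using conv[of "a / 2" "b / 2"] that by (simp add: add_divide_distrib)
      have "(G ((real (Suc k) / real m + real (Suc (Suc (Suc k))) / real m) / 2))\<^sup>2
         \<le> G (real (Suc k) / real m) * G (real (Suc (Suc (Suc k))) / real m)"
        using m by (intro conv') auto
      moreover have "(real (Suc k) / real m + real (Suc (Suc (Suc k))) / real m) / 2 = real (Suc (Suc k)) / real m"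
        using m by (simp add: field_simps)
      ultimately show ?thesis by metis
    qed
    ultimately show ?thesis by (rule log_convex_ratio) blast
  qed
  obtain \<rho> where \<rho>: "\<rho> > 0" "\<rho> \<le> 1" "(\<lambda>k. G (real (Suc (Suc k))) / G (real (Suc k))) \<longlonglongrightarrow> \<rho>"
    using lattice[of 1] by auto
  define \<kappa> where "\<kappa> = - ln \<rho>"
  have \<kappa>: "\<kappa> \<ge> 0" "\<rho> = exp (- \<kappa>)" using \<rho> by (auto simp: \<kappa>_def)
  have step: "G (real (Suc (Suc k)) / real m) \<le> exp (- \<kappa> / real m) * G (real (Suc k) / real m)" if m: "m > 0" for m k :: nat
  proof -
    let ?g = "\<lambda>k. G (real (Suc k) / real m)"
    obtain \<sigma> where \<sigma>: "\<sigma> > 0" "(\<lambda>k. ?g (Suc k) / ?g k) \<longlonglongrightarrow> \<sigma>" "\<And>k. ?g (Suc k) \<le> \<sigma> * ?g k"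
      using lattice[OF m] by blast
    have gp: "?g k > 0" for k using m by (intro pos) auto
    let ?k = "\<lambda>k. m * Suc k - 1"
    have tele: "(\<Prod>i<n. ?g (Suc (j + i)) / ?g (j + i)) = ?g (j + n) / ?g j" for n j
    proof (induction n)
      case (Suc n)
      then show ?case using gp[of "j + n"] by simp
    qed (use gp[of j] in simp)
    have fk: "filterlim (\<lambda>k. ?k k + i) at_top sequentially" for i
    proof (rule filterlim_at_top_mono[OF filterlim_ident])
      show "\<forall>\<^sub>F k in sequentially. k \<le> ?k k + i"
      proof (intro always_eventually allI)
        fix k show "k \<le> ?k k + i" using m by (cases m) auto
      qed
    qed
    have "(\<lambda>k. \<Prod>i<m. ?g (Suc (?k k + i)) / ?g (?k k + i)) \<longlonglongrightarrow> (\<Prod>i<m. \<sigma>)"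
      by (intro tendsto_prod filterlim_compose[OF \<sigma>(2) fk])
    moreover have "(\<Prod>i<m. ?g (Suc (?k k + i)) / ?g (?k k + i)) = G (real (Suc (Suc k))) / G (real (Suc k))" for k
    proof -
      have quot: "real (m * n) / real m = real n" for n
        using m by (simp only: of_nat_mult) simp
      have 1: "Suc (?k k) = m * Suc k" "Suc (?k k + m) = m * Suc (Suc k)" using m by (cases m; simp)+
      have "real (Suc (?k k)) / real m = real (Suc k)" "real (Suc (?k k + m)) / real m = real (Suc (Suc k))"
        unfolding 1 by (rule quot)+
      then show ?thesis unfolding tele by simp
    qed
    ultimately have "(\<lambda>k. G (real (Suc (Suc k))) / G (real (Suc k))) \<longlonglongrightarrow> \<sigma> ^ m" by simp
    then have "\<sigma> ^ m = \<rho>" using \<rho>(3) LIMSEQ_unique by blast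
    also have "\<rho> = exp (- \<kappa> / real m) ^ m" unfolding \<kappa>(2) using m by (simp flip: exp_of_nat_mult)
    finally have "\<sigma> = exp (- \<kappa> / real m)"
      using power_eq_imp_eq_base[of \<sigma> m "exp (- \<kappa> / real m)"] \<sigma>(1) m by simp
    then show ?thesis using \<sigma>(3)[of k] by simp
  qed
  let ?H = "\<lambda>t. exp (\<kappa> * t) * G t"
  have H_lattice: "?H (real (Suc (k + n)) / real m) \<le> ?H (real (Suc k) / real m)" if m: "m > 0" for m k n :: nat
  proof (induction n)
    case (Suc n)
    have "?H (real (Suc (k + Suc n)) / real m) \<le> exp (\<kappa> * (real (Suc (Suc (k + n))) / real m)) * (exp (- \<kappa> / real m) * G (real (Suc (k + n)) / real m))"
      using step[OF m, of "k + n"] by (simp add: mult_left_mono)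
    also have "\<dots> = ?H (real (Suc (k + n)) / real m)"
    proof -
      have "\<kappa> * (real (Suc (Suc (k + n))) / real m) + - \<kappa> / real m = \<kappa> * (real (Suc (k + n)) / real m)"
        by (simp add: add_divide_distrib distrib_left)
      then show ?thesis by (simp only: mult.assoc[symmetric] exp_add[symmetric])
    qed
    finally show ?case using Suc by simp
  qed simp
  have H_rat: "?H q \<le> ?H p" if pq: "p \<in> \<rat>" "q \<in> \<rat>" "0 < p" "p \<le> q" for p q
  proof -
    obtain a b where a: "b > 0" "p = of_int a / of_int b" using pq(1) by (rule Rats_cases')
    obtain c d where c: "d > 0" "q = of_int c / of_int d" using pq(2) by (rule Rats_cases')
    define m where "m = nat (b * d)"
    have m: "m > 0" using a c by (simp add: m_def)
    have rm: "real m = of_int b * of_int d" using a c by (simp add: m_def)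
    have ad: "0 < a * d" using a c pq(3) by (simp add: zero_less_divide_iff)
    have "p = of_int (a * d) / real m" "q = of_int (c * b) / real m" using a c by (auto simp: rm field_simps)
    moreover have "a * d \<le> c * b"
    proof -
      have "of_int (a * d) / real m \<le> of_int (c * b) / real m" using pq(4) calculation by simp
      then have "real_of_int (a * d) \<le> real_of_int (c * b)" using m by (simp add: divide_le_cancel del: of_int_mult)
      then show ?thesis by (simp only: of_int_le_iff)
    qed
    moreover define k where "k = nat (a * d) - 1"
    moreover define n where "n = nat (c * b) - nat (a * d)"
    ultimately have "p = real (Suc k) / real m" "q = real (Suc (k + n)) / real m"
    proof -
      have "int (Suc k) = a * d" "int (Suc (k + n)) = c * b"
        using ad \<open>a * d \<le> c * b\<close> by (auto simp: k_def n_def of_nat_diff nat_le_eq_zle)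
      then show "p = real (Suc k) / real m" "q = real (Suc (k + n)) / real m"
        using \<open>p = of_int (a * d) / real m\<close> \<open>q = of_int (c * b) / real m\<close> by (metis of_int_of_nat_eq)+
    qed
    then show ?thesis using H_lattice[OF m, of k n] by simp
  qed
  have H: "?H t \<le> ?H s" if st: "0 < s" "s < t" for s t
  proof -
    have "?H t \<le> exp (2 * \<kappa> * \<eta>) * ?H s" if \<eta>: "0 < \<eta>" "\<eta> < (t - s) / 2" for \<eta>
    proof -
      obtain p where p: "p \<in> \<rat>" "s < p" "p < s + \<eta>" using Rats_dense_in_real[of s "s + \<eta>"] \<eta> by auto
      obtain q where q: "q \<in> \<rat>" "t - \<eta> < q" "q < t" using Rats_dense_in_real[of "t - \<eta>" t] \<eta> by auto
      have sq: "0 < q" "p \<le> q" using p q st \<eta> by auto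
      have "?H t \<le> exp (\<kappa> * t) * G q" using q sq by (intro mult_left_mono anti) auto
      also have "\<dots> = exp (\<kappa> * (t - q)) * ?H q" by (simp only: mult.assoc[symmetric] exp_add[symmetric]) (simp add: right_diff_distrib)
      also have "\<dots> \<le> exp (\<kappa> * \<eta>) * ?H p"
      proof (rule mult_mono)
        show "exp (\<kappa> * (t - q)) \<le> exp (\<kappa> * \<eta>)" using q \<kappa>(1) by (simp add: mult_left_mono)
        show "?H q \<le> ?H p" using p q sq st by (intro H_rat) auto
        show "0 \<le> ?H q" using pos[of q] sq by simp
      qed simp
      also have "\<dots> \<le> exp (\<kappa> * \<eta>) * (exp (\<kappa> * (s + \<eta>)) * G s)"
      proof (intro mult_left_mono mult_mono)
        show "exp (\<kappa> * p) \<le> exp (\<kappa> * (s + \<eta>))" using p \<kappa>(1) by (simp add: mult_left_mono)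
        show "G p \<le> G s" using p st by (intro anti) auto
        show "0 \<le> G p" using pos[of p] p st by simp
      qed auto
      also have "\<dots> = exp (2 * \<kappa> * \<eta>) * ?H s" by (simp only: mult.assoc[symmetric] exp_add[symmetric]) (simp add: distrib_left)
      finally show ?thesis .
    qed
    then have "eventually (\<lambda>\<eta>. ?H t \<le> exp (2 * \<kappa> * \<eta>) * ?H s) (at_right 0)"
      using st by (auto simp: eventually_at_right_field intro!: exI[of _ "(t - s) / 2"])
    moreover have "((\<lambda>\<eta>. exp (2 * \<kappa> * \<eta>) * ?H s) \<longlongrightarrow> exp (2 * \<kappa> * 0) * ?H s) (at_right 0)"
      by (intro tendsto_intros)
    ultimately show ?thesis using tendsto_lowerbound[of "\<lambda>\<eta>. exp (2 * \<kappa> * \<eta>) * ?H s" _ "at_right 0" "?H t"] by simp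
  qed
  show thesis
  proof (rule that[OF \<kappa>(1)])
    show "(\<lambda>k. G (real (Suc (Suc k))) / G (real (Suc k))) \<longlonglongrightarrow> exp (- \<kappa>)" using \<rho>(3) \<kappa>(2) by simp
    show "?H t \<le> ?H s" if "0 < s" "s \<le> t" for s t using H[of s t] that by (cases "s = t") auto
  qed
qed

text \<open>
  The function \<open>exp (\<kappa> * t) * G t\<close> decreases, hence converges. Its limit is positive: if it were ever
  smaller than \<open>\<delta>\<close>, then by submultiplicativity \<open>G\<close> would decay faster than the rate \<open>\<kappa>\<close>, which is
  the exact limit of the ratios.
\<close>

theorem exponential_asymptotics:
  fixes G :: "real \<Rightarrow> real"
  assumes pos: "\<And>t. t > 0 \<Longrightarrow> G t > 0" and anti: "\<And>s t. 0 < s \<Longrightarrow> s \<le> t \<Longrightarrow> G t \<le> G s"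
    and conv: "\<And>s t. 0 < s \<Longrightarrow> 0 < t \<Longrightarrow> (G (s + t))\<^sup>2 \<le> G (2 * s) * G (2 * t)"
    and submult: "\<And>s t. 0 < s \<Longrightarrow> 0 < t \<Longrightarrow> G (s + 1 + t) \<le> C * G s * G t"
    and lim0: "(G \<longlongrightarrow> 0) at_top"
  obtains \<kappa> a where "\<kappa> > 0" "a > 0" "((\<lambda>t. exp (\<kappa> * t) * G t) \<longlongrightarrow> a) at_top"
proof -
  obtain \<kappa> where \<kappa>: "\<kappa> \<ge> 0" "(\<lambda>k. G (real (Suc (Suc k))) / G (real (Suc k))) \<longlonglongrightarrow> exp (- \<kappa>)"
    "\<And>s t. 0 < s \<Longrightarrow> s \<le> t \<Longrightarrow> exp (\<kappa> * t) * G t \<le> exp (\<kappa> * s) * G s"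
    using rate_of_log_convex[OF pos anti conv] by blast
  let ?H = "\<lambda>t. exp (\<kappa> * t) * G t"
  have C: "C > 0"
  proof -
    have "0 < C * (G 1 * G 1)" using pos[of 3] submult[of 1 1] by (simp add: mult.assoc)
    then show ?thesis using pos[of 1] by (simp add: zero_less_mult_iff)
  qed
  \<comment> \<open>a drop below this value at time n would push the ratios over n + 1 steps below half of their limit\<close>
  define \<delta> where "\<delta> = exp (- \<kappa>) / (2 * C)"
  have \<delta>: "\<delta> > 0" using C by (simp add: \<delta>_def)
  have lb_nat: "\<delta> \<le> ?H (real n)" if n: "n > 0" for n
  proof (rule ccontr)
    assume "\<not> \<delta> \<le> ?H (real n)"
    then have small: "?H (real n) < \<delta>" by simp
    let ?r = "\<lambda>k. G (real (Suc (Suc k))) / G (real (Suc k))"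
    have tele: "(\<Prod>i<m. ?r (k + i)) = G (real (Suc (k + m))) / G (real (Suc k))" for k m
    proof (induction m)
      case (Suc m)
      then show ?case using pos[of "real (Suc (k + m))"] by simp
    qed (use pos[of "real (Suc k)"] in simp)
    have "(\<lambda>k. \<Prod>i<Suc n. ?r (k + i)) \<longlonglongrightarrow> (\<Prod>i<Suc n. exp (- \<kappa>))"
      by (intro tendsto_prod LIMSEQ_ignore_initial_segment \<kappa>(2))
    then have lim: "(\<lambda>k. G (real (Suc (k + Suc n))) / G (real (Suc k))) \<longlonglongrightarrow> exp (- \<kappa>) ^ Suc n"
      unfolding tele by simp
    have "G (real (Suc (k + Suc n))) / G (real (Suc k)) \<le> 1/2 * exp (- \<kappa>) ^ Suc n" for k
    proof -
      have "G (real n + 1 + real (Suc k)) \<le> C * G (real n) * G (real (Suc k))"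
        using n by (intro submult) auto
      moreover have "C * G (real n) \<le> 1/2 * exp (- \<kappa>) ^ Suc n"
      proof -
        have "C * G (real n) = C * (exp (- \<kappa> * real n) * ?H (real n))" by (simp add: exp_minus)
        also have "\<dots> \<le> C * (exp (- \<kappa> * real n) * \<delta>)" using small C by (intro mult_left_mono) auto
        also have "\<dots> = 1/2 * exp (- \<kappa>) ^ Suc n"
        proof -
          have "exp (- \<kappa>) ^ Suc n = exp (- \<kappa> * real n) * exp (- \<kappa>)"
            by (simp add: exp_of_nat_mult[symmetric] mult.commute)
          then show ?thesis using C by (simp add: \<delta>_def)
        qed
        finally show ?thesis .
      qed
      ultimately have "G (real n + 1 + real (Suc k)) \<le> 1/2 * exp (- \<kappa>) ^ Suc n * G (real (Suc k))"
        using pos[of "real (Suc k)"] by (meson less_imp_le mult_right_mono of_nat_0_less_iff order_trans zero_less_Suc)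
      then show ?thesis using pos[of "real (Suc k)"] by (simp add: divide_le_eq algebra_simps)
    qed
    then have "exp (- \<kappa>) ^ Suc n \<le> 1/2 * exp (- \<kappa>) ^ Suc n"
      by (intro LIMSEQ_le_const2[OF lim]) auto
    moreover have "0 < exp (- \<kappa>) ^ Suc n" by (intro zero_less_power) simp
    ultimately show False by linarith
  qed
  have lb: "\<delta> \<le> ?H t" if "t > 0" for t
  proof -
    obtain n where n: "t \<le> real n" using real_arch_simple by blast
    then have "\<delta> \<le> ?H (real n)" using that by (intro lb_nat) (auto simp: of_nat_0_less_iff[symmetric] simp del: of_nat_0_less_iff)
    also have "\<dots> \<le> ?H t" using \<kappa>(3)[OF that n] .
    finally show ?thesis .
  qed
  have "\<kappa> > 0"
  proof (rule ccontr)
    assume "\<not> \<kappa> > 0"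
    then have "\<kappa> = 0" using \<kappa>(1) by simp
    then have "\<forall>\<^sub>F t in at_top. \<delta> \<le> G t" using lb by (intro eventually_mono[OF eventually_gt_at_top[of 0]]) auto
    then have "\<delta> \<le> 0" using tendsto_lowerbound[OF lim0] by simp
    then show False using \<delta> by simp
  qed
  define a where "a = (INF t\<in>{0<..}. ?H t)"
  have bdd: "bdd_below (?H ` {0<..})" using lb by (intro bdd_belowI2[of _ \<delta>]) auto
  have "a \<ge> \<delta>" unfolding a_def using lb by (intro cINF_greatest) auto
  have "(?H \<longlongrightarrow> a) at_top"
  proof (rule order_tendstoI)
    fix y assume "y < a"
    have "y < ?H t" if "t > 0" for t
      using cINF_lower[OF bdd, of t] \<open>y < a\<close> that unfolding a_def by simp
    then show "\<forall>\<^sub>F t in at_top. y < ?H t" by (intro eventually_mono[OF eventually_gt_at_top[of 0]]) auto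
  next
    fix y assume "a < y"
    then obtain s where s: "s > 0" "?H s < y" using cINF_less_iff[OF _ bdd] unfolding a_def by auto
    show "\<forall>\<^sub>F t in at_top. ?H t < y"
      using eventually_ge_at_top[of s] by eventually_elim (use \<kappa>(3)[OF s(1)] s(2) in fastforce)
  qed
  moreover have "a > 0" using \<open>a \<ge> \<delta>\<close> \<delta> by simp
  ultimately show thesis using that[of \<kappa> a] \<open>\<kappa> > 0\<close> by blast
qed

section \<open>Comparison of tubes\<close>

lemma concat_dyadic: "dyadic_steps T (J + N) = concat (replicate (2 ^ J) (dyadic_steps (T / 2 ^ J) N))"
proof -
  have "concat (replicate k (replicate n x)) = replicate (k * n) x" for k n and x :: real
    by (induction k) (auto simp: replicate_add)
  then show ?thesis by (simp add: dyadic_steps_def power_add field_simps)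
qed

lemma increments_concat_replicate:
  "increments w s (concat (replicate K xs)) = concat (map (\<lambda>j. increments w (s + real j * sum_list xs) xs) [0..<K])"
proof (induction K arbitrary: s)
  case (Suc K)
  have "increments w s (concat (replicate (Suc K) xs))
     = increments w s xs @ concat (map (\<lambda>j. increments w (s + sum_list xs + real j * sum_list xs) xs) [0..<K])"
    by (simp add: increments_append Suc)
  also have "map (\<lambda>j. increments w (s + sum_list xs + real j * sum_list xs) xs) [0..<K]
     = map (\<lambda>j. increments w (s + real j * sum_list xs) xs) (map Suc [0..<K])"
    by (simp add: algebra_simps)
  also have "increments w s xs @ concat \<dots> = concat (map (\<lambda>j. increments w (s + real j * sum_list xs) xs) [0..<Suc K])"
    by (simp add: upt_conv_Cons map_Suc_upt del: upt_Suc)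
  finally show ?case .
qed simp

text \<open>
  Subtracting a linear function with slope \<open>a\<close> from a path is undone by a tilt.
\<close>

lemma tilt_increments:
  "increments w s xs = tilt_steps a (increments (\<lambda>t. w t - t *\<^sub>R a) s xs)"
  by (induction xs arbitrary: s) (auto simp: tilt_steps_def algebra_simps)

lemma increments_replicate:
  "increments w s (replicate K \<tau>) = map (\<lambda>j. (\<tau>, w (s + real (Suc j) * \<tau>) - w (s + real j * \<tau>))) [0..<K]"
proof (induction K arbitrary: s)
  case (Suc K)
  have "increments w s (replicate (Suc K) \<tau>)
     = (\<tau>, w (s + \<tau>) - w s) # map (\<lambda>j. (\<tau>, w (s + real (Suc j) * \<tau>) - w (s + real j * \<tau>))) (map Suc [0..<K])"
    by (simp add: Suc algebra_simps)
  then show ?case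
    by (simp add: upt_conv_Cons map_Suc_upt del: upt_Suc map_map)
qed simp

text \<open>
  On each of the \<open>2^J\<close> intervals of the coarse partition, \<open>w\<close> is the chord of slope \<open>a j\<close> plus a remainder
  that vanishes at the nodes. The tilt by the chord costs the energy of the polygon, up to boundary
  terms that are linear in \<open>r\<close>, and the remainder is dropped by Anderson's inequality. The bound is
  uniform in the number \<open>N\<close> of further refinements.
\<close>

lemma chain_increments_upper:
  fixes w :: "real \<Rightarrow> 'a::euclidean_space"
  assumes T: "T > 0"
  shows "\<exists>K. \<forall>N r. r \<ge> 0 \<longrightarrow> chain r (increments w 0 (dyadic_steps T (J + N))) (\<lambda>_. 1) (0::'a)
     \<le> ennreal (exp (r * K - action (increments w 0 (dyadic_steps T J)) / 2))
       * chain r (map (\<lambda>\<delta>. (\<delta>, 0)) (dyadic_steps T (J + N))) (\<lambda>_. 1) (0::'a)"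
proof -
  define \<tau> where "\<tau> = T / 2 ^ J"
  have \<tau>: "\<tau> > 0" using T by (simp add: \<tau>_def)
  define a where "a j = (w (real (Suc j) * \<tau>) - w (real j * \<tau>)) /\<^sub>R \<tau>" for j
  define K where "K = (\<Sum>j\<leftarrow>[0..<2^J]. 2 * norm (a j))"
  show ?thesis
  proof (intro exI[of _ K] allI impI)
    fix N and r :: real assume r: "r \<ge> 0"
    let ?xs = "dyadic_steps \<tau> N"
    define bs where "bs = map (\<lambda>j. (a j, increments (\<lambda>t. w t - t *\<^sub>R a j) (real j * \<tau>) ?xs)) [0..<2^J]"
    have inc: "increments w 0 (dyadic_steps T (J + N)) = concat (map (\<lambda>(a, ps). tilt_steps a ps) bs)"
      unfolding concat_dyadic increments_concat_replicate bs_def \<tau>_def[symmetric]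
      by (simp add: tilt_increments[symmetric] comp_def)
    have "unshifted_steps (concat (map snd bs)) = concat (map (\<lambda>j. map (\<lambda>\<delta>. (\<delta>, 0)) ?xs) [0..<2^J])"
      unfolding bs_def by (simp add: unshifted_steps_def map_concat comp_def)
        (simp add: unshifted_increments[unfolded unshifted_steps_def])
    also have "\<dots> = map (\<lambda>\<delta>. (\<delta>, 0)) (dyadic_steps T (J + N))"
      unfolding concat_dyadic \<tau>_def[symmetric] by (simp add: map_concat map_replicate_const)
    finally have uns: "unshifted_steps (concat (map snd bs)) = map (\<lambda>\<delta>. (\<delta>, 0)) (dyadic_steps T (J + N))" .
    have pos: "\<delta> > 0" if "(a, ps) \<in> set bs" "(\<delta>, d) \<in> set ps" for a ps \<delta> d
      using that dyadic_steps_pos[OF \<tau>] unfolding bs_def by (auto dest!: increments_pos[rotated])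
    have "(\<Sum>(a, ps)\<leftarrow>bs. 2 * r * norm a - sum_list (map fst ps) * (norm a)\<^sup>2 / 2)
       = (\<Sum>j\<leftarrow>[0..<2^J]. r * (2 * norm (a j)) - (\<tau> * (norm (a j))\<^sup>2) / 2)"
      unfolding bs_def by (simp add: comp_def algebra_simps)
    also have "\<dots> = r * K - (\<Sum>j\<leftarrow>[0..<2^J]. \<tau> * (norm (a j))\<^sup>2) / 2"
      unfolding K_def interv_sum_list_conv_sum_set_nat sum_distrib_left sum_subtractf sum_divide_distrib by simp
    also have "(\<Sum>j\<leftarrow>[0..<2^J]. \<tau> * (norm (a j))\<^sup>2) = action (increments w 0 (dyadic_steps T J))"
      unfolding dyadic_steps_def \<tau>_def[symmetric] increments_replicate action_def a_def
    proof -
      have "\<tau> * (norm (d /\<^sub>R \<tau>))\<^sup>2 = (norm d)\<^sup>2 / \<tau>" for d :: 'a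
        using \<tau> by (simp add: power_mult_distrib power2_eq_square field_simps)
      then show "(\<Sum>j\<leftarrow>[0..<2^J]. \<tau> * (norm ((w (real (Suc j) * \<tau>) - w (real j * \<tau>)) /\<^sub>R \<tau>))\<^sup>2)
        = (\<Sum>(\<delta>, d)\<leftarrow>map (\<lambda>j. (\<tau>, w (0 + real (Suc j) * \<tau>) - w (0 + real j * \<tau>))) [0..<2 ^ J]. (norm d)\<^sup>2 / \<delta>)"
        by (simp only: map_map comp_def prod.case add_0)
    qed
    finally have e: "(\<Sum>(a, ps)\<leftarrow>bs. 2 * r * norm a - sum_list (map fst ps) * (norm a)\<^sup>2 / 2)
       = r * K - action (increments w 0 (dyadic_steps T J)) / 2" .
    have "chain r (increments w 0 (dyadic_steps T (J + N))) (\<lambda>_. 1) (0::'a)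
      \<le> ennreal (exp (r * K - action (increments w 0 (dyadic_steps T J)) / 2)) * chain r (concat (map snd bs)) (\<lambda>_. 1) 0"
      unfolding inc e[symmetric]
    proof (rule chain_tilt_blocks_le)
      show "sum_list (map snd ps) = 0" if mem: "(b, ps) \<in> set bs" for b ps
      proof -
        obtain j where j: "ps = increments (\<lambda>t. w t - t *\<^sub>R a j) (real j * \<tau>) ?xs" using mem by (auto simp: bs_def)
        have "\<tau> *\<^sub>R a j = w (real (Suc j) * \<tau>) - w (real j * \<tau>)" using \<tau> by (simp add: a_def)
        then show ?thesis unfolding j sum_snd_increments by (simp add: algebra_simps)
      qed
    qed (use pos r in auto)
    also have "\<dots> \<le> ennreal (exp (r * K - action (increments w 0 (dyadic_steps T J)) / 2)) *
        chain r (map (\<lambda>\<delta>. (\<delta>, 0)) (dyadic_steps T (J + N))) (\<lambda>_. 1) (0::'a)"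
    proof (intro mult_left_mono)
      have "chain r (concat (map snd bs)) (\<lambda>_. 1) 0 \<le> chain r (unshifted_steps (concat (map snd bs))) (\<lambda>_. 1) 0"
        by (rule chain_anderson) (use pos in auto)
      then show "chain r (concat (map snd bs)) (\<lambda>_. 1) 0 \<le> chain r (map (\<lambda>\<delta>. (\<delta>, 0)) (dyadic_steps T (J + N))) (\<lambda>_. 1) (0::'a)"
        by (simp only: uns)
    qed simp
    finally show "chain r (increments w 0 (dyadic_steps T (J + N))) (\<lambda>_. 1) (0::'a)
       \<le> ennreal (exp (r * K - action (increments w 0 (dyadic_steps T J)) / 2)) *
        chain r (map (\<lambda>\<delta>. (\<delta>, 0)) (dyadic_steps T (J + N))) (\<lambda>_. 1) (0::'a)" .
  qed
qed

context wiener begin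

abbreviation killed :: "real \<Rightarrow> real \<Rightarrow> nat \<Rightarrow> (real^'n \<Rightarrow> ennreal) \<Rightarrow> real^'n \<Rightarrow> ennreal" where
  "killed r T N \<equiv> chain r (map (\<lambda>\<delta>. (\<delta>, 0)) (dyadic_steps T N))"


lemma chain_tendsto_tube_zero:
  assumes "T > 0"
  shows "(\<lambda>N. killed r T N (\<lambda>_. 1) x) \<longlonglongrightarrow> tube_prob T r (\<lambda>_. - x)"
  using chain_tendsto_tube[OF assms, of "\<lambda>_. - x" r] by (simp add: increments_const)

theorem tube_prob_lower:
  assumes T: "T > 0" and w: "continuous_on {0..T} w" "w 0 = 0"
    and Q: "\<And>N. action (increments w 0 (dyadic_steps T N)) \<le> Q"
  shows "ennreal (exp (- Q / 2)) * tube_prob T r (\<lambda>_. 0) \<le> tube_prob T r w"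
proof (rule LIMSEQ_le)
  show "(\<lambda>N. ennreal (exp (- Q / 2)) * killed r T N (\<lambda>_. 1) (0::real^'n))
    \<longlonglongrightarrow> ennreal (exp (- Q / 2)) * tube_prob T r (\<lambda>_. 0)"
    using chain_tendsto_tube_zero[OF T, of r 0] by (intro tendsto_mult_ennreal) auto
  show "(\<lambda>N. chain r (increments w 0 (dyadic_steps T N)) (\<lambda>_. 1) (- w 0)) \<longlonglongrightarrow> tube_prob T r w"
    by (rule chain_tendsto_tube[OF T w(1)])
  have "ennreal (exp (- Q / 2)) * killed r T N (\<lambda>_. 1) 0
    \<le> chain r (increments w 0 (dyadic_steps T N)) (\<lambda>_. 1) (- w 0)" for N
  proof -
    let ?ps = "increments w 0 (dyadic_steps T N)"
    have "ennreal (exp (- Q / 2)) * killed r T N (\<lambda>_. 1) 0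
       \<le> ennreal (exp (- action ?ps / 2)) * chain r (unshifted_steps ?ps) (\<lambda>_. 1) 0"
      unfolding unshifted_increments using Q[of N] by (intro mult_right_mono ennreal_leI) auto
    also have "\<dots> \<le> chain r ?ps (\<lambda>_. 1) 0"
      by (rule chain_shift_lower_bound) (metis increments_pos dyadic_steps_pos T)
    finally show ?thesis using w(2) by simp
  qed
  then show "\<exists>N. \<forall>n\<ge>N. ennreal (exp (- Q / 2)) * killed r T n (\<lambda>_. 1) 0
    \<le> chain r (increments w 0 (dyadic_steps T n)) (\<lambda>_. 1) (- w 0)" by blast
qed

theorem tube_prob_upper:
  assumes T: "T > 0" and w: "continuous_on {0..T} w" "w 0 = 0"
  obtains K where "\<And>r. r \<ge> 0 \<Longrightarrow> tube_prob T r w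
    \<le> ennreal (exp (r * K - action (increments w 0 (dyadic_steps T J)) / 2)) * tube_prob T r (\<lambda>_. 0)"
proof -
  obtain K where K: "\<And>N r. r \<ge> 0 \<Longrightarrow> chain r (increments w 0 (dyadic_steps T (J + N))) (\<lambda>_. 1) 0
     \<le> ennreal (exp (r * K - action (increments w 0 (dyadic_steps T J)) / 2))
       * killed r T (J + N) (\<lambda>_. 1) 0"
    using chain_increments_upper[OF T, where J=J and w=w] by auto
  show thesis
  proof (rule that)
    fix r :: real assume r: "r \<ge> 0"
    let ?c = "ennreal (exp (r * K - action (increments w 0 (dyadic_steps T J)) / 2))"
    show "tube_prob T r w \<le> ?c * tube_prob T r (\<lambda>_. 0)"
    proof (rule LIMSEQ_le)
      show "(\<lambda>N. chain r (increments w 0 (dyadic_steps T (N + J))) (\<lambda>_. 1) (- w 0)) \<longlonglongrightarrow> tube_prob T r w"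
        using LIMSEQ_ignore_initial_segment[OF chain_tendsto_tube[OF T w(1)], of r J] .
      have "(\<lambda>N. killed r T (N + J) (\<lambda>_. 1) (0::real^'n)) \<longlonglongrightarrow> tube_prob T r (\<lambda>_. 0)"
        using LIMSEQ_ignore_initial_segment[OF chain_tendsto_tube_zero[OF T, of r 0], of J] by simp
      then show "(\<lambda>N. ?c * killed r T (N + J) (\<lambda>_. 1) 0) \<longlonglongrightarrow> ?c * tube_prob T r (\<lambda>_. 0)"
        by (intro tendsto_mult_ennreal) auto
      show "\<exists>N. \<forall>n\<ge>N. chain r (increments w 0 (dyadic_steps T (n + J))) (\<lambda>_. 1) (- w 0)
        \<le> ?c * killed r T (n + J) (\<lambda>_. 1) 0"
        using K[OF r] w(2) by (auto simp: add.commute)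
    qed
  qed
qed

text \<open>
  Brownian scaling, read off from the chains.
\<close>

lemma tube_prob_scale:
  assumes T: "T > 0" and r: "r > 0"
  shows "tube_prob T r (\<lambda>_. 0) = tube_prob (T / r\<^sup>2) 1 (\<lambda>_. 0)"
proof (rule LIMSEQ_unique)
  let ?T = "T / r\<^sup>2"
  show "(\<lambda>N. killed 1 ?T N (\<lambda>_. 1) (0::real^'n)) \<longlonglongrightarrow> tube_prob ?T 1 (\<lambda>_. 0)"
    using chain_tendsto_tube_zero[of ?T 1 0] assms by simp
  have "killed r T N (\<lambda>_. 1) (0::real^'n)
    = killed 1 ?T N (\<lambda>_. 1) (0::real^'n)" for N
  proof -
    let ?ps = "map (\<lambda>\<delta>. (\<delta>, 0::real^'n)) (dyadic_steps ?T N)"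
    have eq: "map (\<lambda>(\<delta>, d). (r\<^sup>2 * \<delta>, r *\<^sub>R d)) ?ps = map (\<lambda>\<delta>. (\<delta>, 0)) (dyadic_steps T N)"
      using r by (simp add: dyadic_steps_def)
    have "\<delta> > 0" if "(\<delta>, d) \<in> set ?ps" for \<delta> d
      using that dyadic_steps_pos[of ?T \<delta> N] T r by auto
    then have "chain (r * 1) (map (\<lambda>(\<delta>, d). (r\<^sup>2 * \<delta>, r *\<^sub>R d)) ?ps) (\<lambda>_. 1) (r *\<^sub>R 0) = chain 1 ?ps (\<lambda>_. 1) 0"
      by (intro chain_scale r) auto
    then show ?thesis by (simp only: eq mult_1_right scaleR_zero_right)
  qed
  then show "(\<lambda>N. killed 1 ?T N (\<lambda>_. 1) (0::real^'n)) \<longlonglongrightarrow> tube_prob T r (\<lambda>_. 0)"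
    using chain_tendsto_tube_zero[OF T, of r 0] by simp
qed

section \<open>Survival in the unit ball\<close>

text \<open>
  The probability that the Wiener process started at \<open>x\<close> stays in the closed unit ball up to time \<open>t\<close>;
  it stays there exactly if \<open>W\<close> stays in the unit tube around the constant path \<open>- x\<close>.
\<close>

definition survival :: "real \<Rightarrow> real^'n \<Rightarrow> ennreal" where
  "survival t x = tube_prob t 1 (\<lambda>_. - x)"

lemma survival_lim: "t > 0 \<Longrightarrow> (\<lambda>N. killed 1 t N (\<lambda>_. 1) x) \<longlonglongrightarrow> survival t x"
  unfolding survival_def by (rule chain_tendsto_tube_zero)

lemma survival_lim2: "s > 0 \<Longrightarrow> t > 0 \<Longrightarrow>
   (\<lambda>N. chain 1 (map (\<lambda>\<delta>. (\<delta>, 0)) (dyadic_steps s N @ dyadic_steps t N)) (\<lambda>_. 1) x) \<longlonglongrightarrow> survival (s + t) x"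
  unfolding survival_def by (rule chain_tendsto_two_dyadic)

lemma survival_measurable [measurable]: "t > 0 \<Longrightarrow> survival t \<in> borel_measurable borel"
  by (rule borel_measurable_LIMSEQ_order[where u="\<lambda>N. killed 1 t N (\<lambda>_. 1)"])
     (use survival_lim in \<open>auto intro: chain_borel\<close>)

lemma survival_le_1: "survival t x \<le> 1"
  unfolding survival_def tube_prob_def by (rule emeasure_le_1)

lemma survival_neq_top [simp]: "survival t x \<noteq> \<top>"
  using survival_le_1[of t x] by (auto simp: top_unique)

lemma survival_antimono: "0 < s \<Longrightarrow> s \<le> t \<Longrightarrow> survival t x \<le> survival s x"
  unfolding survival_def tube_prob_def by (intro emeasure_mono tube_measurable) (auto simp: tube_def)

lemma chain_one_le_1:
  assumes "T > 0"
  shows "killed 1 T N (\<lambda>_. 1) (x::real^'n) \<le> 1"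
proof -
  have "killed 1 T N (\<lambda>_. 1) x
    = (\<integral>\<^sup>+\<omega>. indicator {\<omega>. confined 1 (\<lambda>t. W t \<omega>) 0 (- x) (map (\<lambda>\<delta>. (\<delta>, 0)) (dyadic_steps T N))} \<omega> * 1 \<partial>M)"
    by (rule chain_eq_expectation) (use dyadic_steps_pos[OF assms] in auto)
  also have "\<dots> \<le> (\<integral>\<^sup>+\<omega>. 1 \<partial>M)" by (intro nn_integral_mono) (auto simp: indicator_def)
  finally show ?thesis by (simp add: emeasure_space_1)
qed

lemma survival_le_center: "t > 0 \<Longrightarrow> survival t x \<le> survival t 0"
proof (rule LIMSEQ_le[OF survival_lim survival_lim])
  assume t: "t > 0"
  show "\<exists>N. \<forall>n\<ge>N. killed 1 t n (\<lambda>_. 1) x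
     \<le> killed 1 t n (\<lambda>_. 1) (0::real^'n)"
  proof (intro exI allI impI)
    fix n
    have "unshifted_steps (map (\<lambda>\<delta>. (\<delta>, 0)) (dyadic_steps t n)) = map (\<lambda>\<delta>. (\<delta>, 0::real^'n)) (dyadic_steps t n)"
      by (simp add: unshifted_steps_def)
    then show "killed 1 t n (\<lambda>_. 1) x
     \<le> killed 1 t n (\<lambda>_. 1) 0"
      using chain_anderson[of "map (\<lambda>\<delta>. (\<delta>, 0)) (dyadic_steps t n)" 1 x] dyadic_steps_pos[OF t, of _ n] by fastforce
  qed
qed

lemma nn_integral_ball_finite: "(\<integral>\<^sup>+x\<in>cball 0 1. 1 \<partial>(lborel :: (real^'n) measure)) < \<infinity>"
  using emeasure_bounded_finite[of "cball 0 1 :: (real^'n) set"] by (simp add: bounded_cball)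

lemma survival_integral_finite: "(\<integral>\<^sup>+y\<in>cball 0 1. survival t y \<partial>lborel) \<noteq> \<infinity>"
proof -
  have "(\<integral>\<^sup>+y\<in>cball 0 1. survival t y \<partial>lborel) \<le> (\<integral>\<^sup>+y\<in>cball 0 1. 1 \<partial>(lborel :: (real^'n) measure))"
    using survival_le_1 by (intro nn_integral_mono mult_right_mono) auto
  then show ?thesis using nn_integral_ball_finite by auto
qed

lemma ball_integral_tendsto:
  assumes "\<And>N. f N \<in> borel_measurable borel" "\<And>N x. f N x \<le> 1" "\<And>x. (\<lambda>N. f N x) \<longlonglongrightarrow> g x"
  shows "(\<lambda>N. \<integral>\<^sup>+x\<in>cball 0 1. f N x \<partial>lborel) \<longlonglongrightarrow> (\<integral>\<^sup>+x\<in>cball 0 1. g x \<partial>(lborel :: (real^'n) measure))"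
proof (rule nn_integral_dominated_convergence[where w="indicator (cball 0 1)"])
  show "AE x in lborel. (\<lambda>N. f N x * indicator (cball 0 1) x) \<longlonglongrightarrow> g x * indicator (cball 0 1) x"
    using assms(3) by (auto simp: indicator_def)
  show "(\<lambda>x. g x * indicator (cball 0 1) x) \<in> borel_measurable lborel"
    using borel_measurable_LIMSEQ_order[where u=f and M=borel and u'=g] assms(1,3) by simp
qed (use assms nn_integral_ball_finite in \<open>auto simp: indicator_def\<close>)

text \<open>
  Self-adjointness of the killed semigroup, applied to the constant function \<open>1\<close>.
\<close>

lemma survival_semigroup:
  assumes st: "s > 0" "t > 0"
  shows "(\<integral>\<^sup>+x\<in>cball 0 1. (survival s x * survival t x) \<partial>lborel) = (\<integral>\<^sup>+x\<in>cball 0 1. survival (s + t) x \<partial>lborel)"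
proof (rule LIMSEQ_unique)
  let ?c = "\<lambda>t N. killed 1 t N (\<lambda>_. 1)"
  let ?c2 = "\<lambda>N. chain 1 (map (\<lambda>\<delta>. (\<delta>, 0::real^'n)) (dyadic_steps s N @ dyadic_steps t N)) (\<lambda>_. 1)"
  have le1: "?c2 N x \<le> 1" for N x
  proof -
    have "?c2 N x = (\<integral>\<^sup>+\<omega>. indicator {\<omega>. confined 1 (\<lambda>t. W t \<omega>) 0 (- x) (map (\<lambda>\<delta>. (\<delta>, 0)) (dyadic_steps s N @ dyadic_steps t N))} \<omega> * 1 \<partial>M)"
      by (rule chain_eq_expectation) (use dyadic_steps_pos[OF st(1)] dyadic_steps_pos[OF st(2)] in auto)
    also have "\<dots> \<le> (\<integral>\<^sup>+\<omega>. 1 \<partial>M)" by (intro nn_integral_mono) (auto simp: indicator_def)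
    finally show ?thesis by (simp add: emeasure_space_1)
  qed
  show "(\<lambda>N. \<integral>\<^sup>+x\<in>cball 0 1. ?c2 N x \<partial>lborel) \<longlonglongrightarrow> (\<integral>\<^sup>+x\<in>cball 0 1. survival (s + t) x \<partial>lborel)"
    by (rule ball_integral_tendsto) (use le1 survival_lim2[OF st] in \<open>auto intro: chain_borel simp del: map_append\<close>)
  have "(\<integral>\<^sup>+x\<in>cball 0 1. ?c2 N x \<partial>lborel) = (\<integral>\<^sup>+x\<in>cball 0 1. (?c s N x * ?c t N x) \<partial>lborel)" for N
  proof -
    have rev: "rev (map (\<lambda>\<delta>. (\<delta>, 0::real^'n)) (dyadic_steps s N)) = map (\<lambda>\<delta>. (\<delta>, 0)) (dyadic_steps s N)"
      by (simp add: dyadic_steps_def)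
    have "(\<integral>\<^sup>+x\<in>cball 0 1. ?c2 N x \<partial>lborel) = (\<integral>\<^sup>+x\<in>cball 0 1. (1 * killed 1 s N (?c t N) x) \<partial>lborel)"
      by (simp add: chain_append)
    also have "\<dots> = (\<integral>\<^sup>+x\<in>cball 0 1. (?c s N x * ?c t N x) \<partial>lborel)"
      by (subst chain_adjoint) (auto simp: rev intro: chain_borel)
    finally show ?thesis .
  qed
  moreover have "(\<lambda>N. \<integral>\<^sup>+x\<in>cball 0 1. (?c s N x * ?c t N x) \<partial>lborel) \<longlonglongrightarrow> (\<integral>\<^sup>+x\<in>cball 0 1. (survival s x * survival t x) \<partial>lborel)"
  proof (rule ball_integral_tendsto)
    show "(\<lambda>N. ?c s N x * ?c t N x) \<longlonglongrightarrow> survival s x * survival t x" for x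
      using survival_lim[OF st(1)] survival_lim[OF st(2)] survival_le_1[of s x] survival_le_1[of t x]
      by (intro tendsto_mult_ennreal) (auto simp: top_unique)
    show "?c s N x * ?c t N x \<le> 1" for N x
      using mult_mono[OF chain_one_le_1[OF st(1), of N x] chain_one_le_1[OF st(2), of N x]] by simp
  qed measurable
  ultimately show "(\<lambda>N. \<integral>\<^sup>+x\<in>cball 0 1. ?c2 N x \<partial>lborel) \<longlonglongrightarrow> (\<integral>\<^sup>+x\<in>cball 0 1. (survival s x * survival t x) \<partial>lborel)"
    by simp
qed

text \<open>
  The maximum of the heat kernel at time \<open>s\<close>.
\<close>

definition heat_bound :: "real \<Rightarrow> real" where
  "heat_bound s = 1 / sqrt (2 * pi * s) ^ CARD('n)"

lemma heat_bound_pos: "s > 0 \<Longrightarrow> heat_bound s > 0"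
  by (simp add: heat_bound_def)

lemma chain_two_le:
  fixes x :: "real^'n"
  assumes st: "s > 0" and [measurable]: "u \<in> borel_measurable borel"
  shows "killed 1 s N u x \<le> ennreal (heat_bound s) * (\<integral>\<^sup>+y\<in>cball 0 1. u y \<partial>lborel)"
proof -
  let ?ps = "map (\<lambda>\<delta>. (\<delta>, 0::real^'n)) (dyadic_steps s N)"
  have "chain 1 ?ps u x \<le> chain 1 [(sum_list (map fst ?ps), sum_list (map snd ?ps))] u x"
    by (rule chain_le_free) (use dyadic_steps_pos[OF st(1)] in \<open>auto simp: dyadic_steps_def\<close>)
  also have "sum_list (map fst ?ps) = s" by (simp add: comp_def)
  also have "chain 1 [(s, sum_list (map snd ?ps))] u x \<le> ennreal (1 / sqrt (2 * pi * s) ^ DIM(real^'n)) * (\<integral>\<^sup>+y\<in>cball 0 1. chain 1 [] u y \<partial>lborel)"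
    by (rule chain_Cons_le) (use st in auto)
  finally show ?thesis by (simp add: heat_bound_def)
qed

text \<open>
  Ignore the killing during the first \<open>s\<close> units of time.
\<close>

lemma survival_smoothing:
  assumes st: "s > 0" "t > 0"
  shows "survival (s + t) x \<le> ennreal (heat_bound s) * (\<integral>\<^sup>+y\<in>cball 0 1. survival t y \<partial>lborel)"
proof (rule LIMSEQ_le[OF survival_lim2[OF st]])
  let ?c = "\<lambda>t N. killed 1 t N (\<lambda>_. 1)"
  show "(\<lambda>N. ennreal (heat_bound s) * (\<integral>\<^sup>+y\<in>cball 0 1. ?c t N y \<partial>lborel)) \<longlonglongrightarrow> ennreal (heat_bound s) * (\<integral>\<^sup>+y\<in>cball 0 1. survival t y \<partial>lborel)"
    using survival_integral_finite[of t]
    by (intro tendsto_mult_ennreal ball_integral_tendsto survival_lim chain_one_le_1 st tendsto_const chain_borel) auto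
  show "\<exists>N. \<forall>n\<ge>N. chain 1 (map (\<lambda>\<delta>. (\<delta>, 0)) (dyadic_steps s n @ dyadic_steps t n)) (\<lambda>_. 1) x
     \<le> ennreal (heat_bound s) * (\<integral>\<^sup>+y\<in>cball 0 1. ?c t n y \<partial>lborel)"
    using chain_two_le[OF st(1)] by (auto simp: chain_append)
qed

text \<open>
  The same smoothing for differences: convergence in \<open>L\<^sup>1\<close> of the ball at one time gives
  convergence at the centre one unit of time later.
\<close>

lemma survival_difference:
  assumes st: "s > 0" "t > 0" and ab: "a \<ge> 0" "b \<ge> 0"
  shows "ennreal a * survival (1 + s) 0 \<le> ennreal b * survival (1 + t) 0
    + ennreal (heat_bound 1) * (\<integral>\<^sup>+y\<in>cball 0 1. ennreal \<bar>a * enn2real (survival s y) - b * enn2real (survival t y)\<bar> \<partial>lborel)"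
proof (rule LIMSEQ_le)
  let ?c = "\<lambda>t N. killed 1 t N (\<lambda>_. 1)"
  let ?c2 = "\<lambda>t N. chain 1 (map (\<lambda>\<delta>. (\<delta>, 0::real^'n)) (dyadic_steps 1 N @ dyadic_steps t N)) (\<lambda>_. 1)"
  let ?d = "\<lambda>N y. ennreal \<bar>a * enn2real (?c s N y) - b * enn2real (?c t N y)\<bar>"
  let ?D = "\<lambda>y. ennreal \<bar>a * enn2real (survival s y) - b * enn2real (survival t y)\<bar>"
  show "(\<lambda>N. ennreal a * ?c2 s N 0) \<longlonglongrightarrow> ennreal a * survival (1 + s) 0"
    using survival_lim2[of 1 s 0] st by (intro tendsto_mult_ennreal) auto
  have lim: "(\<lambda>N. enn2real (?c t N y)) \<longlonglongrightarrow> enn2real (survival t y)" if "t > 0" for t y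
    using survival_lim[OF that, of y] by (intro tendsto_enn2real) (simp_all add: less_top[symmetric])
  have "(\<lambda>N. \<integral>\<^sup>+y. ?d N y * indicator (cball 0 1) y \<partial>lborel) \<longlonglongrightarrow> (\<integral>\<^sup>+y. ?D y * indicator (cball 0 1) y \<partial>lborel)"
  proof (rule nn_integral_dominated_convergence[where w="\<lambda>y. ennreal (a + b) * indicator (cball 0 1) y"])
    show "AE y in lborel. ?d N y * indicator (cball 0 1) y \<le> ennreal (a + b) * indicator (cball 0 1) y" for N
    proof (intro AE_I2 mult_right_mono ennreal_leI)
      fix y
      have "enn2real (?c t N y) \<le> 1" if "t > 0" for t
        using chain_one_le_1[OF that, of N y] by (metis enn2real_leI ennreal_1 zero_le_one)
      then have "a * enn2real (?c s N y) \<le> a * 1" "b * enn2real (?c t N y) \<le> b * 1"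
        using st ab by (intro mult_left_mono; simp)+
      moreover have "0 \<le> a * enn2real (?c s N y)" "0 \<le> b * enn2real (?c t N y)" using ab by auto
      ultimately show "\<bar>a * enn2real (?c s N y) - b * enn2real (?c t N y)\<bar> \<le> a + b" using ab by linarith
    qed auto
    show "(\<integral>\<^sup>+y. ennreal (a + b) * indicator (cball 0 1) y \<partial>(lborel :: (real^'n) measure)) < \<infinity>"
      using nn_integral_ball_finite by (subst nn_integral_cmult) (auto simp: ennreal_mult_less_top)
    show "AE y in lborel. (\<lambda>N. ?d N y * indicator (cball 0 1) y) \<longlonglongrightarrow> ?D y * indicator (cball 0 1) y"
    proof (intro AE_I2)
      fix y
      have "(\<lambda>N. ?d N y) \<longlonglongrightarrow> ?D y"
        by (intro tendsto_ennrealI tendsto_intros lim st)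
      then show "(\<lambda>N. ?d N y * indicator (cball 0 1) y) \<longlonglongrightarrow> ?D y * indicator (cball 0 1) y"
        by (auto simp: indicator_def)
    qed
    show "(\<lambda>y. ?D y * indicator (cball 0 1) y) \<in> borel_measurable lborel"
      using st by measurable
  qed (measurable)
  then show "(\<lambda>N. ennreal b * ?c2 t N 0 + ennreal (heat_bound 1) * (\<integral>\<^sup>+y. ?d N y * indicator (cball 0 1) y \<partial>lborel))
     \<longlonglongrightarrow> ennreal b * survival (1 + t) 0 + ennreal (heat_bound 1) * (\<integral>\<^sup>+y. ?D y * indicator (cball 0 1) y \<partial>lborel)"
    using survival_lim2[of 1 t 0] st heat_bound_pos[of 1]
    by (intro tendsto_add tendsto_mult_ennreal) (auto simp: ennreal_eq_0_iff)
  have "ennreal a * ?c2 s N 0 \<le> ennreal b * ?c2 t N 0 + ennreal (heat_bound 1) * (\<integral>\<^sup>+y. ?d N y * indicator (cball 0 1) y \<partial>lborel)" for N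
  proof -
    let ?p = "map (\<lambda>\<delta>. (\<delta>, 0::real^'n)) (dyadic_steps 1 N)"
    have "ennreal a * ?c2 s N 0 = chain 1 ?p (\<lambda>y. ennreal a * ?c s N y) 0"
      by (subst chain_cmult) (auto simp: chain_append intro: chain_borel)
    also have "\<dots> \<le> chain 1 ?p (\<lambda>y. ennreal b * ?c t N y + ?d N y) 0"
    proof (rule chain_mono)
      fix y
      have fin: "?c t N y = ennreal (enn2real (?c t N y))" if "t > 0" for t
        using chain_one_le_1[OF that, of N y] by (metis ennreal_enn2real ennreal_one_less_top le_less_trans)
      have "ennreal a * ?c s N y = ennreal (a * enn2real (?c s N y))"
        using ab by (subst fin[OF st(1)]) (simp add: ennreal_mult)
      also have "\<dots> \<le> ennreal (b * enn2real (?c t N y) + \<bar>a * enn2real (?c s N y) - b * enn2real (?c t N y)\<bar>)"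
        by (intro ennreal_leI) linarith
      also have "\<dots> = ennreal b * ?c t N y + ?d N y"
        using ab by (subst (2) fin[OF st(2)]) (simp add: ennreal_mult ennreal_plus)
      finally show "ennreal a * ?c s N y \<le> ennreal b * ?c t N y + ?d N y" .
    qed simp
    also have "\<dots> = ennreal b * ?c2 t N 0 + chain 1 ?p (?d N) 0"
      by (subst chain_add) (auto simp: chain_append chain_cmult intro: chain_borel)
    also have "chain 1 ?p (?d N) 0 \<le> ennreal (heat_bound 1) * (\<integral>\<^sup>+y. ?d N y * indicator (cball 0 1) y \<partial>lborel)"
      by (rule chain_two_le) (use st in auto)
    finally show ?thesis by (simp add: add_left_mono)
  qed
  then show "\<exists>N. \<forall>n\<ge>N. ennreal a * ?c2 s n 0 \<le> ennreal b * ?c2 t n 0 + ennreal (heat_bound 1) * (\<integral>\<^sup>+y. ?d n y * indicator (cball 0 1) y \<partial>lborel)"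
    by blast
qed

end

context wiener begin

definition total_survival :: "real \<Rightarrow> ennreal" where
  "total_survival t = (\<integral>\<^sup>+x\<in>cball 0 1. survival t x \<partial>lborel)"

definition ball_volume :: real where
  "ball_volume = measure lborel (cball 0 1 :: (real^'n) set)"

lemma ball_volume: "ball_volume > 0" "emeasure lborel (cball 0 1 :: (real^'n) set) = ennreal ball_volume"
proof -
  show e: "emeasure lborel (cball 0 1 :: (real^'n) set) = ennreal ball_volume"
    unfolding ball_volume_def
    by (intro emeasure_eq_ennreal_measure) (use nn_integral_ball_finite in \<open>auto simp: less_top\<close>)
  have "ball_volume = unit_ball_vol (real DIM(real^'n))"
    unfolding ball_volume_def using content_cball[of 1 "0::real^'n"] by simp
  then show "ball_volume > 0" by simp
qed

lemma total_survival_finite [simp]: "total_survival t \<noteq> \<top>"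
  using survival_integral_finite by (simp add: total_survival_def)

lemma total_survival_semigroup:
  "s > 0 \<Longrightarrow> t > 0 \<Longrightarrow> (\<integral>\<^sup>+x\<in>cball 0 1. (survival s x * survival t x) \<partial>lborel) = total_survival (s + t)"
  unfolding total_survival_def by (rule survival_semigroup)

lemma total_survival_antimono: "0 < s \<Longrightarrow> s \<le> t \<Longrightarrow> total_survival t \<le> total_survival s"
  unfolding total_survival_def by (intro nn_integral_mono mult_right_mono survival_antimono) auto

text \<open>
  Cauchy-Schwarz inequality in \<open>L\<^sup>2\<close> of the ball and the semigroup identity.
\<close>

lemma total_survival_log_convex:
  assumes st: "s > 0" "t > 0"
  shows "(total_survival (s + t))\<^sup>2 \<le> total_survival (2 * s) * total_survival (2 * t)"
proof -
  note [measurable] = survival_measurable[OF st(1)] survival_measurable[OF st(2)]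
  let ?f = "\<lambda>t x. survival t x * indicator (cball 0 1) x"
  have sq: "(\<integral>\<^sup>+x. (?f t x)\<^sup>2 \<partial>lborel) = total_survival (2 * t)" if "t > 0" for t
  proof -
    have "(\<integral>\<^sup>+x. (?f t x)\<^sup>2 \<partial>lborel) = (\<integral>\<^sup>+x\<in>cball 0 1. (survival t x * survival t x) \<partial>lborel)"
      by (intro nn_integral_cong) (auto simp: power2_eq_square indicator_def)
    then show ?thesis using total_survival_semigroup[OF that that] by simp
  qed
  have "total_survival (s + t) = (\<integral>\<^sup>+x. ?f s x * ?f t x \<partial>lborel)"
    unfolding total_survival_semigroup[OF st, symmetric]
    by (intro nn_integral_cong) (auto simp: indicator_def)
  then have "(total_survival (s + t))\<^sup>2 \<le> (\<integral>\<^sup>+x. (?f s x)\<^sup>2 \<partial>lborel) * (\<integral>\<^sup>+x. (?f t x)\<^sup>2 \<partial>lborel)"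
    by (simp only:) (rule Cauchy_Schwarz_nn_integral; measurable)
  then show ?thesis by (simp add: sq st)
qed

lemma total_survival_double:
  assumes t: "t > 0"
  shows "(total_survival t)\<^sup>2 \<le> total_survival (2 * t) * ennreal ball_volume"
proof -
  note [measurable] = survival_measurable[OF t]
  let ?f = "\<lambda>x. survival t x * indicator (cball 0 1) x" and ?g = "indicator (cball 0 1) :: real^'n \<Rightarrow> ennreal"
  have "total_survival t = (\<integral>\<^sup>+x. ?f x * ?g x \<partial>lborel)"
    unfolding total_survival_def by (intro nn_integral_cong) (auto simp: indicator_def)
  then have "(total_survival t)\<^sup>2 \<le> (\<integral>\<^sup>+x. (?f x)\<^sup>2 \<partial>lborel) * (\<integral>\<^sup>+x. (?g x)\<^sup>2 \<partial>lborel)"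
    by (simp only:) (rule Cauchy_Schwarz_nn_integral; measurable)
  also have "(\<integral>\<^sup>+x. (?f x)\<^sup>2 \<partial>lborel) = (\<integral>\<^sup>+x\<in>cball 0 1. (survival t x * survival t x) \<partial>lborel)"
    by (intro nn_integral_cong) (auto simp: power2_eq_square indicator_def)
  also have "\<dots> = total_survival (2 * t)" using total_survival_semigroup[OF t t] by simp
  also have "(\<integral>\<^sup>+x. (?g x)\<^sup>2 \<partial>lborel) = (\<integral>\<^sup>+x. ?g x \<partial>lborel)"
    by (intro nn_integral_cong) (auto simp: indicator_def)
  also have "\<dots> = ennreal ball_volume" by (simp add: ball_volume)
  finally show ?thesis .
qed

lemma total_survival_submult:
  assumes st: "s > 0" "t > 0"
  shows "total_survival (s + 1 + t) \<le> ennreal (heat_bound 1) * total_survival s * total_survival t"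
proof -
  have "total_survival (s + 1 + t) = (\<integral>\<^sup>+x\<in>cball 0 1. (survival s x * survival (1 + t) x) \<partial>lborel)"
    using total_survival_semigroup[of s "1 + t"] st by (simp add: add.assoc)
  also have "\<dots> \<le> (\<integral>\<^sup>+x. (ennreal (heat_bound 1) * total_survival t) * (survival s x * indicator (cball 0 1) x) \<partial>lborel)"
  proof (intro nn_integral_mono)
    fix x
    have "survival (1 + t) x \<le> ennreal (heat_bound 1) * total_survival t"
      unfolding total_survival_def using survival_smoothing[of 1 t x] st by simp
    then have "survival s x * survival (1 + t) x \<le> survival s x * (ennreal (heat_bound 1) * total_survival t)"
      by (intro mult_left_mono) auto
    then show "survival s x * survival (1 + t) x * indicator (cball 0 1) x
       \<le> (ennreal (heat_bound 1) * total_survival t) * (survival s x * indicator (cball 0 1) x)"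
      by (auto simp: indicator_def mult.commute)
  qed
  also have "\<dots> = (ennreal (heat_bound 1) * total_survival t) * total_survival s"
    unfolding total_survival_def using survival_measurable[OF st(1)] by (subst nn_integral_cmult) auto
  finally show ?thesis by (simp add: ac_simps)
qed

text \<open>
  Paths are continuous, so \<open>W\<close> stays in the ball of radius \<open>1/2\<close> for some short time with positive
  probability; this makes the total survival positive at this time. It remains positive
  when the time is doubled, again by the Cauchy-Schwarz inequality.
\<close>

lemma total_survival_pos:
  assumes t: "t > 0"
  shows "total_survival t > 0"
proof -
  have "\<exists>n. emeasure M (tube (1 / real (Suc n)) (1/2) (\<lambda>_. 0)) > 0"
  proof (rule ccontr)
    assume "\<not> ?thesis"
    then have z: "emeasure M (tube (1 / real (Suc n)) (1/2) (\<lambda>_. 0)) = 0" for n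
      by (simp add: not_less)
    have "AE \<omega> in M. \<omega> \<notin> tube (1 / real (Suc n)) (1/2) (\<lambda>_. 0)" for n
      using z[of n] tube_measurable[of "1 / real (Suc n)" "\<lambda>_. 0" "1/2"] by (intro AE_not_in null_setsI) auto
    then have "AE \<omega> in M. \<forall>n. \<omega> \<notin> tube (1 / real (Suc n)) (1/2) (\<lambda>_. 0)"
      by (simp add: AE_all_countable)
    then have "AE \<omega> in M. False"
      using W_0 AE_space
    proof eventually_elim
      case (elim \<omega>)
      show ?case
      proof -
        have True: "\<omega> \<in> space M" using elim by simp
        have "continuous_on {0..} (\<lambda>t. W t \<omega>)" by (rule W_continuous[OF True])
        then obtain d where d: "d > 0" "\<And>u. u \<in> {0..} \<Longrightarrow> dist u 0 < d \<Longrightarrow> dist (W u \<omega>) (W 0 \<omega>) < 1/2"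
          unfolding continuous_on_iff by (metis atLeast_iff half_gt_zero order_refl zero_less_one)
        obtain n where n: "1 / real (Suc n) < d" using d(1) nat_approx_posE by blast
        have "\<omega> \<in> tube (1 / real (Suc n)) (1/2) (\<lambda>_. 0)"
          using d(2) n elim(2) True unfolding tube_def by (force simp: dist_norm)
        then show ?thesis using elim(1) by blast
      qed
    qed
    then show False by simp
  qed
  then obtain n where n: "emeasure M (tube (1 / real (Suc n)) (1/2) (\<lambda>_. 0)) > 0" ..
  define t0 where "t0 = 1 / real (Suc n)"
  define p where "p = emeasure M (tube t0 (1/2) (\<lambda>_. 0))"
  have t0: "t0 > 0" and p: "p > 0" using n by (auto simp: t0_def p_def)
  have "p \<le> survival t0 x" if "x \<in> cball 0 (1/2)" for x
    unfolding survival_def tube_prob_def p_def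
  proof (intro emeasure_mono tube_measurable t0)
    show "tube t0 (1/2) (\<lambda>_. 0) \<subseteq> tube t0 1 (\<lambda>_. - x)"
    proof
      fix \<omega> assume o: "\<omega> \<in> tube t0 (1/2) (\<lambda>_. 0)"
      have "norm (W t \<omega> - - x) \<le> 1" if t: "t \<in> {0..t0}" for t
      proof -
        have "norm (W t \<omega> + x) \<le> norm (W t \<omega>) + norm x" by (rule norm_triangle_ineq)
        moreover have "norm (W t \<omega>) \<le> 1/2" using o t by (auto simp: tube_def)
        ultimately show ?thesis using \<open>x \<in> cball 0 (1/2)\<close> by simp
      qed
      then show "\<omega> \<in> tube t0 1 (\<lambda>_. - x)" using o by (auto simp: tube_def)
    qed
  qed auto
  then have "(\<integral>\<^sup>+x. p * indicator (cball 0 (1/2)) x \<partial>(lborel :: (real^'n) measure)) \<le> total_survival t0"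
    unfolding total_survival_def by (intro nn_integral_mono) (auto simp: indicator_def)
  moreover have "(\<integral>\<^sup>+x. p * indicator (cball 0 (1/2)) x \<partial>(lborel :: (real^'n) measure)) > 0"
    using p emeasure_cball[of "1/2" "0::real^'n"]
    by (subst nn_integral_cmult_indicator) (auto simp: ennreal_zero_less_mult_iff)
  ultimately have start: "total_survival t0 > 0" by simp
  have dbl: "total_survival (2 ^ k * t0) > 0" for k
  proof (induction k)
    case (Suc k)
    have "0 < (total_survival (2 ^ k * t0))\<^sup>2" using Suc by (simp add: power2_eq_square ennreal_zero_less_mult_iff)
    also have "\<dots> \<le> total_survival (2 * (2 ^ k * t0)) * ennreal ball_volume"
      using t0 by (intro total_survival_double) auto
    finally show ?case by (simp add: mult.assoc ennreal_zero_less_mult_iff)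
  qed (use start in simp)
  obtain k where "t / t0 < 2 ^ k" using real_arch_pow[of 2 "t / t0"] by auto
  then have "t \<le> 2 ^ k * t0" using t0 by (simp add: field_simps)
  then have "total_survival (2 ^ k * t0) \<le> total_survival t" by (rule total_survival_antimono[OF t])
  then show ?thesis using dbl[of k] by simp
qed

lemma heat_bound_tendsto_0: "(heat_bound \<longlongrightarrow> 0) at_top"
proof -
  have "((\<lambda>s. 1 / sqrt (2 * pi * s)) \<longlongrightarrow> 0) at_top" by real_asymp
  then have "((\<lambda>s. (1 / sqrt (2 * pi * s)) ^ CARD('n)) \<longlongrightarrow> 0 ^ CARD('n)) at_top"
    by (intro tendsto_power)
  then show ?thesis
    by (simp add: heat_bound_def[abs_def] power_one_over zero_power)
qed

definition total_survival_real :: "real \<Rightarrow> real" where "total_survival_real t = enn2real (total_survival t)"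

lemma total_survival_real_ennreal: "total_survival t = ennreal (total_survival_real t)"
  by (metis ennreal_enn2real less_top total_survival_finite total_survival_real_def)

lemma total_survival_real_nonneg [simp]: "total_survival_real t \<ge> 0" by (simp add: total_survival_real_def)

text \<open>
  The decay to zero that \<open>exponential_asymptotics\<close> asks for comes from the decay of the heat kernel.
\<close>

lemma total_survival_real_asymptotics:
  obtains \<kappa> a where "\<kappa> > 0" "a > 0" "((\<lambda>t. exp (\<kappa> * t) * total_survival_real t) \<longlongrightarrow> a) at_top"
proof (rule exponential_asymptotics)
  show "total_survival_real t > 0" if "t > 0" for t
    using total_survival_pos[OF that] by (simp add: total_survival_real_ennreal)
  show "total_survival_real t \<le> total_survival_real s" if "0 < s" "s \<le> t" for s t
    using total_survival_antimono[OF that] by (simp add: total_survival_real_ennreal)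
  show "(total_survival_real (s + t))\<^sup>2 \<le> total_survival_real (2 * s) * total_survival_real (2 * t)" if "0 < s" "0 < t" for s t
    using total_survival_log_convex[OF that] by (simp add: total_survival_real_ennreal ennreal_power flip: ennreal_mult)
  show "total_survival_real (s + 1 + t) \<le> heat_bound 1 * total_survival_real s * total_survival_real t" if "0 < s" "0 < t" for s t
    using total_survival_submult[OF that] heat_bound_pos[of 1] by (simp add: total_survival_real_ennreal flip: ennreal_mult)
  have "total_survival_real t \<le> ball_volume * (heat_bound (t - 1) * total_survival_real 1)" if t: "t > 1" for t
  proof -
    have "total_survival t \<le> (\<integral>\<^sup>+x. (ennreal (heat_bound (t - 1)) * total_survival 1) * indicator (cball 0 1) x \<partial>(lborel :: (real^'n) measure))"
      unfolding total_survival_def[of t]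
      using survival_smoothing[of "t - 1" 1] t
      by (intro nn_integral_mono mult_right_mono) (auto simp: total_survival_def)
    also have "\<dots> = ennreal (ball_volume * (heat_bound (t - 1) * total_survival_real 1))"
      using heat_bound_pos[of "t - 1"] t ball_volume
      by (subst nn_integral_cmult_indicator) (simp_all add: total_survival_real_ennreal ennreal_mult mult.commute)
    finally show ?thesis
      using heat_bound_pos[of "t - 1"] t ball_volume by (simp add: total_survival_real_ennreal)
  qed
  moreover have "((\<lambda>t. ball_volume * (heat_bound (t - 1) * total_survival_real 1)) \<longlongrightarrow> ball_volume * (0 * total_survival_real 1)) at_top"
  proof (intro tendsto_intros)
    show "((\<lambda>t. heat_bound (t - 1)) \<longlongrightarrow> 0) at_top"
      by (rule filterlim_compose[OF heat_bound_tendsto_0]) real_asymp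
  qed
  ultimately show "(total_survival_real \<longlongrightarrow> 0) at_top"
    by (intro tendsto_sandwich[of "\<lambda>_. 0" total_survival_real at_top "\<lambda>t. ball_volume * (heat_bound (t - 1) * total_survival_real 1)"])
       (auto intro!: eventually_mono[OF eventually_gt_at_top[of 1]])
qed (use that in blast)

definition survival_real :: "real \<Rightarrow> real^'n \<Rightarrow> real" where "survival_real t x = enn2real (survival t x)"

lemma survival_real_ennreal: "survival t x = ennreal (survival_real t x)"
  by (metis ennreal_enn2real less_top survival_neq_top survival_real_def)

lemma survival_real_bounds [simp]: "0 \<le> survival_real t x" "survival_real t x \<le> 1"
proof -
  show 0: "0 \<le> survival_real t x" by (simp add: survival_real_def)
  show "survival_real t x \<le> 1" using survival_le_1[of t x] by (simp add: survival_real_ennreal)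
qed

lemma survival_real_measurable [measurable]: "t > 0 \<Longrightarrow> survival_real t \<in> borel_measurable borel"
  unfolding survival_real_def using survival_measurable by measurable

lemma survival_real_product_integral:
  assumes st: "s > 0" "t > 0"
  shows "integrable lborel (\<lambda>x. indicator (cball 0 1) x * (survival_real s x * survival_real t x))"
    and "(\<integral>x. indicator (cball 0 1) x * (survival_real s x * survival_real t x) \<partial>lborel) = total_survival_real (s + t)"
proof -
  note [measurable] = survival_real_measurable[OF st(1)] survival_real_measurable[OF st(2)]
  have "(\<integral>\<^sup>+x. ennreal (indicator (cball 0 1) x * (survival_real s x * survival_real t x)) \<partial>lborel) = total_survival (s + t)"
    unfolding total_survival_semigroup[OF st, symmetric] survival_real_ennreal
    by (intro nn_integral_cong) (auto simp: indicator_def ennreal_mult)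
  then have *: "(\<integral>\<^sup>+x. ennreal (indicator (cball 0 1) x * (survival_real s x * survival_real t x)) \<partial>lborel) = ennreal (total_survival_real (s + t))"
    by (simp add: total_survival_real_ennreal)
  show "integrable lborel (\<lambda>x. indicator (cball 0 1) x * (survival_real s x * survival_real t x))"
    using * by (intro integrableI_nn_integral_finite[where x="total_survival_real (s + t)"]) auto
  show "(\<integral>x. indicator (cball 0 1) x * (survival_real s x * survival_real t x) \<partial>lborel) = total_survival_real (s + t)"
    using * by (intro integral_eq_nn_integral[THEN trans]) auto
qed

text \<open>
  Expanding the square, the distance in \<open>L\<^sup>2\<close> of two rescaled survival functions is a combination of
  values of the total survival alone.
\<close>

lemma scaled_difference_bound:
  assumes st: "s > 0" "t > 0"
  shows "\<bar>exp (\<kappa> * s) * survival_real (1 + s) 0 - exp (\<kappa> * t) * survival_real (1 + t) 0\<bar>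
    \<le> heat_bound 1 * sqrt (ball_volume * (exp (\<kappa> * (2 * s)) * total_survival_real (2 * s) - 2 * (exp (\<kappa> * (s + t)) * total_survival_real (s + t)) + exp (\<kappa> * (2 * t)) * total_survival_real (2 * t)))"
proof -
  note [measurable] = survival_real_measurable[OF st(1)] survival_real_measurable[OF st(2)]
  define I where "I = exp (\<kappa> * (2 * s)) * total_survival_real (2 * s) - 2 * (exp (\<kappa> * (s + t)) * total_survival_real (s + t)) + exp (\<kappa> * (2 * t)) * total_survival_real (2 * t)"
  let ?d = "\<lambda>x. exp (\<kappa> * s) * survival_real s x - exp (\<kappa> * t) * survival_real t x"
  let ?B = "cball 0 1 :: (real^'n) set"
  have eq: "indicator ?B x * (?d x)\<^sup>2 = exp (\<kappa> * (2 * s)) * (indicator ?B x * (survival_real s x * survival_real s x))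
     - 2 * (exp (\<kappa> * (s + t)) * (indicator ?B x * (survival_real s x * survival_real t x))) + exp (\<kappa> * (2 * t)) * (indicator ?B x * (survival_real t x * survival_real t x))" for x
  proof -
    have e: "exp (\<kappa> * (2 * s)) = exp (\<kappa> * s) * exp (\<kappa> * s)" "exp (\<kappa> * (2 * t)) = exp (\<kappa> * t) * exp (\<kappa> * t)"
      "exp (\<kappa> * (s + t)) = exp (\<kappa> * s) * exp (\<kappa> * t)"
      by (simp_all add: distrib_left flip: exp_add)
    show ?thesis unfolding e power2_eq_square by (simp add: algebra_simps)
  qed
  note i = survival_real_product_integral[OF st(1) st(1)] survival_real_product_integral[OF st] survival_real_product_integral[OF st(2) st(2)]
  have int: "integrable lborel (\<lambda>x. indicator ?B x * (?d x)\<^sup>2)"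
    unfolding eq by (intro Bochner_Integration.integrable_add Bochner_Integration.integrable_diff integrable_mult_right i)
  have val: "(\<integral>x. indicator ?B x * (?d x)\<^sup>2 \<partial>lborel) = I"
    unfolding eq I_def
    using i by (simp add: Bochner_Integration.integral_add Bochner_Integration.integral_diff mult_2[symmetric])
  have I0: "I \<ge> 0" unfolding val[symmetric] by (intro integral_nonneg_AE) auto
  have nn: "(\<integral>\<^sup>+x. ennreal (indicator ?B x * (?d x)\<^sup>2) \<partial>lborel) = ennreal I"
    using nn_integral_eq_integral[OF int] val by simp
  define J where "J = (\<integral>\<^sup>+x\<in>?B. ennreal \<bar>?d x\<bar> \<partial>lborel)"
  have "J\<^sup>2 \<le> ennreal I * ennreal ball_volume"
  proof -
    have "J = (\<integral>\<^sup>+x. ennreal (indicator ?B x * \<bar>?d x\<bar>) * indicator ?B x \<partial>lborel)"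
      unfolding J_def by (intro nn_integral_cong) (auto simp: indicator_def)
    then have "J\<^sup>2 \<le> (\<integral>\<^sup>+x. (ennreal (indicator ?B x * \<bar>?d x\<bar>))\<^sup>2 \<partial>lborel) * (\<integral>\<^sup>+x. (indicator ?B x)\<^sup>2 \<partial>lborel)"
      by (simp only:) (rule Cauchy_Schwarz_nn_integral; measurable)
    also have "(\<integral>\<^sup>+x. (ennreal (indicator ?B x * \<bar>?d x\<bar>))\<^sup>2 \<partial>lborel) = ennreal I"
      unfolding nn[symmetric] by (intro nn_integral_cong) (auto simp: indicator_def ennreal_power)
    also have "(\<integral>\<^sup>+x. (indicator ?B x)\<^sup>2 \<partial>lborel) = (\<integral>\<^sup>+x. indicator ?B x \<partial>lborel)"
      by (intro nn_integral_cong) (auto simp: indicator_def)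
    also have "\<dots> = ennreal ball_volume" by (simp add: ball_volume)
    finally show ?thesis .
  qed
  also have "\<dots> = (ennreal (sqrt (ball_volume * I)))\<^sup>2"
    using I0 ball_volume(1) by (simp add: ennreal_power mult.commute flip: ennreal_mult)
  finally have J: "J \<le> ennreal (sqrt (ball_volume * I))" by (rule ennreal_square_le_imp_le)
  have one: "exp (\<kappa> * s) * survival_real (1 + s) 0 \<le> exp (\<kappa> * t) * survival_real (1 + t) 0 + heat_bound 1 * sqrt (ball_volume * I)"
    if st: "s > 0" "t > 0" and J: "(\<integral>\<^sup>+x\<in>?B. ennreal \<bar>exp (\<kappa> * s) * survival_real s x - exp (\<kappa> * t) * survival_real t x\<bar> \<partial>lborel) \<le> ennreal (sqrt (ball_volume * I))" for s t
  proof -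
    have "ennreal (exp (\<kappa> * s)) * survival (1 + s) 0 \<le> ennreal (exp (\<kappa> * t)) * survival (1 + t) 0
      + ennreal (heat_bound 1) * (\<integral>\<^sup>+x\<in>?B. ennreal \<bar>exp (\<kappa> * s) * survival_real s x - exp (\<kappa> * t) * survival_real t x\<bar> \<partial>lborel)"
      unfolding survival_real_def by (rule survival_difference) (use st in auto)
    also have "\<dots> \<le> ennreal (exp (\<kappa> * t)) * survival (1 + t) 0 + ennreal (heat_bound 1) * ennreal (sqrt (ball_volume * I))"
      by (intro add_left_mono mult_left_mono J) auto
    finally show ?thesis
      using heat_bound_pos[of 1] I0 ball_volume(1) by (simp add: survival_real_ennreal flip: ennreal_mult ennreal_plus)
  qed
  have "exp (\<kappa> * s) * survival_real (1 + s) 0 \<le> exp (\<kappa> * t) * survival_real (1 + t) 0 + heat_bound 1 * sqrt (ball_volume * I)"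
    using one[OF st J[unfolded J_def]] .
  moreover have "exp (\<kappa> * t) * survival_real (1 + t) 0 \<le> exp (\<kappa> * s) * survival_real (1 + s) 0 + heat_bound 1 * sqrt (ball_volume * I)"
    using one[OF st(2,1)] J[unfolded J_def] by (simp add: abs_minus_commute)
  ultimately show ?thesis unfolding I_def[symmetric] by linarith
qed

text \<open>
  The combination in \<open>scaled_difference_bound\<close> tends to \<open>b - 2 b + b = 0\<close>, which gives a Cauchy
  property. The limit is positive, because the survival function is largest at the centre, so that its
  value there is at least the mean over the ball.
\<close>

theorem survival_asymptotics:
  obtains \<kappa> a where "\<kappa> > 0" "a > 0" "((\<lambda>t. exp (\<kappa> * t) * survival_real t 0) \<longlongrightarrow> a) at_top"
proof -
  obtain \<kappa> b where \<kappa>: "\<kappa> > 0" and b: "b > 0" and lim: "((\<lambda>t. exp (\<kappa> * t) * total_survival_real t) \<longlongrightarrow> b) at_top"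
    by (rule total_survival_real_asymptotics)
  let ?H = "\<lambda>t. exp (\<kappa> * t) * total_survival_real t"
  let ?g = "\<lambda>t. exp (\<kappa> * t) * survival_real (1 + t) 0"
  let ?D = "\<lambda>s t. heat_bound 1 * sqrt (ball_volume * (?H (2 * s) - 2 * ?H (s + t) + ?H (2 * t)))"
  have small: "\<exists>T>0. \<forall>s\<ge>T. \<forall>t\<ge>T. ?D s t \<le> e" if e: "e > 0" for e
  proof -
    \<comment> \<open>the four values of ?H, counted with multiplicity, are within \<eta> of b\<close>
    define \<eta> where "\<eta> = (e / heat_bound 1)\<^sup>2 / (4 * ball_volume)"
    have \<eta>: "\<eta> > 0" using e heat_bound_pos[of 1] ball_volume(1) by (simp add: \<eta>_def)
    then have "\<forall>\<^sub>F t in at_top. dist (?H t) b < \<eta>" using tendstoD[OF lim] by blast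
    then obtain T where T: "\<And>t. t \<ge> T \<Longrightarrow> \<bar>?H t - b\<bar> < \<eta>"
      by (auto simp: eventually_at_top_linorder dist_real_def)
    have "?D s t \<le> e" if "s \<ge> max T 1" "t \<ge> max T 1" for s t
    proof -
      have "\<bar>?H (2 * s) - b\<bar> < \<eta>" "\<bar>?H (s + t) - b\<bar> < \<eta>" "\<bar>?H (2 * t) - b\<bar> < \<eta>"
        using that by (intro T; simp)+
      then have "?H (2 * s) - 2 * ?H (s + t) + ?H (2 * t) \<le> 4 * \<eta>" by linarith
      then have "ball_volume * (?H (2 * s) - 2 * ?H (s + t) + ?H (2 * t)) \<le> ball_volume * (4 * \<eta>)"
        using ball_volume(1) by (intro mult_left_mono) auto
      also have "\<dots> = (e / heat_bound 1)\<^sup>2" using ball_volume(1) by (simp add: \<eta>_def)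
      finally have "sqrt (ball_volume * (?H (2 * s) - 2 * ?H (s + t) + ?H (2 * t))) \<le> e / heat_bound 1"
        using e heat_bound_pos[of 1] by (intro real_le_lsqrt) auto
      then show ?thesis using heat_bound_pos[of 1] by (simp add: field_simps)
    qed
    then show ?thesis by (intro exI[of _ "max T 1"]) auto
  qed
  have cau: "\<exists>T>0. \<forall>s\<ge>T. \<forall>t\<ge>T. \<bar>?g s - ?g t\<bar> \<le> e" if e: "e > 0" for e
  proof -
    obtain T where "T > 0" "\<forall>s\<ge>T. \<forall>t\<ge>T. ?D s t \<le> e" using small[OF e] by blast
    then show ?thesis
      using scaled_difference_bound[of _ _ \<kappa>] by (intro exI[of _ T]) (meson less_le_trans order_trans)
  qed
  have "Cauchy (\<lambda>n. ?g (real n))"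
  proof (rule CauchyI')
    fix e :: real assume "e > 0"
    then obtain T where T: "\<forall>s\<ge>T. \<forall>t\<ge>T. \<bar>?g s - ?g t\<bar> \<le> e/2" using cau[of "e/2"] by auto
    obtain N where "T \<le> real N" using real_arch_simple by blast
    then have "dist (?g (real m)) (?g (real n)) < e" if "m \<ge> N" "n > m" for m n
    proof -
      have "\<bar>?g (real m) - ?g (real n)\<bar> \<le> e/2" using T \<open>T \<le> real N\<close> that by auto
      then show ?thesis using \<open>e > 0\<close> by (simp add: dist_real_def)
    qed
    then show "\<exists>N. \<forall>m\<ge>N. \<forall>n>m. dist (?g (real m)) (?g (real n)) < e" by blast
  qed
  then obtain l where l: "(\<lambda>n. ?g (real n)) \<longlonglongrightarrow> l" using Cauchy_convergent_iff convergent_def by blast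
  have lim_g: "(?g \<longlongrightarrow> l) at_top"
  proof (rule tendstoI)
    fix e :: real assume "e > 0"
    then obtain T where T: "\<forall>s\<ge>T. \<forall>t\<ge>T. \<bar>?g s - ?g t\<bar> \<le> e/2" using cau[of "e/2"] by auto
    have "\<bar>?g t - l\<bar> \<le> e/2" if "t \<ge> T" for t
    proof (rule LIMSEQ_le_const2)
      show "(\<lambda>n. \<bar>?g t - ?g (real n)\<bar>) \<longlonglongrightarrow> \<bar>?g t - l\<bar>" by (intro tendsto_intros l)
      obtain N where "T \<le> real N" using real_arch_simple by blast
      then have "\<bar>?g t - ?g (real n)\<bar> \<le> e/2" if "n \<ge> N" for n
        using T \<open>t \<ge> T\<close> that by auto
      then show "\<exists>N. \<forall>n\<ge>N. \<bar>?g t - ?g (real n)\<bar> \<le> e/2" by blast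
    qed
    then have "dist (?g t) l < e" if "t \<ge> T" for t
      using that \<open>e > 0\<close> by (smt (verit) dist_real_def field_sum_of_halves)
    then show "\<forall>\<^sub>F t in at_top. dist (?g t) l < e" by (auto simp: eventually_at_top_linorder)
  qed
  \<comment> \<open>the centre dominates the mean over the ball\<close>
  have "b * exp (- \<kappa>) / ball_volume \<le> l"
  proof (rule tendsto_le[OF _ lim_g])
    have "((\<lambda>t. ?H (1 + t)) \<longlongrightarrow> b) at_top"
      by (rule filterlim_compose[OF lim]) real_asymp
    then show "((\<lambda>t. ?H (1 + t) * exp (- \<kappa>) / ball_volume) \<longlongrightarrow> b * exp (- \<kappa>) / ball_volume) at_top"
      using ball_volume(1) by (intro tendsto_intros) auto
    have "?H (1 + t) * exp (- \<kappa>) / ball_volume \<le> ?g t" if t: "t > 0" for t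
    proof -
      have "total_survival (1 + t) \<le> (\<integral>\<^sup>+x. survival (1 + t) 0 * indicator (cball 0 1) x \<partial>(lborel :: (real^'n) measure))"
        unfolding total_survival_def using t by (intro nn_integral_mono mult_right_mono survival_le_center) auto
      also have "\<dots> = ennreal (survival_real (1 + t) 0 * ball_volume)"
        using ball_volume by (simp add: nn_integral_cmult_indicator survival_real_ennreal ennreal_mult)
      finally have "total_survival_real (1 + t) \<le> survival_real (1 + t) 0 * ball_volume"
        using ball_volume(1) by (simp add: total_survival_real_ennreal)
      have "?H (1 + t) * exp (- \<kappa>) = exp (\<kappa> * t) * total_survival_real (1 + t)"
        by (simp add: distrib_left exp_add exp_minus)
      also have "\<dots> \<le> exp (\<kappa> * t) * (survival_real (1 + t) 0 * ball_volume)"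
        using \<open>total_survival_real (1 + t) \<le> survival_real (1 + t) 0 * ball_volume\<close> by (intro mult_left_mono) auto
      finally show ?thesis using ball_volume(1) by (simp only: pos_divide_le_eq mult.assoc)
    qed
    then show "\<forall>\<^sub>F t in at_top. ?H (1 + t) * exp (- \<kappa>) / ball_volume \<le> ?g t"
      by (intro eventually_mono[OF eventually_gt_at_top[of 0]]) auto
  qed simp
  moreover have "0 < b * exp (- \<kappa>) / ball_volume" using b ball_volume(1) by simp
  ultimately have l0: "l > 0" by linarith
  have "((\<lambda>t. exp \<kappa> * ?g (t - 1)) \<longlongrightarrow> exp \<kappa> * l) at_top"
    by (intro tendsto_intros filterlim_compose[OF lim_g]) real_asymp
  moreover have "(\<lambda>t. exp \<kappa> * ?g (t - 1)) = (\<lambda>t. exp (\<kappa> * t) * survival_real t 0)"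
    by (simp add: fun_eq_iff right_diff_distrib exp_diff)
  ultimately have "((\<lambda>t. exp (\<kappa> * t) * survival_real t 0) \<longlongrightarrow> exp \<kappa> * l) at_top" by (simp only:)
  then show thesis using that[OF \<kappa>, of "exp \<kappa> * l"] l0 by simp
qed

section \<open>Asymptotics of small tubes\<close>

definition open_tube :: "real \<Rightarrow> real \<Rightarrow> (real \<Rightarrow> real^'n) \<Rightarrow> 'a set" where
  "open_tube T r w = {\<omega> \<in> space M. (SUP t\<in>{0..T}. norm (w t - W t \<omega>)) < r}"

text \<open>
  On the open tube the supremum of the deviation is strictly smaller than \<open>r\<close>, so that the path already
  lies in a smaller closed tube.
\<close>

lemma open_tube_eq_Union:
  assumes T: "T > 0" and w: "continuous_on {0..T} w" and r: "r > 0"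
  shows "open_tube T r w = (\<Union>n. tube T (r - r / real (Suc n)) w)"
proof (intro set_eqI iffI)
  fix \<omega> assume o: "\<omega> \<in> open_tube T r w"
  then have \<omega>: "\<omega> \<in> space M" by (simp add: open_tube_def)
  define S where "S = (SUP t\<in>{0..T}. norm (w t - W t \<omega>))"
  have S: "S < r" using o by (simp add: open_tube_def S_def)
  have "bdd_above ((\<lambda>t. norm (w t - W t \<omega>)) ` {0..T})"
    by (intro compact_imp_bounded[THEN bounded_imp_bdd_above] compact_continuous_image continuous_intros w
        continuous_on_subset[OF W_continuous[OF \<omega>]]) auto
  then have le: "norm (w t - W t \<omega>) \<le> S" if "t \<in> {0..T}" for t
    unfolding S_def using that by (intro cSUP_upper) auto
  obtain n where n: "1 / real (Suc n) < (r - S) / r" using nat_approx_posE[of "(r - S) / r"] S r by auto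
  then have "r * (1 / real (Suc n)) < r * ((r - S) / r)" using r by (intro mult_strict_left_mono) auto
  then have "S \<le> r - r / real (Suc n)" using r by simp
  then have "\<omega> \<in> tube T (r - r / real (Suc n)) w"
    using le \<omega> by (force simp: tube_def norm_minus_commute)
  then show "\<omega> \<in> (\<Union>n. tube T (r - r / real (Suc n)) w)" by blast
next
  fix \<omega> assume "\<omega> \<in> (\<Union>n. tube T (r - r / real (Suc n)) w)"
  then obtain n where n: "\<omega> \<in> tube T (r - r / real (Suc n)) w" by blast
  then have "(SUP t\<in>{0..T}. norm (w t - W t \<omega>)) \<le> r - r / real (Suc n)"
    using T by (intro cSUP_least) (auto simp: tube_def norm_minus_commute)
  also have "\<dots> < r" using r by simp
  finally show "\<omega> \<in> open_tube T r w" using n by (simp add: open_tube_def tube_def)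
qed

lemma open_tube_indep_initial:
  assumes T: "T > 0" and w: "continuous_on {0..T} w" and r: "r > 0" and D: "D \<in> sets (F 0)"
  shows "open_tube T r w \<in> sets M"
    and "measure M (D \<inter> open_tube T r w) = measure M D * measure M (open_tube T r w)"
proof -
  have DM: "D \<in> sets M" using D sets_F_le[of 0] by auto
  let ?E = "\<lambda>n. tube T (r - r / real (Suc n)) w"
  have E: "?E n \<in> sets M" for n by (rule tube_measurable[OF T w])
  have U: "open_tube T r w = (\<Union>n. ?E n)" by (rule open_tube_eq_Union[OF T w r])
  show "open_tube T r w \<in> sets M" unfolding U using E by auto
  have inc: "incseq ?E"
  proof (rule incseq_SucI)
    fix n
    have "r / real (Suc (Suc n)) \<le> r / real (Suc n)" using r by (intro divide_left_mono) auto
    then show "?E n \<subseteq> ?E (Suc n)" by (force simp: tube_def)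
  qed
  have "(\<lambda>n. measure M (D \<inter> ?E n)) \<longlonglongrightarrow> measure M (\<Union>n. D \<inter> ?E n)"
    using E DM inc by (intro finite_Lim_measure_incseq) (auto simp: incseq_def)
  then have 1: "(\<lambda>n. measure M (D \<inter> ?E n)) \<longlonglongrightarrow> measure M (D \<inter> open_tube T r w)"
    unfolding U by (simp only: Int_UN_distrib)
  have "measure M (D \<inter> ?E n) = measure M D * measure M (?E n)" for n
    using tube_indep_initial[OF T w D, of "r - r / real (Suc n)"]
    by (simp add: tube_prob_def emeasure_eq_measure flip: ennreal_mult)
  moreover have "(\<lambda>n. measure M (?E n)) \<longlonglongrightarrow> measure M (open_tube T r w)"
    unfolding U using E inc by (intro finite_Lim_measure_incseq) auto
  then have "(\<lambda>n. measure M D * measure M (?E n)) \<longlonglongrightarrow> measure M D * measure M (open_tube T r w)"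
    by (intro tendsto_intros)
  ultimately show "measure M (D \<inter> open_tube T r w) = measure M D * measure M (open_tube T r w)"
    using LIMSEQ_unique[OF 1] by simp
qed

lemma tube_prob_eq_measure: "tube_prob T r w = ennreal (measure M (tube T r w))"
  by (simp add: tube_prob_def emeasure_eq_measure)

lemma measure_tube_zero: "T > 0 \<Longrightarrow> r > 0 \<Longrightarrow> measure M (tube T r (\<lambda>_. 0)) = survival_real (T / r\<^sup>2) 0"
  using tube_prob_scale[of T r] by (simp add: survival_real_def survival_def tube_prob_eq_measure)

text \<open>
  The path \<open>w\<close> enters through the limit \<open>Q\<close> of its dyadic energies, which is also an upper bound for
  them. The lower bound of the tube probability is exact; the upper bound holds with the energy of
  each polygon in place of \<open>Q\<close>. Finally the closed tubes are replaced by open ones.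
\<close>

theorem open_tube_asymptotics:
  assumes T: "T > 0"
  obtains \<kappa> a where "\<kappa> > 0" "a > 0"
    "\<And>w Q. continuous_on {0..T} w \<Longrightarrow> w 0 = 0 \<Longrightarrow> (\<And>N. action (increments w 0 (dyadic_steps T N)) \<le> Q) \<Longrightarrow>
       (\<lambda>N. action (increments w 0 (dyadic_steps T N))) \<longlonglongrightarrow> Q \<Longrightarrow>
       ((\<lambda>r. exp (\<kappa> / r\<^sup>2) * measure M (open_tube T r w)) \<longlongrightarrow> a * exp (- Q / 2)) (at_right 0)"
proof -
  obtain \<mu> a where \<mu>: "\<mu> > 0" and a: "a > 0" and lim: "((\<lambda>t. exp (\<mu> * t) * survival_real t 0) \<longlongrightarrow> a) at_top"
    by (rule survival_asymptotics)
  define \<kappa> where "\<kappa> = \<mu> * T"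
  have \<kappa>: "\<kappa> > 0" using \<mu> T by (simp add: \<kappa>_def)
  let ?c = "\<lambda>r. exp (\<kappa> / r\<^sup>2) * measure M (tube T r (\<lambda>_. 0))"
  have c: "(?c \<longlongrightarrow> a) (at_right 0)"
  proof (rule Lim_transform_eventually)
    have "filterlim (\<lambda>r. T / r\<^sup>2) at_top (at_right 0)" using T by real_asymp
    then show "((\<lambda>r. exp (\<mu> * (T / r\<^sup>2)) * survival_real (T / r\<^sup>2) 0) \<longlongrightarrow> a) (at_right 0)"
      by (rule filterlim_compose[OF lim])
    show "\<forall>\<^sub>F r in at_right 0. exp (\<mu> * (T / r\<^sup>2)) * survival_real (T / r\<^sup>2) 0 = ?c r"
      using eventually_at_right_less[of "0::real"]
      by eventually_elim (simp add: measure_tube_zero[OF T] \<kappa>_def)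
  qed
  show thesis
  proof (rule that[OF \<kappa> a])
    fix w :: "real \<Rightarrow> real^'n" and Q
    assume w: "continuous_on {0..T} w" "w 0 = 0"
      and Q: "\<And>N. action (increments w 0 (dyadic_steps T N)) \<le> Q"
      and Qlim: "(\<lambda>N. action (increments w 0 (dyadic_steps T N))) \<longlonglongrightarrow> Q"
    let ?f = "\<lambda>r. exp (\<kappa> / r\<^sup>2) * measure M (tube T r w)"
    have lower: "exp (- Q / 2) * ?c r \<le> ?f r" for r
    proof -
      have "exp (- Q / 2) * measure M (tube T r (\<lambda>_. 0)) \<le> measure M (tube T r w)"
        using tube_prob_lower[OF T w Q, of r] by (simp add: tube_prob_eq_measure flip: ennreal_mult)
      then have "exp (\<kappa> / r\<^sup>2) * (exp (- Q / 2) * measure M (tube T r (\<lambda>_. 0))) \<le> ?f r"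
        by (intro mult_left_mono) auto
      then show ?thesis by (simp add: mult.left_commute)
    qed
    have f: "(?f \<longlongrightarrow> a * exp (- Q / 2)) (at_right 0)"
    proof (rule order_tendstoI)
      fix y assume y: "y < a * exp (- Q / 2)"
      have "((\<lambda>r. exp (- Q / 2) * ?c r) \<longlongrightarrow> exp (- Q / 2) * a) (at_right 0)"
        by (intro tendsto_intros c)
      then have "\<forall>\<^sub>F r in at_right 0. y < exp (- Q / 2) * ?c r"
        using y by (intro order_tendstoD(1)) (simp only: mult.commute)
      then show "\<forall>\<^sub>F r in at_right 0. y < ?f r"
        by eventually_elim (rule less_le_trans[OF _ lower])
    next
      fix y assume y: "a * exp (- Q / 2) < y"
      have "(\<lambda>J. a * exp (- action (increments w 0 (dyadic_steps T J)) / 2)) \<longlonglongrightarrow> a * exp (- Q / 2)"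
        by (intro tendsto_intros Qlim) auto
      then have "\<forall>\<^sub>F J in sequentially. a * exp (- action (increments w 0 (dyadic_steps T J)) / 2) < y"
        using y by (rule order_tendstoD)
      then obtain J where J: "a * exp (- action (increments w 0 (dyadic_steps T J)) / 2) < y"
        using eventually_happens'[OF sequentially_bot] by blast
      let ?A = "action (increments w 0 (dyadic_steps T J))"
      obtain K where K: "\<And>r. r \<ge> 0 \<Longrightarrow> tube_prob T r w \<le> ennreal (exp (r * K - ?A / 2)) * tube_prob T r (\<lambda>_. 0)"
        using tube_prob_upper[OF T w] by blast
      have "((\<lambda>r. exp (r * K - ?A / 2) * ?c r) \<longlongrightarrow> exp (0 * K - ?A / 2) * a) (at_right 0)"
        by (intro tendsto_intros c)
      then have "\<forall>\<^sub>F r in at_right 0. exp (r * K - ?A / 2) * ?c r < y"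
        using J by (intro order_tendstoD(2)) (simp_all only: mult_zero_left diff_0 minus_divide_left mult.commute[of a])
      then show "\<forall>\<^sub>F r in at_right 0. ?f r < y"
        using eventually_at_right_less[of "0::real"]
      proof eventually_elim
        case (elim r)
        have "measure M (tube T r w) \<le> exp (r * K - ?A / 2) * measure M (tube T r (\<lambda>_. 0))"
          using K[of r] elim(2) by (simp add: tube_prob_eq_measure flip: ennreal_mult)
        then have "?f r \<le> exp (\<kappa> / r\<^sup>2) * (exp (r * K - ?A / 2) * measure M (tube T r (\<lambda>_. 0)))"
          by (intro mult_left_mono) auto
        also have "\<dots> = exp (r * K - ?A / 2) * ?c r" by (simp only: mult.left_commute)
        also have "\<dots> < y" by (rule elim(1))
        finally show ?case .
      qed
    qed
    let ?q = "\<lambda>r. exp (\<kappa> / r\<^sup>2) * measure M (open_tube T r w)"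
    show "(?q \<longlongrightarrow> a * exp (- Q / 2)) (at_right 0)"
    proof (rule order_tendstoI)
      fix y assume "a * exp (- Q / 2) < y"
      then have "\<forall>\<^sub>F r in at_right 0. ?f r < y" by (intro order_tendstoD[OF f])
      then show "\<forall>\<^sub>F r in at_right 0. ?q r < y"
        using eventually_at_right_less[of "0::real"]
      proof eventually_elim
        case (elim r)
        have "open_tube T r w \<subseteq> tube T r w"
        proof (unfold open_tube_eq_Union[OF T w(1) elim(2)], intro UN_least subsetI)
          fix n \<omega> assume "\<omega> \<in> tube T (r - r / real (Suc n)) w"
          moreover have "r - r / real (Suc n) \<le> r" using elim(2) by simp
          ultimately show "\<omega> \<in> tube T r w" unfolding tube_def by (blast intro: order_trans)
        qed
        then have "measure M (open_tube T r w) \<le> measure M (tube T r w)"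
          by (intro finite_measure_mono tube_measurable T w)
        then have "?q r \<le> ?f r" by (intro mult_left_mono) auto
        also have "\<dots> < y" by (rule elim(1))
        finally show ?case .
      qed
    next
      fix y assume y: "y < a * exp (- Q / 2)"
      define y' where "y' = max ((y + a * exp (- Q / 2)) / 2) 0"
      have y': "y < y'" "y' < a * exp (- Q / 2)" "y' \<ge> 0"
      proof -
        define A where "A = a * exp (- Q / 2)"
        have A: "0 < A" "y < A" using a y by (auto simp: A_def)
        then have "y < (y + A) / 2" "(y + A) / 2 < A" by simp_all
        then show "y < y'" "y' < a * exp (- Q / 2)" "y' \<ge> 0"
          using A(1) by (auto simp only: y'_def A_def[symmetric] less_max_iff_disj max_less_iff_conj max.cobounded2)
      qed
      have "\<forall>\<^sub>F r in at_right 0. y' < ?f r" by (rule order_tendstoD(1)[OF f y'(2)])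
      then obtain d where d: "d > 0" "\<And>r. 0 < r \<Longrightarrow> r < d \<Longrightarrow> y' < ?f r"
        by (auto simp: eventually_at_right_field)
      \<comment> \<open>the bound y' for closed tubes holds for all radii s below r, and s can tend to r while r is fixed\<close>
      have "y' \<le> ?q r" if r: "0 < r" "r < d" for r
      proof -
        have "exp (\<kappa> / r\<^sup>2 - \<kappa> / s\<^sup>2) * y' \<le> ?q r" if s: "0 < s" "s < r" for s
        proof -
          have "tube T s w \<subseteq> open_tube T r w"
          proof
            fix \<omega> assume o: "\<omega> \<in> tube T s w"
            then have "(SUP t\<in>{0..T}. norm (w t - W t \<omega>)) \<le> s"
              using T by (intro cSUP_least) (auto simp: tube_def norm_minus_commute)
            then show "\<omega> \<in> open_tube T r w" using o s by (simp add: open_tube_def tube_def)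
          qed
          then have m: "measure M (tube T s w) \<le> measure M (open_tube T r w)"
            by (intro finite_measure_mono open_tube_indep_initial(1)[OF T w(1) r(1) space_in_F0])
          have "exp (\<kappa> / r\<^sup>2 - \<kappa> / s\<^sup>2) * y' \<le> exp (\<kappa> / r\<^sup>2 - \<kappa> / s\<^sup>2) * ?f s"
            using d(2)[of s] s r by (intro mult_left_mono) auto
          also have "\<dots> = exp (\<kappa> / r\<^sup>2) * measure M (tube T s w)"
            by (simp add: exp_diff)
          also have "\<dots> \<le> ?q r" using m by (intro mult_left_mono) auto
          finally show ?thesis .
        qed
        then have "\<forall>\<^sub>F s in at_left r. exp (\<kappa> / r\<^sup>2 - \<kappa> / s\<^sup>2) * y' \<le> ?q r"
          using r(1) by (auto simp: eventually_at_left_field intro!: exI[of _ 0])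
        moreover have "((\<lambda>s. exp (\<kappa> / r\<^sup>2 - \<kappa> / s\<^sup>2) * y') \<longlongrightarrow> exp (\<kappa> / r\<^sup>2 - \<kappa> / r\<^sup>2) * y') (at_left r)"
          using r(1) by (intro tendsto_intros) auto
        ultimately show ?thesis
          using tendsto_upperbound[of "\<lambda>s. exp (\<kappa> / r\<^sup>2 - \<kappa> / s\<^sup>2) * y'" _ "at_left r" "?q r"] by simp
      qed
      then show "\<forall>\<^sub>F r in at_right 0. y < ?q r"
        using d(1) y'(1) by (auto simp: eventually_at_right_field intro!: exI[of _ d] less_le_trans[OF y'(1)])
    qed
  qed
qed

end

section \<open>Weak derivatives\<close>

text \<open>
  A class of functions that is closed under differentiation consists of smooth functions.
\<close>

lemma smooth_coinduct:
  fixes C :: "(real \<Rightarrow> real) set"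
  assumes "f \<in> C" and C: "\<And>f. f \<in> C \<Longrightarrow> \<exists>f'\<in>C. \<forall>x. (f has_real_derivative f' x) (at x)"
  shows "(deriv ^^ k) f differentiable_on UNIV"
proof -
  have "(deriv ^^ k) f \<in> C"
  proof (induction k)
    case (Suc k)
    then obtain f' where f': "f' \<in> C" "\<forall>x. ((deriv ^^ k) f has_real_derivative f' x) (at x)" using C by blast
    then have "deriv ((deriv ^^ k) f) = f'" by (auto intro: DERIV_imp_deriv)
    then show ?case using f' by simp
  qed (use assms in simp)
  then obtain f' where "\<forall>x. ((deriv ^^ k) f has_real_derivative f' x) (at x)" using C by blast
  then show ?thesis
    by (auto simp: differentiable_on_def real_differentiable_def intro: has_field_derivative_at_within)
qed

text \<open>
  The derivatives of the bump \<open>exp (- 1 / (1 - x\<^sup>2))\<close> are again of this form, with a polynomial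
  \<open>p\<close> and a power \<open>k\<close>.
\<close>

definition bump_family :: "real poly \<Rightarrow> nat \<Rightarrow> real \<Rightarrow> real" where
  "bump_family p k x = (if \<bar>x\<bar> < 1 then poly p x * inverse (1 - x\<^sup>2) ^ k * exp (- inverse (1 - x\<^sup>2)) else 0)"

lemma power_le_fact_exp:
  fixes y :: real
  assumes "y \<ge> 0"
  shows "y ^ n \<le> fact n * exp y"
proof -
  have "(\<Sum>i\<in>{n}. inverse (fact i) * y ^ i) \<le> (\<Sum>i. inverse (fact i) * y ^ i)"
    by (rule sum_le_suminf[OF summable_exp]) (use assms in auto)
  then have "inverse (fact n) * y ^ n \<le> exp y" by (simp add: exp_def)
  then show ?thesis by (simp add: field_simps)
qed

text \<open>
  The exponential beats every power of \<open>1 / (1 - x\<^sup>2)\<close>. The quadratic bound makes all these functions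
  differentiable with derivative \<open>0\<close> at \<open>1\<close> and \<open>- 1\<close>.
\<close>

lemma bump_family_boundary:
  assumes x: "\<bar>x\<bar> = 1"
  obtains B where "\<And>z. \<bar>bump_family p k z\<bar> \<le> B * \<bar>z - x\<bar>\<^sup>2"
proof -
  have "bounded (poly p ` {-1..1})"
    by (intro compact_imp_bounded compact_continuous_image continuous_intros) auto
  then obtain C where "\<forall>z\<in>{-1..1}. \<bar>poly p z\<bar> \<le> C" by (auto simp: bounded_iff)
  then have C: "\<And>z. z \<in> {-1..1} \<Longrightarrow> \<bar>poly p z\<bar> \<le> C" by blast
  have C0: "C \<ge> 0" using C[of 0] by simp
  show thesis
  proof (rule that[of "C * fact (k + 2) * 4"])
    fix z
    show "\<bar>bump_family p k z\<bar> \<le> C * fact (k + 2) * 4 * \<bar>z - x\<bar>\<^sup>2"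
    proof (cases "\<bar>z\<bar> < 1")
      case True
      define u where "u = 1 - z\<^sup>2"
      have u: "u > 0" using True by (simp add: u_def abs_square_less_1)
      have "inverse u ^ (k + 2) \<le> fact (k + 2) * exp (inverse u)"
        using u by (intro power_le_fact_exp) auto
      then have "inverse u ^ (k + 2) * exp (- inverse u) \<le> fact (k + 2) * exp (inverse u) * exp (- inverse u)"
        by (intro mult_right_mono) auto
      also have "\<dots> = fact (k + 2)" by (simp only: mult.assoc exp_minus_inverse mult_1_right)
      finally have "inverse u ^ k * (inverse u)\<^sup>2 * exp (- inverse u) \<le> fact (k + 2)"
        by (simp only: power_add)
      then have "(inverse u ^ k * exp (- inverse u)) * (inverse u)\<^sup>2 * u\<^sup>2 \<le> fact (k + 2) * u\<^sup>2"
        by (intro mult_right_mono) (auto simp: ac_simps)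
      moreover have "(inverse u)\<^sup>2 * u\<^sup>2 = 1" using u by (simp flip: power_mult_distrib)
      ultimately have 1: "inverse u ^ k * exp (- inverse u) \<le> fact (k + 2) * u\<^sup>2"
        by (simp add: mult.assoc)
      have "u = (1 - \<bar>z\<bar>) * (1 + \<bar>z\<bar>)" by (simp add: u_def algebra_simps power2_eq_square)
      also have "\<dots> \<le> (1 - \<bar>z\<bar>) * 2" using True by (intro mult_left_mono) auto
      also have "\<dots> \<le> \<bar>z - x\<bar> * 2" using x by (intro mult_right_mono) auto
      finally have "u\<^sup>2 \<le> (\<bar>z - x\<bar> * 2)\<^sup>2" using u by (intro power_mono) auto
      then have 2: "u\<^sup>2 \<le> 4 * \<bar>z - x\<bar>\<^sup>2" by (simp add: power_mult_distrib)
      have "\<bar>bump_family p k z\<bar> = \<bar>poly p z\<bar> * (inverse u ^ k * exp (- inverse u))"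
        using True u by (simp add: bump_family_def u_def[symmetric] abs_mult)
      also have "\<dots> \<le> C * (fact (k + 2) * (4 * \<bar>z - x\<bar>\<^sup>2))"
      proof (rule mult_mono)
        show "\<bar>poly p z\<bar> \<le> C" by (rule C) (use True in auto)
        show "inverse u ^ k * exp (- inverse u) \<le> fact (k + 2) * (4 * \<bar>z - x\<bar>\<^sup>2)"
          by (rule order_trans[OF 1]) (intro mult_left_mono 2 fact_ge_zero)
        show "0 \<le> inverse u ^ k * exp (- inverse u)" using u by simp
      qed (rule C0)
      finally show ?thesis by (simp add: mult.assoc)
    qed (use C0 in \<open>simp add: bump_family_def\<close>)
  qed
qed

text \<open>
  The numerator of the derivative over the denominator \<open>(1 - x\<^sup>2)^(k + 2)\<close>.
\<close>

definition bump_deriv_poly :: "real poly \<Rightarrow> nat \<Rightarrow> real poly" where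
  "bump_deriv_poly p k = pderiv p * [:1, 0, -1:]\<^sup>2 + smult (2 * real k) ([:0, 1:] * p * [:1, 0, -1:]) - smult 2 ([:0, 1:] * p)"

lemma bump_family_has_derivative:
  "(bump_family p k has_real_derivative bump_family (bump_deriv_poly p k) (k + 2) x) (at x)"
proof -
  consider "\<bar>x\<bar> < 1" | "\<bar>x\<bar> = 1" | "\<bar>x\<bar> > 1" by linarith
  then show ?thesis
  proof cases
    case 1
    then have u: "1 - x\<^sup>2 > 0" by (simp add: abs_square_less_1)
    let ?y = "\<lambda>x::real. inverse (1 - x\<^sup>2)"
    have y: "(?y has_real_derivative 2 * x * (?y x)\<^sup>2) (at x)"
      using u by (auto intro!: derivative_eq_intros simp: power2_eq_square field_simps)
    have yk: "((\<lambda>x. ?y x ^ k) has_real_derivative 2 * real k * x * ?y x ^ (k + 1)) (at x)"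
    proof (cases k)
      case (Suc j)
      show ?thesis unfolding Suc
        by (rule DERIV_cong[OF DERIV_power[OF y]]) (simp add: power2_eq_square ac_simps)
    qed simp
    have e: "((\<lambda>x. exp (- ?y x)) has_real_derivative - (2 * x * (?y x)\<^sup>2) * exp (- ?y x)) (at x)"
      by (rule DERIV_cong[OF DERIV_chain2[OF DERIV_exp DERIV_minus[OF y]]]) simp
    have *: "((\<lambda>x. poly p x * ?y x ^ k * exp (- ?y x)) has_real_derivative
        (poly (pderiv p) x * ?y x ^ k + 2 * real k * x * ?y x ^ (k + 1) * poly p x) * exp (- ?y x)
         + - (2 * x * (?y x)\<^sup>2) * exp (- ?y x) * (poly p x * ?y x ^ k)) (at x)"
      by (rule DERIV_mult[OF DERIV_mult[OF poly_DERIV yk] e])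
    have "(poly (pderiv p) x * ?y x ^ k + 2 * real k * x * ?y x ^ (k + 1) * poly p x) * exp (- ?y x)
         + - (2 * x * (?y x)\<^sup>2) * exp (- ?y x) * (poly p x * ?y x ^ k)
       = bump_family (bump_deriv_poly p k) (k + 2) x"
    proof -
      define Y where "Y = ?y x"
      have Y: "(1 - x\<^sup>2) * Y = 1" using u by (simp add: Y_def)
      have Y1: "(1 - x\<^sup>2) * Y ^ (k + 2) = Y ^ (k + 1)"
      proof -
        have "(1 - x\<^sup>2) * Y ^ (k + 2) = ((1 - x\<^sup>2) * Y) * Y ^ (k + 1)" by simp
        then show ?thesis by (simp only: Y mult_1)
      qed
      have Y2: "(1 - x\<^sup>2)\<^sup>2 * Y ^ (k + 2) = Y ^ k"
      proof -
        have "(1 - x\<^sup>2)\<^sup>2 * Y ^ (k + 2) = ((1 - x\<^sup>2) * Y)\<^sup>2 * Y ^ k" by (simp add: power_mult_distrib power_add power2_eq_square)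
        then show ?thesis by (simp only: Y power_one mult_1)
      qed
      have "poly (bump_deriv_poly p k) x = poly (pderiv p) x * (1 - x\<^sup>2)\<^sup>2 + 2 * real k * x * poly p x * (1 - x\<^sup>2) - 2 * x * poly p x"
        by (simp add: bump_deriv_poly_def power2_eq_square algebra_simps)
      then have "poly (bump_deriv_poly p k) x * Y ^ (k + 2)
        = poly (pderiv p) x * ((1 - x\<^sup>2)\<^sup>2 * Y ^ (k + 2)) + 2 * real k * x * poly p x * ((1 - x\<^sup>2) * Y ^ (k + 2)) - 2 * x * poly p x * Y ^ (k + 2)"
        by (simp only: left_diff_distrib distrib_right mult.assoc)
      then have E: "poly (bump_deriv_poly p k) x * Y ^ (k + 2)
        = poly (pderiv p) x * Y ^ k + 2 * real k * x * poly p x * Y ^ (k + 1) - 2 * x * poly p x * Y ^ (k + 2)"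
        by (simp only: Y1 Y2)
      have F: "bump_family (bump_deriv_poly p k) (k + 2) x = poly (bump_deriv_poly p k) x * Y ^ (k + 2) * exp (- Y)"
        unfolding bump_family_def Y_def[symmetric] using 1 by simp
      show ?thesis unfolding Y_def[symmetric] F E by (simp add: algebra_simps power2_eq_square)
    qed
    with * have "((\<lambda>x. poly p x * ?y x ^ k * exp (- ?y x)) has_real_derivative bump_family (bump_deriv_poly p k) (k + 2) x) (at x)"
      by simp
    then show ?thesis
      by (rule has_field_derivative_transform_within_open[of _ _ _ "{-1<..<1}"]) (use 1 in \<open>auto simp: bump_family_def\<close>)
  next
    case 2
    obtain B where B: "\<And>z. \<bar>bump_family p k z\<bar> \<le> B * \<bar>z - x\<bar>\<^sup>2" using bump_family_boundary[OF 2] by blast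
    have 0: "bump_family p k x = 0" "bump_family (bump_deriv_poly p k) (k + 2) x = 0" using 2 by (auto simp: bump_family_def)
    have "((\<lambda>h. (bump_family p k (x + h) - bump_family p k x) / h) \<longlongrightarrow> 0) (at 0)"
    proof (rule Lim_null_comparison)
      show "\<forall>\<^sub>F h in at 0. norm ((bump_family p k (x + h) - bump_family p k x) / h) \<le> B * \<bar>h\<bar>"
        using eventually_neq_at_within[of 0 0 UNIV]
      proof eventually_elim
        case (elim h)
        then show ?case using B[of "x + h"] by (simp add: 0 divide_le_eq power2_eq_square abs_mult mult.assoc)
      qed
      show "((\<lambda>h. B * \<bar>h\<bar>) \<longlongrightarrow> 0) (at 0)" by (auto intro!: tendsto_eq_intros)
    qed
    then show ?thesis unfolding 0 DERIV_def by simp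
  next
    case 3
    have "((\<lambda>_. 0) has_real_derivative 0) (at x)" by simp
    then have "(bump_family p k has_real_derivative 0) (at x)"
      by (rule has_field_derivative_transform_within_open[of _ _ _ "{z. 1 < \<bar>z\<bar>}"])
         (use 3 in \<open>auto simp: bump_family_def intro!: open_Collect_less continuous_intros\<close>)
    then show ?thesis using 3 by (simp add: bump_family_def)
  qed
qed

definition bump :: "real \<Rightarrow> real" where "bump = bump_family 1 0"

lemma bump_nonneg [simp]: "bump x \<ge> 0"
  by (simp add: bump_def bump_family_def)

lemma bump_eq_0: "\<bar>x\<bar> \<ge> 1 \<Longrightarrow> bump x = 0"
  by (simp add: bump_def bump_family_def)

lemma bump_continuous: "continuous_on A bump"
  unfolding bump_def by (intro continuous_at_imp_continuous_on ballI DERIV_isCont[OF bump_family_has_derivative])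

definition bump_mass :: real where "bump_mass = integral {-2..2} bump"

lemma bump_integrable: "bump integrable_on {a..b}"
  by (intro integrable_continuous_real bump_continuous)

lemma bump_mass_pos: "bump_mass > 0"
proof -
  have "exp (- (4/3)) = integral {-(1/2)..1/2::real} (\<lambda>x. exp (- (4/3)))" by simp
  also have "\<dots> \<le> integral {-(1/2)..1/2} bump"
  proof (intro integral_le bump_integrable)
    fix x :: real assume x: "x \<in> {-(1/2)..1/2}"
    then have "\<bar>x\<bar> \<le> 1/2" by auto
    then have "\<bar>x\<bar>\<^sup>2 \<le> (1/2)\<^sup>2" by (intro power_mono) auto
    then have "x\<^sup>2 \<le> 1/4" by (simp add: power2_eq_square)
    then have "inverse (1 - x\<^sup>2) \<le> inverse (3/4)" by (intro le_imp_inverse_le) auto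
    then show "exp (- (4/3)) \<le> bump x" using \<open>\<bar>x\<bar> \<le> 1/2\<close> by (simp add: bump_def bump_family_def)
  qed (simp add: integrable_const_ivl)
  also have "\<dots> \<le> bump_mass" unfolding bump_mass_def
    by (intro integral_subset_le bump_integrable) auto
  finally show ?thesis using exp_gt_zero[of "- (4/3)::real"] by linarith
qed

definition smooth_step :: "real \<Rightarrow> real" where
  "smooth_step x = integral {-2..x} bump / bump_mass"

lemma smooth_step_0: "x \<le> -1 \<Longrightarrow> smooth_step x = 0"
proof -
  assume x: "x \<le> -1"
  have "integral {-2..x} bump = integral {-2..x} (\<lambda>_. 0)"
    by (rule integral_cong) (use x in \<open>auto intro!: bump_eq_0\<close>)
  then show ?thesis by (simp add: smooth_step_def)
qed

lemma smooth_step_1: "x \<ge> 1 \<Longrightarrow> smooth_step x = 1"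
proof -
  have *: "integral {-2..x} bump = integral {-2..1} bump" if x: "x \<ge> 1" for x
  proof -
    have "integral {-2..1} bump + integral {1..x} bump = integral {-2..x} bump"
      by (rule Henstock_Kurzweil_Integration.integral_combine) (use x bump_integrable in auto)
    moreover have "integral {1..x} bump = integral {1..x} (\<lambda>_. 0)"
      by (rule integral_cong) (auto intro!: bump_eq_0)
    ultimately show ?thesis by simp
  qed
  assume "x \<ge> 1"
  then show ?thesis using *[of x] *[of 2] bump_mass_pos by (simp add: smooth_step_def bump_mass_def)
qed

lemma smooth_step_has_derivative: "(smooth_step has_real_derivative bump x / bump_mass) (at x)"
proof (cases "x > -2")
  case True
  have "((\<lambda>u. integral {-2..u} bump) has_real_derivative bump x) (at x within {-2..x+1})"
    using True by (intro integral_has_real_derivative bump_continuous) auto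
  then have "((\<lambda>u. integral {-2..u} bump) has_real_derivative bump x) (at x)"
    using True by (subst (asm) at_within_interior) auto
  then show ?thesis unfolding smooth_step_def by (rule DERIV_cdivide)
next
  case False
  have "((\<lambda>_. 0) has_real_derivative 0) (at x)" by simp
  then have "(smooth_step has_real_derivative 0) (at x)"
    by (rule has_field_derivative_transform_within_open[of _ _ _ "{..<-1}"])
       (use False in \<open>auto simp: smooth_step_0\<close>)
  then show ?thesis using False by (simp add: bump_eq_0)
qed

lemma smooth_step_bounds: "0 \<le> smooth_step x" "smooth_step x \<le> 1"
proof -
  show "0 \<le> smooth_step x"
    unfolding smooth_step_def using bump_mass_pos by (intro divide_nonneg_pos integral_nonneg bump_integrable) auto
  show "smooth_step x \<le> 1"
  proof (cases "x \<ge> 1")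
    case False
    then have "integral {-2..x} bump \<le> bump_mass"
      unfolding bump_mass_def by (intro integral_subset_le bump_integrable) auto
    then show ?thesis using bump_mass_pos by (simp add: smooth_step_def)
  qed (simp add: smooth_step_1)
qed

definition mollifier :: "real \<Rightarrow> real \<Rightarrow> real \<Rightarrow> real" where
  "mollifier \<kappa> s t = bump ((t - s) / \<kappa>) / (bump_mass * \<kappa>)"

text \<open>
  A smooth approximation of the indicator of \<open>[s, r]\<close>; its derivative is a difference of two mollifiers
  at \<open>s\<close> and \<open>r\<close>.
\<close>

definition plateau :: "real \<Rightarrow> real \<Rightarrow> real \<Rightarrow> real \<Rightarrow> real" where
  "plateau \<kappa> s r t = smooth_step ((t - s) / \<kappa>) - smooth_step ((t - r) / \<kappa>)"

lemma mollifier_nonneg: "\<kappa> > 0 \<Longrightarrow> mollifier \<kappa> s t \<ge> 0"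
  using bump_mass_pos by (simp add: mollifier_def)

lemma mollifier_eq_0: "\<kappa> > 0 \<Longrightarrow> \<bar>t - s\<bar> \<ge> \<kappa> \<Longrightarrow> mollifier \<kappa> s t = 0"
  by (simp add: mollifier_def bump_eq_0 divide_simps)

lemma mollifier_continuous: "\<kappa> > 0 \<Longrightarrow> continuous_on A (mollifier \<kappa> s)"
  unfolding mollifier_def using bump_mass_pos
  by (intro continuous_intros continuous_on_compose2[OF bump_continuous[of UNIV]]) auto

lemma shifted_step_derivative:
  assumes "\<kappa> > 0"
  shows "((\<lambda>t. smooth_step ((t - s) / \<kappa>)) has_real_derivative mollifier \<kappa> s t) (at t)"
proof -
  have "((\<lambda>t. (t - s) / \<kappa>) has_real_derivative 1 / \<kappa>) (at t)"
    using assms by (auto intro!: derivative_eq_intros)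
  from DERIV_chain2[OF smooth_step_has_derivative this] show ?thesis
    by (simp add: mollifier_def field_simps)
qed

lemma plateau_derivative:
  "\<kappa> > 0 \<Longrightarrow> (plateau \<kappa> s r has_real_derivative mollifier \<kappa> s t - mollifier \<kappa> r t) (at t)"
  unfolding plateau_def by (intro DERIV_diff shifted_step_derivative)

lemma plateau_test_function:
  assumes \<kappa>: "\<kappa> > 0" "\<kappa> < s" "s \<le> r" "r + \<kappa> < tf"
  shows "plateau \<kappa> s r \<in> test_functions tf"
  unfolding test_functions_def
proof (intro CollectI conjI allI)
  define C where "C = {\<lambda>t. a * bump_family p k ((t - s) / \<kappa>) + b * bump_family q l ((t - r) / \<kappa>) |a b p q k l. True}"
  have der: "((\<lambda>t. bump_family p k ((t - s) / \<kappa>)) has_real_derivative (1 / \<kappa>) * bump_family (bump_deriv_poly p k) (k + 2) ((t - s) / \<kappa>)) (at t)" for p k s t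
  proof -
    have "((\<lambda>t. (t - s) / \<kappa>) has_real_derivative 1 / \<kappa>) (at t)"
      using assms by (auto intro!: derivative_eq_intros)
    from DERIV_chain2[OF bump_family_has_derivative this] show ?thesis by (simp add: mult.commute)
  qed
  fix k
  show "(deriv ^^ k) (plateau \<kappa> s r) differentiable_on UNIV"
  proof (rule smooth_coinduct[of _ "insert (plateau \<kappa> s r) C"])
    fix f assume "f \<in> insert (plateau \<kappa> s r) C"
    then consider "f = plateau \<kappa> s r" | "f \<in> C" by blast
    then show "\<exists>f'\<in>insert (plateau \<kappa> s r) C. \<forall>x. (f has_real_derivative f' x) (at x)"
    proof cases
      case 1
      have "(\<lambda>t. mollifier \<kappa> s t - mollifier \<kappa> r t) \<in> C"
        unfolding C_def mollifier_def bump_def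
        by (intro CollectI exI[of _ "1 / (bump_mass * \<kappa>)"] exI[of _ "- 1 / (bump_mass * \<kappa>)"] exI[of _ 1] exI[of _ 0]) (auto simp: fun_eq_iff)
      then show ?thesis using plateau_derivative[OF \<kappa>(1), of s r] 1
        by (intro bexI[of _ "\<lambda>t. mollifier \<kappa> s t - mollifier \<kappa> r t"]) auto
    next
      case 2
      then obtain a b p q k l where f: "f = (\<lambda>t. a * bump_family p k ((t - s) / \<kappa>) + b * bump_family q l ((t - r) / \<kappa>))"
        unfolding C_def by blast
      let ?f' = "\<lambda>t. (a * (1 / \<kappa>)) * bump_family (bump_deriv_poly p k) (k + 2) ((t - s) / \<kappa>) + (b * (1 / \<kappa>)) * bump_family (bump_deriv_poly q l) (l + 2) ((t - r) / \<kappa>)"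
      have "?f' \<in> C" unfolding C_def by blast
      moreover have "(f has_real_derivative ?f' t) (at t)" for t
        unfolding f mult.assoc by (intro DERIV_add DERIV_cmult der)
      ultimately show ?thesis by (intro bexI[of _ ?f']) auto
    qed
  qed simp
next
  show "\<exists>K. compact K \<and> K \<subseteq> {0<..<tf} \<and> (\<forall>t. t \<notin> K \<longrightarrow> plateau \<kappa> s r t = 0)"
  proof (intro exI[of _ "{s - \<kappa>..r + \<kappa>}"] conjI allI impI)
    fix t assume "t \<notin> {s - \<kappa>..r + \<kappa>}"
    then consider "t < s - \<kappa>" | "t > r + \<kappa>" by fastforce
    then show "plateau \<kappa> s r t = 0"
    proof cases
      case 1
      then have "(t - s) / \<kappa> \<le> -1" "(t - r) / \<kappa> \<le> -1" using \<kappa> by (simp_all add: divide_le_eq)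
      then show ?thesis by (simp add: plateau_def smooth_step_0)
    next
      case 2
      then have "(t - s) / \<kappa> \<ge> 1" "(t - r) / \<kappa> \<ge> 1" using \<kappa> by (simp_all add: le_divide_eq)
      then show ?thesis by (simp add: plateau_def smooth_step_1)
    qed
  qed (use \<kappa> in auto)
qed

lemma mollifier_has_integral:
  assumes "\<kappa> > 0" "\<kappa> < s" "s + \<kappa> < tf"
  shows "(mollifier \<kappa> s has_integral 1) {0..tf}"
proof -
  have "(mollifier \<kappa> s has_integral (smooth_step ((tf - s) / \<kappa>) - smooth_step ((0 - s) / \<kappa>))) {0..tf}"
    using assms shifted_step_derivative[OF assms(1)]
    by (intro fundamental_theorem_of_calculus)
       (auto simp: has_real_derivative_iff_has_vector_derivative[symmetric] intro: has_field_derivative_at_within)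
  moreover have "smooth_step ((tf - s) / \<kappa>) = 1" using assms by (intro smooth_step_1) (simp add: le_divide_eq)
  moreover have "smooth_step ((0 - s) / \<kappa>) = 0" using assms by (intro smooth_step_0) (simp add: divide_le_eq)
  ultimately show ?thesis by simp
qed

lemma mollifier_approximate_identity:
  fixes w :: "real \<Rightarrow> 'a::euclidean_space"
  assumes w: "continuous_on {0..tf} w" and s: "0 < s" "s < tf"
    and \<kappa>: "\<And>n. \<kappa> n > 0" "\<kappa> \<longlonglongrightarrow> 0"
  shows "(\<lambda>n. integral {0..tf} (\<lambda>t. mollifier (\<kappa> n) s t *\<^sub>R w t)) \<longlonglongrightarrow> w s"
proof (rule tendstoI)
  fix e :: real assume e: "e > 0"
  obtain d where d: "d > 0" "\<And>t. t \<in> {0..tf} \<Longrightarrow> dist t s < d \<Longrightarrow> dist (w t) (w s) < e/2"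
    using w s e unfolding continuous_on_iff by (metis atLeastAtMost_iff half_gt_zero less_imp_le)
  have "\<forall>\<^sub>F n in sequentially. \<kappa> n < min d (min s (tf - s))"
    using d(1) s by (intro order_tendstoD(2)[OF \<kappa>(2)]) auto
  then show "\<forall>\<^sub>F n in sequentially. dist (integral {0..tf} (\<lambda>t. mollifier (\<kappa> n) s t *\<^sub>R w t)) (w s) < e"
  proof eventually_elim
    case (elim n)
    let ?k = "mollifier (\<kappa> n) s"
    have k: "\<kappa> n > 0" "\<kappa> n < d" "\<kappa> n < s" "s + \<kappa> n < tf" using elim \<kappa>(1)[of n] by auto
    note one = mollifier_has_integral[OF k(1,3,4)]
    have int: "(\<lambda>t. ?k t *\<^sub>R w t) integrable_on {0..tf}"
      by (intro integrable_continuous_real continuous_intros w mollifier_continuous k)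
    have "((\<lambda>t. ?k t *\<^sub>R w s) has_integral 1 *\<^sub>R w s) {0..tf}"
      by (rule has_integral_scaleR_left[OF one])
    then have "integral {0..tf} (\<lambda>t. ?k t *\<^sub>R w t) - w s = integral {0..tf} (\<lambda>t. ?k t *\<^sub>R w t - ?k t *\<^sub>R w s)"
      using int by (subst Henstock_Kurzweil_Integration.integral_diff) (auto simp: has_integral_iff)
    also have "norm \<dots> \<le> integral {0..tf} (\<lambda>t. ?k t * (e/2))"
    proof (rule integral_norm_bound_integral)
      show "(\<lambda>t. ?k t *\<^sub>R w t - ?k t *\<^sub>R w s) integrable_on {0..tf}"
        by (intro integrable_continuous_real continuous_intros w mollifier_continuous k)
      show "(\<lambda>t. ?k t * (e/2)) integrable_on {0..tf}"
        by (intro integrable_continuous_real continuous_intros mollifier_continuous k)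
      fix t assume t: "t \<in> {0..tf}"
      show "norm (?k t *\<^sub>R w t - ?k t *\<^sub>R w s) \<le> ?k t * (e/2)"
      proof (cases "\<bar>t - s\<bar> < \<kappa> n")
        case True
        then have "norm (w t - w s) \<le> e/2" using d(2)[OF t] k by (auto simp: dist_norm less_imp_le)
        then have "?k t * norm (w t - w s) \<le> ?k t * (e/2)" using mollifier_nonneg[OF k(1)] by (intro mult_left_mono) auto
        then show ?thesis using mollifier_nonneg[OF k(1), of s t] by (simp flip: scaleR_diff_right)
      qed (use mollifier_eq_0[OF k(1)] in auto)
    qed
    also have "\<dots> = e/2" using has_integral_mult_left[OF one, of "e/2"] by (simp add: has_integral_iff)
    also have "\<dots> < e" using e by simp
    finally show ?case by (simp add: dist_norm)
  qed
qed

lemma plateau_bound: "\<kappa> > 0 \<Longrightarrow> \<bar>plateau \<kappa> s r t\<bar> \<le> 1"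
  unfolding plateau_def using smooth_step_bounds[of "(t - s) / \<kappa>"] smooth_step_bounds[of "(t - r) / \<kappa>"] by linarith

lemma plateau_limit:
  assumes "\<And>n. \<kappa> n > 0" "\<kappa> \<longlonglongrightarrow> 0" and sr: "s < r" and t: "t \<noteq> s" "t \<noteq> r"
  shows "(\<lambda>n. plateau (\<kappa> n) s r t) \<longlonglongrightarrow> indicator {s..r} t"
proof -
  have step: "\<forall>\<^sub>F n in sequentially. smooth_step ((t - a) / \<kappa> n) = (if t > a then 1 else 0)" if "t \<noteq> a" for a
  proof -
    have "\<forall>\<^sub>F n in sequentially. \<kappa> n < \<bar>t - a\<bar>" using that by (intro order_tendstoD(2)[OF assms(2)]) auto
    then show ?thesis
    proof eventually_elim
      case (elim n)
      show ?case
      proof (cases "t > a")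
        case True
        then have "(t - a) / \<kappa> n \<ge> 1" using elim assms(1)[of n] by (simp add: le_divide_eq)
        then show ?thesis using True by (simp add: smooth_step_1)
      next
        case False
        then have "(t - a) / \<kappa> n \<le> -1" using elim assms(1)[of n] that by (simp add: divide_le_eq)
        then show ?thesis using False by (simp add: smooth_step_0)
      qed
    qed
  qed
  have "\<forall>\<^sub>F n in sequentially. plateau (\<kappa> n) s r t = indicator {s..r} t"
    using step[OF t(1)] step[OF t(2)]
    by eventually_elim (use sr t in \<open>auto simp: plateau_def indicator_def\<close>)
  then show ?thesis by (rule tendsto_eventually)
qed

text \<open>
  Testing the weak derivative with \<open>plateau \<kappa> s r\<close> and letting \<open>\<kappa>\<close> tend to zero gives
  \<open>w r - w s = integral {s..r} v\<close> for interior points, because the derivative of the plateau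
  evaluates \<open>w\<close> at the end points while the plateau itself tends to the indicator.
\<close>

theorem weak_derivative_integral:
  fixes w v :: "real \<Rightarrow> 'a::euclidean_space"
  assumes T: "0 < T" and w: "continuous_on {0..T} w" and weak: "has_weak_derivative T w v" and t: "t \<in> {0..T}"
  shows "w t = w 0 + integral {0..t} v"
proof -
  have abs: "v absolutely_integrable_on {0..T}" using weak by (simp add: has_weak_derivative_def)
  then have int: "v integrable_on {0..T}" by (simp add: absolutely_integrable_on_def)
  have nint: "(\<lambda>t. norm (v t)) integrable_on {0..T}" using abs by (simp add: absolutely_integrable_on_def)
  have meas: "v \<in> borel_measurable (lebesgue_on {0..T})"
    using int by (intro integrable_imp_measurable)
  have sub: "v integrable_on {a..b}" if "0 \<le> a" "b \<le> T" for a b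
    using int that by (intro integrable_subinterval_real[OF int]) auto
  have inner: "w r - w s = integral {s..r} v" if sr: "0 < s" "s < r" "r < T" for s r
  proof -
    define m where "m = min s (T - r) / 2"
    define \<kappa> where "\<kappa> n = m / real (Suc n)" for n
    have m: "m > 0" using sr by (simp add: m_def)
    have \<kappa>: "\<kappa> n > 0" "\<kappa> n < s" "r + \<kappa> n < T" for n
    proof -
      show "\<kappa> n > 0" using m by (simp add: \<kappa>_def)
      have "\<kappa> n \<le> m" using m by (simp add: \<kappa>_def divide_le_eq)
      moreover have "m \<le> s / 2" "m \<le> (T - r) / 2" by (simp_all add: m_def)
      then have "m < s" "r + m < T" using sr by auto
      ultimately show "\<kappa> n < s" "r + \<kappa> n < T" by auto
    qed
    have \<kappa>0: "\<kappa> \<longlonglongrightarrow> 0" unfolding \<kappa>_def by (rule LIMSEQ_Suc) (rule lim_const_over_n)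
    have id: "integral {0..T} (\<lambda>t. mollifier (\<kappa> n) s t *\<^sub>R w t) - integral {0..T} (\<lambda>t. mollifier (\<kappa> n) r t *\<^sub>R w t)
       = - integral {0..T} (\<lambda>t. plateau (\<kappa> n) s r t *\<^sub>R v t)" for n
    proof -
      have "plateau (\<kappa> n) s r \<in> test_functions T" using \<kappa>[of n] sr by (intro plateau_test_function) auto
      then have "integral {0..T} (\<lambda>t. deriv (plateau (\<kappa> n) s r) t *\<^sub>R w t) = - integral {0..T} (\<lambda>t. plateau (\<kappa> n) s r t *\<^sub>R v t)"
        using weak by (simp add: has_weak_derivative_def)
      moreover have "deriv (plateau (\<kappa> n) s r) t = mollifier (\<kappa> n) s t - mollifier (\<kappa> n) r t" for t
        by (rule DERIV_imp_deriv[OF plateau_derivative[OF \<kappa>(1)]])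
      moreover have "integral {0..T} (\<lambda>t. (mollifier (\<kappa> n) s t - mollifier (\<kappa> n) r t) *\<^sub>R w t)
         = integral {0..T} (\<lambda>t. mollifier (\<kappa> n) s t *\<^sub>R w t) - integral {0..T} (\<lambda>t. mollifier (\<kappa> n) r t *\<^sub>R w t)"
        unfolding scaleR_diff_left
        by (intro Henstock_Kurzweil_Integration.integral_diff integrable_continuous_real continuous_intros w mollifier_continuous \<kappa>)
      ultimately show ?thesis by simp
    qed
    have "(\<lambda>n. integral {0..T} (\<lambda>t. mollifier (\<kappa> n) s t *\<^sub>R w t) - integral {0..T} (\<lambda>t. mollifier (\<kappa> n) r t *\<^sub>R w t)) \<longlonglongrightarrow> w s - w r"
      by (intro tendsto_diff mollifier_approximate_identity w \<kappa> \<kappa>0) (use sr in auto)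
    moreover have "(\<lambda>n. integral {0..T} (\<lambda>t. plateau (\<kappa> n) s r t *\<^sub>R v t)) \<longlonglongrightarrow> integral {s..r} v"
    proof -
      \<comment> \<open>at s and r themselves the plateaus do not converge to the indicator\<close>
      let ?v = "\<lambda>t. if t = s \<or> t = r then 0 else v t"
      let ?g = "\<lambda>t. indicator {s..r} t *\<^sub>R ?v t"
      have cont: "continuous_on {0..T} (plateau (\<kappa> n) s r)" for n
        by (intro continuous_at_imp_continuous_on ballI DERIV_isCont[OF plateau_derivative[OF \<kappa>(1)]])
      have vint: "?v absolutely_integrable_on {0..T}"
        by (rule absolutely_integrable_spike[OF abs, of "{s, r}"]) auto
      have "(\<lambda>n. integral {0..T} (\<lambda>t. plateau (\<kappa> n) s r t *\<^sub>R ?v t)) \<longlonglongrightarrow> integral {0..T} ?g"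
      proof (rule dominated_convergence(2))
        show "(\<lambda>t. plateau (\<kappa> n) s r t *\<^sub>R ?v t) integrable_on {0..T}" for n
        proof (rule measurable_bounded_by_integrable_imp_integrable)
          have "?v \<in> borel_measurable (lebesgue_on {0..T})"
            using vint by (intro integrable_imp_measurable) (simp add: absolutely_integrable_on_def)
          moreover have "plateau (\<kappa> n) s r \<in> borel_measurable (lebesgue_on {0..T})"
            by (intro continuous_imp_measurable_on_sets_lebesgue cont) simp
          ultimately show "(\<lambda>t. plateau (\<kappa> n) s r t *\<^sub>R ?v t) \<in> borel_measurable (lebesgue_on {0..T})"
            by (rule borel_measurable_scaleR[rotated])
          show "norm (plateau (\<kappa> n) s r t *\<^sub>R ?v t) \<le> norm (v t)" for t
            using plateau_bound[OF \<kappa>(1), of n s r t] by (auto intro: mult_left_le_one_le)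
        qed (use nint in auto)
        show "norm (plateau (\<kappa> n) s r t *\<^sub>R ?v t) \<le> norm (v t)" for n t
          using plateau_bound[OF \<kappa>(1), of n s r t] by (auto intro: mult_left_le_one_le)
        show "(\<lambda>n. plateau (\<kappa> n) s r t *\<^sub>R ?v t) \<longlonglongrightarrow> ?g t" for t
        proof (cases "t = s \<or> t = r")
          case False
          then show ?thesis by (intro tendsto_intros plateau_limit \<kappa> \<kappa>0 sr) auto
        qed auto
      qed (rule nint)
      moreover have "integral {0..T} (\<lambda>t. plateau (\<kappa> n) s r t *\<^sub>R ?v t) = integral {0..T} (\<lambda>t. plateau (\<kappa> n) s r t *\<^sub>R v t)" for n
        by (rule integral_spike[of "{s, r}"]) auto
      moreover have "integral {0..T} ?g = integral {s..r} v"
      proof -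
        have "integral {0..T} ?g = integral {0..T} (\<lambda>t. if t \<in> {s..r} then v t else 0)"
          by (rule integral_spike[of "{s, r}"]) (auto simp: indicator_def)
        also have "\<dots> = integral {s..r} v"
          using sr by (subst integral_restrict_Int) (simp add: Int_absorb2)
        finally show ?thesis .
      qed
      ultimately show ?thesis by simp
    qed
    then have "(\<lambda>n. - integral {0..T} (\<lambda>t. plateau (\<kappa> n) s r t *\<^sub>R v t)) \<longlonglongrightarrow> - integral {s..r} v"
      by (rule tendsto_minus)
    ultimately have "w s - w r = - integral {s..r} v" unfolding id by (rule LIMSEQ_unique)
    then show ?thesis by (simp add: algebra_simps)
  qed
  let ?\<Phi> = "\<lambda>t. w t - integral {0..t} v"
  have cont: "continuous_on {0..T} ?\<Phi>"
    by (intro continuous_intros w indefinite_integral_continuous_1 int)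
  have const: "?\<Phi> t = ?\<Phi> (T/2)" if t: "t \<in> {0<..<T}" for t
  proof -
    have *: "?\<Phi> r = ?\<Phi> s" if sr: "0 < s" "s < r" "r < T" for s r
    proof -
      have "integral {0..s} v + integral {s..r} v = integral {0..r} v"
        by (rule Henstock_Kurzweil_Integration.integral_combine) (use sr sub in auto)
      then show ?thesis using inner[OF sr] by (simp add: algebra_simps)
    qed
    show ?thesis using *[of t "T/2"] *[of "T/2" t] t T by (cases t "T/2" rule: linorder_cases) auto
  qed
  have cl: "closure {0<..<T} = {0..T}" using T by simp
  have "?\<Phi> t = ?\<Phi> (T/2)" if "t \<in> {0..T}" for t
    using continuous_constant_on_closure[of "{0<..<T}" ?\<Phi> "?\<Phi> (T/2)" t] cont const that unfolding cl by blast
  from this[OF t] this[of 0] T have "?\<Phi> t = ?\<Phi> 0" by simp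
  then show ?thesis by (simp add: algebra_simps)
qed

section \<open>The energy of a path as a limit over dyadic partitions\<close>

text \<open>
  The nearest-point retraction onto the ball of radius \<open>m\<close>.
\<close>

definition clip :: "real \<Rightarrow> 'a::real_normed_vector \<Rightarrow> 'a" where
  "clip m y = (m / max m (norm y)) *\<^sub>R y"

lemma clip_id: "m > 0 \<Longrightarrow> norm y \<le> m \<Longrightarrow> clip m y = y"
  by (simp add: clip_def max_absorb1)

lemma norm_clip:
  assumes "m > 0"
  shows "norm (clip m y) \<le> m" "norm (y - clip m y) \<le> norm y"
proof -
  show "norm (clip m y) \<le> m"
    using assms by (auto simp: clip_def max_def divide_le_eq)
  have q: "0 \<le> m / max m (norm y)" "m / max m (norm y) \<le> 1" using assms by (auto simp: max_def divide_le_eq)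
  have "y - clip m y = (1 - m / max m (norm y)) *\<^sub>R y" by (simp add: clip_def algebra_simps)
  then have "norm (y - clip m y) = (1 - m / max m (norm y)) * norm y" using q by simp
  also have "\<dots> \<le> 1 * norm y" using q by (intro mult_right_mono) auto
  finally show "norm (y - clip m y) \<le> norm y" by simp
qed

lemma clip_continuous:
  assumes "m > 0"
  shows "continuous_on A (clip m)"
proof -
  have "max m (norm y) \<noteq> 0" for y :: 'a using assms by (auto simp: max_def)
  then show ?thesis unfolding clip_def by (intro continuous_intros) auto
qed

text \<open>
  A measurable function is a limit almost everywhere of continuous functions. Clip it at a height
  that loses little of its norm, and clip the approximants at the same height; dominated convergence applies.
\<close>

lemma Lp_approx_continuous:
  fixes f :: "real \<Rightarrow> 'a::euclidean_space" and p :: nat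
  assumes meas: "f \<in> borel_measurable (lebesgue_on {0..T})"
    and int: "(\<lambda>t. norm (f t) ^ p) integrable_on {0..T}" and e: "e > 0" and p: "p > 0"
  obtains c where "continuous_on UNIV c" "(\<lambda>t. norm (f t - c t) ^ p) integrable_on {0..T}"
    "integral {0..T} (\<lambda>t. norm (f t - c t) ^ p) \<le> e"
proof -
  define L where "L = lebesgue_on {0..T}"
  have fin: "finite_measure L"
    unfolding L_def by (intro finite_measureI) (auto simp: emeasure_restrict_space emeasure_lborel_Icc_eq)
  interpret finite_measure L by (rule fin)
  have [measurable]: "f \<in> borel_measurable L" using meas by (simp add: L_def)
  have clip_meas [measurable]: "clip m \<in> borel_measurable borel" if "m > 0" for m :: real
    by (intro borel_measurable_continuous_onI clip_continuous that)
  have intL: "integrable L (\<lambda>t. norm (f t) ^ p)"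
  proof -
    have "(\<lambda>t. norm (f t) ^ p) absolutely_integrable_on {0..T}"
      by (intro nonnegative_absolutely_integrable_1 int) auto
    then show ?thesis unfolding L_def by (simp add: integrable_restrict_space set_integrable_def)
  qed
  \<comment> \<open>the factor 2 ^ p is lost when the p-th power of a sum of two norms is split\<close>
  have "\<exists>n. integral\<^sup>L L (\<lambda>t. norm (f t - clip (real (Suc n)) (f t)) ^ p) < e / (2 * 2 ^ p)"
  proof -
    have "(\<lambda>n. integral\<^sup>L L (\<lambda>t. norm (f t - clip (real (Suc n)) (f t)) ^ p)) \<longlonglongrightarrow> integral\<^sup>L L (\<lambda>t. 0)"
    proof (rule integral_dominated_convergence[where w="\<lambda>t. norm (f t) ^ p"])
      show "AE t in L. (\<lambda>n. norm (f t - clip (real (Suc n)) (f t)) ^ p) \<longlonglongrightarrow> 0"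
      proof (intro AE_I2 tendsto_eventually)
        fix t
        obtain N where N: "norm (f t) \<le> real N" using real_arch_simple by blast
        have "norm (f t - clip (real (Suc n)) (f t)) ^ p = 0" if "n \<ge> N" for n
          using clip_id[of "real (Suc n)" "f t"] N that p by (simp add: power_0_left)
        then show "\<forall>\<^sub>F n in sequentially. norm (f t - clip (real (Suc n)) (f t)) ^ p = 0"
          unfolding eventually_sequentially by blast
      qed
      show "AE t in L. norm (norm (f t - clip (real (Suc n)) (f t)) ^ p) \<le> norm (f t) ^ p" for n
        using norm_clip(2)[of "real (Suc n)"] by (intro AE_I2) (auto intro!: power_mono)
      show "(\<lambda>t. norm (f t - clip (real (Suc n)) (f t)) ^ p) \<in> borel_measurable L" for n
        using clip_meas[of "real (Suc n)"] by measurable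
    qed (use intL in auto)
    then have "\<forall>\<^sub>F n in sequentially. integral\<^sup>L L (\<lambda>t. norm (f t - clip (real (Suc n)) (f t)) ^ p) < e / (2 * 2 ^ p)"
      using e by (intro order_tendstoD(2)) auto
    then show ?thesis by (auto simp: eventually_sequentially)
  qed
  then obtain n where n: "integral\<^sup>L L (\<lambda>t. norm (f t - clip (real (Suc n)) (f t)) ^ p) < e / (2 * 2 ^ p)" ..
  define m where "m = real (Suc n)"
  have m: "m > 0" by (simp add: m_def)
  note [measurable] = clip_meas[OF m]
  have "(\<lambda>x. if x \<in> {0..T} then f x else 0) \<in> borel_measurable lebesgue"
    using meas by (subst borel_measurable_if) auto
  then have "(\<lambda>x. if x \<in> {0..T} then f x else 0) measurable_on UNIV"
    by (rule lebesgue_measurable_imp_measurable_on) simp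
  then obtain N g where N: "negligible N" and g: "\<And>n. continuous_on UNIV (g n)"
    "\<And>x. x \<notin> N \<Longrightarrow> (\<lambda>n. g n x) \<longlonglongrightarrow> (if x \<in> {0..T} then f x else 0)"
    unfolding measurable_on_def by auto
  have AEN: "AE t in L. t \<notin> N"
  proof -
    have "AE t in lebesgue. t \<notin> N" using N by (intro AE_not_in) (simp add: negligible_iff_null_sets)
    then show ?thesis unfolding L_def by (subst AE_restrict_space_iff) auto
  qed
  have g_meas [measurable]: "g k \<in> borel_measurable L" for k
    unfolding L_def by (intro continuous_imp_measurable_on_sets_lebesgue continuous_on_subset[OF g(1)]) auto
  have "\<exists>k. integral\<^sup>L L (\<lambda>t. norm (clip m (f t) - clip m (g k t)) ^ p) < e / (2 * 2 ^ p)"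
  proof -
    have "(\<lambda>k. integral\<^sup>L L (\<lambda>t. norm (clip m (f t) - clip m (g k t)) ^ p)) \<longlonglongrightarrow> integral\<^sup>L L (\<lambda>t. 0)"
    proof (rule integral_dominated_convergence[where w="\<lambda>t. (2 * m) ^ p"])
      show "AE t in L. (\<lambda>k. norm (clip m (f t) - clip m (g k t)) ^ p) \<longlonglongrightarrow> 0"
        using AEN AE_space
      proof eventually_elim
        case (elim t)
        have "(\<lambda>k. g k t) \<longlonglongrightarrow> f t" using g(2)[OF elim(1)] elim(2) by (simp add: L_def)
        then have "(\<lambda>k. clip m (g k t)) \<longlonglongrightarrow> clip m (f t)"
          by (rule continuous_on_tendsto_compose[OF clip_continuous[OF m, of UNIV]]) auto
        then have "(\<lambda>k. norm (clip m (f t) - clip m (g k t)) ^ p) \<longlonglongrightarrow> norm (clip m (f t) - clip m (f t)) ^ p"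
          by (intro tendsto_intros)
        then show ?case using p by (simp add: power_0_left)
      qed
      show "AE t in L. norm (norm (clip m (f t) - clip m (g k t)) ^ p) \<le> (2 * m) ^ p" for k
      proof (intro AE_I2)
        fix t
        have "norm (clip m (f t) - clip m (g k t)) \<le> norm (clip m (f t)) + norm (clip m (g k t))" by (rule norm_triangle_ineq4)
        also have "\<dots> \<le> m + m" by (intro add_mono norm_clip m)
        finally have "norm (clip m (f t) - clip m (g k t)) ^ p \<le> (m + m) ^ p"
          by (intro power_mono) auto
        then show "norm (norm (clip m (f t) - clip m (g k t)) ^ p) \<le> (2 * m) ^ p"
          by (simp add: mult_2[symmetric])
      qed
    qed auto
    then have "\<forall>\<^sub>F k in sequentially. integral\<^sup>L L (\<lambda>t. norm (clip m (f t) - clip m (g k t)) ^ p) < e / (2 * 2 ^ p)"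
      using e by (intro order_tendstoD(2)) auto
    then show ?thesis by (auto simp: eventually_sequentially)
  qed
  then obtain k where k: "integral\<^sup>L L (\<lambda>t. norm (clip m (f t) - clip m (g k t)) ^ p) < e / (2 * 2 ^ p)" ..
  define c where "c t = clip m (g k t)" for t
  have c: "continuous_on UNIV c" unfolding c_def
    by (rule continuous_on_compose2[OF clip_continuous[OF m, of UNIV] g(1)]) auto
  have [measurable]: "c \<in> borel_measurable L" unfolding c_def by measurable
  have i1: "integrable L (\<lambda>t. norm (f t - clip m (f t)) ^ p)"
    by (rule Bochner_Integration.integrable_bound[OF intL])
      (use norm_clip(2)[OF m] in \<open>auto intro!: power_mono AE_I2\<close>)
  have i2: "integrable L (\<lambda>t. norm (clip m (f t) - c t) ^ p)"
  proof (rule integrable_const_bound[where B="(2 * m) ^ p"])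
    show "AE t in L. norm (norm (clip m (f t) - c t) ^ p) \<le> (2 * m) ^ p"
    proof (intro AE_I2)
      fix t
      have "norm (clip m (f t) - c t) \<le> norm (clip m (f t)) + norm (c t)" by (rule norm_triangle_ineq4)
      also have "\<dots> \<le> m + m" unfolding c_def by (intro add_mono norm_clip m)
      finally have "norm (clip m (f t) - c t) ^ p \<le> (m + m) ^ p"
        by (intro power_mono) auto
      then show "norm (norm (clip m (f t) - c t) ^ p) \<le> (2 * m) ^ p"
        by (simp add: mult_2[symmetric])
    qed
  qed measurable
  have pt: "norm (f t - c t) ^ p \<le> 2 ^ p * (norm (f t - clip m (f t)) ^ p + norm (clip m (f t) - c t) ^ p)" for t
  proof -
    have "norm (f t - c t) \<le> norm (f t - clip m (f t)) + norm (clip m (f t) - c t)"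
      using norm_triangle_ineq[of "f t - clip m (f t)" "clip m (f t) - c t"] by simp
    also have "\<dots> \<le> 2 * max (norm (f t - clip m (f t))) (norm (clip m (f t) - c t))" by simp
    finally have "norm (f t - c t) ^ p \<le> (2 * max (norm (f t - clip m (f t))) (norm (clip m (f t) - c t))) ^ p"
      by (intro power_mono) auto
    also have "\<dots> = 2 ^ p * max (norm (f t - clip m (f t))) (norm (clip m (f t) - c t)) ^ p"
      by (rule power_mult_distrib)
    also have "\<dots> \<le> 2 ^ p * (norm (f t - clip m (f t)) ^ p + norm (clip m (f t) - c t) ^ p)"
      by (intro mult_left_mono) (auto simp: max_def)
    finally show ?thesis .
  qed
  have iB: "integrable L (\<lambda>t. 2 ^ p * (norm (f t - clip m (f t)) ^ p + norm (clip m (f t) - c t) ^ p))"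
    using i1 i2 by auto
  have iF: "integrable L (\<lambda>t. norm (f t - c t) ^ p)"
    by (rule Bochner_Integration.integrable_bound[OF iB]) (use pt in \<open>auto intro!: AE_I2 abs_ge_self[THEN order_trans[rotated]]\<close>)
  have "integral\<^sup>L L (\<lambda>t. norm (f t - c t) ^ p) \<le> integral\<^sup>L L (\<lambda>t. 2 ^ p * (norm (f t - clip m (f t)) ^ p + norm (clip m (f t) - c t) ^ p))"
    by (intro integral_mono iF iB pt)
  also have "\<dots> = 2 ^ p * (integral\<^sup>L L (\<lambda>t. norm (f t - clip m (f t)) ^ p) + integral\<^sup>L L (\<lambda>t. norm (clip m (f t) - c t) ^ p))"
    using i1 i2 by simp
  also have "\<dots> \<le> 2 ^ p * (e / (2 * 2 ^ p) + e / (2 * 2 ^ p))"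
    using n k unfolding m_def[symmetric] c_def[symmetric] by (intro mult_left_mono add_mono) auto
  also have "\<dots> = e" by (simp add: field_simps)
  finally have le: "integral\<^sup>L L (\<lambda>t. norm (f t - c t) ^ p) \<le> e" .
  show thesis
  proof (rule that[OF c])
    show "(\<lambda>t. norm (f t - c t) ^ p) integrable_on {0..T}"
      using iF unfolding L_def by (intro integrable_on_lebesgue_on) auto
    show "integral {0..T} (\<lambda>t. norm (f t - c t) ^ p) \<le> e"
      using le lebesgue_integral_eq_integral[of "{0..T}" "\<lambda>t. norm (f t - c t) ^ p"] iF unfolding L_def by simp
  qed
qed

lemma integral_const_interval: "a < b \<Longrightarrow> integral {a..b} (\<lambda>_. k) = (b - a) *\<^sub>R (k::'a::euclidean_space)"
  by simp

lemma step_width: "real (Suc j) * h - real j * h = h"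
  by (simp add: algebra_simps)

lemma integral_sum_partition:
  fixes g :: "real \<Rightarrow> 'a::euclidean_space"
  assumes "g integrable_on {0..real K * \<tau>}" "\<tau> > 0"
  shows "(\<Sum>j<K. integral {real j * \<tau>..real (Suc j) * \<tau>} g) = integral {0..real K * \<tau>} g"
  using assms(1)
proof (induction K)
  case (Suc K)
  have sub: "real K * \<tau> \<le> real (Suc K) * \<tau>" "0 \<le> real K * \<tau>" using assms(2) by (auto intro: mult_right_mono)
  then have "g integrable_on {0..real K * \<tau>}"
    using Suc.prems by (rule_tac integrable_subinterval_real) auto
  then have "(\<Sum>j<Suc K. integral {real j * \<tau>..real (Suc j) * \<tau>} g)
     = integral {0..real K * \<tau>} g + integral {real K * \<tau>..real (Suc K) * \<tau>} g"
    using Suc.IH by simp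
  also have "\<dots> = integral {0..real (Suc K) * \<tau>} g"
    by (rule Henstock_Kurzweil_Integration.integral_combine) (use sub Suc.prems in auto)
  finally show ?case .
qed simp

lemma action_dyadic:
  "action (increments w 0 (dyadic_steps T N))
   = (\<Sum>j<2^N. (norm (w (real (Suc j) * (T / 2^N)) - w (real j * (T / 2^N))))\<^sup>2 / (T / 2^N))"
  unfolding dyadic_steps_def increments_replicate action_def map_map comp_def prod.case interv_sum_list_conv_sum_set_nat
  by (simp add: atLeast0LessThan)

text \<open>
  The difference of the mean square and the square of the mean is the variance, which
  is at most the mean square distance to any constant \<open>s\<close>.
\<close>

lemma square_deviation_integral:
  fixes v :: "real \<Rightarrow> 'a::euclidean_space"
  assumes v: "v integrable_on {a..b}" and v2: "(\<lambda>t. (norm (v t))\<^sup>2) integrable_on {a..b}" and ab: "a < b"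
  shows "(\<lambda>t. (norm (v t - s))\<^sup>2) integrable_on {a..b}"
    and "integral {a..b} (\<lambda>t. (norm (v t))\<^sup>2) - (norm (integral {a..b} v))\<^sup>2 / (b - a)
        \<le> integral {a..b} (\<lambda>t. (norm (v t - s))\<^sup>2)"
    and "(norm (integral {a..b} v))\<^sup>2 / (b - a) \<le> integral {a..b} (\<lambda>t. (norm (v t))\<^sup>2)"
proof -
  let ?V = "integral {a..b} v"
  have "((\<lambda>t. (norm (v t - s))\<^sup>2) has_integral integral {a..b} (\<lambda>t. (norm (v t))\<^sup>2) - 2 * (s \<bullet> ?V) + (b - a) * (norm s)\<^sup>2) {a..b}" for s
  proof -
    have sv: "((\<lambda>t. s \<bullet> v t) has_integral (s \<bullet> ?V)) {a..b}"
      using has_integral_linear[OF integrable_integral[OF v] bounded_linear_inner_right[of s]] by (simp add: o_def)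
    have "((\<lambda>t. (norm (v t))\<^sup>2 - 2 * (s \<bullet> v t) + (norm s)\<^sup>2) has_integral
        integral {a..b} (\<lambda>t. (norm (v t))\<^sup>2) - 2 * (s \<bullet> ?V) + (b - a) *\<^sub>R (norm s)\<^sup>2) {a..b}"
      using ab by (intro has_integral_add has_integral_diff integrable_integral v2 has_integral_mult_right sv)
        (use has_integral_const_real[of "(norm s)\<^sup>2" a b] in auto)
    moreover have "(norm (v t - s))\<^sup>2 = (norm (v t))\<^sup>2 - 2 * (s \<bullet> v t) + (norm s)\<^sup>2" for t
      by (simp add: power2_norm_eq_inner inner_diff_left inner_diff_right inner_commute)
    ultimately show ?thesis by simp
  qed
  note hi = this
  show "(\<lambda>t. (norm (v t - s))\<^sup>2) integrable_on {a..b}" using hi by blast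
  have key: "2 * (s \<bullet> ?V) - (b - a) * (norm s)\<^sup>2 \<le> (norm ?V)\<^sup>2 / (b - a)"
  proof -
    have "0 \<le> (norm (?V - (b - a) *\<^sub>R s))\<^sup>2 / (b - a)" using ab by simp
    also have "(norm (?V - (b - a) *\<^sub>R s))\<^sup>2 = (norm ?V)\<^sup>2 - 2 * (b - a) * (s \<bullet> ?V) + (b - a)\<^sup>2 * (norm s)\<^sup>2"
      unfolding power2_norm_eq_inner
      by (simp add: inner_diff_left inner_diff_right inner_commute power2_eq_square algebra_simps del: power2_norm_eq_inner)
    also have "\<dots> / (b - a) = (norm ?V)\<^sup>2 / (b - a) - 2 * (s \<bullet> ?V) + (b - a) * (norm s)\<^sup>2"
    proof -
      have "(p - 2 * h * q + h\<^sup>2 * r) / h = p / h - 2 * q + h * r" if "h \<noteq> 0" for p q r h :: real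
        using that by (simp add: field_simps power2_eq_square)
      then show ?thesis using ab by (metis diff_gt_0_iff_gt less_irrefl)
    qed
    finally show ?thesis by simp
  qed
  show "integral {a..b} (\<lambda>t. (norm (v t))\<^sup>2) - (norm ?V)\<^sup>2 / (b - a) \<le> integral {a..b} (\<lambda>t. (norm (v t - s))\<^sup>2)"
    using key integral_unique[OF hi[of s]] by simp
  let ?s = "?V /\<^sub>R (b - a)"
  have "0 \<le> integral {a..b} (\<lambda>t. (norm (v t - ?s))\<^sup>2)"
    using hi[of ?s] by (intro integral_nonneg) (auto simp: has_integral_iff)
  also have "\<dots> = integral {a..b} (\<lambda>t. (norm (v t))\<^sup>2) - (norm ?V)\<^sup>2 / (b - a)"
  proof -
    have "2 * ((V /\<^sub>R h) \<bullet> V) - h * (norm (V /\<^sub>R h))\<^sup>2 = (norm V)\<^sup>2 / h" if "h > 0" for h and V :: 'a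
    proof -
      have "h * (norm (V /\<^sub>R h))\<^sup>2 = (norm V)\<^sup>2 / h"
        using that by (simp add: power2_eq_square field_simps)
      moreover have "(V /\<^sub>R h) \<bullet> V = (norm V)\<^sup>2 / h"
        by (simp add: dot_square_norm divide_inverse mult.commute)
      ultimately show ?thesis by simp
    qed
    from this[of "b - a" ?V] have "2 * (?s \<bullet> ?V) - (b - a) * (norm ?s)\<^sup>2 = (norm ?V)\<^sup>2 / (b - a)"
      using ab by simp
    then show ?thesis using integral_unique[OF hi[of ?s]] by simp
  qed
  finally show "(norm ?V)\<^sup>2 / (b - a) \<le> integral {a..b} (\<lambda>t. (norm (v t))\<^sup>2)" by simp
qed

lemma uniform_step_modulus:
  fixes c :: "real \<Rightarrow> 'a::metric_space"
  assumes "continuous_on UNIV c" "\<eta> > 0" "T > 0"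
  obtains N0 where "\<And>N j t. N \<ge> N0 \<Longrightarrow> j < 2 ^ N \<Longrightarrow> t \<in> {real j * (T / 2^N)..real (Suc j) * (T / 2^N)} \<Longrightarrow> dist (c t) (c (real j * (T / 2^N))) < \<eta>"
proof -
  have "uniformly_continuous_on {0..T} c"
    by (intro compact_uniformly_continuous continuous_on_subset[OF assms(1)]) auto
  then obtain d where d: "d > 0" "\<And>x x'. x \<in> {0..T} \<Longrightarrow> x' \<in> {0..T} \<Longrightarrow> dist x' x < d \<Longrightarrow> dist (c x') (c x) < \<eta>"
    using assms(2) unfolding uniformly_continuous_on_def by metis
  obtain N0 where N0: "T / d < 2 ^ N0" using real_arch_pow[of 2 "T / d"] by auto
  show thesis
  proof (rule that[of N0])
    fix N j t assume N: "N \<ge> N0" and j: "j < 2 ^ N" and t: "t \<in> {real j * (T / 2^N)..real (Suc j) * (T / 2^N)}"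
    have "T / d < 2 ^ N" using N0 N by (meson less_le_trans one_le_numeral power_increasing)
    then have small: "T / 2 ^ N < d" using d(1) by (simp add: field_simps)
    have "real (Suc j) \<le> 2 ^ N" using j by (metis Suc_leI of_nat_le_iff of_nat_numeral of_nat_power)
    then have up: "real (Suc j) * (T / 2 ^ N) \<le> T"
      using assms(3) mult_right_mono[of "real (Suc j)" "2 ^ N" "T / 2 ^ N"] by simp
    have lo: "0 \<le> real j * (T / 2 ^ N)" using assms(3) by simp
    have mid: "real j * (T / 2 ^ N) \<le> real (Suc j) * (T / 2 ^ N)" using assms(3) by (intro mult_right_mono) auto
    have "real (Suc j) * (T / 2 ^ N) = real j * (T / 2 ^ N) + T / 2 ^ N" using step_width[of j "T / 2 ^ N"] by linarith
    moreover have "real j * (T / 2 ^ N) \<le> t" "t \<le> real (Suc j) * (T / 2 ^ N)" using t by (simp_all only: atLeastAtMost_iff)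
    ultimately have dist: "dist t (real j * (T / 2 ^ N)) < d" using small unfolding dist_real_def by linarith
    show "dist (c t) (c (real j * (T / 2 ^ N))) < \<eta>"
      by (rule d(2)) (use t up lo mid dist in auto)
  qed
qed

lemma dyadic_subinterval:
  assumes "T > 0" "j < 2 ^ N"
  shows "real j * (T / 2^N) < real (Suc j) * (T / 2^N)" "{real j * (T / 2^N)..real (Suc j) * (T / 2^N)} \<subseteq> {0..T}"
proof -
  show "real j * (T / 2^N) < real (Suc j) * (T / 2^N)" using assms by (intro mult_strict_right_mono) auto
  have "real (Suc j) \<le> 2 ^ N" using assms(2) by (metis Suc_leI of_nat_le_iff of_nat_numeral of_nat_power)
  then have "real (Suc j) * (T / 2 ^ N) \<le> T"
    using assms mult_right_mono[of "real (Suc j)" "2 ^ N" "T / 2 ^ N"] by simp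
  moreover have "0 \<le> real j * (T / 2 ^ N)" using assms by simp
  ultimately show "{real j * (T / 2^N)..real (Suc j) * (T / 2^N)} \<subseteq> {0..T}" by auto
qed

lemma integral_dyadic_sum:
  fixes g :: "real \<Rightarrow> 'a::euclidean_space"
  assumes "g integrable_on {0..T}" "T > 0"
  shows "(\<Sum>j<2^N. integral {real j * (T / 2^N)..real (Suc j) * (T / 2^N)} g) = integral {0..T} g"
  using integral_sum_partition[of g "2^N" "T / 2^N"] assms by simp

text \<open>
  On each interval the difference between the integral of \<open>|v|\<^sup>2\<close> and the energy of the chord is a
  variance. Approximate \<open>v\<close> in \<open>L\<^sup>2\<close> by a continuous function, which is almost constant on short intervals.
\<close>

theorem action_dyadic_limit:
  fixes v w :: "real \<Rightarrow> 'a::euclidean_space"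
  assumes T: "T > 0" and v: "v integrable_on {0..T}" and v2: "(\<lambda>t. (norm (v t))\<^sup>2) integrable_on {0..T}"
    and w: "\<And>t. t \<in> {0..T} \<Longrightarrow> w t = w 0 + integral {0..t} v"
  shows "action (increments w 0 (dyadic_steps T N)) \<le> integral {0..T} (\<lambda>t. (norm (v t))\<^sup>2)"
    and "(\<lambda>N. action (increments w 0 (dyadic_steps T N))) \<longlonglongrightarrow> integral {0..T} (\<lambda>t. (norm (v t))\<^sup>2)"
proof -
  let ?I = "\<lambda>N j. {real j * (T / 2^N)..real (Suc j) * (T / 2^N)}"
  let ?Q = "integral {0..T} (\<lambda>t. (norm (v t))\<^sup>2)"
  have sub: "v integrable_on ?I N j" "(\<lambda>t. (norm (v t))\<^sup>2) integrable_on ?I N j" if "j < 2 ^ N" for N j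
    using v v2 dyadic_subinterval(2)[OF T that] by (meson integrable_on_subinterval)+
  have dw: "w (real (Suc j) * (T / 2^N)) - w (real j * (T / 2^N)) = integral (?I N j) v" if j: "j < 2 ^ N" for N j
  proof -
    let ?a = "real j * (T / 2^N)" and ?b = "real (Suc j) * (T / 2^N)"
    note d = dyadic_subinterval[OF T j]
    have ab: "?a \<in> {0..T}" "?b \<in> {0..T}" using d by auto
    have "integral {0..?a} v + integral {?a..?b} v = integral {0..?b} v"
      by (rule Henstock_Kurzweil_Integration.integral_combine)
        (use ab d(1) integrable_subinterval_real[OF v, of 0 ?b] in auto)
    then show ?thesis unfolding w[OF ab(1)] w[OF ab(2)] by (simp add: algebra_simps)
  qed
  note width = step_width
  have act: "action (increments w 0 (dyadic_steps T N)) = (\<Sum>j<2^N. (norm (integral (?I N j) v))\<^sup>2 / (T / 2^N))" for N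
    unfolding action_dyadic by (intro sum.cong refl) (simp only: dw lessThan_iff)
  have Qsum: "?Q = (\<Sum>j<2^N. integral (?I N j) (\<lambda>t. (norm (v t))\<^sup>2))" for N
    by (rule integral_dyadic_sum[OF v2 T, symmetric])
  show le: "action (increments w 0 (dyadic_steps T N)) \<le> ?Q" for N
    unfolding act Qsum[of N]
    using square_deviation_integral(3)[OF sub dyadic_subinterval(1)[OF T]] by (intro sum_mono) (simp only: width lessThan_iff)
  show "(\<lambda>N. action (increments w 0 (dyadic_steps T N))) \<longlonglongrightarrow> ?Q"
  proof (rule tendstoI)
    fix e :: real assume e: "e > 0"
    have "v \<in> borel_measurable (lebesgue_on {0..T})" using v by (rule integrable_imp_measurable)
    then obtain c where c: "continuous_on UNIV c" "(\<lambda>t. (norm (v t - c t))\<^sup>2) integrable_on {0..T}"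
      "integral {0..T} (\<lambda>t. (norm (v t - c t))\<^sup>2) \<le> e / 8"
      using Lp_approx_continuous[of v T 2 "e / 8"] v2 e by auto
    define \<eta> where "\<eta> = sqrt (e / (8 * T))"
    have \<eta>: "\<eta> > 0" "\<eta>\<^sup>2 * T = e / 8" using e T by (auto simp: \<eta>_def field_simps)
    obtain N0 where N0: "\<And>N j t. N \<ge> N0 \<Longrightarrow> j < 2 ^ N \<Longrightarrow> t \<in> ?I N j \<Longrightarrow> dist (c t) (c (real j * (T / 2^N))) < \<eta>"
      using uniform_step_modulus[OF c(1) \<eta>(1) T] by blast
    have "?Q - action (increments w 0 (dyadic_steps T N)) < e" if N: "N \<ge> N0" for N
    proof -
      let ?g = "\<lambda>t. 2 * (norm (v t - c t))\<^sup>2 + 2 * \<eta>\<^sup>2"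
      have g1: "(\<lambda>t. 2 * (norm (v t - c t))\<^sup>2) integrable_on {0..T}"
        using integrable_cmul[OF c(2), of 2] by simp
      have g: "?g integrable_on {0..T}"
        by (intro integrable_add g1 integrable_const_ivl)
      have "?Q - action (increments w 0 (dyadic_steps T N))
        = (\<Sum>j<2^N. integral (?I N j) (\<lambda>t. (norm (v t))\<^sup>2) - (norm (integral (?I N j) v))\<^sup>2 / (T / 2^N))"
        unfolding act Qsum[of N] by (simp add: sum_subtractf)
      also have "\<dots> \<le> (\<Sum>j<2^N. integral (?I N j) ?g)"
      proof (rule sum_mono)
        fix j :: nat assume "j \<in> {..<2^N}"
        then have j: "j < 2 ^ N" by simp
        let ?s = "c (real j * (T / 2^N))"
        note sq = square_deviation_integral(1,2)[OF sub[OF j] dyadic_subinterval(1)[OF T j], of ?s, unfolded width]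
        have "integral (?I N j) (\<lambda>t. (norm (v t))\<^sup>2) - (norm (integral (?I N j) v))\<^sup>2 / (T / 2^N)
           \<le> integral (?I N j) (\<lambda>t. (norm (v t - ?s))\<^sup>2)" by (rule sq(2))
        also have "\<dots> \<le> integral (?I N j) ?g"
        proof (rule integral_le[OF sq(1)])
          show "?g integrable_on ?I N j" using g dyadic_subinterval(2)[OF T j] by (meson integrable_on_subinterval)
          fix t assume t: "t \<in> ?I N j"
          have "norm (v t - ?s) \<le> norm (v t - c t) + norm (c t - ?s)"
            using norm_triangle_ineq[of "v t - c t" "c t - ?s"] by simp
          also have "\<dots> \<le> norm (v t - c t) + \<eta>"
            using N0[OF N j t] by (simp add: dist_norm)
          finally have "(norm (v t - ?s))\<^sup>2 \<le> (norm (v t - c t) + \<eta>)\<^sup>2" by (intro power_mono) auto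
          also have "\<dots> \<le> ?g t" using sum_squares_bound[of "norm (v t - c t)" \<eta>] by (simp add: power2_sum)
          finally show "(norm (v t - ?s))\<^sup>2 \<le> ?g t" .
        qed
        finally show "integral (?I N j) (\<lambda>t. (norm (v t))\<^sup>2) - (norm (integral (?I N j) v))\<^sup>2 / (T / 2^N)
           \<le> integral (?I N j) ?g" .
      qed
      also have "\<dots> = integral {0..T} ?g" by (rule integral_dyadic_sum[OF g T])
      also have "\<dots> = 2 * integral {0..T} (\<lambda>t. (norm (v t - c t))\<^sup>2) + T * (2 * \<eta>\<^sup>2)"
        by (subst Henstock_Kurzweil_Integration.integral_add[OF g1 integrable_const_ivl])
          (use T in simp)
      also have "\<dots> \<le> 2 * (e / 8) + 2 * (e / 8)"
        using c(3) \<eta>(2) by (simp add: mult.commute mult.left_commute)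
      also have "\<dots> < e" using e by simp
      finally show ?thesis .
    qed
    then have "dist (action (increments w 0 (dyadic_steps T N))) ?Q < e" if "N \<ge> N0" for N
      using le[of N] that by (auto simp: dist_real_def)
    then show "\<forall>\<^sub>F N in sequentially. dist (action (increments w 0 (dyadic_steps T N))) ?Q < e"
      unfolding eventually_sequentially by blast
  qed
qed

text \<open>
  The integrals of \<open>u\<close> over all dyadic intervals vanish, so those of a continuous
  \<open>L\<^sup>1\<close>-approximation are small; as the approximation is almost constant on short intervals, its
  norm in \<open>L\<^sup>1\<close> is small as well.
\<close>

lemma zero_indefinite_integral_AE:
  fixes u :: "real \<Rightarrow> 'a::euclidean_space"
  assumes T: "T > 0" and u: "u absolutely_integrable_on {0..T}"
    and zero: "\<And>t. t \<in> {0..T} \<Longrightarrow> integral {0..t} u = 0"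
  shows "negligible {t \<in> {0..T}. u t \<noteq> 0}"
proof -
  have ui: "u integrable_on {0..T}" and un: "(\<lambda>t. norm (u t)) integrable_on {0..T}"
    using u by (auto simp: absolutely_integrable_on_def)
  let ?I = "\<lambda>N j. {real j * (T / 2^N)..real (Suc j) * (T / 2^N)}"
  have "integral {0..T} (\<lambda>t. norm (u t)) \<le> e" if e: "e > 0" for e
  proof -
    have "u \<in> borel_measurable (lebesgue_on {0..T})" using ui by (rule integrable_imp_measurable)
    then obtain c where c: "continuous_on UNIV c" "(\<lambda>t. norm (u t - c t)) integrable_on {0..T}"
      "integral {0..T} (\<lambda>t. norm (u t - c t)) \<le> e / 4"
      using Lp_approx_continuous[of u T 1 "e / 4"] un e by auto
    define \<eta> where "\<eta> = e / (4 * T)"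
    have \<eta>: "\<eta> > 0" using e T by (simp add: \<eta>_def)
    obtain N where N: "\<And>j t. j < 2 ^ N \<Longrightarrow> t \<in> ?I N j \<Longrightarrow> dist (c t) (c (real j * (T / 2^N))) < \<eta>"
      using uniform_step_modulus[OF c(1) \<eta> T] by (metis order_refl)
    let ?\<tau> = "T / 2^N"
    have ci: "c integrable_on {a..b}" for a b by (intro integrable_continuous_real continuous_on_subset[OF c(1)]) auto
    have cn: "(\<lambda>t. norm (c t)) integrable_on {a..b}" for a b
      by (intro integrable_continuous_real continuous_intros continuous_on_subset[OF c(1)]) auto
    have "integral {0..T} (\<lambda>t. norm (u t)) \<le> integral {0..T} (\<lambda>t. norm (u t - c t) + norm (c t))"
      by (intro integral_le un integrable_add c(2) cn) (metis diff_add_cancel norm_triangle_ineq)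
    also have "\<dots> = integral {0..T} (\<lambda>t. norm (u t - c t)) + integral {0..T} (\<lambda>t. norm (c t))"
      by (intro Henstock_Kurzweil_Integration.integral_add c(2) cn)
    also have "integral {0..T} (\<lambda>t. norm (c t)) = (\<Sum>j<2^N. integral (?I N j) (\<lambda>t. norm (c t)))"
      by (rule integral_dyadic_sum[OF cn T, symmetric])
    also have "\<dots> \<le> (\<Sum>j<2^N. integral (?I N j) (\<lambda>t. norm (u t - c t) + 2 * \<eta>))"
    proof (rule sum_mono)
      fix j :: nat assume "j \<in> {..<2^N}"
      then have j: "j < 2 ^ N" by simp
      let ?s = "c (real j * ?\<tau>)"
      note d = dyadic_subinterval[OF T j]
      note width = step_width[of j ?\<tau>]
      have uI: "u integrable_on ?I N j" and ucI: "(\<lambda>t. norm (u t - c t)) integrable_on ?I N j"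
        using ui c(2) d(2) by (meson integrable_on_subinterval)+
      have uz: "integral (?I N j) u = 0"
      proof -
        have "integral {0..real j * ?\<tau>} u + integral (?I N j) u = integral {0..real (Suc j) * ?\<tau>} u"
          by (rule Henstock_Kurzweil_Integration.integral_combine)
            (use d integrable_subinterval_real[OF ui, of 0 "real (Suc j) * ?\<tau>"] in auto)
        then show ?thesis using zero[of "real j * ?\<tau>"] zero[of "real (Suc j) * ?\<tau>"] d by auto
      qed
      have "integral (?I N j) (\<lambda>t. norm (c t)) \<le> integral (?I N j) (\<lambda>t. norm ?s + \<eta>)"
      proof (intro integral_le cn integrable_const_ivl)
        fix t assume "t \<in> ?I N j"
        then show "norm (c t) \<le> norm ?s + \<eta>"
          using N[OF j] norm_triangle_ineq2[of "c t" ?s] by (force simp: dist_norm)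
      qed
      also have "\<dots> = norm (?\<tau> *\<^sub>R ?s) + ?\<tau> * \<eta>"
        unfolding integral_const_interval[OF d(1)] width using T by (simp add: distrib_left)
      also have "?\<tau> *\<^sub>R ?s = integral (?I N j) (\<lambda>t. ?s)"
        unfolding integral_const_interval[OF d(1)] width ..
      also have "\<dots> = integral (?I N j) (\<lambda>t. ?s - u t)"
        using uz Henstock_Kurzweil_Integration.integral_diff[OF integrable_const_ivl[of ?s] uI] by simp
      also have "\<dots> = integral (?I N j) (\<lambda>t. (?s - c t) - (u t - c t))" by simp
      also have "norm \<dots> \<le> integral (?I N j) (\<lambda>t. norm (u t - c t) + \<eta>)"
      proof (rule integral_norm_bound_integral)
        show "(\<lambda>t. ?s - c t - (u t - c t)) integrable_on ?I N j" by (intro integrable_diff integrable_const_ivl ci uI)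
        show "(\<lambda>t. norm (u t - c t) + \<eta>) integrable_on ?I N j" by (intro integrable_add integrable_const_ivl ucI)
        fix t assume t: "t \<in> ?I N j"
        have "norm (?s - c t - (u t - c t)) \<le> norm (?s - c t) + norm (u t - c t)" by (rule norm_triangle_ineq4)
        then show "norm (?s - c t - (u t - c t)) \<le> norm (u t - c t) + \<eta>"
          using N[OF j t] by (simp add: dist_norm norm_minus_commute)
      qed
      also have "integral (?I N j) (\<lambda>t. norm (u t - c t) + \<eta>) + ?\<tau> * \<eta> = integral (?I N j) (\<lambda>t. norm (u t - c t) + 2 * \<eta>)"
      proof -
        have *: "integral (?I N j) (\<lambda>t. norm (u t - c t) + k) = integral (?I N j) (\<lambda>t. norm (u t - c t)) + ?\<tau> * k" for k :: real
          using Henstock_Kurzweil_Integration.integral_add[OF ucI integrable_const_ivl[of k]]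
          unfolding integral_const_interval[OF d(1)] width by simp
        show ?thesis unfolding * by (simp add: algebra_simps)
      qed
      finally show "integral (?I N j) (\<lambda>t. norm (c t)) \<le> integral (?I N j) (\<lambda>t. norm (u t - c t) + 2 * \<eta>)" by simp
    qed
    also have "\<dots> = integral {0..T} (\<lambda>t. norm (u t - c t) + 2 * \<eta>)"
      by (intro integral_dyadic_sum integrable_add c(2) integrable_const_ivl T)
    also have "\<dots> = integral {0..T} (\<lambda>t. norm (u t - c t)) + 2 * (T * \<eta>)"
      using c(2) T by (subst Henstock_Kurzweil_Integration.integral_add) auto
    also have "T * \<eta> = e / 4" using T by (simp add: \<eta>_def)
    finally show ?thesis using c(3) by simp
  qed
  then have "integral {0..T} (\<lambda>t. norm (u t)) \<le> 0" by (rule field_le_epsilon[where y=0, simplified])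
  moreover have "0 \<le> integral {0..T} (\<lambda>t. norm (u t))" by (intro integral_nonneg un) auto
  ultimately have z: "integral {0..T} (\<lambda>t. norm (u t)) = 0" by simp
  have iL: "integrable (lebesgue_on {0..T}) (\<lambda>t. norm (u t))"
    using absolutely_integrable_norm[OF u] by (simp add: integrable_restrict_space set_integrable_def o_def)
  have "integral\<^sup>L (lebesgue_on {0..T}) (\<lambda>t. norm (u t)) = 0"
    using lebesgue_integral_eq_integral[OF iL] z by simp
  then have "AE t in lebesgue_on {0..T}. norm (u t) = 0"
    using integral_nonneg_eq_0_iff_AE[OF iL] by auto
  then have "AE t in lebesgue. t \<in> {0..T} \<longrightarrow> u t = 0" by (subst (asm) AE_restrict_space_iff) auto
  then obtain N where "N \<in> null_sets lebesgue" "{t. \<not> (t \<in> {0..T} \<longrightarrow> u t = 0)} \<subseteq> N"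
    by (auto simp: eventually_ae_filter)
  then have "negligible N" "{t \<in> {0..T}. u t \<noteq> 0} \<subseteq> N" by (auto simp: negligible_iff_null_sets)
  then show ?thesis by (rule negligible_subset)
qed

text \<open>
  The function chosen in the definition of \<open>weak_deriv\<close> may differ from a square-integrable weak
  derivative, but only on a null set, since both have \<open>w\<close> as their primitive.
\<close>

theorem W2_path_action:
  fixes w :: "real \<Rightarrow> 'a::euclidean_space"
  assumes T: "T > 0" and w: "w \<in> W2_paths T"
  defines "Q \<equiv> integral {0..T} (\<lambda>t. (norm (weak_deriv T w t))\<^sup>2)"
  shows "continuous_on {0..T} w" and "action (increments w 0 (dyadic_steps T N)) \<le> Q"
    and "(\<lambda>N. action (increments w 0 (dyadic_steps T N))) \<longlonglongrightarrow> Q"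
proof -
  show cw: "continuous_on {0..T} w" using w by (simp add: W2_paths_def mspace_path_metric)
  obtain v where v: "has_weak_derivative T w v" "(\<lambda>t. (norm (v t))\<^sup>2) integrable_on {0..T}"
    using w unfolding W2_paths_def by blast
  define v' where "v' = weak_deriv T w"
  have v': "has_weak_derivative T w v'" unfolding v'_def weak_deriv_def using someI[where P="has_weak_derivative T w", OF v(1)] by simp
  have ab: "v absolutely_integrable_on {0..T}" "v' absolutely_integrable_on {0..T}"
    using v(1) v' by (auto simp: has_weak_derivative_def)
  have i: "v integrable_on {0..T}" "v' integrable_on {0..T}" using ab by (auto simp: absolutely_integrable_on_def)
  have "integral {0..t} (\<lambda>s. v' s - v s) = 0" if t: "t \<in> {0..T}" for t
  proof -
    have "integral {0..t} v' = integral {0..t} v"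
      using weak_derivative_integral[OF T cw v(1) t] weak_derivative_integral[OF T cw v' t] by simp
    moreover have "v integrable_on {0..t}" "v' integrable_on {0..t}"
      using t by (auto intro: integrable_subinterval_real[OF i(1)] integrable_subinterval_real[OF i(2)])
    ultimately show ?thesis by (simp add: Henstock_Kurzweil_Integration.integral_diff)
  qed
  then have neg: "negligible {t \<in> {0..T}. v' t - v t \<noteq> 0}"
    by (intro zero_indefinite_integral_AE[OF T] set_integral_diff(1) ab)
  have Q: "Q = integral {0..T} (\<lambda>t. (norm (v t))\<^sup>2)"
    unfolding Q_def v'_def[symmetric] by (rule integral_spike[OF neg]) auto
  note lim = action_dyadic_limit[OF T i(1) v(2) weak_derivative_integral[OF T cw v(1)]]
  show "action (increments w 0 (dyadic_steps T N)) \<le> Q" unfolding Q by (rule lim(1))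
  show "(\<lambda>N. action (increments w 0 (dyadic_steps T N))) \<longlonglongrightarrow> Q" unfolding Q by (rule lim(2))
qed

section \<open>The integral equations\<close>

lemma integral_exp_weight:
  fixes L :: real
  assumes "L > 0" "t \<ge> 0"
  shows "((\<lambda>s. exp (2 * L * s)) has_integral (exp (2 * L * t) - 1) / (2 * L)) {0..t}"
proof -
  have "((\<lambda>s. exp (2 * L * s)) has_integral (exp (2 * L * t) / (2 * L) - exp (2 * L * 0) / (2 * L))) {0..t}"
    using assms
    by (intro fundamental_theorem_of_calculus)
       (auto intro!: derivative_eq_intros simp: has_real_derivative_iff_has_vector_derivative[symmetric])
  then show ?thesis by (simp add: diff_divide_distrib)
qed

text \<open>
  Gronwall's inequality with a constant that is not optimal but has a short proof: in the norm with the
  weight \<open>exp (- (2 * L * t))\<close> the integral operator has norm at most \<open>1/2\<close>.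
\<close>

lemma weak_gronwall:
  fixes u :: "real \<Rightarrow> real"
  assumes cont: "continuous_on {0..T} u" and L: "L > 0" and T: "T \<ge> 0"
    and le: "\<And>t. t \<in> {0..T} \<Longrightarrow> u t \<le> a + L * integral {0..t} u" and a: "a \<ge> 0"
    and t: "t \<in> {0..T}"
  shows "u t \<le> 2 * a * exp (2 * L * t)"
proof -
  have "continuous_on {0..T} (\<lambda>t. exp (- (2 * L * t)) * u t)" by (intro continuous_intros cont)
  then obtain s where s: "s \<in> {0..T}" "\<And>t. t \<in> {0..T} \<Longrightarrow> exp (- (2 * L * t)) * u t \<le> exp (- (2 * L * s)) * u s"
    using continuous_attains_sup[of "{0..T}" "\<lambda>t. exp (- (2 * L * t)) * u t"] T by auto
  define m where "m = exp (- (2 * L * s)) * u s"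
  have um: "u t \<le> m * exp (2 * L * t)" if "t \<in> {0..T}" for t
    using s(2)[OF that] unfolding m_def by (simp add: exp_minus field_simps)
  have "m \<le> 2 * a"
  proof (cases "m \<ge> 0")
    case True
    have "integral {0..s} u \<le> integral {0..s} (\<lambda>r. m * exp (2 * L * r))"
    proof (rule integral_le)
      show "u integrable_on {0..s}" using s(1) by (intro integrable_continuous_real continuous_on_subset[OF cont]) auto
      show "(\<lambda>r. m * exp (2 * L * r)) integrable_on {0..s}" by (intro integrable_continuous_real continuous_intros)
    qed (use um s(1) in auto)
    also have "\<dots> = m * ((exp (2 * L * s) - 1) / (2 * L))"
      using integral_unique[OF integral_exp_weight[OF L]] s(1) by simp
    finally have "u s \<le> a + L * (m * ((exp (2 * L * s) - 1) / (2 * L)))"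
      using le[OF s(1)] L by (smt (verit) mult_left_mono)
    also have "L * (m * ((exp (2 * L * s) - 1) / (2 * L))) = m * (exp (2 * L * s) - 1) / 2" using L by simp
    also have "\<dots> \<le> m * exp (2 * L * s) / 2" using True by (simp add: right_diff_distrib)
    finally have "exp (- (2 * L * s)) * u s \<le> exp (- (2 * L * s)) * (a + m * exp (2 * L * s) / 2)"
      by (intro mult_left_mono) auto
    also have "\<dots> = exp (- (2 * L * s)) * a + m / 2" by (simp add: distrib_left exp_minus)
    also have "exp (- (2 * L * s)) * a \<le> 1 * a" using a L s(1) by (intro mult_right_mono) auto
    finally show ?thesis unfolding m_def[symmetric] by simp
  qed (use a in auto)
  then have "m * exp (2 * L * t) \<le> 2 * a * exp (2 * L * t)" by (intro mult_right_mono) auto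
  then show ?thesis using um[OF t] by linarith
qed

lemma integrand_continuous:
  fixes H :: "real \<Rightarrow> 'e::euclidean_space \<Rightarrow> 'b::euclidean_space"
  assumes "continuous_on ({0..T} \<times> UNIV) (\<lambda>(t, y). H t y)" "continuous_on {0..T} y"
  shows "continuous_on {0..T} (\<lambda>t. H t (y t))"
proof -
  have "continuous_on {0..T} (\<lambda>t. (t, y t))" by (intro continuous_intros assms(2))
  from continuous_on_compose2[OF assms(1) this] show ?thesis by auto
qed

text \<open>
  Picard iteration as one contraction. Write \<open>y t = exp (2 * L * t) *\<^sub>R \<eta> t\<close>; for \<open>\<eta>\<close> in the space
  of bounded continuous functions the integral operator is a contraction with factor \<open>1/2\<close> on the whole interval.
\<close>

theorem integral_equation_exists:
  fixes H :: "real \<Rightarrow> 'e::euclidean_space \<Rightarrow> 'e"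
  assumes T: "T > 0" and H: "continuous_on ({0..T} \<times> UNIV) (\<lambda>(t, y). H t y)"
    and L: "L > 0" "\<And>t y y'. t \<in> {0..T} \<Longrightarrow> norm (H t y - H t y') \<le> L * norm (y - y')"
    and g: "continuous_on {0..T} g"
  obtains y where "continuous_on {0..T} y" "\<And>t. t \<in> {0..T} \<Longrightarrow> y t = g t + integral {0..t} (\<lambda>s. H s (y s))"
proof -
  \<comment> \<open>c projects the line onto [0, T], to work in the complete space of bounded continuous functions on the line\<close>
  define c where "c t = max 0 (min T t)" for t
  have c: "c t \<in> {0..T}" for t using T by (auto simp: c_def)
  have c_id: "c t = t" if "t \<in> {0..T}" for t using that by (auto simp: c_def)
  have c_cont: "continuous_on UNIV c" unfolding c_def by (intro continuous_intros)
  define P where "P \<eta> t = exp (- (2 * L * t)) *\<^sub>R (g t + integral {0..t} (\<lambda>s. H s (exp (2 * L * s) *\<^sub>R \<eta> s)))" for \<eta> :: "real \<Rightarrow> 'e" and t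
  have Hc: "continuous_on {0..T} (\<lambda>s. H s (exp (2 * L * s) *\<^sub>R \<eta> s))" if "continuous_on {0..T} \<eta>" for \<eta>
    by (intro integrand_continuous[OF H] continuous_intros that)
  have P_cont: "continuous_on {0..T} (P \<eta>)" if "continuous_on {0..T} \<eta>" for \<eta>
    unfolding P_def
    by (intro continuous_intros g indefinite_integral_continuous_1 integrable_continuous_real Hc that)
  have Pb: "(\<lambda>t. P \<eta> (c t)) \<in> bcontfun" if "continuous_on {0..T} \<eta>" for \<eta>
  proof -
    have "continuous_on UNIV (\<lambda>t. P \<eta> (c t))"
      by (rule continuous_on_compose2[OF P_cont[OF that] c_cont]) (use c in auto)
    moreover have "bounded (P \<eta> ` {0..T})"
      by (intro compact_imp_bounded compact_continuous_image P_cont that) auto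
    then have "bounded (range (\<lambda>t. P \<eta> (c t)))"
      by (rule bounded_subset) (use c in auto)
    ultimately show ?thesis by (simp add: bcontfun_def)
  qed
  define F where "F \<eta> = Bcontfun (\<lambda>t. P (apply_bcontfun \<eta>) (c t))" for \<eta> :: "real \<Rightarrow>\<^sub>C 'e"
  have F: "apply_bcontfun (F \<eta>) t = P (apply_bcontfun \<eta>) (c t)" for \<eta> t
    unfolding F_def by (subst Bcontfun_inverse[OF Pb]) auto
  have lip: "dist (F \<eta>) (F \<zeta>) \<le> 1/2 * dist \<eta> \<zeta>" for \<eta> \<zeta>
  proof (rule dist_bound)
    fix t
    define s where "s = c t"
    have s: "s \<in> {0..T}" using c by (simp add: s_def)
    let ?h = "\<lambda>\<eta> r. H r (exp (2 * L * r) *\<^sub>R apply_bcontfun \<eta> r)"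
    have hc: "continuous_on {0..s} (?h \<eta>)" for \<eta>
      by (rule continuous_on_subset[OF Hc]) (use s in auto)
    have "norm (integral {0..s} (?h \<eta>) - integral {0..s} (?h \<zeta>)) = norm (integral {0..s} (\<lambda>r. ?h \<eta> r - ?h \<zeta> r))"
      by (subst Henstock_Kurzweil_Integration.integral_diff) (auto intro: integrable_continuous_real hc)
    also have "\<dots> \<le> integral {0..s} (\<lambda>r. (L * dist \<eta> \<zeta>) * exp (2 * L * r))"
    proof (rule integral_norm_bound_integral)
      show "(\<lambda>r. ?h \<eta> r - ?h \<zeta> r) integrable_on {0..s}" by (intro integrable_continuous_real continuous_intros hc)
      show "(\<lambda>r. (L * dist \<eta> \<zeta>) * exp (2 * L * r)) integrable_on {0..s}" by (intro integrable_continuous_real continuous_intros)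
      fix r assume r: "r \<in> {0..s}"
      have "norm (?h \<eta> r - ?h \<zeta> r) \<le> L * norm (exp (2 * L * r) *\<^sub>R apply_bcontfun \<eta> r - exp (2 * L * r) *\<^sub>R apply_bcontfun \<zeta> r)"
        by (rule L(2)) (use r s in auto)
      also have "\<dots> = L * (exp (2 * L * r) * dist (apply_bcontfun \<eta> r) (apply_bcontfun \<zeta> r))"
        by (simp add: dist_norm flip: scaleR_diff_right)
      also have "\<dots> \<le> L * (exp (2 * L * r) * dist \<eta> \<zeta>)"
        using L(1) by (intro mult_left_mono dist_bounded) auto
      finally show "norm (?h \<eta> r - ?h \<zeta> r) \<le> (L * dist \<eta> \<zeta>) * exp (2 * L * r)" by (simp add: ac_simps)
    qed
    also have "\<dots> = (L * dist \<eta> \<zeta>) * ((exp (2 * L * s) - 1) / (2 * L))"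
      using integral_unique[OF integral_exp_weight[OF L(1)]] s by simp
    also have "\<dots> = dist \<eta> \<zeta> * (exp (2 * L * s) - 1) / 2" using L(1) by simp
    also have "\<dots> \<le> 1/2 * dist \<eta> \<zeta> * exp (2 * L * s)" by (simp add: algebra_simps)
    finally have "exp (- (2 * L * s)) * norm (integral {0..s} (?h \<eta>) - integral {0..s} (?h \<zeta>))
      \<le> exp (- (2 * L * s)) * (1/2 * dist \<eta> \<zeta> * exp (2 * L * s))" by (intro mult_left_mono) auto
    also have "\<dots> = 1/2 * dist \<eta> \<zeta>" by (simp add: exp_minus)
    finally show "dist (apply_bcontfun (F \<eta>) t) (apply_bcontfun (F \<zeta>) t) \<le> 1/2 * dist \<eta> \<zeta>"
      unfolding F s_def[symmetric] P_def dist_norm by (simp flip: scaleR_diff_right)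
  qed
  then obtain \<eta> where \<eta>: "F \<eta> = \<eta>" using banach_fix_type[of "1/2" F] by auto
  define y where "y t = exp (2 * L * t) *\<^sub>R apply_bcontfun \<eta> t" for t
  show thesis
  proof (rule that)
    show "continuous_on {0..T} y" unfolding y_def by (intro continuous_intros continuous_on_apply_bcontfun)
    fix t assume t: "t \<in> {0..T}"
    have "apply_bcontfun \<eta> t = P (apply_bcontfun \<eta>) t" using F[of \<eta> t] c_id[OF t] by (simp add: \<eta>)
    then show "y t = g t + integral {0..t} (\<lambda>s. H s (y s))"
      unfolding y_def P_def by (simp flip: exp_add)
  qed
qed

lemma test_function_props:
  assumes "\<phi> \<in> test_functions T"
  shows "(\<phi> has_real_derivative deriv \<phi> t) (at t)" "continuous_on A \<phi>" "continuous_on A (deriv \<phi>)"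
    "\<phi> 0 = 0" "\<phi> T = 0"
proof -
  have d: "(deriv ^^ k) \<phi> differentiable_on UNIV" for k using assms by (simp add: test_functions_def)
  show der: "(\<phi> has_real_derivative deriv \<phi> t) (at t)" for t
    using d[of 0] by (auto simp: differentiable_on_def DERIV_deriv_iff_real_differentiable)
  show "continuous_on A \<phi>" using differentiable_imp_continuous_on[OF d[of 0]] by (auto intro: continuous_on_subset)
  show "continuous_on A (deriv \<phi>)" using differentiable_imp_continuous_on[OF d[of 1]] by (auto intro: continuous_on_subset)
  obtain K where "K \<subseteq> {0<..<T}" "\<And>t. t \<notin> K \<Longrightarrow> \<phi> t = 0" using assms by (auto simp: test_functions_def)
  then show "\<phi> 0 = 0" "\<phi> T = 0" by force+
qed

lemma continuous_bounded_interval: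
  fixes \<phi> :: "real \<Rightarrow> 'a::real_normed_vector"
  assumes "continuous_on {0..T} \<phi>"
  obtains B where "B \<ge> 0" "\<And>t. t \<in> {0..T} \<Longrightarrow> norm (\<phi> t) \<le> B"
proof -
  have "bounded (\<phi> ` {0..T})" using assms by (intro compact_imp_bounded compact_continuous_image) auto
  then obtain B where B: "\<forall>t\<in>{0..T}. norm (\<phi> t) \<le> B" by (auto simp: bounded_iff)
  show thesis by (rule that[of "max B 0"]) (use B in \<open>auto simp: max.coboundedI1\<close>)
qed

lemma test_function_times_integrable:
  fixes v :: "real \<Rightarrow> 'a::euclidean_space"
  assumes "\<phi> \<in> test_functions T" "v absolutely_integrable_on {0..T}"
  shows "(\<lambda>t. \<phi> t *\<^sub>R v t) integrable_on {0..T}"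
proof -
  obtain B where B: "\<And>t. t \<in> {0..T} \<Longrightarrow> norm (\<phi> t) \<le> B"
    using continuous_bounded_interval[OF test_function_props(2)[OF assms(1)]] by blast
  show ?thesis
  proof (rule measurable_bounded_by_integrable_imp_integrable)
    have "v \<in> borel_measurable (lebesgue_on {0..T})"
      using assms(2) by (intro integrable_imp_measurable) (simp add: absolutely_integrable_on_def)
    moreover have "\<phi> \<in> borel_measurable (lebesgue_on {0..T})"
      by (intro continuous_imp_measurable_on_sets_lebesgue test_function_props(2)[OF assms(1)]) simp
    ultimately show "(\<lambda>t. \<phi> t *\<^sub>R v t) \<in> borel_measurable (lebesgue_on {0..T})"
      by (rule borel_measurable_scaleR[rotated])
    show "(\<lambda>t. B *\<^sub>R norm (v t)) integrable_on {0..T}"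
      using assms(2) by (intro integrable_cmul) (simp add: absolutely_integrable_on_def)
    show "norm (\<phi> t *\<^sub>R v t) \<le> B *\<^sub>R norm (v t)" if "t \<in> {0..T}" for t
      using B[OF that] by (simp add: mult_right_mono)
  qed simp
qed

text \<open>
  Integration by parts; the boundary terms vanish with the test function.
\<close>

lemma weak_derivative_primitive:
  fixes k :: "real \<Rightarrow> 'a::euclidean_space"
  assumes T: "T > 0" and k: "continuous_on {0..T} k" and \<phi>: "\<phi> \<in> test_functions T"
  shows "integral {0..T} (\<lambda>t. deriv \<phi> t *\<^sub>R (x0 + integral {0..t} k)) = - integral {0..T} (\<lambda>t. \<phi> t *\<^sub>R k t)"
proof -
  note tf = test_function_props[OF \<phi>]
  let ?y = "\<lambda>t. x0 + integral {0..t} k"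
  have yc: "continuous_on {0..T} ?y"
    by (intro continuous_intros indefinite_integral_continuous_1 integrable_continuous_real k)
  have "((\<lambda>t. \<phi> t *\<^sub>R k t + deriv \<phi> t *\<^sub>R ?y t) has_integral (\<phi> T *\<^sub>R ?y T - \<phi> 0 *\<^sub>R ?y 0)) {0..T}"
  proof (rule fundamental_theorem_of_calculus)
    fix t assume t: "t \<in> {0..T}"
    have "(?y has_vector_derivative 0 + k t) (at t within {0..T})"
      by (intro has_vector_derivative_add has_vector_derivative_const integral_has_vector_derivative k t)
    then show "((\<lambda>t. \<phi> t *\<^sub>R ?y t) has_vector_derivative \<phi> t *\<^sub>R k t + deriv \<phi> t *\<^sub>R ?y t) (at t within {0..T})"
      using has_vector_derivative_scaleR[of \<phi> "deriv \<phi> t" t "{0..T}" ?y "k t"] has_field_derivative_at_within[OF tf(1)]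
      by simp
  qed (use T in simp)
  then have "integral {0..T} (\<lambda>t. \<phi> t *\<^sub>R k t + deriv \<phi> t *\<^sub>R ?y t) = 0"
    using tf(4,5) by (simp add: integral_unique)
  moreover have "integral {0..T} (\<lambda>t. \<phi> t *\<^sub>R k t + deriv \<phi> t *\<^sub>R ?y t)
      = integral {0..T} (\<lambda>t. \<phi> t *\<^sub>R k t) + integral {0..T} (\<lambda>t. deriv \<phi> t *\<^sub>R ?y t)"
    by (intro Henstock_Kurzweil_Integration.integral_add integrable_continuous_real continuous_intros tf(2,3) k yc)
  ultimately show ?thesis by (simp add: eq_neg_iff_add_eq_0 add.commute)
qed

text \<open>
  The form of a solution: the drift contributes a primitive of a continuous function, the noise the
  linear image of \<open>w\<close>.
\<close>

theorem W2_paths_primitive_plus_linear: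
  fixes w :: "real \<Rightarrow> 'a::euclidean_space" and k :: "real \<Rightarrow> 'b::euclidean_space"
  assumes T: "T > 0" and w: "w \<in> W2_paths T" and A: "bounded_linear A" and k: "continuous_on {0..T} k"
  shows "(\<lambda>t\<in>{0..T}. x0 + integral {0..t} k + A (w t)) \<in> W2_paths T"
proof -
  let ?x = "\<lambda>t\<in>{0..T}. x0 + integral {0..t} k + A (w t)"
  have wc: "continuous_on {0..T} w" and wac: "absolutely_continuous_on_Icc T w"
    using w by (auto simp: W2_paths_def mspace_path_metric)
  obtain v where v: "has_weak_derivative T w v" "(\<lambda>t. (norm (v t))\<^sup>2) integrable_on {0..T}"
    using w by (auto simp: W2_paths_def)
  have va: "v absolutely_integrable_on {0..T}" using v(1) by (simp add: has_weak_derivative_def)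
  obtain K where K: "K > 0" "\<And>x. norm (A x) \<le> norm x * K" using bounded_linear.pos_bounded[OF A] by blast
  obtain B where B: "B \<ge> 0" "\<And>t. t \<in> {0..T} \<Longrightarrow> norm (k t) \<le> B"
    using continuous_bounded_interval[OF k] by blast
  have ki: "k integrable_on {a..b}" if "0 \<le> a" "b \<le> T" for a b
    using that by (intro integrable_continuous_real continuous_on_subset[OF k]) auto
  have xc: "continuous_on {0..T} ?x"
  proof -
    have "continuous_on {0..T} (\<lambda>t. x0 + integral {0..t} k + A (w t))"
      by (intro continuous_intros indefinite_integral_continuous_1 ki bounded_linear.continuous_on[OF A] wc) (use T in auto)
    then show ?thesis by (rule continuous_on_eq) simp
  qed
  have diff: "norm (?x b - ?x a) \<le> B * (b - a) + K * norm (w b - w a)" if ab: "0 \<le> a" "a \<le> b" "b \<le> T" for a b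
  proof -
    have "integral {0..a} k + integral {a..b} k = integral {0..b} k"
      by (rule Henstock_Kurzweil_Integration.integral_combine) (use ab ki in auto)
    then have "?x b - ?x a = integral {a..b} k + A (w b - w a)"
      using ab by (simp add: linear_diff[OF bounded_linear.linear[OF A]] algebra_simps)
    then have "norm (?x b - ?x a) \<le> norm (integral {a..b} k) + norm (A (w b - w a))" by (simp add: norm_triangle_ineq)
    moreover have "norm (integral {a..b} k) \<le> B * (b - a)"
      by (rule integral_bound) (use ab B in \<open>auto intro: continuous_on_subset[OF k]\<close>)
    ultimately show ?thesis using K(2)[of "w b - w a"] by (simp add: mult.commute)
  qed
  have ac: "absolutely_continuous_on_Icc T ?x"
    unfolding absolutely_continuous_on_Icc_def
  proof (intro allI impI)
    fix e :: real assume e: "e > 0"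
    have "e / (2 * K) > 0" using e K(1) by simp
    with wac obtain d where d: "d > 0" "\<forall>(N::nat) a b. (\<forall>i<N. 0 \<le> a i \<and> a i \<le> b i \<and> b i \<le> T) \<longrightarrow>
        disjoint_family_on (\<lambda>i. {a i<..<b i}) {..<N} \<longrightarrow> (\<Sum>i<N. b i - a i) < d \<longrightarrow>
        (\<Sum>i<N. norm (w (b i) - w (a i))) < e / (2 * K)"
      unfolding absolutely_continuous_on_Icc_def by (elim allE[of _ "e / (2 * K)"] impE exE conjE)
    show "\<exists>d>0. \<forall>(N::nat) a b. (\<forall>i<N. 0 \<le> a i \<and> a i \<le> b i \<and> b i \<le> T) \<longrightarrow>
        disjoint_family_on (\<lambda>i. {a i<..<b i}) {..<N} \<longrightarrow> (\<Sum>i<N. b i - a i) < d \<longrightarrow>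
        (\<Sum>i<N. norm (?x (b i) - ?x (a i))) < e"
    proof (intro exI[of _ "min d (e / (2 * (B + 1)))"] conjI allI impI)
      show "0 < min d (e / (2 * (B + 1)))" using d(1) e B(1) by simp
      fix N :: nat and a b :: "nat \<Rightarrow> real"
      assume ab: "\<forall>i<N. 0 \<le> a i \<and> a i \<le> b i \<and> b i \<le> T" and dis: "disjoint_family_on (\<lambda>i. {a i<..<b i}) {..<N}"
        and sum: "(\<Sum>i<N. b i - a i) < min d (e / (2 * (B + 1)))"
      have "(\<Sum>i<N. norm (?x (b i) - ?x (a i))) \<le> (\<Sum>i<N. B * (b i - a i) + K * norm (w (b i) - w (a i)))"
        by (intro sum_mono diff) (use ab in auto)
      also have "\<dots> = B * (\<Sum>i<N. b i - a i) + K * (\<Sum>i<N. norm (w (b i) - w (a i)))"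
        by (simp add: sum.distrib sum_distrib_left)
      also have "\<dots> < e / 2 + e / 2"
      proof (rule add_le_less_mono)
        have "B * (\<Sum>i<N. b i - a i) \<le> B * (e / (2 * (B + 1)))" using B(1) sum by (intro mult_left_mono) auto
        also have "\<dots> \<le> (B + 1) * (e / (2 * (B + 1)))" using e B(1) by (intro mult_right_mono) auto
        also have "\<dots> = e / 2" using B(1) by (simp add: field_simps)
        finally show "B * (\<Sum>i<N. b i - a i) \<le> e / 2" .
        have "(\<Sum>i<N. b i - a i) < d" using sum by simp
        with d(2) ab dis have "(\<Sum>i<N. norm (w (b i) - w (a i))) < e / (2 * K)" by blast
        then have "K * (\<Sum>i<N. norm (w (b i) - w (a i))) < K * (e / (2 * K))"
          using K(1) by (intro mult_strict_left_mono) auto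
        then show "K * (\<Sum>i<N. norm (w (b i) - w (a i))) < e / 2" using K(1) by simp
      qed
      finally show "(\<Sum>i<N. norm (?x (b i) - ?x (a i))) < e" by simp
    qed
  qed
  let ?v = "\<lambda>t. k t + A (v t)"
  have Av: "(\<lambda>t. A (v t)) absolutely_integrable_on {0..T}"
    using absolutely_integrable_linear[OF va A] by (simp add: o_def)
  have vabs: "?v absolutely_integrable_on {0..T}"
    by (intro set_integral_add(1) Av absolutely_integrable_continuous_real k)
  have weak: "has_weak_derivative T ?x ?v"
    unfolding has_weak_derivative_def
  proof (intro conjI ballI vabs)
    fix \<phi> assume \<phi>: "\<phi> \<in> test_functions T"
    note tf = test_function_props[OF \<phi>]
    have ic: "continuous_on {0..T} (\<lambda>t. x0 + integral {0..t} k)"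
      by (intro continuous_intros indefinite_integral_continuous_1 ki) (use T in auto)
    have i1: "(\<lambda>t. deriv \<phi> t *\<^sub>R (x0 + integral {0..t} k)) integrable_on {0..T}"
      by (intro integrable_continuous_real continuous_intros tf(3) ic)
    have i2: "(\<lambda>t. deriv \<phi> t *\<^sub>R w t) integrable_on {0..T}"
      by (intro integrable_continuous_real continuous_intros tf(3) wc)
    have i3: "(\<lambda>t. \<phi> t *\<^sub>R v t) integrable_on {0..T}" by (rule test_function_times_integrable[OF \<phi> va])
    have i4: "(\<lambda>t. \<phi> t *\<^sub>R k t) integrable_on {0..T}" by (intro integrable_continuous_real continuous_intros tf(2) k)
    have lin: "A (c *\<^sub>R y) = c *\<^sub>R A y" for c y using A by (simp add: linear_scale bounded_linear.linear)
    have "integral {0..T} (\<lambda>t. deriv \<phi> t *\<^sub>R ?x t)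
      = integral {0..T} (\<lambda>t. deriv \<phi> t *\<^sub>R (x0 + integral {0..t} k) + A (deriv \<phi> t *\<^sub>R w t))"
      by (rule integral_cong) (simp add: lin scaleR_right_distrib)
    also have "\<dots> = integral {0..T} (\<lambda>t. deriv \<phi> t *\<^sub>R (x0 + integral {0..t} k)) + integral {0..T} (\<lambda>t. A (deriv \<phi> t *\<^sub>R w t))"
      using integrable_linear[OF i2 A] by (intro Henstock_Kurzweil_Integration.integral_add i1) (simp add: o_def)
    also have "integral {0..T} (\<lambda>t. A (deriv \<phi> t *\<^sub>R w t)) = A (integral {0..T} (\<lambda>t. deriv \<phi> t *\<^sub>R w t))"
      using integral_linear[OF i2 A] by (simp add: o_def)
    also have "integral {0..T} (\<lambda>t. deriv \<phi> t *\<^sub>R w t) = - integral {0..T} (\<lambda>t. \<phi> t *\<^sub>R v t)"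
      using v(1) \<phi> by (simp add: has_weak_derivative_def)
    also have "A (- integral {0..T} (\<lambda>t. \<phi> t *\<^sub>R v t)) = - integral {0..T} (\<lambda>t. \<phi> t *\<^sub>R A (v t))"
      using integral_linear[OF i3 A] by (simp add: o_def lin linear_neg[OF bounded_linear.linear[OF A]])
    also have "integral {0..T} (\<lambda>t. deriv \<phi> t *\<^sub>R (x0 + integral {0..t} k)) = - integral {0..T} (\<lambda>t. \<phi> t *\<^sub>R k t)"
      by (rule weak_derivative_primitive[OF T k \<phi>])
    also have "- integral {0..T} (\<lambda>t. \<phi> t *\<^sub>R k t) + - integral {0..T} (\<lambda>t. \<phi> t *\<^sub>R A (v t))
       = - integral {0..T} (\<lambda>t. \<phi> t *\<^sub>R ?v t)"
    proof -
      have "(\<lambda>t. \<phi> t *\<^sub>R A (v t)) integrable_on {0..T}" using integrable_linear[OF i3 A] by (simp add: o_def lin)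
      then show ?thesis using i4 by (simp add: scaleR_right_distrib Henstock_Kurzweil_Integration.integral_add)
    qed
    finally show "integral {0..T} (\<lambda>t. deriv \<phi> t *\<^sub>R ?x t) = - integral {0..T} (\<lambda>t. \<phi> t *\<^sub>R ?v t)" .
  qed
  have sq: "(\<lambda>t. (norm (?v t))\<^sup>2) integrable_on {0..T}"
  proof (rule measurable_bounded_by_integrable_imp_integrable_real)
    have "?v \<in> borel_measurable (lebesgue_on {0..T})"
      using vabs by (intro integrable_imp_measurable) (simp add: absolutely_integrable_on_def)
    then show "(\<lambda>t. (norm (?v t))\<^sup>2) \<in> borel_measurable (lebesgue_on {0..T})" by measurable
    show "(\<lambda>t. 2 * B\<^sup>2 + (2 * K\<^sup>2) *\<^sub>R (norm (v t))\<^sup>2) integrable_on {0..T}"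
      by (intro integrable_add integrable_const_ivl integrable_cmul v(2))
    fix t assume t: "t \<in> {0..T}"
    have "norm (?v t) \<le> B + K * norm (v t)"
      using norm_triangle_ineq[of "k t" "A (v t)"] B(2)[OF t] K(2)[of "v t"] by (simp add: mult.commute)
    then have "(norm (?v t))\<^sup>2 \<le> (B + K * norm (v t))\<^sup>2" by (intro power_mono) auto
    also have "\<dots> \<le> 2 * B\<^sup>2 + 2 * (K * norm (v t))\<^sup>2" using sum_squares_bound[of B "K * norm (v t)"] by (simp add: power2_sum)
    finally show "\<bar>(norm (?v t))\<^sup>2\<bar> \<le> 2 * B\<^sup>2 + (2 * K\<^sup>2) *\<^sub>R (norm (v t))\<^sup>2" by (simp add: power_mult_distrib)
  qed simp
  show ?thesis unfolding W2_paths_def using xc ac weak sq by (auto simp: mspace_path_metric)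
qed

theorem path_solution_exists_unique:
  fixes f :: "real \<Rightarrow> real^'n \<Rightarrow> real^'q \<Rightarrow> real^'m \<Rightarrow> real^'n"
    and h :: "real \<Rightarrow> real^'n \<Rightarrow> real^'q \<Rightarrow> real^'m \<Rightarrow> real^'q" and G :: "real^'n^'n"
  assumes T: "T > 0" and w: "w \<in> W2_paths T"
    and fc: "continuous_on ({0..T} \<times> UNIV) (\<lambda>(t, x, z). f t x z \<theta>)"
    and hc: "continuous_on ({0..T} \<times> UNIV) (\<lambda>(t, x, z). h t x z \<theta>)"
    and L: "L > 0" "\<And>t x x' z z'. t \<in> {0..T} \<Longrightarrow> norm (f t x z \<theta> - f t x' z' \<theta>) \<le> L * (norm (x - x') + norm (z - z'))"
       "\<And>t x x' z z'. t \<in> {0..T} \<Longrightarrow> norm (h t x z \<theta> - h t x' z' \<theta>) \<le> L * (norm (x - x') + norm (z - z'))"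
  shows "\<exists>x z. path_solution T f h G w x0 z0 \<theta> x z \<and>
     (\<forall>x' z'. path_solution T f h G w x0 z0 \<theta> x' z' \<longrightarrow> x' = x \<and> z' = z)"
proof -
  define H where "H t y = (f t (fst y) (snd y) \<theta>, h t (fst y) (snd y) \<theta>)" for t and y :: "(real^'n) \<times> (real^'q)"
  have Hc: "continuous_on ({0..T} \<times> UNIV) (\<lambda>(t, y). H t y)"
    using continuous_on_Pair[OF fc hc] by (simp add: H_def case_prod_beta')
  have HL: "norm (H t y - H t y') \<le> (4 * L) * norm (y - y')" if t: "t \<in> {0..T}" for t y y'
  proof -
    have pr: "(fst y - fst y', snd y - snd y') = y - y'" by (simp add: prod_eq_iff)
    have "norm (H t y - H t y') \<le> norm (f t (fst y) (snd y) \<theta> - f t (fst y') (snd y') \<theta>) + norm (h t (fst y) (snd y) \<theta> - h t (fst y') (snd y') \<theta>)"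
      unfolding H_def by (simp add: norm_Pair_le)
    also have "\<dots> \<le> L * (norm (fst y - fst y') + norm (snd y - snd y')) + L * (norm (fst y - fst y') + norm (snd y - snd y'))"
      by (intro add_mono L t)
    also have "\<dots> = (2 * L) * (norm (fst y - fst y') + norm (snd y - snd y'))" by simp
    also have "\<dots> \<le> (2 * L) * (norm (y - y') + norm (y - y'))"
      using L(1) norm_fst_le[of "fst y - fst y'" "snd y - snd y'"] norm_snd_le[of "snd y - snd y'" "fst y - fst y'"]
      unfolding pr by (intro mult_left_mono add_mono) auto
    finally show ?thesis by simp
  qed
  have wc: "continuous_on {0..T} w" using w by (simp add: W2_paths_def mspace_path_metric)
  define g where "g t = (x0 + G *v w t, z0)" for t
  have gc: "continuous_on {0..T} g" unfolding g_def
    by (intro continuous_intros bounded_linear.continuous_on[OF matrix_vector_mul_bounded_linear] wc)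
  have L4: "4 * L > 0" using L(1) by simp
  obtain y where y: "continuous_on {0..T} y" "\<And>t. t \<in> {0..T} \<Longrightarrow> y t = g t + integral {0..t} (\<lambda>s. H s (y s))"
    using integral_equation_exists[OF T Hc L4 HL gc] by blast
  have split: "integral {0..t} (\<lambda>s. H s (y s)) = (integral {0..t} (\<lambda>s. f s (fst (y s)) (snd (y s)) \<theta>), integral {0..t} (\<lambda>s. h s (fst (y s)) (snd (y s)) \<theta>))"
    if y: "continuous_on {0..T} y" and t: "t \<in> {0..T}" for y t
  proof -
    have i: "(\<lambda>s. H s (y s)) integrable_on {0..t}"
      by (intro integrable_continuous_real continuous_on_subset[OF integrand_continuous[OF Hc y]]) (use t in auto)
    show ?thesis
      using integral_linear[OF i bounded_linear_fst] integral_linear[OF i bounded_linear_snd]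
      by (simp add: o_def H_def prod_eq_iff)
  qed
  define x where "x = (\<lambda>t\<in>{0..T}. fst (y t))"
  define z where "z = (\<lambda>t\<in>{0..T}. snd (y t))"
  have fi: "continuous_on {0..T} (\<lambda>s. f s (fst (y s)) (snd (y s)) \<theta>)" "continuous_on {0..T} (\<lambda>s. h s (fst (y s)) (snd (y s)) \<theta>)"
    using continuous_on_fst[OF integrand_continuous[OF Hc y(1)]] continuous_on_snd[OF integrand_continuous[OF Hc y(1)]]
    by (simp_all add: H_def)
  have xeq: "x = (\<lambda>t\<in>{0..T}. x0 + integral {0..t} (\<lambda>s. f s (fst (y s)) (snd (y s)) \<theta>) + G *v w t)"
    unfolding x_def by (intro restrict_ext) (simp add: y(2) split[OF y(1)] g_def)
  have zeq: "z = (\<lambda>t\<in>{0..T}. z0 + integral {0..t} (\<lambda>s. h s (fst (y s)) (snd (y s)) \<theta>) + (\<lambda>_. 0) (w t))"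
    unfolding z_def by (intro restrict_ext) (simp add: y(2) split[OF y(1)] g_def)
  have cong: "integral {0..t} (\<lambda>s. f s (x s) (z s) \<theta>) = integral {0..t} (\<lambda>s. f s (fst (y s)) (snd (y s)) \<theta>)"
    "integral {0..t} (\<lambda>s. h s (x s) (z s) \<theta>) = integral {0..t} (\<lambda>s. h s (fst (y s)) (snd (y s)) \<theta>)" if "t \<in> {0..T}" for t
    using that by (auto intro!: integral_cong simp: x_def z_def)
  have sol: "path_solution T f h G w x0 z0 \<theta> x z"
    unfolding path_solution_def
  proof (intro conjI ballI)
    show "x \<in> W2_paths T" unfolding xeq
      by (intro W2_paths_primitive_plus_linear T w matrix_vector_mul_bounded_linear fi)
    show "z \<in> W2_paths T" unfolding zeq
      by (rule W2_paths_primitive_plus_linear[OF T w bounded_linear_zero fi(2)])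
    fix t assume t: "t \<in> {0..T}"
    show "x t = x0 + integral {0..t} (\<lambda>\<tau>. f \<tau> (x \<tau>) (z \<tau>) \<theta>) + G *v w t" unfolding cong[OF t] using t by (simp add: xeq)
    show "z t = z0 + integral {0..t} (\<lambda>\<tau>. h \<tau> (x \<tau>) (z \<tau>) \<theta>)" unfolding cong[OF t] using t by (simp add: zeq)
  qed
  have "x' = x \<and> z' = z" if sol': "path_solution T f h G w x0 z0 \<theta> x' z'" for x' z'
  proof -
    define y' where "y' t = (x' t, z' t)" for t
    have ext: "x' \<in> extensional {0..T}" "z' \<in> extensional {0..T}" and xc: "continuous_on {0..T} x'" "continuous_on {0..T} z'"
      using sol' by (auto simp: path_solution_def W2_paths_def mspace_path_metric)
    have yc': "continuous_on {0..T} y'" unfolding y'_def by (intro continuous_intros xc)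
    have yeq': "y' t = g t + integral {0..t} (\<lambda>s. H s (y' s))" if t: "t \<in> {0..T}" for t
      using sol' t unfolding split[OF yc' t] by (simp add: path_solution_def y'_def g_def)
    have Hi: "(\<lambda>s. H s (y s)) integrable_on {0..t}" if "continuous_on {0..T} y" "t \<in> {0..T}" for y t
      by (intro integrable_continuous_real continuous_on_subset[OF integrand_continuous[OF Hc that(1)]]) (use that in auto)
    have "norm (y' t - y t) \<le> 2 * 0 * exp (2 * (4 * L) * t)" if t: "t \<in> {0..T}" for t
    proof (rule weak_gronwall[where T=T and u="\<lambda>t. norm (y' t - y t)"])
      show "continuous_on {0..T} (\<lambda>t. norm (y' t - y t))" by (intro continuous_intros yc' y)
      fix t assume t: "t \<in> {0..T}"
      have "y' t - y t = integral {0..t} (\<lambda>s. H s (y' s) - H s (y s))"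
        using yeq'[OF t] y(2)[OF t] Hi[OF yc' t] Hi[OF y(1) t] by (simp add: Henstock_Kurzweil_Integration.integral_diff)
      also have "norm \<dots> \<le> integral {0..t} (\<lambda>s. (4 * L) * norm (y' s - y s))"
      proof (rule integral_norm_bound_integral)
        show "(\<lambda>s. H s (y' s) - H s (y s)) integrable_on {0..t}"
          by (intro integrable_diff Hi[OF yc' t] Hi[OF y(1) t])
        show "(\<lambda>s. (4 * L) * norm (y' s - y s)) integrable_on {0..t}"
          by (intro integrable_continuous_real continuous_intros continuous_on_subset[OF yc'] continuous_on_subset[OF y(1)])
            (use t in auto)
        show "norm (H s (y' s) - H s (y s)) \<le> (4 * L) * norm (y' s - y s)" if "s \<in> {0..t}" for s
          using HL[of s "y' s" "y s"] that t by auto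
      qed
      finally show "norm (y' t - y t) \<le> 0 + (4 * L) * integral {0..t} (\<lambda>t. norm (y' t - y t))" by simp
    qed (use L T t in auto)
    then have yy: "y' t = y t" if "t \<in> {0..T}" for t using that by force
    have "x' t = x t" "z' t = z t" if "t \<in> {0..T}" for t
      using that yy[OF that] by (cases "y t"; simp add: x_def z_def y'_def)+
    then show ?thesis
      using ext by (auto simp: x_def z_def intro!: extensionalityI[of _ "{0..T}"])
  qed
  with sol show ?thesis by blast
qed

text \<open>
  Uniform continuity compares the drifts for \<open>\<theta>'\<close> and \<open>\<theta>\<close>, uniformly along the path \<open>(x', z')\<close>, and
  the Lipschitz condition for \<open>\<theta>\<close> compares the two paths. The sum \<open>|x' - x| + |z' - z|\<close> then satisfies Gronwall's
  inequality with a small constant term.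
\<close>

theorem path_solution_stable:
  fixes f :: "real \<Rightarrow> real^'n \<Rightarrow> real^'q \<Rightarrow> real^'m \<Rightarrow> real^'n"
    and h :: "real \<Rightarrow> real^'n \<Rightarrow> real^'q \<Rightarrow> real^'m \<Rightarrow> real^'q" and G :: "real^'n^'n"
  assumes T: "T > 0" and \<theta>: "\<theta> \<in> S" and e: "e > 0"
    and fu: "uniformly_continuous_on ({0..T} \<times> UNIV \<times> UNIV \<times> S) (\<lambda>(t, x, z, \<theta>). f t x z \<theta>)"
    and hu: "uniformly_continuous_on ({0..T} \<times> UNIV \<times> UNIV \<times> S) (\<lambda>(t, x, z, \<theta>). h t x z \<theta>)"
    and L: "L > 0" "\<And>t x x' z z'. t \<in> {0..T} \<Longrightarrow> norm (f t x z \<theta> - f t x' z' \<theta>) \<le> L * (norm (x - x') + norm (z - z'))"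
       "\<And>t x x' z z'. t \<in> {0..T} \<Longrightarrow> norm (h t x z \<theta> - h t x' z' \<theta>) \<le> L * (norm (x - x') + norm (z - z'))"
    and xc: "continuous_on {0..T} x" and zc: "continuous_on {0..T} z"
    and x: "\<And>t. t \<in> {0..T} \<Longrightarrow> x t = x0 + integral {0..t} (\<lambda>s. f s (x s) (z s) \<theta>) + G *v w t"
    and z: "\<And>t. t \<in> {0..T} \<Longrightarrow> z t = z0 + integral {0..t} (\<lambda>s. h s (x s) (z s) \<theta>)"
  obtains d where "d > 0" "\<And>x' z' w' x0' z0' \<theta>'. \<lbrakk>\<theta>' \<in> S; norm (\<theta>' - \<theta>) < d; norm (x0' - x0) < d; norm (z0' - z0) < d;
      \<And>t. t \<in> {0..T} \<Longrightarrow> norm (w t - w' t) < d; continuous_on {0..T} x'; continuous_on {0..T} z';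
      \<And>t. t \<in> {0..T} \<Longrightarrow> x' t = x0' + integral {0..t} (\<lambda>s. f s (x' s) (z' s) \<theta>') + G *v w' t;
      \<And>t. t \<in> {0..T} \<Longrightarrow> z' t = z0' + integral {0..t} (\<lambda>s. h s (x' s) (z' s) \<theta>')\<rbrakk>
      \<Longrightarrow> \<forall>t\<in>{0..T}. norm (x' t - x t) \<le> e \<and> norm (z' t - z t) \<le> e"
proof -
  obtain K where K: "K > 0" "\<And>v. norm (G *v v) \<le> norm v * K"
    using bounded_linear.pos_bounded[OF matrix_vector_mul_bounded_linear[of G]] by blast
  \<comment> \<open>the constant term in Gronwall's inequality is (2 + K) * d + 2 * T * \<eta>; \<eta> and d are chosen such that its two summands contribute at most e / 2 each\<close>
  define E where "E = exp (2 * (2 * L) * T)"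
  have E: "E > 0" by (simp add: E_def)
  define \<eta> where "\<eta> = e / (8 * T * E)"
  have \<eta>: "\<eta> > 0" using e T E by (simp add: \<eta>_def)
  from fu[unfolded uniformly_continuous_on_def, rule_format, OF \<eta>]
  obtain d1 where d1: "d1 > 0" "\<forall>p\<in>{0..T} \<times> UNIV \<times> UNIV \<times> S. \<forall>p'\<in>{0..T} \<times> UNIV \<times> UNIV \<times> S. dist p' p < d1 \<longrightarrow>
      dist (case p' of (t, x, z, \<theta>) \<Rightarrow> f t x z \<theta>) (case p of (t, x, z, \<theta>) \<Rightarrow> f t x z \<theta>) < \<eta>"
    by (elim exE conjE)
  from hu[unfolded uniformly_continuous_on_def, rule_format, OF \<eta>]
  obtain d2 where d2: "d2 > 0" "\<forall>p\<in>{0..T} \<times> UNIV \<times> UNIV \<times> S. \<forall>p'\<in>{0..T} \<times> UNIV \<times> UNIV \<times> S. dist p' p < d2 \<longrightarrow>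
      dist (case p' of (t, x, z, \<theta>) \<Rightarrow> h t x z \<theta>) (case p of (t, x, z, \<theta>) \<Rightarrow> h t x z \<theta>) < \<eta>"
    by (elim exE conjE)
  define d where "d = min (min d1 d2) (e / (4 * E * (2 + K)))"
  have d: "d > 0" using d1 d2 e E K by (simp add: d_def)
  have dle: "d \<le> d1" "d \<le> d2" "d \<le> e / (4 * E * (2 + K))" by (auto simp: d_def)
  have fint: "continuous_on {0..T} (\<lambda>s. f s (x' s) (z' s) \<theta>')" "continuous_on {0..T} (\<lambda>s. h s (x' s) (z' s) \<theta>')"
    if "continuous_on {0..T} x'" "continuous_on {0..T} z'" "\<theta>' \<in> S" for x' z' \<theta>'
  proof -
    have c: "continuous_on {0..T} (\<lambda>s. (s, x' s, z' s, \<theta>'))" by (intro continuous_intros that)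
    show "continuous_on {0..T} (\<lambda>s. f s (x' s) (z' s) \<theta>')"
    proof -
      have "continuous_on {0..T} (\<lambda>s. case (s, x' s, z' s, \<theta>') of (t, x, z, \<theta>) \<Rightarrow> f t x z \<theta>)"
        by (rule continuous_on_compose2[OF uniformly_continuous_imp_continuous[OF fu] c]) (use that(3) in auto)
      then show ?thesis by simp
    qed
    show "continuous_on {0..T} (\<lambda>s. h s (x' s) (z' s) \<theta>')"
    proof -
      have "continuous_on {0..T} (\<lambda>s. case (s, x' s, z' s, \<theta>') of (t, x, z, \<theta>) \<Rightarrow> h t x z \<theta>)"
        by (rule continuous_on_compose2[OF uniformly_continuous_imp_continuous[OF hu] c]) (use that(3) in auto)
      then show ?thesis by simp
    qed
  qed
  show ?thesis
  proof (rule that[OF d])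
    fix x' z' w' x0' z0' \<theta>'
    assume \<theta>': "\<theta>' \<in> S" "norm (\<theta>' - \<theta>) < d" and i: "norm (x0' - x0) < d" "norm (z0' - z0) < d"
      and w': "\<And>t. t \<in> {0..T} \<Longrightarrow> norm (w t - w' t) < d" and c': "continuous_on {0..T} x'" "continuous_on {0..T} z'"
      and x': "\<And>t. t \<in> {0..T} \<Longrightarrow> x' t = x0' + integral {0..t} (\<lambda>s. f s (x' s) (z' s) \<theta>') + G *v w' t"
      and z': "\<And>t. t \<in> {0..T} \<Longrightarrow> z' t = z0' + integral {0..t} (\<lambda>s. h s (x' s) (z' s) \<theta>')"
    let ?u = "\<lambda>t. norm (x' t - x t) + norm (z' t - z t)"
    have uc: "continuous_on {0..T} ?u" by (intro continuous_intros c' xc zc)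
    have fd: "norm (f s (x' s) (z' s) \<theta>' - f s (x s) (z s) \<theta>) \<le> \<eta> + L * ?u s" if s: "s \<in> {0..T}" for s
    proof -
      have "norm (f s (x' s) (z' s) \<theta>' - f s (x' s) (z' s) \<theta>) < \<eta>"
        using d1(2)[rule_format, of "(s, x' s, z' s, \<theta>)" "(s, x' s, z' s, \<theta>')"] s \<theta> \<theta>' dle by (simp add: dist_Pair_Pair dist_norm)
      then show ?thesis using L(2)[OF s, of "x' s" "z' s" "x s" "z s"]
          norm_triangle_ineq[of "f s (x' s) (z' s) \<theta>' - f s (x' s) (z' s) \<theta>" "f s (x' s) (z' s) \<theta> - f s (x s) (z s) \<theta>"]
        by simp
    qed
    have hd: "norm (h s (x' s) (z' s) \<theta>' - h s (x s) (z s) \<theta>) \<le> \<eta> + L * ?u s" if s: "s \<in> {0..T}" for s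
    proof -
      have "norm (h s (x' s) (z' s) \<theta>' - h s (x' s) (z' s) \<theta>) < \<eta>"
        using d2(2)[rule_format, of "(s, x' s, z' s, \<theta>)" "(s, x' s, z' s, \<theta>')"] s \<theta> \<theta>' dle by (simp add: dist_Pair_Pair dist_norm)
      then show ?thesis using L(3)[OF s, of "x' s" "z' s" "x s" "z s"]
          norm_triangle_ineq[of "h s (x' s) (z' s) \<theta>' - h s (x' s) (z' s) \<theta>" "h s (x' s) (z' s) \<theta> - h s (x s) (z s) \<theta>"]
        by simp
    qed
    have bound: "norm (integral {0..t} k' - integral {0..t} k) \<le> T * \<eta> + L * integral {0..t} ?u"
      if t: "t \<in> {0..T}" and k: "continuous_on {0..T} k" "continuous_on {0..T} k'"
        and le: "\<And>s. s \<in> {0..T} \<Longrightarrow> norm (k' s - k s) \<le> \<eta> + L * ?u s" for t and k k' :: "real \<Rightarrow> 'b::euclidean_space"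
    proof -
      have sub: "{0..t} \<subseteq> {0..T}" using t by auto
      have ki: "k integrable_on {0..t}" "k' integrable_on {0..t}"
        by (intro integrable_continuous_real continuous_on_subset[OF _ sub] k)+
      have ui: "?u integrable_on {0..t}" by (intro integrable_continuous_real continuous_on_subset[OF uc sub])
      have Lui: "(\<lambda>s. L * ?u s) integrable_on {0..t}"
        by (intro integrable_continuous_real continuous_on_mult_left continuous_on_subset[OF uc sub])
      have "norm (integral {0..t} k' - integral {0..t} k) = norm (integral {0..t} (\<lambda>s. k' s - k s))"
        using ki by (simp add: Henstock_Kurzweil_Integration.integral_diff)
      also have "\<dots> \<le> integral {0..t} (\<lambda>s. \<eta> + L * ?u s)"
        by (intro integral_norm_bound_integral integrable_diff ki integrable_add integrable_const_ivl
            Lui le) (use sub in auto)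
      also have "\<dots> = t * \<eta> + L * integral {0..t} ?u"
        using t by (subst Henstock_Kurzweil_Integration.integral_add[OF integrable_const_ivl Lui]) auto
      also have "\<dots> \<le> T * \<eta> + L * integral {0..t} ?u" using t \<eta> by simp
      finally show ?thesis .
    qed
    have u: "?u t \<le> (2 + K) * d + 2 * T * \<eta> + (2 * L) * integral {0..t} ?u" if t: "t \<in> {0..T}" for t
    proof -
      let ?F = "integral {0..t} (\<lambda>s. f s (x' s) (z' s) \<theta>') - integral {0..t} (\<lambda>s. f s (x s) (z s) \<theta>)"
      let ?H = "integral {0..t} (\<lambda>s. h s (x' s) (z' s) \<theta>') - integral {0..t} (\<lambda>s. h s (x s) (z s) \<theta>)"
      have F: "norm ?F \<le> T * \<eta> + L * integral {0..t} ?u"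
        by (rule bound[OF t fint(1)[OF xc zc \<theta>] fint(1)[OF c' \<theta>'(1)] fd])
      have H: "norm ?H \<le> T * \<eta> + L * integral {0..t} ?u"
        by (rule bound[OF t fint(2)[OF xc zc \<theta>] fint(2)[OF c' \<theta>'(1)] hd])
      have tri3: "norm v \<le> norm a + norm b + norm c" if "v = a + b + c" for v a b c :: "real^'n"
        unfolding that by (intro norm_triangle_le add_right_mono norm_triangle_ineq)
      have Kd: "(2 + K) * d = d + d + d * K" by (simp add: algebra_simps)
      have "x' t - x t = (x0' - x0) + ?F + G *v (w' t - w t)"
        unfolding x[OF t] x'[OF t] by (simp add: matrix_vector_mult_diff_distrib)
      then have "norm (x' t - x t) \<le> norm (x0' - x0) + norm ?F + norm (G *v (w' t - w t))"
        by (rule tri3)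
      moreover have "norm (G *v (w' t - w t)) \<le> d * K"
      proof (rule order_trans[OF K(2)])
        show "norm (w' t - w t) * K \<le> d * K"
          using w'[OF t] K(1) by (intro mult_right_mono) (auto simp: norm_minus_commute)
      qed
      moreover have "z' t - z t = (z0' - z0) + ?H" unfolding z[OF t] z'[OF t] by simp
      then have "norm (z' t - z t) \<le> norm (z0' - z0) + norm ?H" by (simp only: norm_triangle_ineq)
      ultimately show ?thesis using F H i unfolding Kd by linarith
    qed
    show "\<forall>t\<in>{0..T}. norm (x' t - x t) \<le> e \<and> norm (z' t - z t) \<le> e"
    proof
      fix t assume t: "t \<in> {0..T}"
      have "?u t \<le> 2 * ((2 + K) * d + 2 * T * \<eta>) * exp (2 * (2 * L) * t)"
        by (rule weak_gronwall[OF uc _ _ u _ t]) (use L T K d \<eta> in auto)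
      also have "\<dots> \<le> 2 * ((2 + K) * d + 2 * T * \<eta>) * E"
        unfolding E_def using t L T K d \<eta> by (intro mult_left_mono) auto
      also have "\<dots> = 2 * E * (2 + K) * d + 4 * T * E * \<eta>" by (simp add: algebra_simps)
      also have "\<dots> \<le> e / 2 + e / 2"
      proof (rule add_mono)
        have "2 * E * (2 + K) * d \<le> 2 * E * (2 + K) * (e / (4 * E * (2 + K)))"
          using E K dle by (intro mult_left_mono) auto
        also have "\<dots> = 2 * (E * (2 + K)) * (e / (4 * (E * (2 + K))))" by (simp only: mult.assoc)
        also have "\<dots> = e / 2"
        proof -
          have c: "2 * c * (e / (4 * c)) = e / 2" if "c > 0" for c :: real using that by simp
          show ?thesis by (rule c) (use E K in simp)
        qed
        finally show "2 * E * (2 + K) * d \<le> e / 2" .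
        show "4 * T * E * \<eta> \<le> e / 2" using E T by (simp add: \<eta>_def field_simps)
      qed
      finally show "norm (x' t - x t) \<le> e \<and> norm (z' t - z t) \<le> e"
        using norm_ge_zero[of "x' t - x t"] norm_ge_zero[of "z' t - z t"] by linarith
    qed
  qed
qed

section \<open>Continuous functionals of paths\<close>

lemma mdist_path_metric_le:
  fixes x x' :: "real \<Rightarrow> 'e::euclidean_space"
  assumes "0 \<le> d" "\<And>t. t \<in> {0..T} \<Longrightarrow> norm (x t - x' t) \<le> d"
  shows "mdist (path_metric T) x x' \<le> d"
  unfolding path_metric_def using assms by (intro mdist_cfunspace_le) (auto simp: dist_norm)

text \<open>
  Continuity for the product topology in terms of pointwise bounds on the paths.
\<close>

lemma state_topology_continuous_near:
  fixes p :: "(real \<Rightarrow> 'e::euclidean_space) \<times> (real \<Rightarrow> 'f::euclidean_space) \<times> 'g::euclidean_space \<Rightarrow> real"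
  assumes p: "continuous_map (state_topology T) euclideanreal p"
    and x: "x \<in> mspace (path_metric T)" and z: "z \<in> mspace (path_metric T)" and e: "e > 0"
  obtains d where "d > 0" "\<And>x' z' \<theta>'. \<lbrakk>x' \<in> mspace (path_metric T); z' \<in> mspace (path_metric T);
     \<And>t. t \<in> {0..T} \<Longrightarrow> norm (x' t - x t) \<le> d; \<And>t. t \<in> {0..T} \<Longrightarrow> norm (z' t - z t) \<le> d; norm (\<theta>' - \<theta>) \<le> d\<rbrakk>
     \<Longrightarrow> \<bar>p (x', z', \<theta>') - p (x, z, \<theta>)\<bar> < e"
proof -
  let ?m = "prod_metric (path_metric T) (prod_metric (path_metric T) euclidean_metric)
    :: ((real \<Rightarrow> 'e) \<times> (real \<Rightarrow> 'f) \<times> 'g) metric"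
  have "continuous_map (mtopology_of ?m) (mtopology_of euclidean_metric) p"
    using p by (simp add: state_topology_def)
  then have "\<forall>a\<in>mspace ?m. \<forall>e>0. \<exists>d>0. \<forall>x. x \<in> mspace ?m \<and> mdist ?m a x < d \<longrightarrow> mdist euclidean_metric (p a) (p x) < e"
    unfolding mtopology_of_def
    by (subst (asm) Metric_space.metric_continuous_map[OF Metric_space_mspace_mdist Metric_space_mspace_mdist]) blast
  moreover have "(x, z, \<theta>) \<in> mspace ?m" using x z by simp
  ultimately obtain d where d: "d > 0" "\<And>a. a \<in> mspace ?m \<Longrightarrow> mdist ?m (x, z, \<theta>) a < d \<Longrightarrow> dist (p (x, z, \<theta>)) (p a) < e"
    using e by (metis mdist_euclidean_metric)
  \<comment> \<open>the distance in the product is at most the sum of the three distances\<close>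
  show ?thesis
  proof (rule that[of "d / 4"])
    fix x' :: "real \<Rightarrow> 'e" and z' :: "real \<Rightarrow> 'f" and \<theta>' :: 'g
    assume m: "x' \<in> mspace (path_metric T)" "z' \<in> mspace (path_metric T)"
      and c: "\<And>t. t \<in> {0..T} \<Longrightarrow> norm (x' t - x t) \<le> d / 4" "\<And>t. t \<in> {0..T} \<Longrightarrow> norm (z' t - z t) \<le> d / 4" "norm (\<theta>' - \<theta>) \<le> d / 4"
    have "mdist (path_metric T) x x' \<le> d / 4" "mdist (path_metric T) z z' \<le> d / 4"
      using c d by (intro mdist_path_metric_le; simp add: norm_minus_commute)+
    moreover have "dist \<theta> \<theta>' \<le> d / 4" using c by (simp add: dist_norm norm_minus_commute)
    moreover have "mdist ?m (x, z, \<theta>) (x', z', \<theta>')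
       \<le> mdist (path_metric T) x x' + (mdist (path_metric T) z z' + dist \<theta> \<theta>')"
    proof -
      have le: "sqrt (a\<^sup>2 + b\<^sup>2) \<le> a + b" if "0 \<le> a" "0 \<le> b" for a b :: real
        using sqrt_sum_squares_le_sum[of a b] that by simp
      then show ?thesis
        unfolding mdist_prod_metric prod_dist_def prod.case mdist_euclidean_metric
        by (rule order_trans[OF _ add_left_mono]) (auto intro!: le)
    qed
    ultimately have "mdist ?m (x, z, \<theta>) (x', z', \<theta>') < d" using d by linarith
    from d(2)[OF _ this] m show "\<bar>p (x', z', \<theta>') - p (x, z, \<theta>)\<bar> < e" by (simp add: dist_real_def abs_minus_commute)
  qed (use d in simp)
qed

lemma path_of_in_mspace:
  assumes "continuous_on {0..T} (\<lambda>t. X t \<omega>)"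
  shows "path_of T X \<omega> \<in> mspace (path_metric T)"
proof -
  have "continuous_on {0..T} (path_of T X \<omega>)" by (rule continuous_on_eq[OF assms]) (simp add: path_of_def)
  then show ?thesis by (simp add: mspace_path_metric path_of_def)
qed

text \<open>
  The Bernstein polynomial of degree \<open>N\<close> with the coefficients \<open>a\<close>, rescaled to \<open>[0, T]\<close>: it depends on
  finitely many values of a path only and, as a function of them, continuously.
\<close>

definition bernstein_path :: "real \<Rightarrow> nat \<Rightarrow> (nat \<Rightarrow> 'e::euclidean_space) \<Rightarrow> real \<Rightarrow> 'e" where
  "bernstein_path T N a = (\<lambda>t\<in>{0..T}. \<Sum>k\<le>N. Bernstein N k (t / T) *\<^sub>R a k)"

lemma bernstein_path_in_mspace: "bernstein_path T N a \<in> mspace (path_metric T)"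
proof -
  have "continuous_on {0..T} (\<lambda>t. \<Sum>k\<le>N. Bernstein N k (t / T) *\<^sub>R a k)"
    unfolding Bernstein_def by (cases "T = 0") (auto intro!: continuous_intros)
  then have "continuous_on {0..T} (bernstein_path T N a)" by (rule continuous_on_eq) (simp add: bernstein_path_def)
  then show ?thesis by (simp add: mspace_path_metric bernstein_path_def)
qed

lemma bernstein_path_diff:
  assumes T: "T > 0" and t: "t \<in> {0..T}"
  shows "norm (bernstein_path T N a t - bernstein_path T N b t) \<le> (\<Sum>k\<le>N. norm (a k - b k))"
proof -
  have "bernstein_path T N a t - bernstein_path T N b t = (\<Sum>k\<le>N. Bernstein N k (t / T) *\<^sub>R (a k - b k))"
    using t by (simp add: bernstein_path_def sum_subtractf scaleR_diff_right)
  also have "norm \<dots> \<le> (\<Sum>k\<le>N. norm (Bernstein N k (t / T) *\<^sub>R (a k - b k)))" by (rule norm_sum)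
  also have "\<dots> \<le> (\<Sum>k\<le>N. norm (a k - b k))"
  proof (rule sum_mono)
    fix k assume k: "k \<in> {..N}"
    have nn: "0 \<le> Bernstein N j (t / T)" for j using t T by (intro Bernstein_nonneg) auto
    have "Bernstein N k (t / T) \<le> (\<Sum>k\<le>N. Bernstein N k (t / T))" using k nn by (intro member_le_sum) auto
    then have "Bernstein N k (t / T) \<le> 1" by simp
    then show "norm (Bernstein N k (t / T) *\<^sub>R (a k - b k)) \<le> norm (a k - b k)" using nn by (simp add: mult_left_le_one_le)
  qed
  finally show ?thesis .
qed

lemma bernstein_path_converges:
  fixes x :: "real \<Rightarrow> 'e::euclidean_space"
  assumes T: "T > 0" and x: "continuous_on {0..T} x" and e: "e > 0"
  shows "\<forall>\<^sub>F N in sequentially. \<forall>t\<in>{0..T}. norm (bernstein_path T N (\<lambda>k. x (T * (k / N))) t - x t) \<le> e"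
proof -
  let ?D = "real DIM('e)"
  have D: "?D > 0" by simp
  have "\<forall>\<^sub>F N in sequentially. \<forall>i\<in>Basis. \<forall>s\<in>{0..1}.
      \<bar>x (T * s) \<bullet> i - (\<Sum>k\<le>N. (x (T * (k / N)) \<bullet> i) * Bernstein N k s)\<bar> < e / ?D"
  proof (rule eventually_ball_finite[OF finite_Basis], rule)
    fix i :: 'e assume i: "i \<in> Basis"
    have "continuous_on {0..1} (\<lambda>s. x (T * s))"
      using T by (intro continuous_on_compose2[OF x] continuous_intros) (auto simp: mult_left_le)
    then have "continuous_on {0..1} (\<lambda>s. x (T * s) \<bullet> i)" by (intro continuous_intros)
    from Bernstein_Weierstrass[OF this, of "e / ?D"] e D obtain N0 where
      "\<forall>n x'. N0 \<le> n \<and> x' \<in> {0..1} \<longrightarrow> \<bar>x (T * x') \<bullet> i - (\<Sum>k\<le>n. x (T * (k / n)) \<bullet> i * Bernstein n k x')\<bar> < e / ?D"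
      by auto
    then show "\<forall>\<^sub>F N in sequentially. \<forall>s\<in>{0..1}. \<bar>x (T * s) \<bullet> i - (\<Sum>k\<le>N. (x (T * (k / N)) \<bullet> i) * Bernstein N k s)\<bar> < e / ?D"
      unfolding eventually_sequentially by blast
  qed
  then show ?thesis
  proof eventually_elim
    case (elim N)
    show ?case
    proof
      fix t assume t: "t \<in> {0..T}"
      let ?v = "bernstein_path T N (\<lambda>k. x (T * (k / N))) t - x t"
      have "norm ?v \<le> (\<Sum>i\<in>Basis. \<bar>?v \<bullet> i\<bar>)" by (rule norm_le_l1)
      also have "\<dots> \<le> (\<Sum>i\<in>(Basis :: 'e set). e / ?D)"
      proof (rule sum_mono)
        fix i :: 'e assume i: "i \<in> Basis"
        have "t / T \<in> {0..1}" using t T by auto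
        with elim i have "\<bar>x (T * (t / T)) \<bullet> i - (\<Sum>k\<le>N. (x (T * (k / N)) \<bullet> i) * Bernstein N k (t / T))\<bar> < e / ?D" by blast
        then show "\<bar>?v \<bullet> i\<bar> \<le> e / ?D"
          using t T by (simp add: bernstein_path_def inner_diff_left inner_sum_left mult.commute abs_minus_commute)
      qed
      also have "\<dots> = e" by simp
      finally show "norm ?v \<le> e" .
    qed
  qed
qed

lemma continuous_bernstein_path:
  assumes T: "T > 0"
  shows "continuous_map euclidean (mtopology_of (path_metric T)) (bernstein_path T N :: (nat \<Rightarrow> 'e::euclidean_space) \<Rightarrow> _)"
  unfolding mtopology_of_def Metric_space.continuous_map_to_metric[OF Metric_space_mspace_mdist]
proof (intro ballI allI impI)
  fix a :: "nat \<Rightarrow> 'e" and e :: real assume e: "e > 0"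
  let ?U = "{b. (\<Sum>k\<le>N. norm (a k - b k)) < e / 2}"
  have "open ?U" by (intro open_Collect_less continuous_intros continuous_on_product_coordinates)
  moreover have "a \<in> ?U" using e by simp
  moreover have "bernstein_path T N b \<in> Metric_space.mball (mspace (path_metric T)) (mdist (path_metric T)) (bernstein_path T N a) e"
    if "b \<in> ?U" for b
  proof -
    have "mdist (path_metric T) (bernstein_path T N a) (bernstein_path T N b) \<le> e / 2"
    proof (rule mdist_path_metric_le)
      fix t assume t: "t \<in> {0..T}"
      show "norm (bernstein_path T N a t - bernstein_path T N b t) \<le> e / 2"
        using bernstein_path_diff[OF T t, of N a b] that by simp
    qed (use e in simp)
    then show ?thesis using e by (simp add: Metric_space.in_mball[OF Metric_space_mspace_mdist] bernstein_path_in_mspace)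
  qed
  ultimately show "\<exists>U. openin euclidean U \<and> a \<in> U \<and>
      (\<forall>y\<in>U. bernstein_path T N y \<in> Metric_space.mball (mspace (path_metric T)) (mdist (path_metric T)) (bernstein_path T N a) e)"
    by auto
qed

text \<open>
  Evaluated on Bernstein polynomials, the functional is a continuous function of finitely many
  coordinates of the paths and hence measurable; these polynomials converge uniformly.
\<close>

theorem path_functional_measurable:
  fixes p :: "(real \<Rightarrow> 'e::euclidean_space) \<times> (real \<Rightarrow> 'f::euclidean_space) \<times> 'g::euclidean_space \<Rightarrow> real"
  assumes T: "T > 0" and p: "continuous_map (state_topology T) euclideanreal p"
    and X: "\<And>t. t \<in> {0..T} \<Longrightarrow> X t \<in> borel_measurable M" "\<And>\<omega>. \<omega> \<in> space M \<Longrightarrow> continuous_on {0..T} (\<lambda>t. X t \<omega>)"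
    and Z: "\<And>t. t \<in> {0..T} \<Longrightarrow> Z t \<in> borel_measurable M" "\<And>\<omega>. \<omega> \<in> space M \<Longrightarrow> continuous_on {0..T} (\<lambda>t. Z t \<omega>)"
    and \<Theta>: "\<Theta> \<in> borel_measurable M"
  shows "(\<lambda>\<omega>. p (path_of T X \<omega>, path_of T Z \<omega>, \<Theta> \<omega>)) \<in> borel_measurable M"
proof -
  define q where "q N = (\<lambda>(a :: nat \<Rightarrow> 'e, b :: nat \<Rightarrow> 'f, c :: 'g). p (bernstein_path T N a, bernstein_path T N b, c))" for N
  \<comment> \<open>the index is capped such that the nodes stay in [0, T]; the polynomial of degree N ignores larger k\<close>
  have nodes: "T * (real (min k N) / real N) \<in> {0..T}" for k N :: nat
  proof -
    have "real (min k N) / real N \<le> 1" by (cases "N = 0") auto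
    then have "T * (real (min k N) / real N) \<le> T * 1" using T by (intro mult_left_mono) auto
    then show ?thesis using T by simp
  qed
  have q: "q N \<in> borel_measurable borel" for N
  proof (rule borel_measurable_continuous_onI)
    let ?g = "\<lambda>u :: (nat \<Rightarrow> 'e) \<times> (nat \<Rightarrow> 'f) \<times> 'g. (bernstein_path T N (fst u), bernstein_path T N (fst (snd u)), snd (snd u))"
    have "continuous_map euclidean (state_topology T) ?g"
      unfolding state_topology_def
    proof (intro continuous_map_pairedI)
      have "continuous_map euclidean euclidean (fst :: (nat \<Rightarrow> 'e) \<times> (nat \<Rightarrow> 'f) \<times> 'g \<Rightarrow> _)"
        unfolding continuous_map_iff_continuous2 by (intro continuous_intros)
      from continuous_map_compose[OF this continuous_bernstein_path[OF T]]
      show "continuous_map euclidean (mtopology_of (path_metric T)) (\<lambda>u :: (nat \<Rightarrow> 'e) \<times> (nat \<Rightarrow> 'f) \<times> 'g. bernstein_path T N (fst u))"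
        by (simp add: o_def)
      have "continuous_map euclidean euclidean (\<lambda>u :: (nat \<Rightarrow> 'e) \<times> (nat \<Rightarrow> 'f) \<times> 'g. fst (snd u))"
        unfolding continuous_map_iff_continuous2 by (intro continuous_intros)
      from continuous_map_compose[OF this continuous_bernstein_path[OF T]]
      show "continuous_map euclidean (mtopology_of (path_metric T)) (\<lambda>u :: (nat \<Rightarrow> 'e) \<times> (nat \<Rightarrow> 'f) \<times> 'g. bernstein_path T N (fst (snd u)))"
        by (simp add: o_def)
      show "continuous_map euclidean euclidean (\<lambda>u :: (nat \<Rightarrow> 'e) \<times> (nat \<Rightarrow> 'f) \<times> 'g. snd (snd u))"
        unfolding continuous_map_iff_continuous2 by (intro continuous_intros)
    qed
    from continuous_map_compose[OF this p] show "continuous_on UNIV (q N)"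
      by (simp add: o_def q_def case_prod_beta')
  qed
  have "(\<lambda>\<omega>. (\<lambda>k. X (T * (real (min k N) / real N)) \<omega>, \<lambda>k. Z (T * (real (min k N) / real N)) \<omega>, \<Theta> \<omega>)) \<in> borel_measurable M" for N
    by (intro borel_measurable_Pair measurable_coordinatewise_then_product X Z nodes \<Theta>)
  then have m: "(\<lambda>\<omega>. q N (\<lambda>k. X (T * (real (min k N) / real N)) \<omega>, \<lambda>k. Z (T * (real (min k N) / real N)) \<omega>, \<Theta> \<omega>)) \<in> borel_measurable M" for N
    by (rule measurable_compose[OF _ q])
  show ?thesis
  proof (rule borel_measurable_LIMSEQ_real[OF _ m])
    fix \<omega> assume \<omega>: "\<omega> \<in> space M"
    have mem: "path_of T X \<omega> \<in> mspace (path_metric T)" "path_of T Z \<omega> \<in> mspace (path_metric T)"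
      by (intro path_of_in_mspace X Z \<omega>)+
    have min: "bernstein_path T N (\<lambda>k. Y (T * (real (min k N) / real N)) \<omega>) = bernstein_path T N (\<lambda>k. Y (T * (k / N)) \<omega>)" for N
      and Y :: "real \<Rightarrow> 'a \<Rightarrow> 'h::euclidean_space"
      unfolding bernstein_path_def by (intro restrict_ext sum.cong) (auto simp: min_absorb1)
    show "(\<lambda>N. q N (\<lambda>k. X (T * (real (min k N) / real N)) \<omega>, \<lambda>k. Z (T * (real (min k N) / real N)) \<omega>, \<Theta> \<omega>))
      \<longlonglongrightarrow> p (path_of T X \<omega>, path_of T Z \<omega>, \<Theta> \<omega>)"
      unfolding q_def prod.case min
    proof (rule tendstoI)
      fix e :: real assume e: "e > 0"
      obtain d where d: "d > 0" "\<And>x' z' \<theta>'. \<lbrakk>x' \<in> mspace (path_metric T); z' \<in> mspace (path_metric T);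
         \<And>t. t \<in> {0..T} \<Longrightarrow> norm (x' t - path_of T X \<omega> t) \<le> d; \<And>t. t \<in> {0..T} \<Longrightarrow> norm (z' t - path_of T Z \<omega> t) \<le> d; norm (\<theta>' - \<Theta> \<omega>) \<le> d\<rbrakk>
         \<Longrightarrow> \<bar>p (x', z', \<theta>') - p (path_of T X \<omega>, path_of T Z \<omega>, \<Theta> \<omega>)\<bar> < e"
        using state_topology_continuous_near[OF p mem e, of "\<Theta> \<omega>"] by blast
      from bernstein_path_converges[OF T X(2)[OF \<omega>] d(1)] bernstein_path_converges[OF T Z(2)[OF \<omega>] d(1)]
      show "\<forall>\<^sub>F N in sequentially. dist (p (bernstein_path T N (\<lambda>k. X (T * (k / N)) \<omega>), bernstein_path T N (\<lambda>k. Z (T * (k / N)) \<omega>), \<Theta> \<omega>))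
         (p (path_of T X \<omega>, path_of T Z \<omega>, \<Theta> \<omega>)) < e"
      proof eventually_elim
        case (elim N)
        show ?case unfolding dist_real_def
          by (rule d(2)) (use elim d(1) in \<open>auto simp: bernstein_path_in_mspace path_of_def\<close>)
      qed
    qed
  qed
qed

section \<open>Small balls and supports\<close>

text \<open>
  The error is measured relative to \<open>R\<close>, whose limit may be zero.
\<close>

lemma tendsto_of_relative_error:
  fixes g R :: "'a \<Rightarrow> real"
  assumes R: "(R \<longlongrightarrow> R0) F" and err: "\<And>e. e > 0 \<Longrightarrow> \<forall>\<^sub>F x in F. \<bar>g x - c * R x\<bar> \<le> e * \<bar>R x\<bar>"
  shows "(g \<longlongrightarrow> c * R0) F"
proof -
  have "((\<lambda>x. g x - c * R x) \<longlongrightarrow> 0) F"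
  proof (rule tendstoI)
    fix e :: real assume e: "e > 0"
    have "((\<lambda>x. \<bar>R x\<bar>) \<longlongrightarrow> \<bar>R0\<bar>) F" by (intro tendsto_intros R)
    then have "\<forall>\<^sub>F x in F. \<bar>R x\<bar> < \<bar>R0\<bar> + 1" by (rule order_tendstoD) simp
    moreover have "\<forall>\<^sub>F x in F. \<bar>g x - c * R x\<bar> \<le> (e / (\<bar>R0\<bar> + 1)) * \<bar>R x\<bar>" by (rule err) (use e in simp)
    ultimately show "\<forall>\<^sub>F x in F. dist (g x - c * R x) 0 < e"
    proof eventually_elim
      case (elim x)
      have "(e / (\<bar>R0\<bar> + 1)) * \<bar>R x\<bar> < (e / (\<bar>R0\<bar> + 1)) * (\<bar>R0\<bar> + 1)"
        using elim e by (intro mult_strict_left_mono) auto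
      with elim show ?case by (simp add: dist_real_def)
    qed
  qed
  from tendsto_add[OF this tendsto_mult_left[OF R, of c]] show ?thesis by simp
qed

text \<open>
  The complement of the support is a union of countably many null sets of a countable base.
\<close>

lemma AE_in_topological_support:
  fixes X :: "'a \<Rightarrow> 'b::second_countable_topology"
  assumes X: "X \<in> borel_measurable M"
  shows "AE \<omega> in M. X \<omega> \<in> topological_support (distr M borel X)"
proof -
  obtain \<B> :: "'b set set" where \<B>: "countable \<B>" "topological_basis \<B>"
    using ex_countable_basis by blast
  let ?N = "{B \<in> \<B>. emeasure (distr M borel X) B = 0}"
  have op: "open B" if "B \<in> \<B>" for B using \<B>(2) that by (rule topological_basis_open)
  have "AE \<omega> in M. \<forall>B\<in>?N. X \<omega> \<notin> B"
  proof (subst AE_ball_countable)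
    show "countable ?N" using \<B>(1) by (rule countable_subset[rotated]) auto
    show "\<forall>B\<in>?N. AE \<omega> in M. X \<omega> \<notin> B"
    proof
      fix B assume B: "B \<in> ?N"
      have Bm: "B \<in> sets borel" using op B by auto
      have "emeasure M (X -` B \<inter> space M) = 0" using B Bm X by (simp add: emeasure_distr)
      moreover have "X -` B \<inter> space M \<in> sets M" using X Bm by (rule measurable_sets)
      ultimately show "AE \<omega> in M. X \<omega> \<notin> B" by (intro AE_I[where N="X -` B \<inter> space M"]) auto
    qed
  qed
  then show ?thesis
  proof (rule AE_mp, intro AE_I2 impI)
    fix \<omega> assume "\<omega> \<in> space M" and n: "\<forall>B\<in>?N. X \<omega> \<notin> B"
    show "X \<omega> \<in> topological_support (distr M borel X)"
      unfolding topological_support_def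
    proof (intro CollectI allI impI)
      fix U assume U: "open U" "X \<omega> \<in> U"
      obtain B where B: "B \<in> \<B>" "X \<omega> \<in> B" "B \<subseteq> U" using topological_basisE[OF \<B>(2) U] by blast
      then have "emeasure (distr M borel X) B \<noteq> 0" using n by blast
      moreover have "emeasure (distr M borel X) B \<le> emeasure (distr M borel X) U"
        using B(3) U(1) by (intro emeasure_mono) auto
      ultimately show "emeasure (distr M borel X) U > 0" by (auto simp: zero_less_iff_neq_zero)
    qed
  qed
qed

lemma null_ball_outside_topological_support:
  fixes X :: "'a \<Rightarrow> 'b::euclidean_space"
  assumes X: "X \<in> borel_measurable M" and x: "x \<notin> topological_support (distr M borel X)"
  obtains d where "d > 0" "AE \<omega> in M. norm (X \<omega> - x) \<ge> d"
proof -
  obtain U where U: "open U" "x \<in> U" "emeasure (distr M borel X) U = 0"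
    using x by (auto simp: topological_support_def zero_less_iff_neq_zero)
  obtain d where d: "d > 0" "ball x d \<subseteq> U" using U by (meson openE)
  have "emeasure M (X -` U \<inter> space M) = 0" using U X by (simp add: emeasure_distr)
  moreover have "X -` U \<inter> space M \<in> sets M" using X U(1) by (intro measurable_sets) auto
  ultimately have "AE \<omega> in M. X \<omega> \<notin> U" by (intro AE_I[where N="X -` U \<inter> space M"]) auto
  then have "AE \<omega> in M. norm (X \<omega> - x) \<ge> d"
  proof (rule AE_mp, intro AE_I2 impI)
    fix \<omega> assume "X \<omega> \<notin> U"
    then have "X \<omega> \<notin> ball x d" using d(2) by blast
    then show "norm (X \<omega> - x) \<ge> d" by (simp add: dist_norm norm_minus_commute)
  qed
  with d(1) show ?thesis by (rule that)
qed

definition ball_product_volume :: "nat \<Rightarrow> nat \<Rightarrow> nat \<Rightarrow> real" where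
  "ball_product_volume n q m = unit_ball_vol n * (unit_ball_vol q * unit_ball_vol m)"

lemma ball_product_volume_pos: "ball_product_volume n q m > 0"
  by (simp add: ball_product_volume_def)

lemma emeasure_ball_product:
  fixes a :: "'e::euclidean_space" and b :: "'f::euclidean_space" and c :: "'g::euclidean_space"
  assumes "r \<ge> 0"
  shows "emeasure lborel (ball a r \<times> ball b r \<times> ball c r)
    = ennreal (ball_product_volume DIM('e) DIM('f) DIM('g) * r ^ (DIM('e) + DIM('f) + DIM('g)))"
proof -
  have times: "emeasure lborel (A \<times> B) = emeasure lborel A * emeasure lborel B"
    if "A \<in> sets borel" "B \<in> sets borel" for A :: "'x::euclidean_space set" and B :: "'y::euclidean_space set"
    unfolding lborel_prod[symmetric] by (rule lborel.emeasure_pair_measure_Times) (use that in auto)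
  have "emeasure lborel (ball a r \<times> ball b r \<times> ball c r)
     = emeasure lborel (ball a r) * (emeasure lborel (ball b r) * emeasure lborel (ball c r))"
    by (subst times; (subst times)?; intro refl borel_open open_Times open_ball)
  also have "\<dots> = ennreal (ball_product_volume DIM('e) DIM('f) DIM('g) * r ^ (DIM('e) + DIM('f) + DIM('g)))"
    using assms by (simp add: emeasure_ball ball_product_volume_def power_add ac_simps flip: ennreal_mult')
  finally show ?thesis .
qed

text \<open>
  On small balls the density is almost constant.
\<close>

lemma (in finite_measure) small_ball_probability:
  fixes U :: "'a \<Rightarrow> 'e::euclidean_space \<times> 'f::euclidean_space \<times> 'g::euclidean_space"
  assumes U: "distributed M lborel U (\<lambda>u. ennreal (p u))" and p: "isCont p (a, b, c)" "0 \<le> p (a, b, c)"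
  shows "((\<lambda>r. measure M (U -` (ball a r \<times> ball b r \<times> ball c r) \<inter> space M) / r ^ (DIM('e) + DIM('f) + DIM('g)))
    \<longlongrightarrow> p (a, b, c) * ball_product_volume DIM('e) DIM('f) DIM('g)) (at_right 0)"
proof (rule tendsto_of_relative_error[OF tendsto_const])
  fix e :: real assume e: "e > 0"
  let ?p = "p (a, b, c)" and ?V = "ball_product_volume DIM('e) DIM('f) DIM('g)" and ?k = "DIM('e) + DIM('f) + DIM('g)"
  have V: "?V > 0" by (rule ball_product_volume_pos)
  obtain d where d: "d > 0" "\<And>u. dist u (a, b, c) < d \<Longrightarrow> dist (p u) ?p < e"
    using p(1) e unfolding continuous_at_eps_delta by blast
  have "\<forall>\<^sub>F r in at_right 0. r \<in> {0<..<d / 3}" by (rule eventually_at_right_real) (use d in simp)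
  then show "\<forall>\<^sub>F r in at_right 0. \<bar>measure M (U -` (ball a r \<times> ball b r \<times> ball c r) \<inter> space M) / r ^ ?k - ?p * ?V\<bar> \<le> e * \<bar>?V\<bar>"
  proof eventually_elim
    case (elim r)
    let ?A = "ball a r \<times> ball b r \<times> ball c r"
    let ?m = "measure M (U -` ?A \<inter> space M)"
    have r: "r > 0" "r < d / 3" using elim by auto
    have rk: "r ^ ?k > 0" using r by simp
    have vol: "emeasure lborel ?A = ennreal (?V * r ^ ?k)" by (rule emeasure_ball_product) (use r in simp)
    have A: "?A \<in> sets lborel"
      unfolding sets_lborel by (intro borel_open open_Times open_ball)
    have near: "\<bar>p u - ?p\<bar> < e" if u: "u \<in> ?A" for u
    proof -
      obtain u1 u2 u3 where u123: "u = (u1, u2, u3)" by (cases u) auto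
      have "dist u (a, b, c) \<le> dist u1 a + dist (u2, u3) (b, c)"
        unfolding u123 dist_Pair_Pair[of u1] using sqrt_sum_squares_le_sum[of "dist u1 a" "dist (u2, u3) (b, c)"] by simp
      moreover have "dist (u2, u3) (b, c) \<le> dist u2 b + dist u3 c"
        unfolding dist_Pair_Pair using sqrt_sum_squares_le_sum[of "dist u2 b" "dist u3 c"] by simp
      moreover have "dist u1 a < r" "dist u2 b < r" "dist u3 c < r" using u by (auto simp: u123 dist_commute)
      ultimately have "dist u (a, b, c) < d" using r by linarith
      then show ?thesis using d(2) by (simp add: dist_real_def)
    qed
    have m: "ennreal ?m = (\<integral>\<^sup>+u. ennreal (p u) * indicator ?A u \<partial>lborel)"
      using distributed_emeasure[OF U A] by (simp add: emeasure_eq_measure)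
    have "ennreal ?m \<le> (\<integral>\<^sup>+u. ennreal (?p + e) * indicator ?A u \<partial>lborel)"
      unfolding m by (rule nn_integral_mono) (use near in \<open>fastforce simp: indicator_def intro!: ennreal_leI\<close>)
    also have "\<dots> = ennreal (?p + e) * ennreal (?V * r ^ ?k)" using nn_integral_cmult_indicator[OF A] vol by simp
    also have "\<dots> = ennreal ((?p + e) * (?V * r ^ ?k))" using V r by (simp add: ennreal_mult'')
    finally have up: "?m \<le> (?p + e) * (?V * r ^ ?k)" using p(2) e V r by (subst (asm) ennreal_le_iff) auto
    have pe: "ennreal (p u) * indicator ?A u \<ge> ennreal (?p - e) * indicator ?A u" for u
      using near[of u] by (cases "u \<in> ?A") (auto intro!: ennreal_leI)
    have "ennreal ((?p - e) * (?V * r ^ ?k)) = ennreal (?p - e) * ennreal (?V * r ^ ?k)" using V r by (simp add: ennreal_mult'')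
    also have "\<dots> = (\<integral>\<^sup>+u. ennreal (?p - e) * indicator ?A u \<partial>lborel)" using nn_integral_cmult_indicator[OF A] vol by simp
    also have "\<dots> \<le> ennreal ?m" unfolding m by (rule nn_integral_mono) (rule pe)
    finally have lo: "(?p - e) * (?V * r ^ ?k) \<le> ?m" by simp
    have "?m / r ^ ?k \<le> (?p + e) * ?V" "(?p - e) * ?V \<le> ?m / r ^ ?k"
      using up lo rk by (simp_all add: pos_divide_le_eq pos_le_divide_eq mult.assoc)
    then show ?case using V by (simp add: abs_le_iff algebra_simps)
  qed
qed

lemma (in finite_measure) set_integral_near_constant:
  fixes L :: "'a \<Rightarrow> real"
  assumes L: "integrable M L" and A: "A \<in> sets M" and near: "AE \<omega> in M. \<omega> \<in> A \<longrightarrow> \<bar>L \<omega> - c\<bar> \<le> e"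
  shows "\<bar>(LINT \<omega>:A|M. L \<omega>) - c * measure M A\<bar> \<le> e * measure M A"
proof -
  have i: "integrable M (\<lambda>\<omega>. indicator A \<omega> * L \<omega>)" using integrable_mult_indicator[OF A L] by simp
  have ind: "integrable M (\<lambda>\<omega>. indicator A \<omega> * k)" for k :: real
    using A by (intro integrable_mult_left) (simp add: emeasure_finite less_top[symmetric])
  have "(LINT \<omega>:A|M. L \<omega>) - c * measure M A = (\<integral>\<omega>. indicator A \<omega> * L \<omega> - indicator A \<omega> * c \<partial>M)"
    using A by (subst Bochner_Integration.integral_diff[OF i ind]) (simp add: set_lebesgue_integral_def mult.commute)
  also have "\<bar>\<dots>\<bar> \<le> (\<integral>\<omega>. \<bar>indicator A \<omega> * L \<omega> - indicator A \<omega> * c\<bar> \<partial>M)"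
    by (rule integral_abs_bound)
  also have "\<dots> \<le> (\<integral>\<omega>. indicator A \<omega> * e \<partial>M)"
  proof (rule integral_mono_AE)
    show "integrable M (\<lambda>\<omega>. \<bar>indicator A \<omega> * L \<omega> - indicator A \<omega> * c\<bar>)"
      by (intro integrable_abs Bochner_Integration.integrable_diff i ind)
    show "AE \<omega> in M. \<bar>indicator A \<omega> * L \<omega> - indicator A \<omega> * c\<bar> \<le> indicator A \<omega> * e"
      using near by eventually_elim (auto simp: indicator_def)
  qed (rule ind)
  also have "\<dots> = e * measure M A" using A by simp
  finally show ?thesis .
qed

section \<open>The posterior probability of small noise balls\<close>

lemma (in wiener) open_tube_pointwise:
  assumes w: "continuous_on {0..T} w" and \<omega>: "\<omega> \<in> open_tube T r w" and t: "t \<in> {0..T}"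
  shows "norm (w t - W t \<omega>) < r"
proof -
  have sp: "\<omega> \<in> space M" using \<omega> by (simp add: open_tube_def)
  have "bdd_above ((\<lambda>t. norm (w t - W t \<omega>)) ` {0..T})"
    by (intro compact_imp_bounded[THEN bounded_imp_bdd_above] compact_continuous_image continuous_intros w
        continuous_on_subset[OF W_continuous[OF sp]]) auto
  then have "norm (w t - W t \<omega>) \<le> (SUP t\<in>{0..T}. norm (w t - W t \<omega>))"
    using t by (intro cSUP_upper) auto
  then show ?thesis using \<omega> by (simp add: open_tube_def)
qed

text \<open>
  Inside the ball the weight \<open>L\<close> is almost the constant \<open>l\<close>, and the probability of the ball factorizes
  by independence of the tube from the initial values.
\<close>

lemma (in wiener) weighted_tube_limit:
  fixes U :: "'a \<Rightarrow> (real^'x) \<times> (real^'y) \<times> (real^'z)" and L :: "'a \<Rightarrow> real"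
  assumes T: "T > 0" and w: "continuous_on {0..T} w" and L: "integrable M L"
    and UF: "U \<in> borel_measurable (F 0)" and U: "distributed M lborel U (\<lambda>u. ennreal (p u))"
    and p: "isCont p (a, b, c)" "0 \<le> p (a, b, c)"
    and near: "\<And>e. e > 0 \<Longrightarrow> \<exists>r>0. AE \<omega> in M. \<omega> \<in> U -` (ball a r \<times> ball b r \<times> ball c r) \<inter> space M \<inter> open_tube T r w \<longrightarrow> \<bar>L \<omega> - l\<bar> \<le> e"
    and tube: "((\<lambda>r. exp (\<kappa> / r\<^sup>2) * measure M (open_tube T r w)) \<longlongrightarrow> s) (at_right 0)"
  defines "k \<equiv> CARD('x) + CARD('y) + CARD('z)" and "V \<equiv> ball_product_volume CARD('x) CARD('y) CARD('z)"
  shows "((\<lambda>r. (LINT \<omega>:U -` (ball a r \<times> ball b r \<times> ball c r) \<inter> space M \<inter> open_tube T r w|M. L \<omega>) / (exp (- (\<kappa> / r\<^sup>2)) * r ^ k))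
    \<longlongrightarrow> l * ((p (a, b, c) * V) * s)) (at_right 0)"
proof (rule tendsto_of_relative_error)
  let ?D = "\<lambda>r. U -` (ball a r \<times> ball b r \<times> ball c r) \<inter> space M"
  let ?R = "\<lambda>r. (measure M (?D r) / r ^ k) * (exp (\<kappa> / r\<^sup>2) * measure M (open_tube T r w))"
  show "(?R \<longlongrightarrow> (p (a, b, c) * V) * s) (at_right 0)"
    using small_ball_probability[OF U p] tube by (intro tendsto_mult) (simp_all add: k_def V_def)
  fix e :: real assume e: "e > 0"
  obtain r0 where r0: "r0 > 0" "AE \<omega> in M. \<omega> \<in> ?D r0 \<inter> open_tube T r0 w \<longrightarrow> \<bar>L \<omega> - l\<bar> \<le> e"
    using near[OF e] by blast
  have "\<forall>\<^sub>F r in at_right 0. r \<in> {0<..<r0}" by (rule eventually_at_right_real) (use r0 in simp)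
  then show "\<forall>\<^sub>F r in at_right 0. \<bar>(LINT \<omega>:?D r \<inter> open_tube T r w|M. L \<omega>) / (exp (- (\<kappa> / r\<^sup>2)) * r ^ k) - l * ?R r\<bar> \<le> e * \<bar>?R r\<bar>"
  proof eventually_elim
    case (elim r)
    have r: "r > 0" "r < r0" using elim by auto
    let ?B = "?D r \<inter> open_tube T r w" and ?den = "exp (- (\<kappa> / r\<^sup>2)) * r ^ k"
    have "ball a r \<times> ball b r \<times> ball c r \<in> sets borel" by (intro borel_open open_Times open_ball)
    from measurable_sets[OF UF this] have D: "?D r \<in> sets (F 0)" by (simp add: space_F)
    note tb = open_tube_indep_initial[OF T w r(1) D]
    have BM: "?B \<in> sets M" using D sets_F_le[of 0] tb(1) by auto
    have den: "?den > 0" using r by simp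
    have Rr: "?R r = measure M ?B / ?den" unfolding tb(2) by (simp add: exp_minus field_simps)
    have "\<bar>(LINT \<omega>:?B|M. L \<omega>) - l * measure M ?B\<bar> \<le> e * measure M ?B"
    proof (rule set_integral_near_constant[OF L BM])
      show "AE \<omega> in M. \<omega> \<in> ?B \<longrightarrow> \<bar>L \<omega> - l\<bar> \<le> e"
        using r0(2)
      proof eventually_elim
        case (elim \<omega>)
        have "?B \<subseteq> ?D r0 \<inter> open_tube T r0 w" using r by (auto simp: open_tube_def)
        then show ?case using elim by blast
      qed
    qed
    then have "\<bar>(LINT \<omega>:?B|M. L \<omega>) - l * measure M ?B\<bar> / ?den \<le> e * measure M ?B / ?den"
      using den by (intro divide_right_mono) auto
    moreover have "(LINT \<omega>:?B|M. L \<omega>) / ?den - l * (measure M ?B / ?den) = ((LINT \<omega>:?B|M. L \<omega>) - l * measure M ?B) / ?den"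
      by (simp add: diff_divide_distrib)
    ultimately show ?case unfolding Rr using den by (simp add: abs_divide)
  qed
qed

theorem theorem2p26:
  fixes M :: "'a measure" and F :: "real \<Rightarrow> 'a measure" and tf :: real
    and W X :: "real \<Rightarrow> 'a \<Rightarrow> real^'n" and Z :: "real \<Rightarrow> 'a \<Rightarrow> real^'q" and \<Theta> :: "'a \<Rightarrow> real^'m"
    and f :: "real \<Rightarrow> real^'n \<Rightarrow> real^'q \<Rightarrow> real^'m \<Rightarrow> real^'n"
    and h :: "real \<Rightarrow> real^'n \<Rightarrow> real^'q \<Rightarrow> real^'m \<Rightarrow> real^'q"
    and G :: "real^'n^'n"
    and \<pi> :: "real^'n \<Rightarrow> real^'q \<Rightarrow> real^'m \<Rightarrow> real"
    and Y :: "'a \<Rightarrow> 'y::metric_space" and y :: 'y and \<nu> :: "'y measure"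
    and \<psi> :: "'y \<Rightarrow> (real \<Rightarrow> real^'n) \<Rightarrow> (real \<Rightarrow> real^'q) \<Rightarrow> real^'m \<Rightarrow> real"
  defines "S \<equiv> topological_support (distr M borel \<Theta>)"
    and "L \<equiv> (\<lambda>\<omega>. \<psi> y (path_of tf X \<omega>) (path_of tf Z \<omega>) (\<Theta> \<omega>))"
  assumes "tf > 0" and "prob_space M" and "filtration_of M F" and "wiener_process M F W"
    and "sde_solution M F tf f h G W X Z \<Theta>"
    and A1: "X 0 \<in> borel_measurable (F 0)" "Z 0 \<in> borel_measurable (F 0)"
            "\<Theta> \<in> borel_measurable (F 0)"
    and A2: "continuous_on UNIV (\<lambda>(x, z, \<theta>). \<pi> x z \<theta>)" "\<And>x z \<theta>. 0 \<le> \<pi> x z \<theta>"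
            "distributed M lborel (\<lambda>\<omega>. (X 0 \<omega>, Z 0 \<omega>, \<Theta> \<omega>)) (\<lambda>(x, z, \<theta>). ennreal (\<pi> x z \<theta>))"
    and A3: "uniformly_continuous_on ({0..tf} \<times> UNIV \<times> UNIV \<times> S) (\<lambda>(t, x, z, \<theta>). f t x z \<theta>)"
            "uniformly_continuous_on ({0..tf} \<times> UNIV \<times> UNIV \<times> S) (\<lambda>(t, x, z, \<theta>). h t x z \<theta>)"
    and A4: "\<forall>\<theta>\<in>S. \<exists>Lf>0. \<exists>Lh>0. \<forall>t\<in>{0..tf}. \<forall>x x' z z'.
              norm (f t x z \<theta> - f t x' z' \<theta>) \<le> Lf * (norm (x - x') + norm (z - z')) \<and>
              norm (h t x z \<theta> - h t x' z' \<theta>) \<le> Lh * (norm (x - x') + norm (z - z'))"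
    and A5: "drift_differentiable tf S f"
    and A6: "rank G = CARD('n)"
    and A7: "(\<integral>\<^sup>+\<omega>. ennreal (exp (integral {0..tf}
               (\<lambda>t. (norm (matrix_inv G *v f t (X t \<omega>) (Z t \<omega>) (\<Theta> \<omega>)))\<^sup>2))) \<partial>M) < \<infinity>"
    and B1: "Y \<in> borel_measurable M"
    and B2: "sets \<nu> = sets borel"
            "conditional_density M (borel_algebra_of (state_topology tf))
               (\<lambda>\<omega>. (path_of tf X \<omega>, path_of tf Z \<omega>, \<Theta> \<omega>)) Y \<nu> (\<lambda>y' (x, z, \<theta>). \<psi> y' x z \<theta>)"
    and B3: "continuous_map (state_topology tf) euclideanreal (\<lambda>(x, z, \<theta>). \<psi> y x z \<theta>)"
    and B4: "0 < (\<integral>\<^sup>+\<omega>. ennreal (L \<omega>) \<partial>M)" "(\<integral>\<^sup>+\<omega>. ennreal (L \<omega>) \<partial>M) < \<infinity>"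
  shows "\<exists>a11>0. \<exists>a12>0. \<forall>w\<in>W2_paths tf. w 0 = 0 \<longrightarrow> (\<forall>x0 z0 \<theta>.
     let ratio = (\<lambda>\<epsilon>::real. posterior_prob M L (noise_ball M tf W X Z \<Theta> w x0 z0 \<theta> \<epsilon>) /
                    (a11 * exp (- (a12 / \<epsilon>\<^sup>2)) * \<epsilon> ^ (CARD('m) + CARD('n) + CARD('q)))) in
     (\<theta> \<in> S \<longrightarrow>
        (\<exists>x z. path_solution tf f h G w x0 z0 \<theta> x z \<and>
           (\<forall>x' z'. path_solution tf f h G w x0 z0 \<theta> x' z' \<longrightarrow> x' = x \<and> z' = z) \<and>
           (ratio \<longlongrightarrow> \<psi> y x z \<theta> * \<pi> x0 z0 \<theta> *
              exp (- (1/2) * integral {0..tf} (\<lambda>t. (norm (weak_deriv tf w t))\<^sup>2))) (at_right 0))) \<and>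
     (\<theta> \<notin> S \<longrightarrow> (ratio \<longlongrightarrow> 0) (at_right 0)))"
proof -
  interpret Wp: wiener M F W
    using \<open>prob_space M\<close> \<open>filtration_of M F\<close> \<open>wiener_process M F W\<close> by (rule wiener.intro)
  note T = \<open>tf > 0\<close>
  have sde: "\<forall>t\<in>{0..tf}. X t \<in> borel_measurable (F t) \<and> Z t \<in> borel_measurable (F t)"
    "\<forall>\<omega>\<in>space M. continuous_on {0..tf} (\<lambda>t. X t \<omega>) \<and> continuous_on {0..tf} (\<lambda>t. Z t \<omega>)"
    "AE \<omega> in M. \<forall>t\<in>{0..tf}.
        X t \<omega> = X 0 \<omega> + integral {0..t} (\<lambda>\<tau>. f \<tau> (X \<tau> \<omega>) (Z \<tau> \<omega>) (\<Theta> \<omega>)) + G *v (W t \<omega> - W 0 \<omega>) \<and>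
        Z t \<omega> = Z 0 \<omega> + integral {0..t} (\<lambda>\<tau>. h \<tau> (X \<tau> \<omega>) (Z \<tau> \<omega>) (\<Theta> \<omega>))"
    using \<open>sde_solution M F tf f h G W X Z \<Theta>\<close> unfolding sde_solution_def by blast+
  have XM: "X t \<in> borel_measurable M" "Z t \<in> borel_measurable M" if "t \<in> {0..tf}" for t
    using sde(1) that Wp.F_measurable_M[of t "X t"] Wp.F_measurable_M[of t "Z t"] by auto
  have Xc: "continuous_on {0..tf} (\<lambda>t. X t \<omega>)" "continuous_on {0..tf} (\<lambda>t. Z t \<omega>)" if "\<omega> \<in> space M" for \<omega>
    using sde(2) that by auto
  have \<Theta>M: "\<Theta> \<in> borel_measurable M" by (rule Wp.F_measurable_M[OF _ A1(3)]) simp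
  let ?p = "\<lambda>(x, z, \<theta>). \<psi> y x z \<theta>"
  have LM: "L \<in> borel_measurable M"
    using path_functional_measurable[OF T B3 XM(1) Xc(1) XM(2) Xc(2) \<Theta>M] by (simp add: L_def)
  have paths: "path_of tf X \<omega> \<in> mspace (path_metric tf)" "path_of tf Z \<omega> \<in> mspace (path_metric tf)"
    if "\<omega> \<in> space M" for \<omega>
    by (rule path_of_in_mspace, rule Xc[OF that])+
  have state: "(path_of tf X \<omega>, path_of tf Z \<omega>, \<Theta> \<omega>) \<in> space (borel_algebra_of (state_topology tf))" if "\<omega> \<in> space M" for \<omega>
    using paths[OF that]
    by (simp add: borel_algebra_of_def space_measure_of_conv state_topology_def)
  have L0: "0 \<le> L \<omega>" if "\<omega> \<in> space M" for \<omega>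
    using B2(2) state[OF that] unfolding conditional_density_def L_def by fastforce
  have LI: "integrable M L"
    by (rule integrableI_nonneg[OF LM]) (use L0 B4(2) in auto)
  define EL where "EL = (\<integral>\<omega>. L \<omega> \<partial>M)"
  have EL: "EL > 0"
  proof -
    have "ennreal EL > 0"
      using B4(1) nn_integral_eq_integral[OF LI] L0 by (simp add: EL_def)
    then show ?thesis by (simp add: ennreal_less_zero_iff)
  qed
  define U where "U \<omega> = (X 0 \<omega>, Z 0 \<omega>, \<Theta> \<omega>)" for \<omega>
  define p where "p = (\<lambda>(x, z, \<theta>). \<pi> x z \<theta>)"
  have UF: "U \<in> borel_measurable (F 0)" unfolding U_def by (intro borel_measurable_Pair A1)
  have Ud: "distributed M lborel U (\<lambda>u. ennreal (p u))"
    using A2(3) unfolding U_def p_def by (simp add: case_prod_beta')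
  have pc: "isCont p u" for u
    using A2(1) unfolding p_def continuous_on_eq_continuous_at[OF open_UNIV] by blast
  obtain \<kappa> a where \<kappa>: "\<kappa> > 0" and a: "a > 0" and asym:
    "\<And>w Q. continuous_on {0..tf} w \<Longrightarrow> w 0 = 0 \<Longrightarrow> (\<And>N. action (increments w 0 (dyadic_steps tf N)) \<le> Q) \<Longrightarrow>
       (\<lambda>N. action (increments w 0 (dyadic_steps tf N))) \<longlonglongrightarrow> Q \<Longrightarrow>
       ((\<lambda>r. exp (\<kappa> / r\<^sup>2) * measure M (Wp.open_tube tf r w)) \<longlongrightarrow> a * exp (- Q / 2)) (at_right 0)"
    using Wp.open_tube_asymptotics[OF T] by blast
  let ?k = "CARD('m) + CARD('n) + CARD('q)"
  define V where "V = ball_product_volume CARD('n) CARD('q) CARD('m)"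
  have V: "V > 0" by (simp add: V_def ball_product_volume_pos)
  \<comment> \<open>the constant collects those of the tube, of the three balls and of the normalization of the posterior\<close>
  define a11 where "a11 = a * V / EL"
  have a11: "a11 > 0" using a V EL by (simp add: a11_def)
  let ?A = "\<lambda>x0 z0 \<theta> r. U -` (ball x0 r \<times> ball z0 r \<times> ball \<theta> r) \<inter> space M"
  have nb: "noise_ball M tf W X Z \<Theta> w x0 z0 \<theta> r = ?A x0 z0 \<theta> r \<inter> Wp.open_tube tf r w" for w x0 z0 \<theta> r
    by (auto simp: noise_ball_def Wp.open_tube_def U_def dist_norm norm_minus_commute)
  have ratio: "posterior_prob M L (noise_ball M tf W X Z \<Theta> w x0 z0 \<theta> r) / (a11 * exp (- (\<kappa> / r\<^sup>2)) * r ^ ?k)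
     = (LINT \<omega>:?A x0 z0 \<theta> r \<inter> Wp.open_tube tf r w|M. L \<omega>) / (exp (- (\<kappa> / r\<^sup>2)) * r ^ (CARD('n) + CARD('q) + CARD('m))) / (a * V)"
    for w x0 z0 \<theta> r
    using EL by (simp add: posterior_prob_def nb a11_def EL_def[symmetric] power_add ac_simps)
  have AES: "AE \<omega> in M. \<Theta> \<omega> \<in> S" unfolding S_def by (rule AE_in_topological_support[OF \<Theta>M])
  show ?thesis
  proof (rule exI[of _ a11], intro conjI a11, rule exI[of _ \<kappa>], intro conjI \<kappa> ballI impI allI, unfold Let_def, intro conjI impI)
    fix w :: "real \<Rightarrow> real^'n" and x0 :: "real^'n" and z0 :: "real^'q" and \<theta> :: "real^'m"
    assume w: "w \<in> W2_paths tf" and w0: "w 0 = 0"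
    let ?Q = "integral {0..tf} (\<lambda>t. (norm (weak_deriv tf w t))\<^sup>2)"
    note act = W2_path_action[OF T w]
    have wc: "continuous_on {0..tf} w" by (rule act(1))
    have tube: "((\<lambda>r. exp (\<kappa> / r\<^sup>2) * measure M (Wp.open_tube tf r w)) \<longlongrightarrow> a * exp (- ?Q / 2)) (at_right 0)"
      by (rule asym[OF wc w0 act(2,3)])
    {
      assume \<theta>: "\<theta> \<in> S"
      obtain Lf Lh where Lfh: "Lf > 0" "Lh > 0" and lip: "\<forall>t\<in>{0..tf}. \<forall>x x' z z'.
              norm (f t x z \<theta> - f t x' z' \<theta>) \<le> Lf * (norm (x - x') + norm (z - z')) \<and>
              norm (h t x z \<theta> - h t x' z' \<theta>) \<le> Lh * (norm (x - x') + norm (z - z'))"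
        using A4 \<theta> by blast
      let ?L = "Lf + Lh"
      have L: "?L > 0" using Lfh by simp
      have lipL: "norm (f t x z \<theta> - f t x' z' \<theta>) \<le> ?L * (norm (x - x') + norm (z - z'))"
        "norm (h t x z \<theta> - h t x' z' \<theta>) \<le> ?L * (norm (x - x') + norm (z - z'))" if "t \<in> {0..tf}" for t x x' z z'
      proof -
        have "Lf * (norm (x - x') + norm (z - z')) \<le> ?L * (norm (x - x') + norm (z - z'))"
          "Lh * (norm (x - x') + norm (z - z')) \<le> ?L * (norm (x - x') + norm (z - z'))"
          using Lfh by (auto intro!: mult_right_mono)
        then show "norm (f t x z \<theta> - f t x' z' \<theta>) \<le> ?L * (norm (x - x') + norm (z - z'))"
          "norm (h t x z \<theta> - h t x' z' \<theta>) \<le> ?L * (norm (x - x') + norm (z - z'))"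
          using lip that by (meson order_trans)+
      qed
      have slice: "continuous_on ({0..tf} \<times> UNIV) (\<lambda>(t, x, z). k t x z \<theta>)"
        if "uniformly_continuous_on ({0..tf} \<times> UNIV \<times> UNIV \<times> S) (\<lambda>(t, x, z, \<theta>). k t x z \<theta>)"
        for k :: "real \<Rightarrow> real^'n \<Rightarrow> real^'q \<Rightarrow> real^'m \<Rightarrow> 'b::real_normed_vector"
      proof -
        let ?g = "\<lambda>u :: real \<times> (real^'n) \<times> (real^'q). (fst u, fst (snd u), snd (snd u), \<theta>)"
        have "continuous_on ({0..tf} \<times> UNIV) ?g" by (intro continuous_intros)
        from continuous_on_compose2[OF uniformly_continuous_imp_continuous[OF that] this]
        have "continuous_on ({0..tf} \<times> UNIV) (\<lambda>u. case ?g u of (t, x, z, \<theta>) \<Rightarrow> k t x z \<theta>)" using \<theta> by force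
        then show ?thesis by (simp add: case_prod_beta')
      qed
      obtain x z where sol: "path_solution tf f h G w x0 z0 \<theta> x z"
        and uniq: "\<forall>x' z'. path_solution tf f h G w x0 z0 \<theta> x' z' \<longrightarrow> x' = x \<and> z' = z"
        using path_solution_exists_unique[where f=f and h=h and G=G and \<theta>=\<theta> and L="?L" and ?x0.0=x0 and ?z0.0=z0, OF T w slice[OF A3(1)] slice[OF A3(2)] L lipL] by blast
      have xz: "x \<in> mspace (path_metric tf)" "z \<in> mspace (path_metric tf)"
        "\<And>t. t \<in> {0..tf} \<Longrightarrow> x t = x0 + integral {0..t} (\<lambda>\<tau>. f \<tau> (x \<tau>) (z \<tau>) \<theta>) + G *v w t"
        "\<And>t. t \<in> {0..tf} \<Longrightarrow> z t = z0 + integral {0..t} (\<lambda>\<tau>. h \<tau> (x \<tau>) (z \<tau>) \<theta>)"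
        using sol by (auto simp: path_solution_def W2_paths_def)
      have xzc: "continuous_on {0..tf} x" "continuous_on {0..tf} z" using xz(1,2) by (auto simp: mspace_path_metric)
      \<comment> \<open>on a small noise ball the solution of the stochastic equation is close to (x, z), hence so is the likelihood\<close>
      have near: "\<exists>r>0. AE \<omega> in M. \<omega> \<in> ?A x0 z0 \<theta> r \<inter> Wp.open_tube tf r w \<longrightarrow> \<bar>L \<omega> - \<psi> y x z \<theta>\<bar> \<le> e"
        if e: "e > 0" for e
      proof -
        obtain d where d: "d > 0" and dc: "\<And>x' z' \<theta>'. \<lbrakk>x' \<in> mspace (path_metric tf); z' \<in> mspace (path_metric tf);
             \<And>t. t \<in> {0..tf} \<Longrightarrow> norm (x' t - x t) \<le> d; \<And>t. t \<in> {0..tf} \<Longrightarrow> norm (z' t - z t) \<le> d; norm (\<theta>' - \<theta>) \<le> d\<rbrakk>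
             \<Longrightarrow> \<bar>?p (x', z', \<theta>') - ?p (x, z, \<theta>)\<bar> < e"
          using state_topology_continuous_near[OF B3 xz(1,2) e, of \<theta>] by blast
        obtain d' where d': "d' > 0" and st: "\<And>x' z' w' x0' z0' \<theta>'. \<lbrakk>\<theta>' \<in> S; norm (\<theta>' - \<theta>) < d'; norm (x0' - x0) < d'; norm (z0' - z0) < d';
            \<And>t. t \<in> {0..tf} \<Longrightarrow> norm (w t - w' t) < d'; continuous_on {0..tf} x'; continuous_on {0..tf} z';
            \<And>t. t \<in> {0..tf} \<Longrightarrow> x' t = x0' + integral {0..t} (\<lambda>s. f s (x' s) (z' s) \<theta>') + G *v w' t;
            \<And>t. t \<in> {0..tf} \<Longrightarrow> z' t = z0' + integral {0..t} (\<lambda>s. h s (x' s) (z' s) \<theta>')\<rbrakk>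
            \<Longrightarrow> \<forall>t\<in>{0..tf}. norm (x' t - x t) \<le> d \<and> norm (z' t - z t) \<le> d"
          by (rule path_solution_stable[where f=f and h=h and G=G and w=w, OF T \<theta> d A3 L lipL xzc xz(3,4)]) (assumption+, rule that, assumption, blast)
        let ?r = "min d d'"
        have "AE \<omega> in M. \<omega> \<in> ?A x0 z0 \<theta> ?r \<inter> Wp.open_tube tf ?r w \<longrightarrow> \<bar>L \<omega> - \<psi> y x z \<theta>\<bar> \<le> e"
          using sde(3) AES Wp.W_0
        proof eventually_elim
          case (elim \<omega>)
          show ?case
          proof
            assume B: "\<omega> \<in> ?A x0 z0 \<theta> ?r \<inter> Wp.open_tube tf ?r w"
            then have \<omega>: "\<omega> \<in> space M" and tb: "\<omega> \<in> Wp.open_tube tf ?r w"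
              and b: "norm (X 0 \<omega> - x0) < ?r" "norm (Z 0 \<omega> - z0) < ?r" "norm (\<Theta> \<omega> - \<theta>) < ?r"
              by (auto simp: U_def dist_norm norm_minus_commute)
            have "\<forall>t\<in>{0..tf}. norm (X t \<omega> - x t) \<le> d \<and> norm (Z t \<omega> - z t) \<le> d"
            proof (rule st[of "\<Theta> \<omega>" "X 0 \<omega>" "Z 0 \<omega>" "\<lambda>t. W t \<omega>" "\<lambda>t. X t \<omega>" "\<lambda>t. Z t \<omega>"])
              show "norm (w t - W t \<omega>) < d'" if "t \<in> {0..tf}" for t
                using Wp.open_tube_pointwise[OF wc tb that] by simp
              show "X t \<omega> = X 0 \<omega> + integral {0..t} (\<lambda>s. f s (X s \<omega>) (Z s \<omega>) (\<Theta> \<omega>)) + G *v W t \<omega>"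
                "Z t \<omega> = Z 0 \<omega> + integral {0..t} (\<lambda>s. h s (X s \<omega>) (Z s \<omega>) (\<Theta> \<omega>))" if "t \<in> {0..tf}" for t
                using bspec[OF elim(1) that] elim(3) by simp_all
              show "\<Theta> \<omega> \<in> S" by (rule elim(2))
            qed (use b in simp_all, (rule Xc[OF \<omega>])+)
            then have "\<bar>?p (path_of tf X \<omega>, path_of tf Z \<omega>, \<Theta> \<omega>) - ?p (x, z, \<theta>)\<bar> < e"
            proof (intro dc paths \<omega>)
            qed (use b in \<open>simp_all add: path_of_def\<close>)
            then show "\<bar>L \<omega> - \<psi> y x z \<theta>\<bar> \<le> e" by (simp add: L_def)
          qed
        qed
        then show ?thesis using d d' by (intro exI[of _ ?r]) auto
      qed
      have pp: "0 \<le> p (x0, z0, \<theta>)" using A2(2) by (simp add: p_def)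
      have "((\<lambda>r. (LINT \<omega>:?A x0 z0 \<theta> r \<inter> Wp.open_tube tf r w|M. L \<omega>)
              / (exp (- (\<kappa> / r\<^sup>2)) * r ^ (CARD('n) + CARD('q) + CARD('m))) / (a * V))
          \<longlongrightarrow> (\<psi> y x z \<theta> * ((p (x0, z0, \<theta>) * V) * (a * exp (- ?Q / 2)))) / (a * V)) (at_right 0)"
        unfolding V_def
        by (intro tendsto_divide tendsto_const Wp.weighted_tube_limit[OF T wc LI UF Ud pc pp near tube])
          (use a V in \<open>simp_all add: V_def\<close>)
      also have "(\<psi> y x z \<theta> * ((p (x0, z0, \<theta>) * V) * (a * exp (- ?Q / 2)))) / (a * V)
         = \<psi> y x z \<theta> * \<pi> x0 z0 \<theta> * exp (- (1/2) * ?Q)"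
        using a V by (simp add: p_def)
      finally show "\<exists>x z. path_solution tf f h G w x0 z0 \<theta> x z \<and>
           (\<forall>x' z'. path_solution tf f h G w x0 z0 \<theta> x' z' \<longrightarrow> x' = x \<and> z' = z) \<and>
           ((\<lambda>\<epsilon>. posterior_prob M L (noise_ball M tf W X Z \<Theta> w x0 z0 \<theta> \<epsilon>) / (a11 * exp (- (\<kappa> / \<epsilon>\<^sup>2)) * \<epsilon> ^ ?k))
              \<longlongrightarrow> \<psi> y x z \<theta> * \<pi> x0 z0 \<theta> * exp (- (1/2) * ?Q)) (at_right 0)"
        unfolding ratio using sol uniq by blast
    }
    assume \<theta>: "\<theta> \<notin> S"
    obtain d where d: "d > 0" "AE \<omega> in M. norm (\<Theta> \<omega> - \<theta>) \<ge> d"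
      using null_ball_outside_topological_support[OF \<Theta>M] \<theta> unfolding S_def by blast
    have "\<forall>\<^sub>F r in at_right 0. r \<in> {0<..<d}" by (rule eventually_at_right_real) (use d in simp)
    then have "\<forall>\<^sub>F r in at_right 0. posterior_prob M L (noise_ball M tf W X Z \<Theta> w x0 z0 \<theta> r) / (a11 * exp (- (\<kappa> / r\<^sup>2)) * r ^ ?k) = 0"
    proof eventually_elim
      case (elim r)
      have "AE \<omega> in M. indicator (noise_ball M tf W X Z \<Theta> w x0 z0 \<theta> r) \<omega> *\<^sub>R L \<omega> = 0"
        using d(2) by eventually_elim (use elim in \<open>auto simp: noise_ball_def indicator_def\<close>)
      then have "(LINT \<omega>:noise_ball M tf W X Z \<Theta> w x0 z0 \<theta> r|M. L \<omega>) = 0"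
        unfolding set_lebesgue_integral_def by (rule integral_eq_zero_AE)
      then show ?case by (simp add: posterior_prob_def)
    qed
    then show "((\<lambda>\<epsilon>. posterior_prob M L (noise_ball M tf W X Z \<Theta> w x0 z0 \<theta> \<epsilon>) / (a11 * exp (- (\<kappa> / \<epsilon>\<^sup>2)) * \<epsilon> ^ ?k)) \<longlongrightarrow> 0) (at_right 0)"
      by (rule tendsto_eventually)
  qed
qed

end
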